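(* Let $B$ be a unital algebra, let $\mathcal{L}$ be a left Hopf algebroid over $B$ and let $\Gamma$ be an invertible left 2-cocycle on $\mathcal{L}$. Then $\mathcal{L}^\Gamma$, i.e. the vector space $\mathcal{L}$ with the product $\cdot_\Gamma$, the source and target maps $s,t$ (regarded as maps from $B^\Gamma$), the coproduct $\Delta^\Gamma$ and the counit $\varepsilon^\Gamma$, is a left Hopf algebroid over $B^\Gamma$. In addition, if $\mathcal{L}$ is an anti-left Hopf algebroid, then $\mathcal{L}^\Gamma$ is also an anti-left Hopf algebroid.
   Context: All algebras are unital over a field $\mathbb{K}$ and $\otimes$ is over $\mathbb K$. $\overline{B}$ is the opposite algebra of $B$, with anti-isomorphism $b\mapsto\overline b$. Standing assumption: all $B$-module and $\overline B$-module structures are faithfully flat. Left bialgebroid over $B$: a unital algebra $\mathcal{L}$ with algebra maps $s:B\to\mathcal{L}$, $t:B^{op}\to\mathcal{L}$ with commuting images; in $\mathcal{L}$ one writes $b$ for $s(b)$ and $\overline b$ for $t(b)$. Put $P\diamond_B Q=P\otimes Q/\langle \overline b p\otimes q-p\otimes bq\rangle$. With the $B$-bimodule structure $a.X.b=a\overline bX$, $\mathcal{L}$ is a $B$-coring with coproduct $\Delta:\mathcal{L}\to\mathcal{L}\diamond_B\mathcal{L}$, $\Delta(X)=X_{(1)}\diamond X_{(2)}$, and counit $\varepsilon:\mathcal{L}\to B$, such that (i) $\Delta$ has image in the Takeuchi product $\{\sum_i X_i\diamond Y_i: \sum_i X_i\overline b\diamond Y_i=\sum_i X_i\diamond Y_ib\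 \forall b\in B\}$ and is an algebra map into it (factorwise product); (ii) $\varepsilon(1)=1$ and $\varepsilon(X\varepsilon(Y))=\varepsilon(XY)=\varepsilon(X\overline{\varepsilon(Y)})$. $\mathcal{L}$ is a left Hopf algebroid if $\lambda:\mathcal{L}\otimes_{\overline B}\mathcal{L}\to\mathcal{L}\diamond_B\mathcal{L}$, $\lambda(X\otimes Y)=X_{(1)}\diamond X_{(2)}Y$ is invertible, where $\mathcal{L}\otimes_{\overline B}\mathcal{L}=\mathcal{L}\otimes\mathcal{L}/\langle X\overline b\otimes Y-X\otimes\overline bY\rangle$; write $X_+\otimes_{\overline B}X_-=\lambda^{-1}(X\diamond 1)$. It is an anti-left Hopf algebroid if $\mu:\mathcal{L}\otimes_B\mathcal{L}\to\mathcal{L}\diamond_B\mathcal{L}$, $\mu(X\otimes Y)=X_{(1)}Y\diamond X_{(2)}$ is invertible, where $\mathcal{L}\otimes_B\mathcal{L}=\mathcal{L}\otimes\mathcal{L}/\langle Xb\otimes Y-X\otimes bY\rangle$. Left 2-cocycle on $\mathcal{L}$: a linear map $\Gamma:\mathcal{L}\otimes_{\overline B}\mathcal{L}\to B$ that is left $\overline B$-linear ($\Gamma(\overline bX,Y)=\Gamma(X,Y)b$) with $\Gamma(X,\Gamma(Y_{(1)},Z_{(1)})Y_{(2)}Z_{(2)})=\Gamma(\Gamma(X_{(1)},Y_{(1)})X_{(2)}Y_{(2)},Z)$ and $\Gamma(1,X)=\varepsilon(X)=\Gamma(X,1)$. $B^\Gamma$ is the vector space $B$ with product $a\cdot_\Gamma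 b=\Gamma(s(a),s(b))$ (associative, same unit). Left $\mathcal{L}$-comodule: a $B$-bimodule $M$ with a map $\delta:M\to\mathcal{L}\diamond_BM$, $\delta(m)=m_{(-1)}\otimes m_{(0)}$, with image in $\{\sum X_i\diamond m_i:\sum X_i\overline b\diamond m_i=\sum X_i\diamond m_ib\ \forall b\}$, coassociative, counital, and $\delta(bmb')=bm_{(-1)}b'\otimes m_{(0)}$. Then $M$ is a $B^\Gamma$-bimodule by $a\cdot_\Gamma m=\Gamma(a,m_{(-1)})m_{(0)}$, $m\cdot_\Gamma a=\Gamma(m_{(-1)},a)m_{(0)}$. For left comodules $M,N$ there is a well-defined map $\Gamma^{\#}=\Gamma^{\#}_{M,N}:M\otimes_{B^\Gamma}N\to M\otimes_BN$, $m\otimes n\mapsto\Gamma(m_{(-1)},n_{(-1)})m_{(0)}\otimes n_{(0)}$. $\Gamma$ is invertible if $\Gamma^\#_{M,N}$ is invertible for all left $\mathcal{L}$-comodules $M,N$. Structure of $\mathcal{L}^\Gamma$: product $X\cdot_\Gamma Y=\Gamma(X_{(1)},Y_{(1)})\,X_{(2)+}Y_{(2)+}\,\overline{\Gamma(Y_{(2)-},X_{(2)-})}$; the same maps $s,t$. Thus $b\cdot_\Gamma X=\Gamma(b,X_{(1)})X_{(2)}$ and $\overline b\cdot_\Gamma X=X_+\overline{\Gamma(X_-,b)}$. The space $\mathcal{L}^\Gamma\diamond_{B^\Gamma}\mathcal{L}^\Gamma$ is $\mathcal{L}\otimes\mathcal{L}/\langle\overline b\cdot_\Gamma X\otimes Y-X\otimes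 b\cdot_\Gamma Y\rangle$, and $\Gamma^\#:\mathcal{L}^\Gamma\diamond_{B^\Gamma}\mathcal{L}^\Gamma\to\mathcal{L}\diamond_B\mathcal{L}$, $\Gamma^\#(X\diamond Y)=X_+\overline{\Gamma(X_-,Y_{(1)})}\diamond Y_{(2)}$ is invertible (it is $\Gamma^\#_{M,N}$ with $N=\mathcal{L}$ with coaction $\Delta$ and $M=\mathcal{L}$ with coaction $X\mapsto X_-\otimes X_+$ and bimodule structure $b.X.b'=\overline{b'}X\overline b$). Coproduct and counit: $\Delta^\Gamma=(\Gamma^\#)^{-1}\circ\Delta$, $\varepsilon^\Gamma(X)=\Gamma(X_+,X_-)$. *)

theory Defs
  imports "HOL-Library.Poly_Mapping" Complex_Main
begin

section \<open>Balanced tensor products of vector spaces\<close>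

text \<open>
  A balanced tensor product is the quotient of the vector space of formal linear combinations
  \<open>('p \<times> 'q) \<Rightarrow>\<^sub>0 'k\<close> by the subspace spanned by the bilinearity and balancing relations.  An
  element of it is a coset, i.e. a set of formal linear combinations.  Vector spaces are subspaces
  \<open>P\<close> of a type with a scalar multiplication \<open>sP\<close>.
\<close>

abbreviation pure :: "'a \<Rightarrow> 'a \<Rightarrow>\<^sub>0 'k::field" where
  "pure a \<equiv> Poly_Mapping.single a 1"

definition fscale :: "'k::field \<Rightarrow> ('a \<Rightarrow>\<^sub>0 'k) \<Rightarrow> ('a \<Rightarrow>\<^sub>0 'k)" where
  "fscale c = Poly_Mapping.map ((*) c)"

definition lsum :: "('k::field \<Rightarrow> 'v::ab_group_add \<Rightarrow> 'v) \<Rightarrow> ('a \<Rightarrow> 'v) \<Rightarrow> ('a \<Rightarrow>\<^sub>0 'k) \<Rightarrow> 'v" where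
  "lsum sV f t = (\<Sum>a \<in> Poly_Mapping.keys t. sV (Poly_Mapping.lookup t a) (f a))"

text \<open>The relations are \<open>ra p r \<otimes> q = p \<otimes> la r q\<close> for all \<open>r\<close>, besides bilinearity.\<close>

definition tensor_null ::
  "('k::field \<Rightarrow> 'p::ab_group_add \<Rightarrow> 'p) \<Rightarrow> 'p set \<Rightarrow> ('p \<Rightarrow> 'r \<Rightarrow> 'p) \<Rightarrow>
   ('k \<Rightarrow> 'q::ab_group_add \<Rightarrow> 'q) \<Rightarrow> 'q set \<Rightarrow> ('r \<Rightarrow> 'q \<Rightarrow> 'q) \<Rightarrow> (('p \<times> 'q) \<Rightarrow>\<^sub>0 'k) set" where
  "tensor_null sP P ra sQ Q la = module.span fscale
     ({pure (p + p', q) - pure (p, q) - pure (p', q) | p p' q. p \<in> P \<and> p' \<in> P \<and> q \<in> Q} \<union>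
      {pure (p, q + q') - pure (p, q) - pure (p, q') | p q q'. p \<in> P \<and> q \<in> Q \<and> q' \<in> Q} \<union>
      {pure (sP c p, q) - fscale c (pure (p, q)) | c p q. p \<in> P \<and> q \<in> Q} \<union>
      {pure (p, sQ c q) - fscale c (pure (p, q)) | c p q. p \<in> P \<and> q \<in> Q} \<union>
      {pure (ra p r, q) - pure (p, la r q) | p r q. p \<in> P \<and> q \<in> Q})"

text \<open>
  Relations of a threefold tensor product \<open>P \<otimes> Q \<otimes> R\<close>, given those of
  \<open>P \<otimes> Q\<close> and of \<open>Q \<otimes> R\<close>.
\<close>

definition tensor_null3 ::
  "'p set \<Rightarrow> 'r set \<Rightarrow> (('p \<times> 'q) \<Rightarrow>\<^sub>0 'k::field) set \<Rightarrow> (('q \<times> 'r) \<Rightarrow>\<^sub>0 'k) set \<Rightarrow>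
   (('p \<times> 'q \<times> 'r) \<Rightarrow>\<^sub>0 'k) set" where
  "tensor_null3 P R NPQ NQR = module.span fscale
     ({lsum fscale (\<lambda>(p, q). pure (p, q, r)) n | n r. n \<in> NPQ \<and> r \<in> R} \<union>
      {lsum fscale (\<lambda>(q, r). pure (p, q, r)) n | p n. p \<in> P \<and> n \<in> NQR})"

definition coset :: "('a \<Rightarrow>\<^sub>0 'k::field) set \<Rightarrow> ('a \<Rightarrow>\<^sub>0 'k) \<Rightarrow> ('a \<Rightarrow>\<^sub>0 'k) set" where
  "coset N t = {t'. t' - t \<in> N}"

definition tensor :: "('a \<Rightarrow>\<^sub>0 'k::field) set \<Rightarrow> 'a set \<Rightarrow> ('a \<Rightarrow>\<^sub>0 'k) set set" where
  "tensor N D = coset N ` {t. Poly_Mapping.keys t \<subseteq> D}"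

text \<open>
  An arbitrary representative of a tensor.  It is only used in expressions that do not depend on
  the choice.
\<close>

definition rep :: "('a \<Rightarrow>\<^sub>0 'k::field) set \<Rightarrow> ('a \<Rightarrow>\<^sub>0 'k)" where
  "rep c = (SOME t. t \<in> c)"

definition legs :: "('p \<Rightarrow> 'p') \<Rightarrow> ('q \<Rightarrow> 'q') \<Rightarrow> (('p \<times> 'q) \<Rightarrow>\<^sub>0 'k::field) \<Rightarrow> (('p' \<times> 'q') \<Rightarrow>\<^sub>0 'k)" where
  "legs f g = lsum fscale (\<lambda>(p, q). pure (f p, g q))"


section \<open>Algebras and modules\<close>

record ('k, 'a) alg =
  ascale :: "'k \<Rightarrow> 'a \<Rightarrow> 'a"
  amult :: "'a \<Rightarrow> 'a \<Rightarrow> 'a"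
  aone :: 'a

locale unital_algebra =
  fixes A :: "('k::field, 'a::ab_group_add) alg"
  assumes vector_space: "vector_space (ascale A)"
    and mult_add_left: "amult A (x + y) z = amult A x z + amult A y z"
    and mult_add_right: "amult A x (y + z) = amult A x y + amult A x z"
    and mult_scale_left: "amult A (ascale A c x) y = ascale A c (amult A x y)"
    and mult_scale_right: "amult A x (ascale A c y) = ascale A c (amult A x y)"
    and mult_assoc: "amult A (amult A x y) z = amult A x (amult A y z)"
    and mult_one_left: "amult A (aone A) x = x"
    and mult_one_right: "amult A x (aone A) = x"

definition opposite :: "('k, 'a) alg \<Rightarrow> ('k, 'a) alg" where
  "opposite A = A\<lparr>amult := \<lambda>x y. amult A y x\<rparr>"

definition algebra_map ::
  "('k::field, 'a::ab_group_add) alg \<Rightarrow> ('k, 'b::ab_group_add) alg \<Rightarrow> ('a \<Rightarrow> 'b) \<Rightarrow> bool" where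
  "algebra_map A B f \<longleftrightarrow> Vector_Spaces.linear (ascale A) (ascale B) f \<and>
     (\<forall>x y. f (amult A x y) = amult B (f x) (f y)) \<and> f (aone A) = aone B"

locale left_module =
  fixes A :: "('k::field, 'a::ab_group_add) alg"
    and sM :: "'k \<Rightarrow> 'm::ab_group_add \<Rightarrow> 'm" and M :: "'m set" and act :: "'a \<Rightarrow> 'm \<Rightarrow> 'm"
  assumes subspace: "module.subspace sM M"
    and act_closed: "m \<in> M \<Longrightarrow> act a m \<in> M"
    and act_add_left: "m \<in> M \<Longrightarrow> act (a + b) m = act a m + act b m"
    and act_add_right: "m \<in> M \<Longrightarrow> n \<in> M \<Longrightarrow> act a (m + n) = act a m + act a n"
    and act_scale_left: "m \<in> M \<Longrightarrow> act (ascale A c a) m = sM c (act a m)"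
    and act_scale_right: "m \<in> M \<Longrightarrow> act a (sM c m) = sM c (act a m)"
    and act_mult: "m \<in> M \<Longrightarrow> act (amult A a b) m = act a (act b m)"
    and act_one: "m \<in> M \<Longrightarrow> act (aone A) m = m"

definition right_module ::
  "('k::field, 'a::ab_group_add) alg \<Rightarrow> ('k \<Rightarrow> 'm::ab_group_add \<Rightarrow> 'm) \<Rightarrow> 'm set \<Rightarrow>
   ('m \<Rightarrow> 'a \<Rightarrow> 'm) \<Rightarrow> bool" where
  "right_module A sM M act \<longleftrightarrow> left_module (opposite A) sM M (\<lambda>a m. act m a)"

definition module_map ::
  "('k::field \<Rightarrow> 'm::ab_group_add \<Rightarrow> 'm) \<Rightarrow> 'm set \<Rightarrow> ('a \<Rightarrow> 'm \<Rightarrow> 'm) \<Rightarrow>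
   ('k \<Rightarrow> 'n::ab_group_add \<Rightarrow> 'n) \<Rightarrow> 'n set \<Rightarrow> ('a \<Rightarrow> 'n \<Rightarrow> 'n) \<Rightarrow> ('m \<Rightarrow> 'n) \<Rightarrow> bool" where
  "module_map sM M aM sN N aN f \<longleftrightarrow> f ` M \<subseteq> N \<and>
     (\<forall>m\<in>M. \<forall>n\<in>M. f (m + n) = f m + f n) \<and>
     (\<forall>c. \<forall>m\<in>M. f (sM c m) = sN c (f m)) \<and>
     (\<forall>a. \<forall>m\<in>M. f (aM a m) = aN a (f m))"

text \<open>
  A right \<open>A\<close>-module \<open>P\<close> is faithfully flat if a sequence \<open>N1 \<rightarrow> N2 \<rightarrow> N3\<close> of left \<open>A\<close>-modules is
  exact if and only if \<open>P \<otimes>\<^sub>A N1 \<rightarrow> P \<otimes>\<^sub>A N2 \<rightarrow> P \<otimes>\<^sub>A N3\<close> is.  The modules \<open>Ni\<close> range over the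
  \<open>A\<close>-modules whose underlying vector space is a subspace of the ambient space of \<open>sU\<close>; up to
  isomorphism these are all \<open>A\<close>-modules of dimension at most that of the ambient space.
\<close>

definition faithfully_flat_right ::
  "('k::field \<Rightarrow> 'u::ab_group_add \<Rightarrow> 'u) \<Rightarrow> ('k, 'a::ab_group_add) alg \<Rightarrow>
   ('k \<Rightarrow> 'p::ab_group_add \<Rightarrow> 'p) \<Rightarrow> 'p set \<Rightarrow> ('p \<Rightarrow> 'a \<Rightarrow> 'p) \<Rightarrow> bool" where
  "faithfully_flat_right sU A sP P ra \<longleftrightarrow> right_module A sP P ra \<and>
     (\<forall>N1 N2 N3 a1 a2 a3 f g.
        left_module A sU N1 a1 \<and> left_module A sU N2 a2 \<and> left_module A sU N3 a3 \<and>
        module_map sU N1 a1 sU N2 a2 f \<and> module_map sU N2 a2 sU N3 a3 g \<longrightarrow>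
        (let Z1 = tensor_null sP P ra sU N1 a1;
             Z2 = tensor_null sP P ra sU N2 a2;
             Z3 = tensor_null sP P ra sU N3 a3
         in f ` N1 = {n \<in> N2. g n = 0} \<longleftrightarrow>
            (\<lambda>c. coset Z2 (legs id f (rep c))) ` tensor Z1 (P \<times> N1) =
              {c \<in> tensor Z2 (P \<times> N2). coset Z3 (legs id g (rep c)) = coset Z3 0}))"

definition faithfully_flat_left ::
  "('k::field \<Rightarrow> 'u::ab_group_add \<Rightarrow> 'u) \<Rightarrow> ('k, 'a::ab_group_add) alg \<Rightarrow>
   ('k \<Rightarrow> 'p::ab_group_add \<Rightarrow> 'p) \<Rightarrow> 'p set \<Rightarrow> ('a \<Rightarrow> 'p \<Rightarrow> 'p) \<Rightarrow> bool" where
  "faithfully_flat_left sU A sP P la \<longleftrightarrow>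
     faithfully_flat_right sU (opposite A) sP P (\<lambda>p a. la a p)"


section \<open>Left bialgebroids and left Hopf algebroids\<close>

record (overloaded) ('k::zero, 'b, 'l) bialgebroid =
  base :: "('k, 'b) alg"
  total :: "('k, 'l) alg"
  src :: "'b \<Rightarrow> 'l"
  tgt :: "'b \<Rightarrow> 'l"
  cop :: "'l \<Rightarrow> (('l \<times> 'l) \<Rightarrow>\<^sub>0 'k) set"
  cou :: "'l \<Rightarrow> 'b"

abbreviation lmult :: "'l \<Rightarrow> ('k::zero, 'b, 'l) bialgebroid \<Rightarrow> 'l \<Rightarrow> 'l" ("(_ \<cdot>\<^bsub>_\<^esub> _)" [70, 0, 71] 70) where
  "X \<cdot>\<^bsub>H\<^esub> Y \<equiv> amult (total H) X Y"

abbreviation lscale :: "('k::zero, 'b, 'l) bialgebroid \<Rightarrow> 'k \<Rightarrow> 'l \<Rightarrow> 'l" where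
  "lscale H \<equiv> ascale (total H)"

text \<open>
  \<open>diamond_null H\<close>, \<open>otgt_null H\<close> and \<open>osrc_null H\<close> are the relations of \<open>L \<diamondop>\<^sub>B L\<close>, of
  \<open>L \<otimes> L\<close> over the opposite of \<open>B\<close> (acting through the target map) and of \<open>L \<otimes>\<^sub>B L\<close>.
\<close>

definition diamond_null :: "('k::field, 'b, 'l::ab_group_add) bialgebroid \<Rightarrow> (('l \<times> 'l) \<Rightarrow>\<^sub>0 'k) set" where
  "diamond_null H = tensor_null (lscale H) UNIV (\<lambda>X b. tgt H b \<cdot>\<^bsub>H\<^esub> X) (lscale H) UNIV (\<lambda>b X. src H b \<cdot>\<^bsub>H\<^esub> X)"

definition otgt_null :: "('k::field, 'b, 'l::ab_group_add) bialgebroid \<Rightarrow> (('l \<times> 'l) \<Rightarrow>\<^sub>0 'k) set" where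
  "otgt_null H = tensor_null (lscale H) UNIV (\<lambda>X b. X \<cdot>\<^bsub>H\<^esub> tgt H b) (lscale H) UNIV (\<lambda>b X. tgt H b \<cdot>\<^bsub>H\<^esub> X)"

definition osrc_null :: "('k::field, 'b, 'l::ab_group_add) bialgebroid \<Rightarrow> (('l \<times> 'l) \<Rightarrow>\<^sub>0 'k) set" where
  "osrc_null H = tensor_null (lscale H) UNIV (\<lambda>X b. X \<cdot>\<^bsub>H\<^esub> src H b) (lscale H) UNIV (\<lambda>b X. src H b \<cdot>\<^bsub>H\<^esub> X)"

text \<open>
  In the axioms, \<open>T \<in> cop H X\<close> says that \<open>T\<close> is a representative of \<open>X\<^sub>1 \<diamondop> X\<^sub>2\<close>.
\<close>

locale left_bialgebroid =
  fixes H :: "('k::field, 'b::ab_group_add, 'l::ab_group_add) bialgebroid"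
  assumes base_algebra: "unital_algebra (base H)"
    and total_algebra: "unital_algebra (total H)"
    and src_map: "algebra_map (base H) (total H) (src H)"
    and tgt_map: "algebra_map (opposite (base H)) (total H) (tgt H)"
    and src_tgt_commute: "src H a \<cdot>\<^bsub>H\<^esub> tgt H b = tgt H b \<cdot>\<^bsub>H\<^esub> src H a"
    \<comment> \<open>coring over the base\<close>
    and cop_diamond: "cop H X \<in> tensor (diamond_null H) UNIV"
    and cop_add: "T \<in> cop H X \<Longrightarrow> T' \<in> cop H Y \<Longrightarrow> T + T' \<in> cop H (X + Y)"
    and cop_scale: "T \<in> cop H X \<Longrightarrow> fscale c T \<in> cop H (lscale H c X)"
    and cop_bimodule: "T \<in> cop H X \<Longrightarrow>
      legs (\<lambda>Y. src H a \<cdot>\<^bsub>H\<^esub> Y) (\<lambda>Y. tgt H b \<cdot>\<^bsub>H\<^esub> Y) T \<in> cop H (src H a \<cdot>\<^bsub>H\<^esub> tgt H b \<cdot>\<^bsub>H\<^esub> X)"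
    and cou_linear: "Vector_Spaces.linear (lscale H) (ascale (base H)) (cou H)"
    and cou_bimodule:
      "cou H (src H a \<cdot>\<^bsub>H\<^esub> tgt H b \<cdot>\<^bsub>H\<^esub> X) = amult (base H) (amult (base H) a (cou H X)) b"
    and coassociative: "T \<in> cop H X \<Longrightarrow>
      (let Z = tensor_null3 UNIV UNIV (diamond_null H) (diamond_null H)
       in coset Z (lsum fscale (\<lambda>(x, y). lsum fscale (\<lambda>(x1, x2). pure (x1, x2, y)) (rep (cop H x))) T) =
          coset Z (lsum fscale (\<lambda>(x, y). lsum fscale (\<lambda>(y1, y2). pure (x, y1, y2)) (rep (cop H y))) T))"
    and counit_left: "T \<in> cop H X \<Longrightarrow> lsum (lscale H) (\<lambda>(x, y). src H (cou H x) \<cdot>\<^bsub>H\<^esub> y) T = X"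
    and counit_right: "T \<in> cop H X \<Longrightarrow> lsum (lscale H) (\<lambda>(x, y). tgt H (cou H y) \<cdot>\<^bsub>H\<^esub> x) T = X"
    \<comment> \<open>the coproduct is an algebra map into the Takeuchi product\<close>
    and takeuchi: "T \<in> cop H X \<Longrightarrow>
      coset (diamond_null H) (legs (\<lambda>Y. Y \<cdot>\<^bsub>H\<^esub> tgt H b) id T) =
      coset (diamond_null H) (legs id (\<lambda>Y. Y \<cdot>\<^bsub>H\<^esub> src H b) T)"
    and cop_mult: "T \<in> cop H X \<Longrightarrow> T' \<in> cop H Y \<Longrightarrow>
      lsum fscale (\<lambda>(x1, x2). legs (\<lambda>y1. x1 \<cdot>\<^bsub>H\<^esub> y1) (\<lambda>y2. x2 \<cdot>\<^bsub>H\<^esub> y2) T') T \<in> cop H (X \<cdot>\<^bsub>H\<^esub> Y)"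
    and cop_one: "pure (aone (total H), aone (total H)) \<in> cop H (aone (total H))"
    and cou_one: "cou H (aone (total H)) = aone (base H)"
    and cou_src: "cou H (X \<cdot>\<^bsub>H\<^esub> src H (cou H Y)) = cou H (X \<cdot>\<^bsub>H\<^esub> Y)"
    and cou_tgt: "cou H (X \<cdot>\<^bsub>H\<^esub> tgt H (cou H Y)) = cou H (X \<cdot>\<^bsub>H\<^esub> Y)"

definition hopf_lambda ::
  "('k::field, 'b, 'l::ab_group_add) bialgebroid \<Rightarrow> (('l \<times> 'l) \<Rightarrow>\<^sub>0 'k) set \<Rightarrow> (('l \<times> 'l) \<Rightarrow>\<^sub>0 'k) set" where
  "hopf_lambda H c = coset (diamond_null H)
     (lsum fscale (\<lambda>(X, Y). legs id (\<lambda>X2. X2 \<cdot>\<^bsub>H\<^esub> Y) (rep (cop H X))) (rep c))"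

definition hopf_mu ::
  "('k::field, 'b, 'l::ab_group_add) bialgebroid \<Rightarrow> (('l \<times> 'l) \<Rightarrow>\<^sub>0 'k) set \<Rightarrow> (('l \<times> 'l) \<Rightarrow>\<^sub>0 'k) set" where
  "hopf_mu H c = coset (diamond_null H)
     (lsum fscale (\<lambda>(X, Y). legs (\<lambda>X1. X1 \<cdot>\<^bsub>H\<^esub> Y) id (rep (cop H X))) (rep c))"

definition left_hopf_algebroid ::
  "('k::field, 'b::ab_group_add, 'l::ab_group_add) bialgebroid \<Rightarrow> bool" where
  "left_hopf_algebroid H \<longleftrightarrow> left_bialgebroid H \<and>
     bij_betw (hopf_lambda H) (tensor (otgt_null H) UNIV) (tensor (diamond_null H) UNIV)"

definition anti_left_hopf_algebroid ::
  "('k::field, 'b::ab_group_add, 'l::ab_group_add) bialgebroid \<Rightarrow> bool" where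
  "anti_left_hopf_algebroid H \<longleftrightarrow> left_bialgebroid H \<and>
     bij_betw (hopf_mu H) (tensor (osrc_null H) UNIV) (tensor (diamond_null H) UNIV)"

text \<open>\<open>translation H X\<close> is \<open>X\<^sub>+ \<otimes> X\<^sub>- = \<lambda>\<^sup>-\<^sup>1 (X \<diamondop> 1)\<close>.\<close>

definition translation ::
  "('k::field, 'b, 'l::ab_group_add) bialgebroid \<Rightarrow> 'l \<Rightarrow> (('l \<times> 'l) \<Rightarrow>\<^sub>0 'k) set" where
  "translation H X = the_inv_into (tensor (otgt_null H) UNIV) (hopf_lambda H)
     (coset (diamond_null H) (pure (X, aone (total H))))"

definition all_faithfully_flat ::
  "('k::field \<Rightarrow> 'u::ab_group_add \<Rightarrow> 'u) \<Rightarrow> ('k, 'b::ab_group_add, 'l::ab_group_add) bialgebroid \<Rightarrow> bool" where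
  "all_faithfully_flat sU H \<longleftrightarrow>
     faithfully_flat_left sU (base H) (lscale H) UNIV (\<lambda>b X. src H b \<cdot>\<^bsub>H\<^esub> X) \<and>
     faithfully_flat_right sU (base H) (lscale H) UNIV (\<lambda>X b. X \<cdot>\<^bsub>H\<^esub> src H b) \<and>
     faithfully_flat_left sU (opposite (base H)) (lscale H) UNIV (\<lambda>b X. tgt H b \<cdot>\<^bsub>H\<^esub> X) \<and>
     faithfully_flat_right sU (opposite (base H)) (lscale H) UNIV (\<lambda>X b. X \<cdot>\<^bsub>H\<^esub> tgt H b)"


section \<open>Comodules\<close>

text \<open>
  The underlying vector space of a comodule is a subspace \<open>carr M\<close> of the ambient space of \<open>sU\<close>.
\<close>

record (overloaded) ('k::zero, 'b, 'l, 'u) comodule =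
  carr :: "'u set"
  lact :: "'b \<Rightarrow> 'u \<Rightarrow> 'u"
  ract :: "'u \<Rightarrow> 'b \<Rightarrow> 'u"
  coact :: "'u \<Rightarrow> (('l \<times> 'u) \<Rightarrow>\<^sub>0 'k) set"

definition codiamond_null ::
  "('k::field \<Rightarrow> 'u::ab_group_add \<Rightarrow> 'u) \<Rightarrow> ('k, 'b, 'l::ab_group_add) bialgebroid \<Rightarrow>
   ('k, 'b, 'l, 'u) comodule \<Rightarrow> (('l \<times> 'u) \<Rightarrow>\<^sub>0 'k) set" where
  "codiamond_null sU H M =
     tensor_null (lscale H) UNIV (\<lambda>X b. tgt H b \<cdot>\<^bsub>H\<^esub> X) sU (carr M) (lact M)"

locale left_comodule =
  fixes sU :: "'k::field \<Rightarrow> 'u::ab_group_add \<Rightarrow> 'u"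
    and H :: "('k, 'b::ab_group_add, 'l::ab_group_add) bialgebroid"
    and M :: "('k, 'b, 'l, 'u) comodule"
  assumes left: "left_module (base H) sU (carr M) (lact M)"
    and right: "right_module (base H) sU (carr M) (ract M)"
    and bimodule: "m \<in> carr M \<Longrightarrow> ract M (lact M a m) b = lact M a (ract M m b)"
    and coact_diamond: "m \<in> carr M \<Longrightarrow> coact M m \<in> tensor (codiamond_null sU H M) (UNIV \<times> carr M)"
    and coact_add: "m \<in> carr M \<Longrightarrow> n \<in> carr M \<Longrightarrow> T \<in> coact M m \<Longrightarrow> T' \<in> coact M n \<Longrightarrow>
      T + T' \<in> coact M (m + n)"
    and coact_scale: "m \<in> carr M \<Longrightarrow> T \<in> coact M m \<Longrightarrow> fscale c T \<in> coact M (sU c m)"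
    and coact_takeuchi: "m \<in> carr M \<Longrightarrow> T \<in> coact M m \<Longrightarrow>
      coset (codiamond_null sU H M) (legs (\<lambda>X. X \<cdot>\<^bsub>H\<^esub> tgt H b) id T) =
      coset (codiamond_null sU H M) (legs id (\<lambda>n. ract M n b) T)"
    and coact_coassociative: "m \<in> carr M \<Longrightarrow> T \<in> coact M m \<Longrightarrow>
      (let Z = tensor_null3 UNIV (carr M) (diamond_null H) (codiamond_null sU H M)
       in coset Z (lsum fscale (\<lambda>(x, n). lsum fscale (\<lambda>(x1, x2). pure (x1, x2, n)) (rep (cop H x))) T) =
          coset Z (lsum fscale (\<lambda>(x, n). lsum fscale (\<lambda>(y, n'). pure (x, y, n')) (rep (coact M n))) T))"
    and coact_counit: "m \<in> carr M \<Longrightarrow> T \<in> coact M m \<Longrightarrow>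
      lsum sU (\<lambda>(x, n). lact M (cou H x) n) T = m"
    and coact_bimodule: "m \<in> carr M \<Longrightarrow> T \<in> coact M m \<Longrightarrow>
      legs (\<lambda>X. src H a \<cdot>\<^bsub>H\<^esub> X \<cdot>\<^bsub>H\<^esub> src H b) id T \<in> coact M (lact M a (ract M m b))"

definition faithfully_flat_comodule ::
  "('k::field \<Rightarrow> 'u::ab_group_add \<Rightarrow> 'u) \<Rightarrow> ('k, 'b::ab_group_add, 'l::ab_group_add) bialgebroid \<Rightarrow>
   ('k, 'b, 'l, 'u) comodule \<Rightarrow> bool" where
  "faithfully_flat_comodule sU H M \<longleftrightarrow> left_comodule sU H M \<and>
     faithfully_flat_left sU (base H) sU (carr M) (lact M) \<and>
     faithfully_flat_right sU (base H) sU (carr M) (ract M)"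


section \<open>Left 2-cocycles\<close>

text \<open>
  A linear map on the tensor product of \<open>L\<close> with itself over the opposite of \<open>B\<close> is given as a
  balanced bilinear map \<open>\<Gamma>\<close>.
\<close>

locale left_2_cocycle =
  fixes H :: "('k::field, 'b::ab_group_add, 'l::ab_group_add) bialgebroid"
    and \<Gamma> :: "'l \<Rightarrow> 'l \<Rightarrow> 'b"
  assumes linear_left: "Vector_Spaces.linear (lscale H) (ascale (base H)) (\<lambda>X. \<Gamma> X Y)"
    and linear_right: "Vector_Spaces.linear (lscale H) (ascale (base H)) (\<lambda>Y. \<Gamma> X Y)"
    and balanced: "\<Gamma> (X \<cdot>\<^bsub>H\<^esub> tgt H b) Y = \<Gamma> X (tgt H b \<cdot>\<^bsub>H\<^esub> Y)"
    and tgt_linear: "\<Gamma> (tgt H b \<cdot>\<^bsub>H\<^esub> X) Y = amult (base H) (\<Gamma> X Y) b"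
    and cocycle: "TX \<in> cop H X \<Longrightarrow> TY \<in> cop H Y \<Longrightarrow> TZ \<in> cop H Z \<Longrightarrow>
      \<Gamma> X (lsum (lscale H) (\<lambda>(y1, y2). lsum (lscale H)
             (\<lambda>(z1, z2). src H (\<Gamma> y1 z1) \<cdot>\<^bsub>H\<^esub> y2 \<cdot>\<^bsub>H\<^esub> z2) TZ) TY) =
      \<Gamma> (lsum (lscale H) (\<lambda>(x1, x2). lsum (lscale H)
             (\<lambda>(y1, y2). src H (\<Gamma> x1 y1) \<cdot>\<^bsub>H\<^esub> x2 \<cdot>\<^bsub>H\<^esub> y2) TY) TX) Z"
    and normal_left: "\<Gamma> (aone (total H)) X = cou H X"
    and normal_right: "\<Gamma> X (aone (total H)) = cou H X"

definition twisted_base ::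
  "('k::field, 'b, 'l) bialgebroid \<Rightarrow> ('l \<Rightarrow> 'l \<Rightarrow> 'b) \<Rightarrow> ('k, 'b) alg" where
  "twisted_base H \<Gamma> = (base H)\<lparr>amult := \<lambda>a b. \<Gamma> (src H a) (src H b)\<rparr>"

definition twisted_lact ::
  "('k::field \<Rightarrow> 'u::ab_group_add \<Rightarrow> 'u) \<Rightarrow> ('k, 'b, 'l) bialgebroid \<Rightarrow> ('l \<Rightarrow> 'l \<Rightarrow> 'b) \<Rightarrow>
   ('k, 'b, 'l, 'u) comodule \<Rightarrow> 'b \<Rightarrow> 'u \<Rightarrow> 'u" where
  "twisted_lact sU H \<Gamma> M a m = lsum sU (\<lambda>(x, n). lact M (\<Gamma> (src H a) x) n) (rep (coact M m))"

definition twisted_ract ::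
  "('k::field \<Rightarrow> 'u::ab_group_add \<Rightarrow> 'u) \<Rightarrow> ('k, 'b, 'l) bialgebroid \<Rightarrow> ('l \<Rightarrow> 'l \<Rightarrow> 'b) \<Rightarrow>
   ('k, 'b, 'l, 'u) comodule \<Rightarrow> 'u \<Rightarrow> 'b \<Rightarrow> 'u" where
  "twisted_ract sU H \<Gamma> M m a = lsum sU (\<lambda>(x, n). lact M (\<Gamma> x (src H a)) n) (rep (coact M m))"

text \<open>The tensor products \<open>M \<otimes>\<^sub>B N\<close> and \<open>M \<otimes> N\<close> over the twisted base.\<close>

definition comod_null ::
  "('k::field \<Rightarrow> 'u::ab_group_add \<Rightarrow> 'u) \<Rightarrow>
   ('k, 'b, 'l, 'u) comodule \<Rightarrow> ('k, 'b, 'l, 'u) comodule \<Rightarrow> (('u \<times> 'u) \<Rightarrow>\<^sub>0 'k) set" where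
  "comod_null sU M N = tensor_null sU (carr M) (ract M) sU (carr N) (lact N)"

definition twisted_comod_null ::
  "('k::field \<Rightarrow> 'u::ab_group_add \<Rightarrow> 'u) \<Rightarrow> ('k, 'b, 'l) bialgebroid \<Rightarrow> ('l \<Rightarrow> 'l \<Rightarrow> 'b) \<Rightarrow>
   ('k, 'b, 'l, 'u) comodule \<Rightarrow> ('k, 'b, 'l, 'u) comodule \<Rightarrow> (('u \<times> 'u) \<Rightarrow>\<^sub>0 'k) set" where
  "twisted_comod_null sU H \<Gamma> M N =
     tensor_null sU (carr M) (twisted_ract sU H \<Gamma> M) sU (carr N) (twisted_lact sU H \<Gamma> N)"

definition gamma_sharp ::
  "('k::field \<Rightarrow> 'u::ab_group_add \<Rightarrow> 'u) \<Rightarrow> ('k, 'b, 'l) bialgebroid \<Rightarrow> ('l \<Rightarrow> 'l \<Rightarrow> 'b) \<Rightarrow>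
   ('k, 'b, 'l, 'u) comodule \<Rightarrow> ('k, 'b, 'l, 'u) comodule \<Rightarrow>
   (('u \<times> 'u) \<Rightarrow>\<^sub>0 'k) set \<Rightarrow> (('u \<times> 'u) \<Rightarrow>\<^sub>0 'k) set" where
  "gamma_sharp sU H \<Gamma> M N c = coset (comod_null sU M N)
     (lsum fscale (\<lambda>(m, n).
        lsum fscale (\<lambda>(x, m0).
          lsum fscale (\<lambda>(y, n0). pure (lact M (\<Gamma> x y) m0, n0))
            (rep (coact N n)))
          (rep (coact M m)))
        (rep c))"

text \<open>All comodules are subject to the standing assumption of faithful flatness.\<close>

definition invertible_cocycle ::
  "('k::field \<Rightarrow> 'u::ab_group_add \<Rightarrow> 'u) \<Rightarrow> ('k, 'b::ab_group_add, 'l::ab_group_add) bialgebroid \<Rightarrow>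
   ('l \<Rightarrow> 'l \<Rightarrow> 'b) \<Rightarrow> bool" where
  "invertible_cocycle sU H \<Gamma> \<longleftrightarrow>
     (\<forall>M N. faithfully_flat_comodule sU H M \<and> faithfully_flat_comodule sU H N \<longrightarrow>
        bij_betw (gamma_sharp sU H \<Gamma> M N)
          (tensor (twisted_comod_null sU H \<Gamma> M N) (carr M \<times> carr N))
          (tensor (comod_null sU M N) (carr M \<times> carr N)))"

text \<open>
  \<open>sU\<close> turns its type into a space that is large enough for the module and comodule notions above:
  it is infinite-dimensional and contains a copy of \<open>L\<close>.  All vector spaces of dimension at most
  \<open>max \<aleph>\<^sub>0 (dim L)\<close> are then isomorphic to subspaces of it; this includes \<open>B\<close>, which embeds into
  \<open>L\<close>, and its cyclic modules and ideals, which suffice to test faithful flatness.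
\<close>

definition large_space ::
  "('k::field \<Rightarrow> 'u::ab_group_add \<Rightarrow> 'u) \<Rightarrow> ('k, 'b, 'l::ab_group_add) bialgebroid \<Rightarrow> bool" where
  "large_space sU H \<longleftrightarrow> vector_space sU \<and>
     (\<exists>S. infinite S \<and> \<not> module.dependent sU S) \<and>
     (\<exists>f. Vector_Spaces.linear (lscale H) sU f \<and> inj f)"


section \<open>The twisted Hopf algebroid\<close>

text \<open>\<open>X\<^sub>2\<^sub>+ \<otimes> X\<^sub>2\<^sub>-\<close> and \<open>Y\<^sub>2\<^sub>+ \<otimes> Y\<^sub>2\<^sub>-\<close> are written \<open>(p, m)\<close> and \<open>(q, n)\<close>.\<close>

definition twisted_mult ::
  "('k::field, 'b, 'l::ab_group_add) bialgebroid \<Rightarrow> ('l \<Rightarrow> 'l \<Rightarrow> 'b) \<Rightarrow> 'l \<Rightarrow> 'l \<Rightarrow> 'l" where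
  "twisted_mult H \<Gamma> X Y =
     lsum (lscale H) (\<lambda>(x1, x2).
       lsum (lscale H) (\<lambda>(y1, y2).
         lsum (lscale H) (\<lambda>(p, m).
           lsum (lscale H) (\<lambda>(q, n). src H (\<Gamma> x1 y1) \<cdot>\<^bsub>H\<^esub> p \<cdot>\<^bsub>H\<^esub> q \<cdot>\<^bsub>H\<^esub> tgt H (\<Gamma> n m))
             (rep (translation H y2)))
           (rep (translation H x2)))
         (rep (cop H Y)))
       (rep (cop H X))"

definition twisted_diamond_null ::
  "('k::field, 'b, 'l::ab_group_add) bialgebroid \<Rightarrow> ('l \<Rightarrow> 'l \<Rightarrow> 'b) \<Rightarrow> (('l \<times> 'l) \<Rightarrow>\<^sub>0 'k) set" where
  "twisted_diamond_null H \<Gamma> =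
     tensor_null (lscale H) UNIV (\<lambda>X b. twisted_mult H \<Gamma> (tgt H b) X)
       (lscale H) UNIV (\<lambda>b X. twisted_mult H \<Gamma> (src H b) X)"

definition diamond_sharp ::
  "('k::field, 'b, 'l::ab_group_add) bialgebroid \<Rightarrow> ('l \<Rightarrow> 'l \<Rightarrow> 'b) \<Rightarrow>
   (('l \<times> 'l) \<Rightarrow>\<^sub>0 'k) set \<Rightarrow> (('l \<times> 'l) \<Rightarrow>\<^sub>0 'k) set" where
  "diamond_sharp H \<Gamma> c = coset (diamond_null H)
     (lsum fscale (\<lambda>(X, Y).
        lsum fscale (\<lambda>(p, m).
          lsum fscale (\<lambda>(y1, y2). pure (p \<cdot>\<^bsub>H\<^esub> tgt H (\<Gamma> m y1), y2))
            (rep (cop H Y)))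
          (rep (translation H X)))
        (rep c))"

definition twisted_cop ::
  "('k::field, 'b, 'l::ab_group_add) bialgebroid \<Rightarrow> ('l \<Rightarrow> 'l \<Rightarrow> 'b) \<Rightarrow>
   'l \<Rightarrow> (('l \<times> 'l) \<Rightarrow>\<^sub>0 'k) set" where
  "twisted_cop H \<Gamma> X =
     the_inv_into (tensor (twisted_diamond_null H \<Gamma>) UNIV) (diamond_sharp H \<Gamma>) (cop H X)"

definition twisted_cou ::
  "('k::field, 'b::ab_group_add, 'l::ab_group_add) bialgebroid \<Rightarrow> ('l \<Rightarrow> 'l \<Rightarrow> 'b) \<Rightarrow> 'l \<Rightarrow> 'b" where
  "twisted_cou H \<Gamma> X = lsum (ascale (base H)) (\<lambda>(p, m). \<Gamma> p m) (rep (translation H X))"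

definition twisted ::
  "('k::field, 'b::ab_group_add, 'l::ab_group_add) bialgebroid \<Rightarrow> ('l \<Rightarrow> 'l \<Rightarrow> 'b) \<Rightarrow>
   ('k, 'b, 'l) bialgebroid" where
  "twisted H \<Gamma> =
     \<lparr>base = twisted_base H \<Gamma>,
      total = (total H)\<lparr>amult := twisted_mult H \<Gamma>\<rparr>,
      src = src H,
      tgt = tgt H,
      cop = twisted_cop H \<Gamma>,
      cou = twisted_cou H \<Gamma>\<rparr>"

end

theory Submission
  imports Defs
begin

text \<open>
  Write \<open>X\<^sub>1 \<diamondop> X\<^sub>2\<close> for the coproduct, \<open>X\<^sub>+ \<otimes> X\<^sub>-\<close> for the translation map, and \<open>\<sigma>\<close>, \<open>\<tau>\<close> for the
  source and target maps.

  The twisted product, written \<open>\<otimes>\<close> between elements, has two halves: \<open>X \<odot> Y = \<sigma>(\<Gamma>(X\<^sub>1, Y\<^sub>1))X\<^sub>2Y\<^sub>2\<close>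
  is twisted on the left only, and \<open>X \<bullet> Y = X\<^sub>+Y\<^sub>+\<tau>(\<Gamma>(Y\<^sub>-, X\<^sub>-))\<close> on the right only.  In terms of
  \<open>\<odot>\<close> the cocycle identity takes the form \<open>\<Gamma>(X, Y \<odot> Z) = \<Gamma>(X \<odot> Y, Z)\<close> (\<open>cocycle_lprod\<close>), and
  together with \<open>\<Delta>(X \<odot> Y) = X\<^sub>1 \<odot> Y\<^sub>1 \<diamondop> X\<^sub>2Y\<^sub>2\<close> it makes \<open>\<odot>\<close> associative.  The twisted product
  is \<open>(X\<^sub>+ \<odot> Y\<^sub>+)\<tau>(\<Gamma>(Y\<^sub>-, X\<^sub>-))\<close>, and it satisfies
  \<open>(X \<otimes> Y)\<^sub>+ \<otimes> (X \<otimes> Y)\<^sub>- = X\<^sub>+ \<odot> Y\<^sub>+ \<otimes> Y\<^sub>- \<odot> X\<^sub>-\<close> (\<open>E_tprod\<close>) and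
  \<open>\<Delta>(X \<otimes> Y) = X\<^sub>1 \<odot> Y\<^sub>1 \<diamondop> X\<^sub>2 \<bullet> Y\<^sub>2\<close> (\<open>D_tprod\<close>).  By the first of these its associativity is
  the cocycle identity once more.

  The twisted coproduct \<open>X\<^sub>[\<^sub>1\<^sub>] \<diamondop> X\<^sub>[\<^sub>2\<^sub>]\<close> is known only through its image
  \<open>X\<^sub>1 \<diamondop> X\<^sub>2\<close> under \<open>\<Gamma>\<^sup>#\<close>.  As \<open>\<Gamma>\<^sup>#\<close> is bijective, an axiom for it can be checked after
  \<open>\<Gamma>\<^sup>#\<close>, and most of the resulting identities follow from a single one (\<open>lsum_twisted_cop_sharp_pull3\<close>),
    \<open>X\<^sub>[\<^sub>1\<^sub>]\<^sub>+ \<otimes> X\<^sub>[\<^sub>1\<^sub>]\<^sub>- \<odot> X\<^sub>[\<^sub>2\<^sub>]\<^sub>1 \<otimes> X\<^sub>[\<^sub>2\<^sub>]\<^sub>2 = X\<^sub>1 \<otimes> 1 \<otimes> X\<^sub>2\<close>,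
  since the cocycle identity brings them into a shape in which \<open>\<odot>\<close> stands between these two legs.
  For coassociativity, every linear form on the twisted threefold tensor product is the pullback of
  one on \<open>L \<diamondop> L \<diamondop> L\<close> along two applications of \<open>\<Gamma>\<^sup>#\<close> (\<open>twisted_trilinear\<close>), and both sides of
  the axiom take the value of the latter at \<open>X\<^sub>1 \<diamondop> X\<^sub>2 \<diamondop> X\<^sub>3\<close>.

  The Galois maps factor.  With \<open>\<Theta>(X \<otimes> Y) = X\<^sub>+ \<otimes> Y\<^sub>+\<tau>(\<Gamma>(Y\<^sub>-, X\<^sub>-))\<close> and
  \<open>\<Xi>(X \<otimes> Y) = \<sigma>(\<Gamma>(X\<^sub>1, Y\<^sub>1))X\<^sub>2 \<otimes> Y\<^sub>2\<close> one has \<open>\<Gamma>\<^sup># \<circ> \<lambda>\<^sup>\<Gamma> = \<lambda> \<circ> \<Theta>\<close> (\<open>lambda_tw0_eq\<close>) and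
  \<open>\<Gamma>\<^sup># \<circ> \<mu>\<^sup>\<Gamma> = \<mu> \<circ> \<Xi>\<close> (\<open>mu_tw0_eq\<close>).  Now \<open>\<Theta>\<close>, with the two factors interchanged, is the map
  \<open>\<Gamma>\<^sup>#\<close> of the comodule \<open>L\<close> with coaction \<open>X\<^sub>- \<otimes> X\<^sub>+\<close> and itself, and \<open>\<Xi>\<close> is that of \<open>L\<close> with
  coaction \<open>\<Delta>\<close> and itself.  Invertibility of the cocycle makes both bijective, so \<open>\<lambda>\<^sup>\<Gamma>\<close> is bijective,
  and \<open>\<mu>\<^sup>\<Gamma>\<close> is if \<open>\<mu>\<close> is.

  Sweedler expressions are rendered by evaluating forms: \<open>D \<phi> X\<close> is \<open>\<phi>(X\<^sub>1, X\<^sub>2)\<close> and \<open>E \<phi> X\<close> is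
  \<open>\<phi>(X\<^sub>+, X\<^sub>-)\<close>, for maps \<open>\<phi>\<close> balanced in the sense required by the tensor product in question.
  An equation between tensors is proved by comparing the values of all scalar forms on both sides,
  which is enough over a field (\<open>functional_separation\<close>); it then holds for balanced maps into any
  abelian group.
\<close>

section \<open>Formal linear combinations and their quotients\<close>

lemma lookup_fscale [simp]: "Poly_Mapping.lookup (fscale c t) a = c * Poly_Mapping.lookup t a"
  by (simp add: fscale_def Poly_Mapping.map.rep_eq when_def)

lemma vector_space_fscale: "vector_space fscale"
  by (standard; rule poly_mapping_eqI; simp add: lookup_add algebra_simps)

interpretation free: vector_space fscale
  by (rule vector_space_fscale)

lemma vector_space_mult: "vector_space ((*) :: 'k::field \<Rightarrow> 'k \<Rightarrow> 'k)"
  by (standard) (auto simp: algebra_simps)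

subsection \<open>Linear extension\<close>

lemma lsum_superset:
  assumes "vector_space sV" "finite A" "Poly_Mapping.keys t \<subseteq> A"
  shows "lsum sV f t = (\<Sum>a\<in>A. sV (Poly_Mapping.lookup t a) (f a))"
proof -
  interpret vector_space sV by fact
  show ?thesis unfolding lsum_def
    by (rule sum.mono_neutral_left) (use assms in \<open>auto simp: in_keys_iff\<close>)
qed

lemma lsum_add:
  assumes "vector_space sV"
  shows "lsum sV f (s + t) = lsum sV f s + lsum sV f t"
proof -
  interpret vector_space sV by fact
  let ?A = "Poly_Mapping.keys s \<union> Poly_Mapping.keys t"
  have "Poly_Mapping.keys (s + t) \<subseteq> ?A" by (rule Poly_Mapping.keys_add)
  then show ?thesis
    using lsum_superset[OF assms, of ?A]
    by (simp add: lookup_add scale_left_distrib sum.distrib)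
qed

lemma lsum_fscale:
  assumes "vector_space sV"
  shows "lsum sV f (fscale c t) = sV c (lsum sV f t)"
proof -
  interpret vector_space sV by fact
  have "Poly_Mapping.keys (fscale c t) \<subseteq> Poly_Mapping.keys t"
    by (auto simp: in_keys_iff)
  then show ?thesis
    using lsum_superset[OF assms, of "Poly_Mapping.keys t"]
    by (simp add: scale_sum_right)
qed

lemma lsum_linear:
  assumes "vector_space sV"
  shows "Vector_Spaces.linear fscale sV (lsum sV f)"
  using assms vector_space_fscale by (auto simp: Vector_Spaces.linear_iff lsum_add lsum_fscale)

lemma lsum_0 [simp]: "lsum sV f 0 = 0"
  by (simp add: lsum_def)

lemma lsum_diff:
  assumes "vector_space sV"
  shows "lsum sV f (s - t) = lsum sV f s - lsum sV f t"
  by (metis add_diff_cancel_right' assms diff_add_cancel lsum_add)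

lemma lsum_pure:
  assumes "vector_space sV"
  shows "lsum sV f (pure a) = f a"
proof -
  interpret vector_space sV by fact
  show ?thesis by (simp add: lsum_def)
qed

lemma linear_lsum:
  assumes "Vector_Spaces.linear sV sW h"
  shows "h (lsum sV f t) = lsum sW (\<lambda>a. h (f a)) t"
proof -
  interpret Vector_Spaces.linear sV sW h by fact
  show ?thesis by (simp add: lsum_def sum scale)
qed

lemma lsum_lsum:
  assumes "vector_space sV"
  shows "lsum sV f (lsum fscale g t) = lsum sV (\<lambda>a. lsum sV f (g a)) t"
  by (rule linear_lsum[OF lsum_linear[OF assms]])

lemma lsum_cong:
  "(\<And>a. a \<in> Poly_Mapping.keys t \<Longrightarrow> f a = g a) \<Longrightarrow> lsum sV f t = lsum sV g t"
  by (simp add: lsum_def)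

lemma lsum_fun_add:
  assumes "vector_space sV"
  shows "lsum sV (\<lambda>a. f a + g a) t = lsum sV f t + lsum sV g t"
proof -
  interpret vector_space sV by fact
  show ?thesis by (simp add: lsum_def scale_right_distrib sum.distrib)
qed

lemma lsum_fun_diff:
  assumes "vector_space sV"
  shows "lsum sV (\<lambda>a. f a - g a) t = lsum sV f t - lsum sV g t"
proof -
  interpret vector_space sV by fact
  show ?thesis by (simp add: lsum_def scale_right_diff_distrib sum_subtractf)
qed

lemma lsum_swap:
  assumes "vector_space sV"
  shows "lsum sV (\<lambda>a. lsum sV (\<lambda>b. f a b) t) s = lsum sV (\<lambda>b. lsum sV (\<lambda>a. f a b) s) t"
proof -
  interpret vector_space sV by fact
  show ?thesis unfolding lsum_def scale_sum_right
    by (subst sum.swap) (simp add: mult.commute)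
qed

lemma lsum_in_subspace:
  assumes "module.subspace fscale N" "\<And>a. a \<in> Poly_Mapping.keys t \<Longrightarrow> g a \<in> N"
  shows "lsum fscale g t \<in> N"
  unfolding lsum_def using assms by (intro free.subspace_sum free.subspace_scale) auto

lemma lsum_pure_id: "lsum fscale pure t = t"
  by (rule poly_mapping_eqI)
    (simp add: lsum_def lookup_sum lookup_single when_def in_keys_iff if_distrib sum.delta cong: if_cong)

lemma lsum_legs:
  assumes "vector_space sV"
  shows "lsum sV h (legs f g t) = lsum sV (\<lambda>(x, y). h (f x, g y)) t"
  unfolding legs_def lsum_lsum[OF assms]
  by (rule lsum_cong) (auto simp: lsum_pure[OF assms])

lemma legs_linear: "Vector_Spaces.linear fscale fscale (legs f g)"
  unfolding legs_def by (rule lsum_linear[OF vector_space_fscale])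

lemma legs_add: "legs f g (s + t) = legs f g s + legs f g t"
  and legs_diff: "legs f g (s - t) = legs f g s - legs f g t"
  and legs_fscale: "legs f g (fscale c t) = fscale c (legs f g t)"
  unfolding legs_def
  by (rule lsum_add[OF vector_space_fscale] lsum_diff[OF vector_space_fscale] lsum_fscale[OF vector_space_fscale])+

lemma legs_pure [simp]: "legs f g (pure (x, y)) = pure (f x, g y)"
  by (simp add: legs_def lsum_pure[OF vector_space_fscale])

lemma legs_legs: "legs f g (legs f' g' t) = legs (\<lambda>x. f (f' x)) (\<lambda>y. g (g' y)) t"
  unfolding legs_def[of f g] lsum_legs[OF vector_space_fscale] by (simp add: legs_def)

lemma legs_id [simp]: "legs id id t = t"
  by (simp add: legs_def lsum_pure_id case_prod_unfold)

subsection \<open>Separation\<close>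

text \<open>Over a field, membership in a span can be tested by linear functionals, and a functional on
  formal linear combinations is an arbitrary function on the basis.\<close>

lemma functional_separation:
  fixes t :: "'a \<Rightarrow>\<^sub>0 'k::field"
  assumes "\<And>h. (\<And>g. g \<in> module.span fscale G \<Longrightarrow> lsum (*) h g = 0) \<Longrightarrow> lsum (*) h t = 0"
  shows "t \<in> module.span fscale G"
proof (rule ccontr)
  assume t: "t \<notin> module.span fscale G"
  interpret k: vector_space "(*) :: 'k \<Rightarrow> 'k \<Rightarrow> 'k" by (rule vector_space_mult)
  interpret vp: vector_space_pair fscale "(*) :: 'k \<Rightarrow> 'k \<Rightarrow> 'k" by unfold_locales
  obtain B where B: "B \<subseteq> module.span fscale G" "free.independent B" "module.span fscale G \<subseteq> module.span fscale B"
    by (rule free.maximal_independent_subset)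
  then have tB: "t \<notin> module.span fscale B"
    using t free.span_mono[OF B(1)] by (auto simp: free.span_span)
  have "free.independent (insert t B)"
    by (rule free.independent_insertI[OF tB B(2)])
  from vp.linear_independent_extend[OF this, of "\<lambda>x. if x = t then 1 else 0"]
  obtain F where lin: "Vector_Spaces.linear fscale (*) F"
    and F': "\<forall>x\<in>insert t B. F x = (if x = t then 1 else 0)" by blast
  have "t \<notin> B" using tB free.span_base by blast
  then have F: "Vector_Spaces.linear fscale (*) F" "F t = 1" "\<And>x. x \<in> B \<Longrightarrow> F x = 0"
    using lin F' by auto
  have FL: "lsum (*) (\<lambda>a. F (pure a)) u = F u" for u
    using linear_lsum[OF F(1), of pure u] by (simp add: lsum_pure_id)
  have "F x = 0" if "x \<in> module.span fscale B" for x
  proof -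
    interpret F: Vector_Spaces.linear fscale "(*)" F by (rule F(1))
    show ?thesis using that by (induction rule: free.span_induct_alt) (auto simp: F.add F.scale F(3))
  qed
  then have "lsum (*) (\<lambda>a. F (pure a)) g = 0" if "g \<in> module.span fscale G" for g
    unfolding FL using that B(3) by blast
  from assms[OF this] show False using F(2) FL by simp
qed

subsection \<open>Quotients\<close>

lemma subspace_tensor_null: "module.subspace fscale (tensor_null sP P ra sQ Q la)"
  unfolding tensor_null_def by (rule free.subspace_span)

lemma subspace_tensor_null3: "module.subspace fscale (tensor_null3 P R NPQ NQR)"
  unfolding tensor_null3_def by (rule free.subspace_span)

lemma coset_eq_iff:
  assumes "module.subspace fscale N"
  shows "coset N s = coset N t \<longleftrightarrow> s - t \<in> N"
proof
  assume "coset N s = coset N t"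
  moreover have "s \<in> coset N s" using assms by (simp add: coset_def free.subspace_0)
  ultimately show "s - t \<in> N" by (simp add: coset_def)
next
  assume st: "s - t \<in> N"
  have "u - s \<in> N \<longleftrightarrow> u - t \<in> N" for u
    using free.subspace_add[OF assms _ st, of "u - s"] free.subspace_diff[OF assms _ st, of "u - t"]
    by auto
  then show "coset N s = coset N t" by (auto simp: coset_def)
qed

lemma mem_coset: "module.subspace fscale N \<Longrightarrow> t \<in> coset N t"
  by (simp add: coset_def free.subspace_0)

lemma rep_coset: "module.subspace fscale N \<Longrightarrow> rep (coset N t) - t \<in> N"
  using someI[of "\<lambda>s. s \<in> coset N t", OF mem_coset] unfolding rep_def by (simp add: coset_def)

lemma coset_rep:
  assumes "module.subspace fscale N" "c \<in> tensor N D"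
  shows "coset N (rep c) = c" "rep c \<in> c"
proof -
  obtain t where t: "c = coset N t" using assms(2) by (auto simp: tensor_def)
  show "coset N (rep c) = c"
    unfolding t using rep_coset[OF assms(1)] coset_eq_iff[OF assms(1)] by blast
  show "rep c \<in> c"
    unfolding t coset_def[of N t] using rep_coset[OF assms(1), of t] by (simp add: coset_def)
qed

lemma coset_in_tensor [simp]: "coset N t \<in> tensor N UNIV"
  by (auto simp: tensor_def)

lemma coset_mem_eq:
  assumes "module.subspace fscale N" "c \<in> tensor N D" "t \<in> c"
  shows "c = coset N t"
proof -
  obtain s where s: "c = coset N s" using assms(2) by (auto simp: tensor_def)
  then have "t - s \<in> N" using assms(3) by (simp add: coset_def)
  then have "s - t \<in> N" using free.subspace_neg[OF assms(1)] by fastforce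
  then show ?thesis using s coset_eq_iff[OF assms(1)] by simp
qed

text \<open>
  Bijectivity of the map that \<open>g\<close> induces between two quotients, in terms of representatives: the
  structure maps of a bialgebroid are defined by means of \<open>rep\<close>, and this form of the condition does
  without it.  The sets \<open>D'\<close> and \<open>D\<close> restrict the representatives, as in \<open>tensor\<close>.
\<close>

definition induces_iso ::
  "('a \<Rightarrow>\<^sub>0 'k::field) set \<Rightarrow> 'a set \<Rightarrow> ('b \<Rightarrow>\<^sub>0 'k) set \<Rightarrow> 'b set \<Rightarrow> (('a \<Rightarrow>\<^sub>0 'k) \<Rightarrow> ('b \<Rightarrow>\<^sub>0 'k)) \<Rightarrow> bool" where
  "induces_iso N' D' N D g \<longleftrightarrow>
     (\<forall>t. Poly_Mapping.keys t \<subseteq> D' \<longrightarrow> (g t \<in> N \<longleftrightarrow> t \<in> N')) \<and>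
     (\<forall>u. Poly_Mapping.keys u \<subseteq> D \<longrightarrow> (\<exists>t. Poly_Mapping.keys t \<subseteq> D' \<and> g t - u \<in> N))"

lemma bij_betw_tensor_iff:
  fixes g :: "('a \<Rightarrow>\<^sub>0 'k::field) \<Rightarrow> ('b \<Rightarrow>\<^sub>0 'k)"
  assumes N: "module.subspace fscale N" and N': "module.subspace fscale N'"
    and g: "Vector_Spaces.linear fscale fscale g"
    and wd: "\<And>t. t \<in> N' \<Longrightarrow> g t \<in> N"
    and D: "\<And>t. Poly_Mapping.keys t \<subseteq> D' \<Longrightarrow> coset N (g t) \<in> tensor N D"
  shows "bij_betw (\<lambda>c. coset N (g (rep c))) (tensor N' D') (tensor N D) \<longleftrightarrow> induces_iso N' D' N D g"
proof -
  interpret g: Vector_Spaces.linear fscale fscale g by fact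
  have r: "coset N (g (rep (coset N' t))) = coset N (g t)" for t
    unfolding coset_eq_iff[OF N] g.diff[symmetric] by (intro wd rep_coset N')
  have mem: "Poly_Mapping.keys (s - t) \<subseteq> D'" if "Poly_Mapping.keys s \<subseteq> D'" "Poly_Mapping.keys t \<subseteq> D'" for s t :: "'a \<Rightarrow>\<^sub>0 'k"
    using that by (meson Un_least keys_diff order_trans)
  have inj: "inj_on (\<lambda>c. coset N (g (rep c))) (tensor N' D') \<longleftrightarrow> (\<forall>t. Poly_Mapping.keys t \<subseteq> D' \<longrightarrow> g t \<in> N \<longrightarrow> t \<in> N')"
  proof safe
    fix t assume inj: "inj_on (\<lambda>c. coset N (g (rep c))) (tensor N' D')" and t: "Poly_Mapping.keys t \<subseteq> D'" "g t \<in> N"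
    have "coset N' t = coset N' 0"
      by (rule inj_onD[OF inj]) (use t in \<open>auto simp: r tensor_def coset_eq_iff[OF N]\<close>)
    then show "t \<in> N'" by (simp add: coset_eq_iff[OF N'])
  next
    assume *: "\<forall>t. Poly_Mapping.keys t \<subseteq> D' \<longrightarrow> g t \<in> N \<longrightarrow> t \<in> N'"
    show "inj_on (\<lambda>c. coset N (g (rep c))) (tensor N' D')"
    proof (rule inj_onI)
      fix c d assume "c \<in> tensor N' D'" "d \<in> tensor N' D'" and eq: "coset N (g (rep c)) = coset N (g (rep d))"
      then obtain s t where st: "c = coset N' s" "d = coset N' t" "Poly_Mapping.keys s \<subseteq> D'" "Poly_Mapping.keys t \<subseteq> D'"
        by (auto simp: tensor_def)
      have "g (s - t) \<in> N" using eq unfolding st r coset_eq_iff[OF N] by (simp add: g.diff)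
      then show "c = d" using * mem[OF st(3,4)] by (simp add: st(1,2) coset_eq_iff[OF N'])
    qed
  qed
  have im: "(\<lambda>c. coset N (g (rep c))) ` tensor N' D' = (\<lambda>t. coset N (g t)) ` {t. Poly_Mapping.keys t \<subseteq> D'}"
    unfolding tensor_def image_image by (simp add: r)
  have surj: "(\<lambda>c. coset N (g (rep c))) ` tensor N' D' = tensor N D \<longleftrightarrow>
      (\<forall>u. Poly_Mapping.keys u \<subseteq> D \<longrightarrow> (\<exists>t. Poly_Mapping.keys t \<subseteq> D' \<and> g t - u \<in> N))"
    unfolding im
  proof safe
    fix u :: "'b \<Rightarrow>\<^sub>0 'k" assume eq: "(\<lambda>t. coset N (g t)) ` {t. Poly_Mapping.keys t \<subseteq> D'} = tensor N D" and u: "Poly_Mapping.keys u \<subseteq> D"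
    have "coset N u \<in> tensor N D" using u by (auto simp: tensor_def)
    then show "\<exists>t. Poly_Mapping.keys t \<subseteq> D' \<and> g t - u \<in> N"
      unfolding eq[symmetric] using coset_eq_iff[OF N] by (auto simp: image_iff) metis
  next
    fix c assume *: "\<forall>u. Poly_Mapping.keys u \<subseteq> D \<longrightarrow> (\<exists>t. Poly_Mapping.keys t \<subseteq> D' \<and> g t - u \<in> N)" "c \<in> tensor N D"
    then show "c \<in> (\<lambda>t. coset N (g t)) ` {t. Poly_Mapping.keys t \<subseteq> D'}"
      by (auto simp: tensor_def image_iff coset_eq_iff[OF N]) (metis coset_eq_iff[OF N])
  qed (use D in auto)
  show ?thesis
    unfolding bij_betw_def inj surj induces_iso_def using wd by blast
qed

section \<open>Evaluation of tensors in biadditive maps\<close>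

definition biadditive :: "('p::ab_group_add \<Rightarrow> 'q::ab_group_add \<Rightarrow> 'v::ab_group_add) \<Rightarrow> bool" where
  "biadditive \<phi> \<longleftrightarrow> (\<forall>x x' y. \<phi> (x + x') y = \<phi> x y + \<phi> x' y) \<and> (\<forall>x y y'. \<phi> x (y + y') = \<phi> x y + \<phi> x y')"

text \<open>
  Homogeneity is not part of the definition.  For the tensor products over \<open>B\<close> and its opposite it
  follows, in the form that scalars can be moved from one leg to the other, because the ground field
  acts through \<open>B\<close>.
\<close>

definition balanced ::
  "('p::ab_group_add \<Rightarrow> 'r \<Rightarrow> 'p) \<Rightarrow> ('r \<Rightarrow> 'q::ab_group_add \<Rightarrow> 'q) \<Rightarrow> ('p \<Rightarrow> 'q \<Rightarrow> 'v::ab_group_add) \<Rightarrow> bool" where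
  "balanced ra la \<phi> \<longleftrightarrow> biadditive \<phi> \<and> (\<forall>x r y. \<phi> (ra x r) y = \<phi> x (la r y))"

text \<open>
  The value of \<open>\<phi>\<close> at a formal tensor.  The coefficients are multiplied into the first leg, so that
  \<open>\<phi>\<close> may take values in an abelian group without scalars; for homogeneous \<open>\<phi>\<close> the result is
  \<open>lsum\<close> (\<open>ev_eq_lsum\<close>).  Scalar forms, products in \<open>L\<close> and tensors built from the two legs are
  thereby treated alike.
\<close>

definition ev :: "('k::field \<Rightarrow> 'p \<Rightarrow> 'p) \<Rightarrow> ('p \<Rightarrow> 'q \<Rightarrow> 'v::ab_group_add) \<Rightarrow> (('p \<times> 'q) \<Rightarrow>\<^sub>0 'k) \<Rightarrow> 'v" where
  "ev sP \<phi> T = (\<Sum>a\<in>Poly_Mapping.keys T. \<phi> (sP (Poly_Mapping.lookup T a) (fst a)) (snd a))"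

definition homogeneous ::
  "('k::field \<Rightarrow> 'p \<Rightarrow> 'p) \<Rightarrow> ('k \<Rightarrow> 'v \<Rightarrow> 'v) \<Rightarrow> ('p \<Rightarrow> 'q \<Rightarrow> 'v) \<Rightarrow> bool" where
  "homogeneous sP sV \<phi> \<longleftrightarrow> (\<forall>c x y. \<phi> (sP c x) y = sV c (\<phi> x y))"

abbreviation additive_left :: "('p::ab_group_add \<Rightarrow> 'q \<Rightarrow> 'v::ab_group_add) \<Rightarrow> bool" where
  "additive_left \<phi> \<equiv> (\<forall>x x' y. \<phi> (x + x') y = \<phi> x y + \<phi> x' y)"

lemma additive_left_0: "additive_left \<phi> \<Longrightarrow> \<phi> 0 y = 0"
  by (metis add_cancel_right_right)

lemma ev_fun_add: "ev sP (\<lambda>x y. f x y + g x y) T = ev sP f T + ev sP g T"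
  by (simp add: ev_def sum.distrib)

lemma ev_additive:
  assumes "\<And>x y. h (x + y) = h x + h y"
  shows "h (ev sP f T) = ev sP (\<lambda>x y. h (f x y)) T"
proof -
  interpret Modules.additive h by standard (rule assms)
  show ?thesis by (simp add: ev_def sum)
qed

lemma ev_swap:
  "ev sP (\<lambda>x y. ev sQ (\<lambda>u v. f x y u v) T) S = ev sQ (\<lambda>u v. ev sP (\<lambda>x y. f x y u v) S) T"
  unfolding ev_def by (rule sum.swap)

lemma ev_eq_lsum: "homogeneous sP sV f \<Longrightarrow> ev sP f T = lsum sV (\<lambda>(x, y). f x y) T"
  by (simp add: ev_def lsum_def homogeneous_def case_prod_unfold)

lemma ev_homogeneous:
  assumes "homogeneous sP sV (\<lambda>x y. f x y)" shows "lsum sV (\<lambda>(x, y). f x y) T = ev sP f T"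
  using assms ev_eq_lsum by metis

context vector_space begin

lemma ev_superset:
  assumes "additive_left \<phi>" "finite A" "Poly_Mapping.keys t \<subseteq> A"
  shows "ev scale \<phi> t = (\<Sum>a\<in>A. \<phi> (scale (Poly_Mapping.lookup t a) (fst a)) (snd a))"
  unfolding ev_def
  by (rule sum.mono_neutral_left) (use assms additive_left_0[OF assms(1)] in \<open>auto simp: in_keys_iff\<close>)

lemma ev_add:
  assumes "additive_left \<phi>"
  shows "ev scale \<phi> (s + t) = ev scale \<phi> s + ev scale \<phi> t"
proof -
  let ?A = "Poly_Mapping.keys s \<union> Poly_Mapping.keys t"
  have "Poly_Mapping.keys (s + t) \<subseteq> ?A" by (rule Poly_Mapping.keys_add)
  then show ?thesis
    using ev_superset[OF assms, of ?A] assms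
    by (simp add: lookup_add scale_left_distrib sum.distrib)
qed

lemma ev_diff: "additive_left \<phi> \<Longrightarrow> ev scale \<phi> (s - t) = ev scale \<phi> s - ev scale \<phi> t"
  using ev_add[of \<phi> "s - t" t] by (simp add: algebra_simps)

lemma ev_fscale:
  assumes "additive_left \<phi>"
  shows "ev scale \<phi> (fscale c t) = ev scale (\<lambda>x y. \<phi> (scale c x) y) t"
proof -
  have "Poly_Mapping.keys (fscale c t) \<subseteq> Poly_Mapping.keys t" by (auto simp: in_keys_iff)
  from ev_superset[OF assms _ this] show ?thesis by (simp add: ev_def)
qed

lemma ev_zero [simp]: "ev scale \<phi> 0 = 0" by (simp add: ev_def)

lemma ev_pure: "ev scale \<phi> (pure (x, y)) = \<phi> x y"
  by (simp add: ev_def)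

lemma ev_lsum:
  assumes "additive_left \<phi>"
  shows "ev scale \<phi> (lsum fscale g t) =
    (\<Sum>a\<in>Poly_Mapping.keys t. ev scale (\<lambda>x y. \<phi> (scale (Poly_Mapping.lookup t a) x) y) (g a))"
proof -
  interpret e: Modules.additive "ev scale \<phi>" by standard (rule ev_add[OF assms])
  show ?thesis by (simp add: lsum_def e.sum ev_fscale[OF assms])
qed

lemma ev_legs:
  assumes "additive_left \<phi>" "\<And>c x. f (scale c x) = scale c (f x)"
  shows "ev scale \<phi> (legs f g t) = ev scale (\<lambda>x y. \<phi> (f x) (g y)) t"
  unfolding legs_def ev_lsum[OF assms(1)]
  by (simp add: ev_def[of _ _ t] case_prod_unfold ev_pure assms(2))

lemma ev_tensor_null:
  assumes n: "n \<in> tensor_null scale UNIV ra sQ UNIV la" and \<phi>: "balanced ra la \<phi>"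
    and sQ: "\<And>c r q. la r (sQ c q) = sQ c (la r q)"
    and hom: "\<And>c x y. \<phi> (scale c x) y = \<phi> x (sQ c y)"
  shows "ev scale \<phi> n = 0"
  using n unfolding tensor_null_def
proof (induction rule: free.span_induct_alt)
  case (step c x y)
  have add: "additive_left \<phi>" and add2: "\<And>x y y'. \<phi> x (y + y') = \<phi> x y + \<phi> x y'"
    and bal: "\<And>x r y. \<phi> (ra x r) y = \<phi> x (la r y)"
    using \<phi> by (auto simp: balanced_def biadditive_def)
  have bal': "\<phi> (scale c (ra p r)) q = \<phi> (scale c p) (la r q)" for p r q
    unfolding hom bal sQ ..
  have add': "additive_left (\<lambda>x y. \<phi> (scale c x) y)" using add by (simp add: scale_right_distrib)
  have "ev scale \<phi> (fscale c x) = 0"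
    using step(1) unfolding ev_fscale[OF add]
    by (auto simp: ev_diff[OF add'] ev_fscale[OF add'] ev_pure add scale_right_distrib add2 bal' mult.commute
        simp flip: hom)
  then show ?case using step(2) by (simp add: ev_add[OF add])
qed simp

end

lemma functional_tensor_null:
  fixes sP :: "'k::field \<Rightarrow> 'p::ab_group_add \<Rightarrow> 'p" and sQ :: "'k \<Rightarrow> 'q::ab_group_add \<Rightarrow> 'q"
    and h :: "'p \<times> 'q \<Rightarrow> 'k"
  assumes *: "\<And>n. n \<in> tensor_null sP UNIV ra sQ UNIV la \<Longrightarrow> lsum (*) h n = 0"
  shows "balanced ra la (\<lambda>p q. h (p, q))" "homogeneous sP (*) (\<lambda>p q. h (p, q))"
proof -
  note l = lsum_add[OF vector_space_mult] lsum_diff[OF vector_space_mult] lsum_pure[OF vector_space_mult]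
    lsum_fscale[OF vector_space_mult]
  note base = *[unfolded tensor_null_def, OF free.span_base]
  have "h (p + p', q) = h (p, q) + h (p', q)" for p p' q
  proof -
    have "lsum (*) h (pure (p + p', q) - pure (p, q) - pure (p', q)) = 0" by (rule base) blast
    then show ?thesis by (simp add: l algebra_simps)
  qed
  moreover have "h (p, q + q') = h (p, q) + h (p, q')" for p q q'
  proof -
    have "lsum (*) h (pure (p, q + q') - pure (p, q) - pure (p, q')) = 0" by (rule base) blast
    then show ?thesis by (simp add: l algebra_simps)
  qed
  moreover have "h (ra p r, q) = h (p, la r q)" for p r q
  proof -
    have "lsum (*) h (pure (ra p r, q) - pure (p, la r q)) = 0" by (rule base) blast
    then show ?thesis by (simp add: l)
  qed
  ultimately show "balanced ra la (\<lambda>p q. h (p, q))" by (simp add: balanced_def biadditive_def)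
  have "h (sP c p, q) = c * h (p, q)" for c p q
  proof -
    have "lsum (*) h (pure (sP c p, q) - fscale c (pure (p, q))) = 0" by (rule base) blast
    then show ?thesis by (simp add: l)
  qed
  then show "homogeneous sP (*) (\<lambda>p q. h (p, q))" by (simp add: homogeneous_def)
qed

text \<open>
  A functional that vanishes on the relations is the same as a homogeneous balanced form, so that
  such forms suffice to recognise the relations.
\<close>

lemma tensor_nullI:
  fixes sP :: "'k::field \<Rightarrow> 'p::ab_group_add \<Rightarrow> 'p" and sQ :: "'k \<Rightarrow> 'q::ab_group_add \<Rightarrow> 'q"
  assumes "\<And>\<phi> :: 'p \<Rightarrow> 'q \<Rightarrow> 'k. balanced ra la \<phi> \<Longrightarrow> homogeneous sP (*) \<phi> \<Longrightarrow>
      lsum (*) (\<lambda>(x, y). \<phi> x y) t = 0"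
  shows "t \<in> tensor_null sP UNIV ra sQ UNIV la"
  unfolding tensor_null_def
proof (rule functional_separation, fold tensor_null_def)
  fix h :: "'p \<times> 'q \<Rightarrow> 'k"
  assume "\<And>n. n \<in> tensor_null sP UNIV ra sQ UNIV la \<Longrightarrow> lsum (*) h n = 0"
  from assms[OF functional_tensor_null[OF this]] show "lsum (*) h t = 0" by simp
qed

section \<open>Sweedler calculus in a left bialgebroid\<close>

context unital_algebra begin

sublocale vs: vector_space "ascale A" by (rule vector_space)

end

context left_bialgebroid begin

abbreviation sc where "sc \<equiv> lscale H"
abbreviation mul (infixl "\<star>" 70) where "x \<star> y \<equiv> amult (total H) x y"
abbreviation unit ("\<one>") where "\<one> \<equiv> aone (total H)"
abbreviation bmul (infixl "\<circ>\<^sub>B" 70) where "a \<circ>\<^sub>B b \<equiv> amult (base H) a b"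
abbreviation src_abb ("\<sigma>") where "\<sigma> \<equiv> src H"
abbreviation tgt_abb ("\<tau>") where "\<tau> \<equiv> tgt H"
abbreviation cou_abb ("\<epsilon>") where "\<epsilon> \<equiv> cou H"

sublocale B: unital_algebra "base H" by (rule base_algebra)
sublocale L: unital_algebra "total H" by (rule total_algebra)

lemma src_hom: "\<sigma> (a + b) = \<sigma> a + \<sigma> b" "\<sigma> (ascale (base H) c a) = sc c (\<sigma> a)"
    "\<sigma> (a \<circ>\<^sub>B b) = \<sigma> a \<star> \<sigma> b" "\<sigma> (aone (base H)) = \<one>"
  and tgt_hom: "\<tau> (a + b) = \<tau> a + \<tau> b" "\<tau> (ascale (base H) c a) = sc c (\<tau> a)"
    "\<tau> (a \<circ>\<^sub>B b) = \<tau> b \<star> \<tau> a" "\<tau> (aone (base H)) = \<one>"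
  using src_map tgt_map by (auto simp: algebra_map_def opposite_def Vector_Spaces.linear_iff)

lemma cou_hom: "\<epsilon> (x + y) = \<epsilon> x + \<epsilon> y" "\<epsilon> (sc c x) = ascale (base H) c (\<epsilon> x)"
  using cou_linear by (auto simp: Vector_Spaces.linear_iff)

lemma comm: "\<sigma> a \<star> \<tau> b = \<tau> b \<star> \<sigma> a" "\<sigma> a \<star> (\<tau> b \<star> x) = \<tau> b \<star> (\<sigma> a \<star> x)"
  using src_tgt_commute by (simp_all flip: L.mult_assoc)

lemmas alg = L.mult_add_left L.mult_add_right L.mult_scale_left L.mult_scale_right L.mult_assoc
  L.mult_one_left L.mult_one_right src_hom tgt_hom comm
  B.mult_add_left B.mult_add_right B.mult_scale_left B.mult_scale_right B.mult_assoc
  B.mult_one_left B.mult_one_right cou_hom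

text \<open>
  The maps that factor through \<open>L \<diamondop>\<^sub>B L\<close> and, for \<open>otgt_bal\<close>, those that factor through
  \<open>L \<otimes> L\<close> over the opposite of \<open>B\<close>.
\<close>

definition diamond_bal :: "('l \<Rightarrow> 'l \<Rightarrow> 'v::ab_group_add) \<Rightarrow> bool" where
  "diamond_bal \<phi> \<longleftrightarrow> balanced (\<lambda>X b. \<tau> b \<star> X) (\<lambda>b X. \<sigma> b \<star> X) \<phi>"

definition otgt_bal :: "('l \<Rightarrow> 'l \<Rightarrow> 'v::ab_group_add) \<Rightarrow> bool" where
  "otgt_bal \<phi> \<longleftrightarrow> balanced (\<lambda>X b. X \<star> \<tau> b) (\<lambda>b X. \<tau> b \<star> X) \<phi>"

lemmas diamond_bal_iff = diamond_bal_def[unfolded balanced_def biadditive_def]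
lemmas otgt_bal_iff = otgt_bal_def[unfolded balanced_def biadditive_def]

lemma diamond_balI: "(\<And>x x' y. \<phi> (x + x') y = \<phi> x y + \<phi> x' y) \<Longrightarrow> (\<And>x y y'. \<phi> x (y + y') = \<phi> x y + \<phi> x y') \<Longrightarrow>
    (\<And>x r y. \<phi> (\<tau> r \<star> x) y = \<phi> x (\<sigma> r \<star> y)) \<Longrightarrow> diamond_bal \<phi>"
  by (simp add: diamond_bal_iff)

lemma otgt_balI: "(\<And>x x' y. \<phi> (x + x') y = \<phi> x y + \<phi> x' y) \<Longrightarrow> (\<And>x y y'. \<phi> x (y + y') = \<phi> x y + \<phi> x y') \<Longrightarrow>
    (\<And>x r y. \<phi> (x \<star> \<tau> r) y = \<phi> x (\<tau> r \<star> y)) \<Longrightarrow> otgt_bal \<phi>"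
  by (simp add: otgt_bal_iff)

lemma sc_eq: "sc c x = \<tau> (ascale (base H) c (aone (base H))) \<star> x"
   "sc c x = \<sigma> (ascale (base H) c (aone (base H))) \<star> x"
   "sc c x = x \<star> \<tau> (ascale (base H) c (aone (base H)))"
  by (simp_all add: alg)

lemma diamond_bal_scale: "diamond_bal \<phi> \<Longrightarrow> \<phi> (sc c x) y = \<phi> x (sc c y)"
  unfolding sc_eq(1)[of c x] sc_eq(2)[of c y] by (simp add: diamond_bal_iff)

lemma otgt_bal_scale: "otgt_bal \<phi> \<Longrightarrow> \<phi> (sc c x) y = \<phi> x (sc c y)"
  unfolding sc_eq(3)[of c x] sc_eq(1)[of c y] by (simp add: otgt_bal_iff)

lemma diamond_bal_simps:
  assumes "diamond_bal \<phi>"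
  shows "\<phi> (x + x') y = \<phi> x y + \<phi> x' y" "\<phi> x (y + y') = \<phi> x y + \<phi> x y'"
    "\<phi> (\<tau> b \<star> x) y = \<phi> x (\<sigma> b \<star> y)" "\<phi> (\<tau> b) y = \<phi> \<one> (\<sigma> b \<star> y)"
  using assms by (auto simp: diamond_bal_iff) (metis L.mult_one_right)

lemma otgt_bal_simps:
  assumes "otgt_bal \<phi>"
  shows "\<phi> (x + x') y = \<phi> x y + \<phi> x' y" "\<phi> x (y + y') = \<phi> x y + \<phi> x y'"
    "\<phi> (x \<star> \<tau> b) y = \<phi> x (\<tau> b \<star> y)" "\<phi> (x \<star> (x' \<star> \<tau> b)) y = \<phi> (x \<star> x') (\<tau> b \<star> y)"
    "\<phi> (x \<star> (x' \<star> (x'' \<star> \<tau> b))) y = \<phi> (x \<star> (x' \<star> x'')) (\<tau> b \<star> y)"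
  using assms by (auto simp: otgt_bal_iff simp flip: L.mult_assoc)

text \<open>
  \<open>\<phi>(X\<^sub>1, X\<^sub>2)\<close>, which for balanced \<open>\<phi>\<close> is independent of the representative (\<open>ev_cop\<close>).
\<close>

definition D :: "('l \<Rightarrow> 'l \<Rightarrow> 'v::ab_group_add) \<Rightarrow> 'l \<Rightarrow> 'v" where
  "D \<phi> X = ev sc \<phi> (rep (cop H X))"

lemma ev_diamond_null: "n \<in> diamond_null H \<Longrightarrow> diamond_bal \<phi> \<Longrightarrow> ev sc \<phi> n = 0"
  using L.vs.ev_tensor_null[of n "\<lambda>X b. \<tau> b \<star> X" sc "\<lambda>b X. \<sigma> b \<star> X" \<phi>] diamond_bal_scale[of \<phi>]
  by (simp add: diamond_null_def diamond_bal_def L.mult_scale_right)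

lemma ev_otgt_null: "n \<in> otgt_null H \<Longrightarrow> otgt_bal \<phi> \<Longrightarrow> ev sc \<phi> n = 0"
  using L.vs.ev_tensor_null[of n "\<lambda>X b. X \<star> \<tau> b" sc "\<lambda>b X. \<tau> b \<star> X" \<phi>] otgt_bal_scale[of \<phi>]
  by (simp add: otgt_null_def otgt_bal_def L.mult_scale_right)

lemma diamond_nullI:
  assumes "\<And>\<phi> :: 'l \<Rightarrow> 'l \<Rightarrow> 'k. diamond_bal \<phi> \<Longrightarrow> homogeneous sc (*) \<phi> \<Longrightarrow> lsum (*) (\<lambda>(x, y). \<phi> x y) t = 0"
  shows "t \<in> diamond_null H"
  unfolding diamond_null_def by (rule tensor_nullI) (rule assms, simp_all add: diamond_bal_def)

lemma subspace_null:
  "module.subspace fscale (diamond_null H)" "module.subspace fscale (otgt_null H)" "module.subspace fscale (osrc_null H)"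
  unfolding diamond_null_def otgt_null_def osrc_null_def by (rule subspace_tensor_null)+

lemma rep_cop: "rep (cop H X) \<in> cop H X"
  by (rule coset_rep(2)[OF subspace_null(1) cop_diamond])

lemma cop_eq_coset: "T \<in> cop H X \<Longrightarrow> cop H X = coset (diamond_null H) T"
  by (rule coset_mem_eq[OF subspace_null(1) cop_diamond])

lemma additive_left_diamond_bal: "diamond_bal \<phi> \<Longrightarrow> additive_left \<phi>" by (simp add: diamond_bal_iff)
lemma additive_left_otgt_bal: "otgt_bal \<phi> \<Longrightarrow> additive_left \<phi>" by (simp add: otgt_bal_iff)

lemma ev_cop: "T \<in> cop H X \<Longrightarrow> diamond_bal \<phi> \<Longrightarrow> ev sc \<phi> T = D \<phi> X"
proof -
  assume T: "T \<in> cop H X" and \<phi>: "diamond_bal \<phi>"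
  have "T - rep (cop H X) \<in> diamond_null H"
    using T cop_eq_coset[OF rep_cop] by (auto simp: coset_def)
  from ev_diamond_null[OF this \<phi>] show ?thesis
    by (simp add: L.vs.ev_diff[OF additive_left_diamond_bal[OF \<phi>]] D_def)
qed

lemma lsum_cop:
  "T \<in> cop H X \<Longrightarrow> diamond_bal \<phi> \<Longrightarrow> homogeneous sc sV \<phi> \<Longrightarrow> lsum sV (\<lambda>(x, y). \<phi> x y) T = D \<phi> X"
  by (simp add: ev_homogeneous ev_cop)

lemma copI:
  assumes "\<And>\<phi> :: 'l \<Rightarrow> 'l \<Rightarrow> 'k. diamond_bal \<phi> \<Longrightarrow> homogeneous sc (*) \<phi> \<Longrightarrow> lsum (*) (\<lambda>(x, y). \<phi> x y) T = D \<phi> X"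
  shows "T \<in> cop H X"
proof -
  have "T - rep (cop H X) \<in> diamond_null H"
    by (rule diamond_nullI) (simp add: assms lsum_diff[OF vector_space_mult] lsum_cop[OF rep_cop])
  then show ?thesis by (subst cop_eq_coset[OF rep_cop]) (simp add: coset_def)
qed

lemma D_fun_add: "D (\<lambda>x y. f x y + g x y) X = D f X + D g X"
  by (simp add: D_def ev_fun_add)

lemma D_additive: "(\<And>x y. h (x + y) = h x + h y) \<Longrightarrow> h (D f X) = D (\<lambda>x y. h (f x y)) X"
  by (simp add: D_def ev_additive)

lemma D_swap: "D (\<lambda>x y. D (\<lambda>u v. f x y u v) Y) X = D (\<lambda>u v. D (\<lambda>x y. f x y u v) X) Y"
  unfolding D_def by (rule ev_swap)

lemma D_add: "diamond_bal \<phi> \<Longrightarrow> D \<phi> (X + Y) = D \<phi> X + D \<phi> Y"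
  using ev_cop[OF cop_add[OF rep_cop[of X] rep_cop[of Y]], of \<phi>] by (simp add: D_def L.vs.ev_add additive_left_diamond_bal)

lemma D_scale: "diamond_bal \<phi> \<Longrightarrow> D \<phi> (sc c X) = D (\<lambda>x y. \<phi> (sc c x) y) X"
  using ev_cop[OF cop_scale[OF rep_cop[of X], of c], of \<phi>] by (simp add: D_def L.vs.ev_fscale additive_left_diamond_bal)

lemma D_bimod: "diamond_bal \<phi> \<Longrightarrow> D \<phi> (\<sigma> a \<star> (\<tau> b \<star> X)) = D (\<lambda>x y. \<phi> (\<sigma> a \<star> x) (\<tau> b \<star> y)) X"
proof -
  assume \<phi>: "diamond_bal \<phi>"
  have "D \<phi> (\<sigma> a \<star> (\<tau> b \<star> X)) = ev sc \<phi> (legs (\<lambda>Y. \<sigma> a \<star> Y) (\<lambda>Y. \<tau> b \<star> Y) (rep (cop H X)))"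
    using ev_cop[OF cop_bimodule[OF rep_cop] \<phi>, of a b X] by (simp add: L.mult_assoc)
  also have "\<dots> = D (\<lambda>x y. \<phi> (\<sigma> a \<star> x) (\<tau> b \<star> y)) X"
    unfolding D_def by (rule L.vs.ev_legs) (use \<phi> in \<open>auto simp: additive_left_diamond_bal L.mult_scale_right diamond_bal_iff\<close>)
  finally show ?thesis .
qed

lemma D_src: "diamond_bal \<phi> \<Longrightarrow> D \<phi> (\<sigma> a \<star> X) = D (\<lambda>x y. \<phi> (\<sigma> a \<star> x) y) X"
  using D_bimod[of \<phi> a "aone (base H)" X] by (simp add: alg)

lemma D_tgt: "diamond_bal \<phi> \<Longrightarrow> D \<phi> (\<tau> b \<star> X) = D (\<lambda>x y. \<phi> x (\<tau> b \<star> y)) X"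
  using D_bimod[of \<phi> "aone (base H)" b X] by (simp add: alg)

lemma D_one: "diamond_bal \<phi> \<Longrightarrow> D \<phi> \<one> = \<phi> \<one> \<one>"
  using ev_cop[OF cop_one] by (metis L.vs.ev_pure)

lemma D_s: "diamond_bal \<phi> \<Longrightarrow> D \<phi> (\<sigma> a) = \<phi> (\<sigma> a) \<one>"
  using D_src[of \<phi> a \<one>] D_one[of "\<lambda>x y. \<phi> (\<sigma> a \<star> x) y"] by (simp add: diamond_bal_iff alg)

lemma D_t: "diamond_bal \<phi> \<Longrightarrow> D \<phi> (\<tau> a) = \<phi> \<one> (\<tau> a)"
  using D_tgt[of \<phi> a \<one>] D_one[of "\<lambda>x y. \<phi> x (\<tau> a \<star> y)"] by (simp add: diamond_bal_iff alg flip: comm)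

text \<open>
  The sum over the legs of \<open>X\<close> has to be the inner one.  By the Takeuchi property it makes the form
  balanced in the legs of \<open>Y\<close> (\<open>diamond_bal_mult\<close>), which it is not for fixed \<open>X\<^sub>1\<close> and \<open>X\<^sub>2\<close>.
\<close>

lemma D_mult:
  assumes "diamond_bal \<phi>" shows "D \<phi> (X \<star> Y) = D (\<lambda>y1 y2. D (\<lambda>x1 x2. \<phi> (x1 \<star> y1) (x2 \<star> y2)) X) Y"
proof -
  have "D \<phi> (X \<star> Y) = ev sc \<phi> (lsum fscale (\<lambda>(x1, x2). legs ((\<star>) x1) ((\<star>) x2) (rep (cop H Y))) (rep (cop H X)))"
    using ev_cop[OF cop_mult[OF rep_cop[of X] rep_cop[of Y]] assms] by simp
  also have "\<dots> = (\<Sum>a\<in>Poly_Mapping.keys (rep (cop H X)).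
        ev sc (\<lambda>x y. \<phi> (sc (Poly_Mapping.lookup (rep (cop H X)) a) (fst a \<star> x)) (snd a \<star> y)) (rep (cop H Y)))"
    using additive_left_diamond_bal[OF assms]
    by (subst L.vs.ev_lsum[OF additive_left_diamond_bal[OF assms]]) (simp add: case_prod_unfold L.vs.ev_legs L.mult_scale_right L.vs.scale_right_distrib)
  also have "\<dots> = D (\<lambda>x1 x2. D (\<lambda>y1 y2. \<phi> (x1 \<star> y1) (x2 \<star> y2)) Y) X"
    by (simp add: D_def ev_def[of _ _ "rep (cop H X)"] L.mult_scale_left)
  finally show ?thesis by (subst D_swap) 
qed

lemma diamond_bal_mulR: "diamond_bal \<phi> \<Longrightarrow> diamond_bal (\<lambda>x y. \<phi> (x \<star> a) (y \<star> b))"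
  by (simp add: diamond_bal_iff alg)

lemma D_tak:
  assumes "diamond_bal \<phi>" shows "D (\<lambda>x y. \<phi> (x \<star> \<tau> b) y) X = D (\<lambda>x y. \<phi> x (y \<star> \<sigma> b)) X"
proof -
  have "ev sc \<phi> (legs (\<lambda>Y. Y \<star> \<tau> b) id (rep (cop H X)) - legs id (\<lambda>Y. Y \<star> \<sigma> b) (rep (cop H X))) = 0"
    using takeuchi[OF rep_cop[of X], of b] ev_diamond_null[OF _ assms] by (simp add: coset_eq_iff[OF subspace_null(1)])
  then show ?thesis using additive_left_diamond_bal[OF assms]
    by (simp add: D_def L.vs.ev_diff L.vs.ev_legs L.mult_scale_left)
qed

lemma diamond_bal_mult:
  assumes "diamond_bal \<phi>" shows "diamond_bal (\<lambda>y1 y2. D (\<lambda>x1 x2. \<phi> (x1 \<star> y1) (x2 \<star> y2)) X)"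
proof (rule diamond_balI)
  fix x r y
  show "D (\<lambda>x1 x2. \<phi> (x1 \<star> (\<tau> r \<star> x)) (x2 \<star> y)) X = D (\<lambda>x1 x2. \<phi> (x1 \<star> x) (x2 \<star> (\<sigma> r \<star> y))) X"
    using D_tak[OF diamond_bal_mulR[OF assms, of x y], of r X] by (simp add: L.mult_assoc)
qed (simp_all add: alg D_fun_add diamond_bal_simps[OF assms])

lemma D_tgtR: "diamond_bal \<phi> \<Longrightarrow> D \<phi> (X \<star> \<tau> b) = D (\<lambda>x y. \<phi> x (y \<star> \<tau> b)) X"
  by (simp add: D_mult D_t[OF diamond_bal_mult] L.mult_one_right)

lemma D_srcR: "diamond_bal \<phi> \<Longrightarrow> D \<phi> (X \<star> \<sigma> b) = D (\<lambda>x y. \<phi> (x \<star> \<sigma> b) y) X"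
  by (simp add: D_mult D_s[OF diamond_bal_mult] L.mult_one_right)

lemma counitL: "D (\<lambda>x y. \<sigma> (\<epsilon> x) \<star> y) X = X"
  using counit_left[OF rep_cop, of X] unfolding D_def
  by (subst (asm) ev_homogeneous) (simp_all add: homogeneous_def alg)

lemma counitR: "D (\<lambda>x y. \<tau> (\<epsilon> y) \<star> x) X = X"
  using counit_right[OF rep_cop, of X] unfolding D_def
  by (subst (asm) ev_homogeneous) (simp_all add: homogeneous_def alg)

lemma cou_left: "\<epsilon> (\<sigma> b \<star> x) = b \<circ>\<^sub>B \<epsilon> x" and cou_right: "\<epsilon> (\<tau> b \<star> x) = \<epsilon> x \<circ>\<^sub>B b"
  using cou_bimodule[of b "aone (base H)" x] cou_bimodule[of "aone (base H)" b x] by (simp_all add: alg)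

lemma cou_s: "\<epsilon> (\<sigma> b) = b" and cou_t: "\<epsilon> (\<tau> b) = b"
  using cou_left[of b \<one>] cou_right[of b \<one>] by (simp_all add: alg cou_one)

text \<open>
  The maps that factor through \<open>L \<diamondop> L \<diamondop> L\<close>.
\<close>

definition diamond_bal3 :: "('l \<Rightarrow> 'l \<Rightarrow> 'l \<Rightarrow> 'v::ab_group_add) \<Rightarrow> bool" where
  "diamond_bal3 \<phi> \<longleftrightarrow> (\<forall>z. diamond_bal (\<lambda>x y. \<phi> x y z)) \<and> (\<forall>x. diamond_bal (\<phi> x))"

definition ev3 :: "('l \<Rightarrow> 'l \<Rightarrow> 'l \<Rightarrow> 'v::ab_group_add) \<Rightarrow> (('l \<times> 'l \<times> 'l) \<Rightarrow>\<^sub>0 'k) \<Rightarrow> 'v" where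
  "ev3 \<phi> T = ev sc (\<lambda>x yz. \<phi> x (fst yz) (snd yz)) T"

lemma ev3_left:
  assumes "diamond_bal3 \<phi>"
  shows "ev3 (\<lambda>x y z. \<phi> (sc c x) y z) (lsum fscale (\<lambda>(p, q). pure (p, q, r)) n) = ev sc (\<lambda>x y. \<phi> (sc c x) y r) n"
proof -
  have "additive_left (\<lambda>x yz. \<phi> (sc c x) (fst yz) (snd yz))" using assms by (simp add: diamond_bal3_def diamond_bal_iff L.vs.scale_right_distrib)
  then show ?thesis
    by (simp add: ev3_def L.vs.ev_lsum case_prod_unfold L.vs.ev_pure) (simp add: ev_def mult.commute)
qed

lemma ev3_right:
  assumes "diamond_bal3 \<phi>"
  shows "ev3 (\<lambda>x y z. \<phi> (sc c x) y z) (lsum fscale (\<lambda>(q, r). pure (p, q, r)) n) = ev sc (\<lambda>x y. \<phi> (sc c p) x y) n"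
proof -
  have "additive_left (\<lambda>x yz. \<phi> (sc c x) (fst yz) (snd yz))" using assms by (simp add: diamond_bal3_def diamond_bal_iff L.vs.scale_right_distrib)
  moreover have "\<phi> (sc c x) y z = \<phi> x (sc c y) z" for c x y z
    using diamond_bal_scale[of "\<lambda>x y. \<phi> x y z"] assms by (simp add: diamond_bal3_def)
  ultimately show ?thesis
    by (simp add: ev3_def L.vs.ev_lsum case_prod_unfold L.vs.ev_pure)
      (simp add: ev_def mult.commute)
qed

lemma ev3_null:
  assumes "n \<in> tensor_null3 UNIV UNIV (diamond_null H) (diamond_null H)" and \<phi>: "diamond_bal3 \<phi>"
  shows "ev3 \<phi> n = 0"
  using assms(1) unfolding tensor_null3_def
proof (induction rule: free.span_induct_alt)
  case (step c x y)
  have add: "additive_left (\<lambda>x yz. \<phi> x (fst yz) (snd yz))" using \<phi> by (simp add: diamond_bal3_def diamond_bal_iff)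
  have "ev3 \<phi> (fscale c x) = ev3 (\<lambda>x y z. \<phi> (sc c x) y z) x"
    unfolding ev3_def by (rule L.vs.ev_fscale[OF add])
  also have "\<dots> = 0"
    using step(1)
  proof safe
    fix n r assume "n \<in> diamond_null H"
    then show "ev3 (\<lambda>x y z. \<phi> (sc c x) y z) (lsum fscale (\<lambda>(p, q). pure (p, q, r)) n) = 0"
      unfolding ev3_left[OF \<phi>] using \<phi>
      by (intro ev_diamond_null) (simp_all add: diamond_bal3_def diamond_bal_iff L.vs.scale_right_distrib flip: L.mult_scale_right)
  next
    fix n p assume "n \<in> diamond_null H"
    then show "ev3 (\<lambda>x y z. \<phi> (sc c x) y z) (lsum fscale (\<lambda>(q, r). pure (p, q, r)) n) = 0"
      unfolding ev3_right[OF \<phi>] using \<phi> by (intro ev_diamond_null) (simp_all add: diamond_bal3_def)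
  qed
  finally show ?case using step(2) L.vs.ev_add[OF add] by (simp add: ev3_def)
qed (simp add: ev3_def)

lemma D_coassoc:
  assumes \<phi>: "diamond_bal3 \<phi>"
  shows "D (\<lambda>x z. D (\<lambda>x y. \<phi> x y z) x) X = D (\<lambda>x y. D (\<lambda>y z. \<phi> x y z) y) X"
proof -
  let ?T = "rep (cop H X)"
  let ?l = "lsum fscale (\<lambda>(x, y). lsum fscale (\<lambda>(x1, x2). pure (x1, x2, y)) (rep (cop H x))) ?T"
  let ?r = "lsum fscale (\<lambda>(x, y). lsum fscale (\<lambda>(y1, y2). pure (x, y1, y2)) (rep (cop H y))) ?T"
  have add: "additive_left (\<lambda>x yz. \<phi> x (fst yz) (snd yz))" using \<phi> by (simp add: diamond_bal3_def diamond_bal_iff)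
  have "?l - ?r \<in> tensor_null3 UNIV UNIV (diamond_null H) (diamond_null H)"
    using coassociative[OF rep_cop[of X]] unfolding Let_def coset_eq_iff[OF subspace_tensor_null3] .
  from ev3_null[OF this \<phi>] have "ev3 \<phi> ?l = ev3 \<phi> ?r"
    unfolding ev3_def L.vs.ev_diff[OF add] by simp
  moreover have "ev3 \<phi> ?l = D (\<lambda>x z. D (\<lambda>x y. \<phi> x y z) x) X"
  proof -
    have "ev3 \<phi> ?l = (\<Sum>a\<in>Poly_Mapping.keys ?T. D (\<lambda>x y. \<phi> (sc (Poly_Mapping.lookup ?T a) x) y (snd a)) (fst a))"
      unfolding ev3_def L.vs.ev_lsum[OF add]
      by (rule sum.cong[OF refl]) (use ev3_left[OF \<phi>] in \<open>auto simp: ev3_def D_def\<close>)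
    also have "\<dots> = D (\<lambda>x z. D (\<lambda>x y. \<phi> x y z) x) X"
      unfolding D_def[of _ X] ev_def[of _ _ ?T]
      by (rule sum.cong[OF refl]) (use \<phi> in \<open>simp add: diamond_bal3_def D_scale\<close>)
    finally show ?thesis .
  qed
  moreover have "ev3 \<phi> ?r = D (\<lambda>x y. D (\<lambda>y z. \<phi> x y z) y) X"
  proof -
    have "ev3 \<phi> ?r = (\<Sum>a\<in>Poly_Mapping.keys ?T. D (\<lambda>x y. \<phi> (sc (Poly_Mapping.lookup ?T a) (fst a)) x y) (snd a))"
      unfolding ev3_def L.vs.ev_lsum[OF add]
      by (rule sum.cong[OF refl]) (use ev3_right[OF \<phi>] in \<open>auto simp: ev3_def D_def\<close>)
    then show ?thesis
      unfolding D_def[of _ X] ev_def[of _ _ ?T] by simp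
  qed
  ultimately show ?thesis by simp
qed

end

section \<open>The translation map of a left Hopf algebroid\<close>

locale left_hopf = left_bialgebroid H
  for H :: "('k::field, 'b::ab_group_add, 'l::ab_group_add) bialgebroid" +
  assumes lambda_bij: "bij_betw (hopf_lambda H) (tensor (otgt_null H) UNIV) (tensor (diamond_null H) UNIV)"
begin

text \<open>
  The Galois map \<open>\<lambda>\<close> on formal tensors; \<open>lambda_pull \<psi>\<close> is the pullback \<open>\<psi> \<circ> \<lambda>\<close>.
\<close>

definition lambda0 :: "(('l \<times> 'l) \<Rightarrow>\<^sub>0 'k) \<Rightarrow> (('l \<times> 'l) \<Rightarrow>\<^sub>0 'k)" where
  "lambda0 = lsum fscale (\<lambda>(X, Y). legs id (\<lambda>X2. X2 \<star> Y) (rep (cop H X)))"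

definition lambda_pull :: "('l \<Rightarrow> 'l \<Rightarrow> 'v::ab_group_add) \<Rightarrow> 'l \<Rightarrow> 'l \<Rightarrow> 'v" where
  "lambda_pull \<psi> x y = D (\<lambda>x1 x2. \<psi> x1 (x2 \<star> y)) x"

lemma diamond_bal_mulr: "diamond_bal \<psi> \<Longrightarrow> diamond_bal (\<lambda>x1 x2. \<psi> x1 (x2 \<star> y))"
  by (simp add: diamond_bal_iff alg)

lemma ev_lambda0: assumes "diamond_bal \<psi>" shows "ev sc \<psi> (lambda0 t) = ev sc (lambda_pull \<psi>) t"
  unfolding lambda0_def L.vs.ev_lsum[OF additive_left_diamond_bal[OF assms]] ev_def[of _ _ t]
  by (rule sum.cong[OF refl])
    (use assms in \<open>auto simp: L.vs.ev_legs diamond_bal_simps L.vs.scale_right_distrib lambda_pull_def D_scale[OF diamond_bal_mulr] D_def[symmetric]\<close>)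

lemma otgt_bal_lambda_pull: assumes "diamond_bal \<psi>" shows "otgt_bal (lambda_pull \<psi>)"
  by (rule otgt_balI) (simp_all add: lambda_pull_def alg D_fun_add D_add[OF diamond_bal_mulr[OF assms]] D_tgtR[OF diamond_bal_mulr[OF assms]] diamond_bal_simps[OF assms])

lemma lambda0_null: "t \<in> otgt_null H \<Longrightarrow> lambda0 t \<in> diamond_null H"
  by (rule diamond_nullI) (simp add: ev_homogeneous ev_lambda0 ev_otgt_null otgt_bal_lambda_pull)

lemma lambda0_iso: "induces_iso (otgt_null H) UNIV (diamond_null H) UNIV lambda0"
proof -
  have "Vector_Spaces.linear fscale fscale lambda0"
    unfolding lambda0_def by (rule lsum_linear[OF vector_space_fscale])
  moreover have "hopf_lambda H = (\<lambda>c. coset (diamond_null H) (lambda0 (rep c)))"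
    by (simp add: fun_eq_iff hopf_lambda_def lambda0_def)
  ultimately show ?thesis
    using lambda_bij by (subst bij_betw_tensor_iff[symmetric]) (simp_all add: subspace_null lambda0_null)
qed

text \<open>
  As \<open>\<lambda>\<close> is injective, an equation in \<open>L \<otimes> L\<close> over the opposite of \<open>B\<close> can be tested on the pullbacks
  of forms on \<open>L \<diamondop> L\<close>.  The equations for \<open>X\<^sub>+ \<otimes> X\<^sub>-\<close> are derived from those for the coproduct in
  this way.
\<close>

lemma lambda_pull_inj:
  assumes "\<And>\<psi> :: 'l \<Rightarrow> 'l \<Rightarrow> 'k. diamond_bal \<psi> \<Longrightarrow> ev sc (lambda_pull \<psi>) t = ev sc (lambda_pull \<psi>) t'" and \<phi>: "otgt_bal \<phi>"
  shows "ev sc \<phi> t = ev sc \<phi> t'"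
proof -
  have "lambda0 (t - t') \<in> diamond_null H"
    by (rule diamond_nullI)
      (simp add: ev_homogeneous ev_lambda0 L.vs.ev_diff[OF additive_left_otgt_bal[OF otgt_bal_lambda_pull]] assms(1))
  then have "t - t' \<in> otgt_null H" using lambda0_iso by (simp add: induces_iso_def)
  from ev_otgt_null[OF this \<phi>] show ?thesis by (simp add: L.vs.ev_diff[OF additive_left_otgt_bal[OF \<phi>]])
qed

text \<open>
  \<open>\<phi>(X\<^sub>+, X\<^sub>-)\<close>.
\<close>

definition E :: "('l \<Rightarrow> 'l \<Rightarrow> 'v::ab_group_add) \<Rightarrow> 'l \<Rightarrow> 'v" where
  "E \<phi> X = ev sc \<phi> (rep (translation H X))"

lemma translation_tensor: "translation H X \<in> tensor (otgt_null H) UNIV"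
  unfolding translation_def using bij_betwE[OF bij_betw_the_inv_into[OF lambda_bij]] by simp

lemma lambda0_translation: "lambda0 (rep (translation H X)) - pure (X, \<one>) \<in> diamond_null H"
proof -
  have "hopf_lambda H (translation H X) = coset (diamond_null H) (pure (X, \<one>))"
    unfolding translation_def by (rule f_the_inv_into_f_bij_betw[OF lambda_bij]) simp
  then show ?thesis unfolding hopf_lambda_def lambda0_def by (simp add: coset_eq_iff subspace_null)
qed

lemma ev_translation: "T \<in> translation H X \<Longrightarrow> otgt_bal \<phi> \<Longrightarrow> ev sc \<phi> T = E \<phi> X"
proof -
  assume T: "T \<in> translation H X" and \<phi>: "otgt_bal \<phi>"
  have "T - rep (translation H X) \<in> otgt_null H"
    using T coset_mem_eq[OF subspace_null(2) translation_tensor coset_rep(2)[OF subspace_null(2) translation_tensor], of X]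
    by (auto simp: coset_def)
  from ev_otgt_null[OF this \<phi>] show ?thesis
    by (simp add: L.vs.ev_diff[OF additive_left_otgt_bal[OF \<phi>]] E_def)
qed

text \<open>
  \<open>X\<^sub>+\<^sub>1 \<diamondop> X\<^sub>+\<^sub>2X\<^sub>- = X \<diamondop> 1\<close>, which defines the translation map.
\<close>

lemma E_galois: assumes "diamond_bal \<psi>" shows "E (\<lambda>p m. D (\<lambda>x y. \<psi> x (y \<star> m)) p) X = \<psi> X \<one>"
  using ev_diamond_null[OF lambda0_translation assms, of X]
  by (simp add: L.vs.ev_diff[OF additive_left_diamond_bal[OF assms]] ev_lambda0[OF assms] L.vs.ev_pure E_def lambda_pull_def[abs_def])

lemma E_unique:
  assumes "\<And>\<psi> :: 'l \<Rightarrow> 'l \<Rightarrow> 'k. diamond_bal \<psi> \<Longrightarrow> ev sc (lambda_pull \<psi>) t = \<psi> X \<one>" and \<phi>: "otgt_bal \<phi>"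
  shows "ev sc \<phi> t = E \<phi> X"
proof -
  have "E (lambda_pull \<psi>) X = \<psi> X \<one>" if "diamond_bal \<psi>" for \<psi> :: "'l \<Rightarrow> 'l \<Rightarrow> 'k"
    using E_galois[OF that] by (simp add: lambda_pull_def[abs_def])
  then show ?thesis
    unfolding E_def by (intro lambda_pull_inj[OF _ \<phi>]) (simp add: assms(1))
qed

lemma E_fun_add: "E (\<lambda>x y. f x y + g x y) X = E f X + E g X"
  by (simp add: E_def ev_fun_add)

lemma E_additive: "(\<And>x y. h (x + y) = h x + h y) \<Longrightarrow> h (E f X) = E (\<lambda>x y. h (f x y)) X"
  by (simp add: E_def ev_additive)

lemma E_swap: "E (\<lambda>x y. E (\<lambda>u v. f x y u v) Y) X = E (\<lambda>u v. E (\<lambda>x y. f x y u v) X) Y"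
  unfolding E_def by (rule ev_swap)

lemma DE_swap: "D (\<lambda>x y. E (\<lambda>u v. f x y u v) Y) X = E (\<lambda>u v. D (\<lambda>x y. f x y u v) X) Y"
  unfolding E_def D_def by (rule ev_swap)

lemma ev_ev: "additive_left \<phi> \<Longrightarrow> ev sc \<phi> (E f X) = E (\<lambda>x y. ev sc \<phi> (f x y)) X"
  "additive_left \<phi> \<Longrightarrow> ev sc \<phi> (D f X) = D (\<lambda>x y. ev sc \<phi> (f x y)) X"
  by (rule E_additive, simp add: L.vs.ev_add) (rule D_additive, simp add: L.vs.ev_add)

lemma ev_lambda_pull:
  assumes "diamond_bal \<psi>"
  shows "ev sc (lambda_pull \<psi>) (E f X) = E (\<lambda>x y. ev sc (lambda_pull \<psi>) (f x y)) X"
    "ev sc (lambda_pull \<psi>) (D f X) = D (\<lambda>x y. ev sc (lambda_pull \<psi>) (f x y)) X"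
    "ev sc (lambda_pull \<psi>) (pure (x, y)) = D (\<lambda>x1 x2. \<psi> x1 (x2 \<star> y)) x"
    "ev sc (lambda_pull \<psi>) (s + t) = ev sc (lambda_pull \<psi>) s + ev sc (lambda_pull \<psi>) t"
    "ev sc (lambda_pull \<psi>) (rep (translation H X)) = \<psi> X \<one>"
  using ev_ev[OF additive_left_otgt_bal[OF otgt_bal_lambda_pull[OF assms]]] L.vs.ev_add[OF additive_left_otgt_bal[OF otgt_bal_lambda_pull[OF assms]]] E_galois[OF assms, of X]
  by (simp_all add: L.vs.ev_pure) (simp_all add: lambda_pull_def[abs_def] E_def)

lemma diamond_bal_lsrc: "diamond_bal \<psi> \<Longrightarrow> diamond_bal (\<lambda>x y. \<psi> (\<sigma> a \<star> x) y)"
   and diamond_bal_ltgt: "diamond_bal \<psi> \<Longrightarrow> diamond_bal (\<lambda>x y. \<psi> x (\<tau> a \<star> y))"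
   and diamond_bal_l: "diamond_bal \<psi> \<Longrightarrow> diamond_bal (\<lambda>x y. \<psi> (x \<star> w) y)"
  by (simp_all add: diamond_bal_iff alg)

lemma E_add: assumes "otgt_bal \<phi>" shows "E \<phi> (X + Y) = E \<phi> X + E \<phi> Y"
proof -
  have "ev sc \<phi> (rep (translation H X) + rep (translation H Y)) = E \<phi> (X + Y)"
    by (rule E_unique[OF _ assms])
      (simp add: ev_lambda_pull diamond_bal_simps)
  then show ?thesis by (simp add: L.vs.ev_add[OF additive_left_otgt_bal[OF assms]] E_def)
qed

text \<open>
  \<open>(XY)\<^sub>+ \<otimes> (XY)\<^sub>- = X\<^sub>+Y\<^sub>+ \<otimes> Y\<^sub>-X\<^sub>-\<close>, since \<open>\<lambda>\<close> maps both sides to \<open>XY \<diamondop> 1\<close>.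
\<close>

lemma E_mult:
  assumes "otgt_bal \<phi>" shows "E \<phi> (X \<star> Y) = E (\<lambda>p m. E (\<lambda>q n. \<phi> (p \<star> q) (n \<star> m)) Y) X"
proof -
  have "ev sc \<phi> (E (\<lambda>p m. E (\<lambda>q n. pure (p \<star> q, n \<star> m)) Y) X) = E \<phi> (X \<star> Y)"
  proof (rule E_unique[OF _ assms])
    fix \<psi> :: "'l \<Rightarrow> 'l \<Rightarrow> 'k" assume \<psi>: "diamond_bal \<psi>"
    have "ev sc (lambda_pull \<psi>) (E (\<lambda>p m. E (\<lambda>q n. pure (p \<star> q, n \<star> m)) Y) X) =
        E (\<lambda>p m. E (\<lambda>q n. D (\<lambda>a b. D (\<lambda>x1 x2. \<psi> (x1 \<star> a) (x2 \<star> ((b \<star> n) \<star> m))) p) q) Y) X"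
      using diamond_bal_mult[OF diamond_bal_mulr[OF \<psi>]]
      by (simp add: ev_lambda_pull[OF \<psi>] D_mult[OF diamond_bal_mulr[OF \<psi>]] L.mult_assoc)
    also have "\<dots> = E (\<lambda>p m. D (\<lambda>x1 x2. \<psi> (x1 \<star> Y) (x2 \<star> m)) p) X"
      using diamond_bal_mult[OF diamond_bal_mulr[OF \<psi>]] by (subst E_galois) (simp_all add: L.mult_assoc L.mult_one_left)
    also have "\<dots> = \<psi> (X \<star> Y) \<one>"
      using E_galois[OF diamond_bal_l[OF \<psi>], of Y X] by simp
    finally show "ev sc (lambda_pull \<psi>) (E (\<lambda>p m. E (\<lambda>q n. pure (p \<star> q, n \<star> m)) Y) X) = \<psi> (X \<star> Y) \<one>" .
  qed
  then show ?thesis by (simp add: ev_ev[OF additive_left_otgt_bal[OF assms]] L.vs.ev_pure)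
qed

lemma E_s: assumes "otgt_bal \<phi>" shows "E \<phi> (\<sigma> a) = \<phi> (\<sigma> a) \<one>"
proof -
  have "ev sc \<phi> (pure (\<sigma> a, \<one>)) = E \<phi> (\<sigma> a)"
    by (rule E_unique[OF _ assms]) (simp add: L.vs.ev_pure lambda_pull_def L.mult_one_right D_s)
  then show ?thesis by (simp add: L.vs.ev_pure)
qed

lemma E_t: assumes "otgt_bal \<phi>" shows "E \<phi> (\<tau> a) = \<phi> \<one> (\<sigma> a)"
proof -
  have "ev sc \<phi> (pure (\<one>, \<sigma> a)) = E \<phi> (\<tau> a)"
    by (rule E_unique[OF _ assms]) (simp add: L.vs.ev_pure lambda_pull_def L.mult_one_left L.mult_one_right D_one diamond_bal_mulr diamond_bal_simps)
  then show ?thesis by (simp add: L.vs.ev_pure)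
qed

lemma E_one: "otgt_bal \<phi> \<Longrightarrow> E \<phi> \<one> = \<phi> \<one> \<one>"
  using E_s[of \<phi> "aone (base H)"] by (simp add: alg)

text \<open>
  \<open>X\<^sub>+ \<otimes> X\<^sub>-\<tau>(b) = \<tau>(b)X\<^sub>+ \<otimes> X\<^sub>-\<close>, since \<open>\<lambda>\<close> maps both sides to \<open>X \<diamondop> \<tau>(b)\<close>.
\<close>

lemma E_tak:
  assumes "otgt_bal \<phi>" shows "E (\<lambda>p m. \<phi> p (m \<star> \<tau> b)) X = E (\<lambda>p m. \<phi> (\<tau> b \<star> p) m) X"
proof -
  have "ev sc \<phi> (E (\<lambda>p m. pure (p, m \<star> \<tau> b)) X) = ev sc \<phi> (E (\<lambda>p m. pure (\<tau> b \<star> p, m)) X)"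
  proof (rule lambda_pull_inj[OF _ assms])
    fix \<psi> :: "'l \<Rightarrow> 'l \<Rightarrow> 'k" assume \<psi>: "diamond_bal \<psi>"
    show "ev sc (lambda_pull \<psi>) (E (\<lambda>p m. pure (p, m \<star> \<tau> b)) X) = ev sc (lambda_pull \<psi>) (E (\<lambda>p m. pure (\<tau> b \<star> p, m)) X)"
      using E_galois[OF diamond_bal_ltgt[OF \<psi>], of b X] E_galois[OF diamond_bal_mulr[OF \<psi>], of "\<tau> b" X]
      by (simp add: ev_lambda_pull[OF \<psi>] D_tgt[OF diamond_bal_mulr[OF \<psi>]] L.mult_assoc
          L.mult_one_left L.mult_one_right)
  qed
  then show ?thesis by (simp add: ev_ev[OF additive_left_otgt_bal[OF assms]] L.vs.ev_pure)
qed

lemma otgt_bal_mulL: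
  assumes "otgt_bal \<phi>" shows "otgt_bal (\<lambda>p m. E (\<lambda>q n. \<phi> (p \<star> q) (n \<star> m)) Y)"
proof (rule otgt_balI)
  fix x r y
  have "otgt_bal (\<lambda>q n. \<phi> (x \<star> q) (n \<star> y))"
    using assms by (auto intro!: otgt_balI simp: alg otgt_bal_simps)
  from E_tak[OF this, of r Y]
  show "E (\<lambda>q n. \<phi> (x \<star> \<tau> r \<star> q) (n \<star> y)) Y = E (\<lambda>q n. \<phi> (x \<star> q) (n \<star> (\<tau> r \<star> y))) Y"
    by (simp add: L.mult_assoc)
qed (simp_all add: alg E_fun_add otgt_bal_simps[OF assms])

lemma otgt_bal_mulR:
  assumes "otgt_bal \<phi>" shows "otgt_bal (\<lambda>q n. \<phi> (p \<star> q) (n \<star> m))"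
  using assms by (auto intro!: otgt_balI simp: alg otgt_bal_simps)

lemma E_src: "otgt_bal \<phi> \<Longrightarrow> E \<phi> (\<sigma> a \<star> X) = E (\<lambda>p m. \<phi> (\<sigma> a \<star> p) m) X"
  by (simp add: E_mult E_s[OF otgt_bal_mulL] alg)
lemma E_tgt: "otgt_bal \<phi> \<Longrightarrow> E \<phi> (\<tau> a \<star> X) = E (\<lambda>p m. \<phi> p (m \<star> \<sigma> a)) X"
  by (simp add: E_mult E_t[OF otgt_bal_mulL] alg)
lemma E_srcR: "otgt_bal \<phi> \<Longrightarrow> E \<phi> (X \<star> \<sigma> a) = E (\<lambda>p m. \<phi> (p \<star> \<sigma> a) m) X"
  by (simp add: E_mult E_s[OF otgt_bal_mulR] alg)
lemma E_tgtR: "otgt_bal \<phi> \<Longrightarrow> E \<phi> (X \<star> \<tau> a) = E (\<lambda>p m. \<phi> p (\<sigma> a \<star> m)) X"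
  by (simp add: E_mult E_t[OF otgt_bal_mulR] alg)

lemma E_scale: "otgt_bal \<phi> \<Longrightarrow> E \<phi> (sc c X) = E (\<lambda>x y. \<phi> (sc c x) y) X"
  unfolding sc_eq(2) by (rule E_src)

text \<open>
  \<open>X\<^sub>1\<^sub>+ \<otimes> X\<^sub>1\<^sub>-X\<^sub>2 = X \<otimes> 1\<close>, since \<open>\<lambda>\<close> maps both sides to \<open>X\<^sub>1 \<diamondop> X\<^sub>2\<close>.
\<close>

lemma D_galois: assumes "otgt_bal \<phi>" shows "D (\<lambda>x y. E (\<lambda>p m. \<phi> p (m \<star> y)) x) X = \<phi> X \<one>"
proof -
  have "ev sc \<phi> (D (\<lambda>x y. E (\<lambda>p m. pure (p, m \<star> y)) x) X) = ev sc \<phi> (pure (X, \<one>))"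
  proof (rule lambda_pull_inj[OF _ assms])
    fix \<psi> :: "'l \<Rightarrow> 'l \<Rightarrow> 'k" assume \<psi>: "diamond_bal \<psi>"
    show "ev sc (lambda_pull \<psi>) (D (\<lambda>x y. E (\<lambda>p m. pure (p, m \<star> y)) x) X) = ev sc (lambda_pull \<psi>) (pure (X, \<one>))"
      using E_galois[OF diamond_bal_mulr[OF \<psi>]]
      by (simp add: ev_lambda_pull[OF \<psi>] L.mult_assoc
          L.mult_one_left L.mult_one_right)
  qed
  then show ?thesis by (simp add: ev_ev[OF additive_left_otgt_bal[OF assms]] L.vs.ev_pure)
qed

lemma otgt_bal_mulr: "otgt_bal \<phi> \<Longrightarrow> otgt_bal (\<lambda>p m. \<phi> p (m \<star> w))"
  by (auto intro!: otgt_balI simp: alg otgt_bal_simps)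

lemma D_galois': assumes "otgt_bal \<phi>" shows "D (\<lambda>x y. E (\<lambda>p m. \<phi> p (m \<star> (y \<star> w))) x) X = \<phi> X w"
  using D_galois[OF otgt_bal_mulr[OF assms]] by (simp add: L.mult_assoc L.mult_one_left)

lemmas D_rules = D_add D_src D_tgt D_srcR D_tgtR
lemmas E_rules = E_add E_src E_tgt E_srcR E_tgtR

text \<open>
  \<open>X\<^sub>1 \<diamondop> X\<^sub>2\<^sub>+ \<otimes> X\<^sub>2\<^sub>- = X\<^sub>+\<^sub>1 \<diamondop> X\<^sub>+\<^sub>2 \<otimes> X\<^sub>-\<close>.  By \<open>D_galois'\<close> one has
  \<open>\<phi>(x, p, m) = \<Theta>(x, p\<^sub>1, p\<^sub>2m)\<close> with \<open>\<Theta>(x, y, w) = \<phi>(x, y\<^sub>+, y\<^sub>-w)\<close>.  Coassociativity turns the right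
  hand side into an expression in \<open>X\<^sub>+\<^sub>1 \<diamondop> X\<^sub>+\<^sub>2X\<^sub>- = X \<diamondop> 1\<close>, whose value is \<open>\<Theta>(X\<^sub>1, X\<^sub>2, 1)\<close>.
\<close>

lemma E_coassoc_plus:
  assumes "\<And>m. diamond_bal (\<lambda>x p. \<phi> x p m)" and otgt_bal: "\<And>x. otgt_bal (\<phi> x)"
  shows "D (\<lambda>x y. E (\<phi> x) y) X = E (\<lambda>p m. D (\<lambda>x y. \<phi> x y m) p) X"
proof -
  note s = diamond_bal_simps[OF assms(1)] otgt_bal_simps[OF assms(2)]
  note bm = otgt_bal_mulr[OF otgt_bal]
  define \<Theta> where "\<Theta> x y w = E (\<lambda>q n. \<phi> x q (n \<star> w)) y" for x y w
  have t3: "diamond_bal3 (\<lambda>x y1 y2. \<Theta> x y1 (y2 \<star> m))" for m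
    unfolding diamond_bal3_def \<Theta>_def
    by (intro allI conjI diamond_balI; simp add: s E_rules[OF bm] E_fun_add alg)
  have \<psi>: "diamond_bal (\<lambda>z w. D (\<lambda>x y. \<Theta> x y w) z)"
  proof -
    have b: "diamond_bal (\<lambda>x y. \<Theta> x y w)" for w
      unfolding \<Theta>_def by (rule diamond_balI; simp add: s E_rules[OF bm] E_fun_add alg)
    show ?thesis
      by (rule diamond_balI) (simp_all add: D_rules[OF b] D_fun_add, simp_all add: \<Theta>_def s E_rules[OF bm] E_fun_add alg D_fun_add)
  qed
  have "E (\<lambda>p m. D (\<lambda>x y. \<phi> x y m) p) X = E (\<lambda>p m. D (\<lambda>x y. D (\<lambda>y1 y2. \<Theta> x y1 (y2 \<star> m)) y) p) X"
    unfolding \<Theta>_def D_galois'[OF otgt_bal] ..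
  also have "\<dots> = E (\<lambda>p m. D (\<lambda>z y2. D (\<lambda>x y1. \<Theta> x y1 (y2 \<star> m)) z) p) X"
    unfolding D_coassoc[OF t3] ..
  also have "\<dots> = D (\<lambda>x y. \<Theta> x y \<one>) X"
    by (rule E_galois[OF \<psi>])
  finally show ?thesis by (simp add: \<Theta>_def L.mult_one_right)
qed

text \<open>
  \<open>X\<^sub>+ \<otimes> X\<^sub>-\<^sub>1 \<diamondop> X\<^sub>-\<^sub>2 = X\<^sub>+\<^sub>+ \<otimes> X\<^sub>- \<diamondop> X\<^sub>+\<^sub>-\<close>.  Put \<open>\<psi>(a, b, c) = \<phi>(a\<^sub>+\<^sub>+, a\<^sub>-b, a\<^sub>+\<^sub>-c)\<close>, which is the
  right hand side for \<open>b = c = 1\<close>.  Applying \<open>D_galois\<close> twice gives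
  \<open>\<phi>(q, m, n) = \<psi>(q\<^sub>1, q\<^sub>2m, q\<^sub>3n)\<close>, so the left hand side is
  \<open>\<psi>(X\<^sub>+\<^sub>1, X\<^sub>+\<^sub>2X\<^sub>-\<^sub>1, X\<^sub>+\<^sub>3X\<^sub>-\<^sub>2)\<close>, in which \<open>X\<^sub>+\<^sub>1 \<diamondop> X\<^sub>+\<^sub>2X\<^sub>- = X \<diamondop> 1\<close>.
\<close>

lemma E_coassoc_minus:
  assumes diamond_bal: "\<And>p. diamond_bal (\<phi> p)" and otgt_bal: "\<And>m. otgt_bal (\<lambda>p n. \<phi> p m n)"
  shows "E (\<lambda>p m. D (\<phi> p) m) X = E (\<lambda>p m. E (\<lambda>q n. \<phi> q m n) p) X"
proof -
  note s = diamond_bal_simps[OF diamond_bal] otgt_bal_simps[OF otgt_bal]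
  \<comment> \<open>\<open>\<chi> b c p w\<close> is \<open>\<phi>(p\<^sub>+, wb, p\<^sub>-c)\<close>\<close>
  define \<chi> where "\<chi> b c p w = E (\<lambda>q n. \<phi> q (w \<star> b) (n \<star> c)) p" for b c p w
  define \<psi> where "\<psi> a b c = E (\<chi> b c) a" for a b c
  have bo1: "otgt_bal (\<lambda>q n. \<phi> q w (n \<star> c))" for w c by (rule otgt_bal_mulr[OF otgt_bal])
  have bo2: "otgt_bal (\<chi> b c)" for b c
    unfolding \<chi>_def by (rule otgt_balI; simp add: s E_rules[OF bo1] E_fun_add alg)
  have \<chi>_add: "\<chi> (x + x') y = (\<lambda>p w. \<chi> x y p w + \<chi> x' y p w)" "\<chi> y (x + x') = (\<lambda>p w. \<chi> y x p w + \<chi> y x' p w)" for x x' y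
    unfolding \<chi>_def by (intro ext; simp add: s E_fun_add alg)+
  have \<psi>_bd: "diamond_bal (\<lambda>b c. \<psi> a b c)" for a
  proof (rule diamond_balI)
    fix x r y
    have "\<chi> (\<tau> r \<star> x) y = (\<lambda>p w. \<chi> x y p (w \<star> \<tau> r))" "\<chi> x (\<sigma> r \<star> y) = (\<lambda>p w. \<chi> x y (\<tau> r \<star> p) w)"
      unfolding \<chi>_def by (intro ext; simp add: E_rules[OF bo1] alg)+
    then show "\<psi> a (\<tau> r \<star> x) y = \<psi> a x (\<sigma> r \<star> y)"
      by (simp only: \<psi>_def E_tak[OF bo2])
  next
    fix x x' y
    show "\<psi> a (x + x') y = \<psi> a x y + \<psi> a x' y" "\<psi> a y (x + x') = \<psi> a y x + \<psi> a y x'"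
      by (simp_all only: \<psi>_def E_fun_add \<chi>_add)
  qed
  have \<psi>_bd': "diamond_bal (\<lambda>a b. \<psi> a b c)" for c
  proof (rule diamond_balI)
    fix x r y
    have "\<chi> (\<sigma> r \<star> y) c = (\<lambda>p w. \<chi> y c p (w \<star> \<sigma> r))"
      unfolding \<chi>_def by (simp add: alg)
    then show "\<psi> (\<tau> r \<star> x) y c = \<psi> x (\<sigma> r \<star> y) c" by (simp only: \<psi>_def E_tgt[OF bo2])
  qed (simp_all only: \<psi>_def E_add[OF bo2] E_fun_add \<chi>_add)
  have \<psi>3: "diamond_bal3 (\<lambda>x y z. \<psi> x (y \<star> m1) (z \<star> m2))" for m1 m2
    unfolding diamond_bal3_def by (intro allI conjI diamond_balI; simp add: diamond_bal_simps[OF \<psi>_bd] diamond_bal_simps[OF \<psi>_bd'] alg)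
  have \<phi>: "\<phi> q m n = D (\<lambda>z y. D (\<lambda>x1 x2. \<psi> x1 (x2 \<star> m) (y \<star> n)) z) q" for q m n
  proof -
    have "D (\<lambda>z y. D (\<lambda>x1 x2. \<psi> x1 (x2 \<star> m) (y \<star> n)) z) q =
        D (\<lambda>z y. D (\<lambda>x1 x2. E (\<lambda>p w. \<chi> m (y \<star> n) p (w \<star> x2)) x1) z) q"
      by (simp add: \<psi>_def \<chi>_def[abs_def] L.mult_assoc)
    also have "\<dots> = D (\<lambda>z y. E (\<lambda>q k. \<phi> q m (k \<star> (y \<star> n))) z) q"
      unfolding D_galois[OF bo2] by (simp add: \<chi>_def L.mult_one_left)
    also have "\<dots> = \<phi> q m n" by (rule D_galois'[OF otgt_bal])
    finally show ?thesis ..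
  qed
  have \<Psi>: "diamond_bal (\<lambda>a w. D (\<psi> a) w)"
  proof -
    have "\<psi> (x + x') = (\<lambda>b c. \<psi> x b c + \<psi> x' b c)" "\<psi> (\<tau> r \<star> x) = (\<lambda>b c. \<psi> x (\<sigma> r \<star> b) c)" for x x' r
      by (intro ext; simp add: diamond_bal_simps[OF \<psi>_bd'])+
    then show ?thesis by (intro diamond_balI) (simp_all only: D_rules[OF \<psi>_bd] D_fun_add)
  qed
  have "E (\<lambda>p m. D (\<phi> p) m) X =
      E (\<lambda>p m. D (\<lambda>m1 m2. D (\<lambda>z y. D (\<lambda>x1 x2. \<psi> x1 (x2 \<star> m1) (y \<star> m2)) z) p) m) X"
    unfolding \<phi>[symmetric] ..
  also have "\<dots> = E (\<lambda>p m. D (\<lambda>m1 m2. D (\<lambda>x y. D (\<lambda>y1 y2. \<psi> x (y1 \<star> m1) (y2 \<star> m2)) y) p) m) X"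
    unfolding D_coassoc[OF \<psi>3] ..
  also have "\<dots> = E (\<lambda>p m. D (\<lambda>x y. D (\<psi> x) (y \<star> m)) p) X"
    unfolding D_mult[OF \<psi>_bd] by (rule arg_cong[where f = "\<lambda>f. E f X"], intro ext, rule D_swap)
  also have "\<dots> = D (\<psi> X) \<one>" by (rule E_galois[OF \<Psi>])
  also have "\<dots> = \<psi> X \<one> \<one>" by (rule D_one[OF \<psi>_bd])
  finally show ?thesis by (simp add: \<psi>_def \<chi>_def[abs_def] L.mult_one_right)
qed

text \<open>
  Apply \<open>\<tau>(\<epsilon>(X\<^sub>2))X\<^sub>1\<close> to both sides of \<open>X\<^sub>+\<^sub>1 \<diamondop> X\<^sub>+\<^sub>2X\<^sub>- = X \<diamondop> 1\<close>.
\<close>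

lemma E_counit: "E (\<lambda>p m. p \<star> \<tau> (\<epsilon> m)) X = X"
proof -
  have b: "diamond_bal (\<lambda>x y. \<tau> (\<epsilon> y) \<star> x)"
    by (rule diamond_balI) (simp_all add: alg cou_left)
  have "X = \<tau> (\<epsilon> \<one>) \<star> X" by (simp add: cou_one alg)
  also have "\<dots> = E (\<lambda>p m. D (\<lambda>x y. \<tau> (\<epsilon> (y \<star> m)) \<star> x) p) X" by (rule E_galois[OF b, symmetric])
  also have "\<dots> = E (\<lambda>p m. D (\<lambda>x y. \<tau> (\<epsilon> y) \<star> x) (p \<star> \<tau> (\<epsilon> m))) X"
    by (simp add: D_tgtR[OF b] cou_tgt)
  also have "\<dots> = E (\<lambda>p m. p \<star> \<tau> (\<epsilon> m)) X" by (simp add: counitR)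
  finally show ?thesis ..
qed

end

section \<open>Products twisted by a cocycle\<close>

context left_bialgebroid begin

text \<open>
  Maps that can be evaluated on \<open>X\<^sub>1, X\<^sub>2, Y\<^sub>1, Y\<^sub>2\<close>.  In the legs of \<open>Y\<close> they are balanced only after
  summation over those of \<open>X\<close>, by the Takeuchi property.
\<close>

definition both_bal :: "('l \<Rightarrow> 'l \<Rightarrow> 'l \<Rightarrow> 'l \<Rightarrow> 'v::ab_group_add) \<Rightarrow> bool" where
  "both_bal F \<longleftrightarrow> (\<forall>y1 y2. diamond_bal (\<lambda>x1 x2. F x1 x2 y1 y2)) \<and> (\<forall>x1 x2. biadditive (F x1 x2)) \<and>
     (\<forall>x1 x2 y1 y2 b. F x1 x2 (\<tau> b \<star> y1) y2 = F (x1 \<star> \<tau> b) x2 y1 y2) \<and>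
     (\<forall>x1 x2 y1 y2 b. F x1 x2 y1 (\<sigma> b \<star> y2) = F x1 (x2 \<star> \<sigma> b) y1 y2)"

lemma both_bal_diamond_bal:
  assumes "both_bal F" shows "diamond_bal (\<lambda>y1 y2. D (\<lambda>x1 x2. F x1 x2 y1 y2) X)"
proof -
  have "diamond_bal (\<lambda>x1 x2. F x1 x2 y1 y2)" for y1 y2 using assms by (simp add: both_bal_def)
  from D_tak[OF this] show ?thesis
    using assms by (intro diamond_balI) (simp_all add: both_bal_def biadditive_def D_fun_add)
qed

definition D2 :: "('l \<Rightarrow> 'l \<Rightarrow> 'l \<Rightarrow> 'l \<Rightarrow> 'v::ab_group_add) \<Rightarrow> 'l \<Rightarrow> 'l \<Rightarrow> 'v" where
  "D2 F X Y = D (\<lambda>y1 y2. D (\<lambda>x1 x2. F x1 x2 y1 y2) X) Y"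

text \<open>
  Coassociativity for \<open>X\<close> and \<open>Y\<close> at the same time: both sides are
  \<open>G(X\<^sub>1, X\<^sub>2, X\<^sub>3, Y\<^sub>1, Y\<^sub>2, Y\<^sub>3)\<close>.
\<close>

lemma D2_coassoc:
  assumes x: "\<And>y1 y2 y3. diamond_bal3 (\<lambda>x1 x2 x3. G x1 x2 x3 y1 y2 y3)"
    and add: "\<And>x1 x2 x3 y1 y1' y2 y3. G x1 x2 x3 (y1 + y1') y2 y3 = G x1 x2 x3 y1 y2 y3 + G x1 x2 x3 y1' y2 y3"
      "\<And>x1 x2 x3 y1 y2 y2' y3. G x1 x2 x3 y1 (y2 + y2') y3 = G x1 x2 x3 y1 y2 y3 + G x1 x2 x3 y1 y2' y3"
      "\<And>x1 x2 x3 y1 y2 y3 y3'. G x1 x2 x3 y1 y2 (y3 + y3') = G x1 x2 x3 y1 y2 y3 + G x1 x2 x3 y1 y2 y3'"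
    and y1: "\<And>x1 x2 x3 y1 y2 y3 b. G x1 x2 x3 (\<tau> b \<star> y1) y2 y3 = G (x1 \<star> \<tau> b) x2 x3 y1 y2 y3"
    and y2: "\<And>x1 x2 x3 y1 y2 y3 b. G x1 x2 x3 y1 (\<tau> b \<star> y2) y3 = G x1 (x2 \<star> \<tau> b) x3 y1 y2 y3"
      "\<And>x1 x2 x3 y1 y2 y3 b. G x1 x2 x3 y1 (\<sigma> b \<star> y2) y3 = G x1 (x2 \<star> \<sigma> b) x3 y1 y2 y3"
    and y3: "\<And>x1 x2 x3 y1 y2 y3 b. G x1 x2 x3 y1 y2 (\<sigma> b \<star> y3) = G x1 x2 (x3 \<star> \<sigma> b) y1 y2 y3"
  shows "D2 (\<lambda>x1 u y1 v. D2 (\<lambda>a b c d. G x1 a b y1 c d) u v) X Y =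
         D2 (\<lambda>u b v d. D2 (\<lambda>x1 a y1 c. G x1 a b y1 c d) u v) X Y"
proof -
  \<comment> \<open>The coproduct of \<open>X\<close> is summed first, after which coassociativity can be applied to \<open>Y\<close>.\<close>
  define K where "K y1 c d = D (\<lambda>u b. D (\<lambda>x1 a. G x1 a b y1 c d) u) X" for y1 c d
  have b1: "diamond_bal (\<lambda>x1 a. G x1 a b y1 c d)" and b2: "diamond_bal (\<lambda>x2 x3. G x1 x2 x3 y1 c d)" for x1 y1 c d b
    using x[of y1 c d] by (simp_all add: diamond_bal3_def)
  have b4: "diamond_bal (\<lambda>u b. D (\<lambda>x1 a. G x1 a b y1 c d) u)" for y1 c d
    by (rule diamond_balI) (simp_all add: D_add[OF b1] D_tgt[OF b1] D_fun_add diamond_bal_simps[OF b2])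
  have K: "diamond_bal3 K"
    unfolding diamond_bal3_def
  proof (intro allI conjI diamond_balI)
    fix z x r y
    show "K (\<tau> r \<star> x) y z = K x (\<sigma> r \<star> y) z"
      unfolding K_def y1 y2 D_tak[OF b1] ..
    show "K z (\<tau> r \<star> x) y = K z x (\<sigma> r \<star> y)"
      using D_tak[OF b4[of z x y], of r X] unfolding K_def y2 y3 D_tgtR[OF b1] .
  qed (simp_all add: K_def add D_fun_add)
  have "D2 (\<lambda>x1 u y1 v. D2 (\<lambda>a b c d. G x1 a b y1 c d) u v) X Y =
      D (\<lambda>y1 v. D (\<lambda>c d. D (\<lambda>x1 u. D (\<lambda>a b. G x1 a b y1 c d) u) X) v) Y"
    unfolding D2_def by (rule arg_cong[where f = "\<lambda>f. D f Y"], intro ext, rule D_swap)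
  also have "\<dots> = D (\<lambda>y1 v. D (K y1) v) Y"
    unfolding D_coassoc[OF x, symmetric] by (simp add: K_def[abs_def])
  also have "\<dots> = D (\<lambda>v d. D (\<lambda>y1 c. K y1 c d) v) Y"
    unfolding D_coassoc[OF K] ..
  also have "\<dots> = D2 (\<lambda>u b v d. D2 (\<lambda>x1 a y1 c. G x1 a b y1 c d) u v) X Y"
    unfolding D2_def K_def by (rule arg_cong[where f = "\<lambda>f. D f Y"], intro ext, rule D_swap)
  finally show ?thesis .
qed

end

locale twist = left_hopf H + left_2_cocycle H \<Gamma>
  for H :: "('k::field, 'b::ab_group_add, 'l::ab_group_add) bialgebroid" and \<Gamma> :: "'l \<Rightarrow> 'l \<Rightarrow> 'b"
begin

lemma \<Gamma>_rules: "\<Gamma> (x + x') y = \<Gamma> x y + \<Gamma> x' y" "\<Gamma> x (y + y') = \<Gamma> x y + \<Gamma> x y'"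
    "\<Gamma> (sc c x) y = ascale (base H) c (\<Gamma> x y)" "\<Gamma> x (sc c y) = ascale (base H) c (\<Gamma> x y)"
    "\<Gamma> (\<tau> b \<star> x) y = \<Gamma> x y \<circ>\<^sub>B b" "\<Gamma> (x \<star> \<tau> b) y = \<Gamma> x (\<tau> b \<star> y)"
    "\<Gamma> \<one> x = \<epsilon> x" "\<Gamma> x \<one> = \<epsilon> x"
  using linear_left[of y] linear_right[of x] tgt_linear balanced normal_left normal_right
  by (auto simp: Vector_Spaces.linear_iff)

lemmas alg\<Gamma> = alg \<Gamma>_rules

text \<open>
  This product, which is twisted on the left only, is the one that the cocycle identity is about.
\<close>

definition lprod :: "'l \<Rightarrow> 'l \<Rightarrow> 'l" (infixl "\<odot>" 70) where
  "X \<odot> Y = D2 (\<lambda>x1 x2 y1 y2. \<sigma> (\<Gamma> x1 y1) \<star> (x2 \<star> y2)) X Y"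

lemma both_bal_lprod: "both_bal (\<lambda>x1 x2 y1 y2. \<sigma> (\<Gamma> x1 y1) \<star> (x2 \<star> y2))"
  by (auto simp: both_bal_def biadditive_def diamond_bal_iff alg\<Gamma>)

lemma diamond_bal_lprod: "diamond_bal (\<lambda>x1 x2. \<sigma> (\<Gamma> x1 y1) \<star> (x2 \<star> y2))"
  "diamond_bal (\<lambda>y1 y2. D (\<lambda>x1 x2. \<sigma> (\<Gamma> x1 y1) \<star> (x2 \<star> y2)) X)"
  using both_bal_lprod both_bal_diamond_bal[OF both_bal_lprod] by (simp_all add: both_bal_def)

lemma lprod_add: "(x + x') \<odot> y = x \<odot> y + x' \<odot> y" "x \<odot> (y + y') = x \<odot> y + x \<odot> y'"
  unfolding lprod_def D2_def by (simp_all only: D_add[OF diamond_bal_lprod(1)] D_add[OF diamond_bal_lprod(2)] D_fun_add)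

lemma D_sc: "D (\<lambda>x y. sc c (f x y)) X = sc c (D f X)"
  by (rule D_additive[symmetric]) (simp add: L.vs.scale_right_distrib)

lemma E_sc: "E (\<lambda>x y. sc c (f x y)) X = sc c (E f X)"
  by (rule E_additive[symmetric]) (simp add: L.vs.scale_right_distrib)

lemma lprod_scale: "(sc c x) \<odot> y = sc c (x \<odot> y)" "x \<odot> (sc c y) = sc c (x \<odot> y)"
  unfolding lprod_def D2_def by (simp_all add: D_scale[OF diamond_bal_lprod(1)] D_scale[OF diamond_bal_lprod(2)] alg\<Gamma> D_sc)

lemma E_homogeneous: "homogeneous sc sV \<phi> \<Longrightarrow> lsum sV (\<lambda>(x, y). \<phi> x y) (rep (translation H X)) = E \<phi> X"
  by (simp add: ev_homogeneous E_def)
lemma D_homogeneous: "homogeneous sc sV \<phi> \<Longrightarrow> lsum sV (\<lambda>(x, y). \<phi> x y) (rep (cop H X)) = D \<phi> X"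
  by (simp add: ev_homogeneous D_def)

text \<open>
  In this form the cocycle identity says that \<open>\<Gamma>\<close> is balanced over \<open>\<odot>\<close>; all later uses of it are of
  this kind.
\<close>

lemma cocycle_lprod: "\<Gamma> X (Y \<odot> Z) = \<Gamma> (X \<odot> Y) Z"
proof -
  have *: "lsum sc (\<lambda>(y1, y2). lsum sc (\<lambda>(z1, z2). \<sigma> (\<Gamma> y1 z1) \<star> y2 \<star> z2) (rep (cop H Z))) (rep (cop H Y)) = Y \<odot> Z" for Y Z
  proof -
    have h: "homogeneous sc sc (\<lambda>z1 z2. \<sigma> (\<Gamma> y1 z1) \<star> y2 \<star> z2)"
      "homogeneous sc sc (\<lambda>y1 y2. D (\<lambda>z1 z2. \<sigma> (\<Gamma> y1 z1) \<star> y2 \<star> z2) Z)" for y1 y2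
      by (simp_all add: homogeneous_def alg\<Gamma> D_sc)
    have "lsum sc (\<lambda>(y1, y2). lsum sc (\<lambda>(z1, z2). \<sigma> (\<Gamma> y1 z1) \<star> y2 \<star> z2) (rep (cop H Z))) (rep (cop H Y)) =
       D (\<lambda>y1 y2. D (\<lambda>z1 z2. \<sigma> (\<Gamma> y1 z1) \<star> (y2 \<star> z2)) Z) Y"
      unfolding D_homogeneous[OF h(1)] D_homogeneous[OF h(2)]
      by (rule arg_cong[where f = "\<lambda>f. D f Y"], intro ext, rule arg_cong[where f = "\<lambda>f. D f Z"], intro ext, rule L.mult_assoc)
    also have "\<dots> = Y \<odot> Z" unfolding lprod_def D2_def by (rule D_swap)
    finally show ?thesis .
  qed
  show ?thesis
    using cocycle[OF rep_cop[of X] rep_cop[of Y] rep_cop[of Z]] unfolding * .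
qed

text \<open>
  \<open>\<Delta>(X \<odot> Y) = X\<^sub>1 \<odot> Y\<^sub>1 \<diamondop> X\<^sub>2Y\<^sub>2\<close>, because \<open>\<odot>\<close> differs from the product only in the first legs.
\<close>

lemma D_lprod:
  assumes \<chi>: "diamond_bal \<chi>"
  shows "D \<chi> (X \<odot> Y) = D (\<lambda>y1 y2. D (\<lambda>x1 x2. \<chi> (x1 \<odot> y1) (x2 \<star> y2)) X) Y"
proof -
  note s = diamond_bal_simps[OF \<chi>]
  define G where "G x1 x2 x3 y1 y2 y3 = \<chi> (\<sigma> (\<Gamma> x1 y1) \<star> (x2 \<star> y2)) (x3 \<star> y3)" for x1 x2 x3 y1 y2 y3
  have "D \<chi> (X \<odot> Y) = D2 (\<lambda>x1 u y1 v. D \<chi> (\<sigma> (\<Gamma> x1 y1) \<star> (u \<star> v))) X Y"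
    unfolding lprod_def D2_def by (simp only: D_additive[of "D \<chi>", OF D_add[OF \<chi>]])
  also have "\<dots> = D2 (\<lambda>x1 u y1 v. D2 (\<lambda>a b c d. G x1 a b y1 c d) u v) X Y"
    unfolding D2_def G_def by (simp add: D_src[OF \<chi>] D_mult[OF diamond_bal_lsrc[OF \<chi>]])
  also have "\<dots> = D2 (\<lambda>u b v d. D2 (\<lambda>x1 a y1 c. G x1 a b y1 c d) u v) X Y"
    by (rule D2_coassoc) (auto simp: G_def diamond_bal3_def diamond_bal_iff alg\<Gamma> s)
  also have "\<dots> = D (\<lambda>y1 y2. D (\<lambda>x1 x2. \<chi> (x1 \<odot> y1) (x2 \<star> y2)) X) Y"
    unfolding lprod_def D2_def G_def by (simp only: D_additive[of "\<lambda>x. \<chi> x y" for y, OF s(1)])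
  finally show ?thesis .
qed

lemma lprod_assoc: "(X \<odot> Y) \<odot> Z = X \<odot> (Y \<odot> Z)"
proof -
  have "(X \<odot> Y) \<odot> Z = D (\<lambda>z1 z2. D (\<lambda>y1 y2. D (\<lambda>x1 x2. \<sigma> (\<Gamma> (x1 \<odot> y1) z1) \<star> (x2 \<star> (y2 \<star> z2))) X) Y) Z"
    unfolding lprod_def[of "X \<odot> Y"] D2_def by (simp add: D_lprod[OF diamond_bal_lprod(1)] L.mult_assoc)
  also have "\<dots> = D (\<lambda>z1 z2. D (\<lambda>y1 y2. D (\<lambda>x1 x2. \<sigma> (\<Gamma> x1 (y1 \<odot> z1)) \<star> (x2 \<star> (y2 \<star> z2))) X) Y) Z"
    unfolding cocycle_lprod ..
  also have "\<dots> = X \<odot> (Y \<odot> Z)"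
    unfolding lprod_def[of X "Y \<odot> Z"] D2_def by (rule D_lprod[OF diamond_bal_lprod(2), symmetric])
  finally show ?thesis .
qed

lemma lprod_one: "\<one> \<odot> X = X" "X \<odot> \<one> = X"
  unfolding lprod_def D2_def D_one[OF diamond_bal_lprod(1)] D_one[OF diamond_bal_lprod(2)] by (simp_all add: alg\<Gamma> counitL)

lemma lprod_tgt: "\<tau> b \<odot> X = \<tau> b \<star> X" "X \<odot> \<tau> b = X \<star> \<tau> b"
proof -
  have "D (\<lambda>x y. \<sigma> (\<epsilon> x) \<star> (\<tau> b \<star> y)) X = \<tau> b \<star> D (\<lambda>x y. \<sigma> (\<epsilon> x) \<star> y) X"
    by (subst D_additive[of "\<lambda>x. \<tau> b \<star> x"]) (simp_all add: alg)
  then show "\<tau> b \<odot> X = \<tau> b \<star> X"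
    unfolding lprod_def D2_def D_t[OF diamond_bal_lprod(1)] by (simp add: alg\<Gamma> counitL)
  have "D (\<lambda>x y. \<sigma> (\<epsilon> x) \<star> (y \<star> \<tau> b)) X = D (\<lambda>x y. \<sigma> (\<epsilon> x) \<star> y) X \<star> \<tau> b"
    by (subst D_additive[of "\<lambda>x. x \<star> \<tau> b"]) (simp_all add: alg)
  then show "X \<odot> \<tau> b = X \<star> \<tau> b"
    unfolding lprod_def D2_def D_t[OF diamond_bal_lprod(2)] by (simp add: alg\<Gamma> counitL)
qed

lemma lprod_src: "\<sigma> a \<odot> \<sigma> b = \<sigma> (\<Gamma> (\<sigma> a) (\<sigma> b))"
  unfolding lprod_def D2_def D_s[OF diamond_bal_lprod(2)] unfolding D_s[OF diamond_bal_lprod(1)] by (simp add: alg)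

lemma lprod_tgt_mult: "(\<tau> b \<star> X) \<odot> Y = \<tau> b \<star> (X \<odot> Y)" "(X \<star> \<tau> b) \<odot> Y = X \<odot> (\<tau> b \<star> Y)" "X \<odot> (Y \<star> \<tau> b) = (X \<odot> Y) \<star> \<tau> b"
  unfolding lprod_tgt[symmetric] lprod_assoc by rule+

lemmas lprod_rules = lprod_add lprod_scale lprod_tgt_mult lprod_one

text \<open>
  By \<open>E_coassoc_minus\<close>, \<open>X\<^sub>+ \<odot> X\<^sub>- = \<sigma>(\<Gamma>(X\<^sub>+\<^sub>1, X\<^sub>-\<^sub>1))X\<^sub>+\<^sub>2X\<^sub>-\<^sub>2 =
  \<sigma>(\<Gamma>(X\<^sub>+\<^sub>+\<^sub>1, X\<^sub>-))X\<^sub>+\<^sub>+\<^sub>2X\<^sub>+\<^sub>-\<close>, which is \<open>\<sigma>(\<Gamma>(X\<^sub>+, X\<^sub>-))\<close> by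
  \<open>E_galois\<close>.  This is the counit of the twisted bialgebroid.
\<close>

lemma lprod_antipode: "E (\<lambda>p m. p \<odot> m) X = \<sigma> (E (\<lambda>p m. \<Gamma> p m) X)"
proof -
  define \<phi> where "\<phi> p m1 m2 = D (\<lambda>p1 p2. \<sigma> (\<Gamma> p1 m1) \<star> (p2 \<star> m2)) p" for p m1 m2
  have "diamond_bal (\<phi> p)" for p unfolding \<phi>_def by (rule diamond_bal_lprod(2))
  moreover have "otgt_bal (\<lambda>p n. \<phi> p m n)" for m
    unfolding \<phi>_def by (rule otgt_balI) (simp_all add: D_add[OF diamond_bal_lprod(1)] D_tgtR[OF diamond_bal_lprod(1)] alg D_fun_add)
  ultimately have "E (\<lambda>p m. D (\<phi> p) m) X = E (\<lambda>p m. E (\<lambda>q n. \<phi> q m n) p) X" by (rule E_coassoc_minus)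
  also have "\<dots> = E (\<lambda>p m. \<sigma> (\<Gamma> p m)) X"
  proof -
    have "diamond_bal (\<lambda>x y. \<sigma> (\<Gamma> x m) \<star> y)" for m by (rule diamond_balI) (simp_all add: alg\<Gamma>)
    from E_galois[OF this] show ?thesis by (simp add: \<phi>_def alg)
  qed
  also have "\<dots> = \<sigma> (E (\<lambda>p m. \<Gamma> p m) X)" by (rule E_additive[symmetric]) (simp add: alg)
  finally show ?thesis by (simp add: \<phi>_def[abs_def] lprod_def D2_def)
qed

text \<open>
  Maps that can be evaluated on \<open>X\<^sub>+ \<odot> Y\<^sub>+, Y\<^sub>-, X\<^sub>-\<close>.
\<close>

definition mixed_bal :: "('l \<Rightarrow> 'l \<Rightarrow> 'l \<Rightarrow> 'v::ab_group_add) \<Rightarrow> bool" where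
  "mixed_bal F \<longleftrightarrow> (\<forall>m. biadditive (\<lambda>a n. F a n m)) \<and> (\<forall>a. biadditive (F a)) \<and>
     (\<forall>a b n m. F (a \<star> \<tau> b) n m = F a (\<tau> b \<star> n) m) \<and> (\<forall>a b n m. F a (n \<star> \<tau> b) m = F a n (\<tau> b \<star> m))"

lemma mixed_bal_simps:
  assumes "mixed_bal F"
  shows "F (a + a') n m = F a n m + F a' n m" "F a (n + n') m = F a n m + F a n' m" "F a n (m + m') = F a n m + F a n m'"
    "F (a \<star> \<tau> b) n m = F a (\<tau> b \<star> n) m" "F (a \<star> (a' \<star> \<tau> b)) n m = F (a \<star> a') (\<tau> b \<star> n) m"
    "F (a \<star> (a' \<star> (a'' \<star> \<tau> b))) n m = F (a \<star> (a' \<star> a'')) (\<tau> b \<star> n) m"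
    "F a (n \<star> \<tau> b) m = F a n (\<tau> b \<star> m)"
  using assms by (auto simp: mixed_bal_def biadditive_def simp flip: L.mult_assoc)

lemma mixed_bal_otgt_bal: assumes "mixed_bal F"
  shows "otgt_bal (\<lambda>q n. F (w \<star> q) n m)" "otgt_bal (\<lambda>q n. F (p \<odot> q) n m)"
    "otgt_bal (\<lambda>p m. E (\<lambda>q n. F (w \<star> (p \<star> q)) n m) Y)" "otgt_bal (\<lambda>p m. E (\<lambda>q n. F (p \<odot> q) n m) Y)"
proof -
  note s = mixed_bal_simps[OF assms]
  show b: "otgt_bal (\<lambda>q n. F (w \<star> q) n m)" "otgt_bal (\<lambda>q n. F (p \<odot> q) n m)" for w m p
    by (rule otgt_balI; simp add: s lprod_rules alg)+
  show "otgt_bal (\<lambda>p m. E (\<lambda>q n. F (w \<star> (p \<star> q)) n m) Y)"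
  proof (rule otgt_balI)
    fix x r y
    show "E (\<lambda>q n. F (w \<star> (x \<star> \<tau> r \<star> q)) n y) Y = E (\<lambda>q n. F (w \<star> (x \<star> q)) n (\<tau> r \<star> y)) Y"
      using E_tak[OF b(1)[of "w \<star> x" y], of r Y] by (simp add: s L.mult_assoc)
  qed (simp_all add: s alg E_fun_add)
  show "otgt_bal (\<lambda>p m. E (\<lambda>q n. F (p \<odot> q) n m) Y)"
  proof (rule otgt_balI)
    fix x r y
    show "E (\<lambda>q n. F ((x \<star> \<tau> r) \<odot> q) n y) Y = E (\<lambda>q n. F (x \<odot> q) n (\<tau> r \<star> y)) Y"
      using E_tak[OF b(2)[of x y], of r Y] by (simp add: s lprod_rules)
  qed (simp_all add: s lprod_rules E_fun_add)
qed

text \<open>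
  The translation map is applied to the second legs of \<open>X\<close> and \<open>Y\<close> on the left, and before the
  coproducts on the right; \<open>E_coassoc_plus\<close> for \<open>X\<close> and then for \<open>Y\<close> relates the two.
\<close>

lemma E_lprod_aux:
  assumes "mixed_bal F"
  shows "D (\<lambda>y1 y2. D (\<lambda>x1 x2. E (\<lambda>p m. E (\<lambda>q n. F (\<sigma> (\<Gamma> x1 y1) \<star> (p \<star> q)) n m) y2) x2) X) Y =
      E (\<lambda>p m. E (\<lambda>q n. F (p \<odot> q) n m) Y) X"
proof -
  note s = mixed_bal_simps[OF assms]
  have "D (\<lambda>x1 x2. E (\<lambda>p m. E (\<lambda>q n. F (\<sigma> (\<Gamma> x1 y1) \<star> (p \<star> q)) n m) y2) x2) X =
     E (\<lambda>p m. D (\<lambda>x1 x2. E (\<lambda>q n. F (\<sigma> (\<Gamma> x1 y1) \<star> (x2 \<star> q)) n m) y2) p) X" for y1 y2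
  proof (rule E_coassoc_plus[OF _ mixed_bal_otgt_bal(3)[OF assms]])
    show "diamond_bal (\<lambda>x1 p. E (\<lambda>q n. F (\<sigma> (\<Gamma> x1 y1) \<star> (p \<star> q)) n m) y2)" for m
      by (rule diamond_balI) (simp_all add: s alg\<Gamma> E_fun_add)
  qed
  then have "D (\<lambda>y1 y2. D (\<lambda>x1 x2. E (\<lambda>p m. E (\<lambda>q n. F (\<sigma> (\<Gamma> x1 y1) \<star> (p \<star> q)) n m) y2) x2) X) Y =
     E (\<lambda>p m. D (\<lambda>y1 y2. E (\<lambda>q n. D (\<lambda>x1 x2. F (\<sigma> (\<Gamma> x1 y1) \<star> (x2 \<star> q)) n m) p) y2) Y) X"
    by (simp add: DE_swap)
  also have "\<dots> = E (\<lambda>p m. E (\<lambda>q n. D (\<lambda>y1 y2. D (\<lambda>x1 x2. F (\<sigma> (\<Gamma> x1 y1) \<star> (x2 \<star> y2)) n m) p) q) Y) X"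
  proof -
    have "D (\<lambda>y1 y2. E (\<lambda>q n. D (\<lambda>x1 x2. F (\<sigma> (\<Gamma> x1 y1) \<star> (x2 \<star> q)) n m) p) y2) Y =
      E (\<lambda>q n. D (\<lambda>y1 y2. D (\<lambda>x1 x2. F (\<sigma> (\<Gamma> x1 y1) \<star> (x2 \<star> y2)) n m) p) q) Y" for p m
    proof (rule E_coassoc_plus)
      show "diamond_bal (\<lambda>y1 q. D (\<lambda>x1 x2. F (\<sigma> (\<Gamma> x1 y1) \<star> (x2 \<star> q)) n m) p)" for n
        by (rule both_bal_diamond_bal) (auto simp: both_bal_def diamond_bal_iff biadditive_def alg\<Gamma> s)
      show "otgt_bal (\<lambda>q n. D (\<lambda>x1 x2. F (\<sigma> (\<Gamma> x1 y1) \<star> (x2 \<star> q)) n m) p)" for y1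
        by (rule otgt_balI) (simp_all add: s alg\<Gamma> D_fun_add)
    qed
    then show ?thesis by simp
  qed
  also have "\<dots> = E (\<lambda>p m. E (\<lambda>q n. F (p \<odot> q) n m) Y) X"
    unfolding lprod_def D2_def by (simp only: D_additive[of "\<lambda>x. F x n m" for n m, OF s(1)])
  finally show ?thesis .
qed

text \<open>
  \<open>(X \<odot> Y)\<^sub>+ \<otimes> (X \<odot> Y)\<^sub>- = X\<^sub>+ \<odot> Y\<^sub>+ \<otimes> Y\<^sub>-X\<^sub>-\<close>: the left factor \<open>\<sigma>(\<Gamma>(X\<^sub>1, Y\<^sub>1))\<close> passes to the plus
  leg, and \<open>E_mult\<close> applies to \<open>X\<^sub>2Y\<^sub>2\<close>.
\<close>

lemma E_lprod:
  assumes \<phi>: "otgt_bal \<phi>"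
  shows "E \<phi> (X \<odot> Y) = E (\<lambda>p m. E (\<lambda>q n. \<phi> (p \<odot> q) (n \<star> m)) Y) X"
proof -
  have mixed_bal: "mixed_bal (\<lambda>a n m. \<phi> a (n \<star> m))" by (auto simp: mixed_bal_def biadditive_def otgt_bal_simps[OF \<phi>] alg)
  have otgt_bal: "otgt_bal (\<lambda>p m. \<phi> (\<sigma> a \<star> p) m)" for a by (rule otgt_balI) (simp_all add: otgt_bal_simps[OF \<phi>] alg)
  have "E \<phi> (X \<odot> Y) = D2 (\<lambda>x1 u y1 v. E \<phi> (\<sigma> (\<Gamma> x1 y1) \<star> (u \<star> v))) X Y"
    unfolding lprod_def D2_def by (simp only: D_additive[of "E \<phi>", OF E_add[OF \<phi>]])
  also have "\<dots> = E (\<lambda>p m. E (\<lambda>q n. \<phi> (p \<odot> q) (n \<star> m)) Y) X"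
    unfolding D2_def by (subst E_lprod_aux[OF mixed_bal, symmetric]) (simp add: E_src[OF \<phi>] E_mult[OF otgt_bal])
  finally show ?thesis .
qed

text \<open>
  The twisted product, which agrees with \<open>twisted_mult\<close> by \<open>E_lprod_aux\<close>.
\<close>

definition tprod :: "'l \<Rightarrow> 'l \<Rightarrow> 'l" (infixl "\<otimes>" 70) where
  "X \<otimes> Y = E (\<lambda>p m. E (\<lambda>q n. (p \<odot> q) \<star> \<tau> (\<Gamma> n m)) Y) X"

text \<open>
  The product twisted on the right only.  It occurs in the second leg of \<open>\<Delta>(X \<otimes> Y)\<close>.
\<close>

definition rprod :: "'l \<Rightarrow> 'l \<Rightarrow> 'l" (infixl "\<bullet>" 70) where
  "X \<bullet> Y = E (\<lambda>p m. E (\<lambda>q n. p \<star> (q \<star> \<tau> (\<Gamma> n m))) Y) X"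

lemma mixed_bal_tprod: "mixed_bal (\<lambda>a n m. a \<star> \<tau> (\<Gamma> n m))"
  by (auto simp: mixed_bal_def biadditive_def alg\<Gamma>)

lemma twisted_mult_eq: "twisted_mult H \<Gamma> X Y = X \<otimes> Y"
proof -
  note b = mixed_bal_otgt_bal(1,3)[OF mixed_bal_tprod]
  have h: "homogeneous sc sc (\<lambda>q n. \<sigma> g \<star> p \<star> q \<star> \<tau> (\<Gamma> n m))"
    "homogeneous sc sc (\<lambda>p m. E (\<lambda>q n. \<sigma> g \<star> p \<star> q \<star> \<tau> (\<Gamma> n m)) y2)"
    "homogeneous sc sc (\<lambda>y1 y2. E (\<lambda>p m. E (\<lambda>q n. \<sigma> (\<Gamma> x1 y1) \<star> p \<star> q \<star> \<tau> (\<Gamma> n m)) y2) x2)"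
    "homogeneous sc sc (\<lambda>x1 x2. D (\<lambda>y1 y2. E (\<lambda>p m. E (\<lambda>q n. \<sigma> (\<Gamma> x1 y1) \<star> p \<star> q \<star> \<tau> (\<Gamma> n m)) y2) x2) Y)"
    for g p m y2 x1 x2
    by (simp_all add: homogeneous_def alg\<Gamma> E_sc D_sc)
  have "twisted_mult H \<Gamma> X Y = D (\<lambda>x1 x2. D (\<lambda>y1 y2. E (\<lambda>p m. E (\<lambda>q n. \<sigma> (\<Gamma> x1 y1) \<star> p \<star> q \<star> \<tau> (\<Gamma> n m)) y2) x2) Y) X"
    unfolding twisted_mult_def E_homogeneous[OF h(1)] E_homogeneous[OF h(2)] D_homogeneous[OF h(3)] D_homogeneous[OF h(4)] ..
  also have "\<dots> = D (\<lambda>y1 y2. D (\<lambda>x1 x2. E (\<lambda>p m. E (\<lambda>q n. \<sigma> (\<Gamma> x1 y1) \<star> (p \<star> q) \<star> \<tau> (\<Gamma> n m)) y2) x2) X) Y"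
    by (subst D_swap) (simp add: L.mult_assoc)
  also have "\<dots> = X \<otimes> Y" unfolding tprod_def by (rule E_lprod_aux[OF mixed_bal_tprod])
  finally show ?thesis .
qed

lemma tprod_add: "(x + x') \<otimes> y = x \<otimes> y + x' \<otimes> y" "x \<otimes> (y + y') = x \<otimes> y + x \<otimes> y'"
  unfolding tprod_def by (simp_all only: E_add[OF mixed_bal_otgt_bal(2)[OF mixed_bal_tprod]] E_add[OF mixed_bal_otgt_bal(4)[OF mixed_bal_tprod]] E_fun_add)

lemma tprod_scale: "(sc c x) \<otimes> y = sc c (x \<otimes> y)" "x \<otimes> (sc c y) = sc c (x \<otimes> y)"
  unfolding tprod_def
  by (simp_all add: E_scale[OF mixed_bal_otgt_bal(2)[OF mixed_bal_tprod]] E_scale[OF mixed_bal_otgt_bal(4)[OF mixed_bal_tprod]] lprod_scale alg\<Gamma> E_sc)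

lemma rprod_otgt_bal: "otgt_bal (\<lambda>q n. p \<star> (q \<star> \<tau> (\<Gamma> n m)))" "otgt_bal (\<lambda>p m. E (\<lambda>q n. p \<star> (q \<star> \<tau> (\<Gamma> n m))) Y)"
  using mixed_bal_otgt_bal(1,3)[OF mixed_bal_tprod, where w = \<one>] mixed_bal_otgt_bal(1)[OF mixed_bal_tprod] by (simp_all add: L.mult_one_left L.mult_assoc)

lemma rprod_add: "(x + x') \<bullet> y = x \<bullet> y + x' \<bullet> y" "x \<bullet> (y + y') = x \<bullet> y + x \<bullet> y'"
  unfolding rprod_def by (simp_all only: E_add[OF rprod_otgt_bal(1)] E_add[OF rprod_otgt_bal(2)] E_fun_add)

lemma rprod_src: "(\<sigma> b \<star> x) \<bullet> y = \<sigma> b \<star> (x \<bullet> y)" "(x \<star> \<sigma> b) \<bullet> y = x \<bullet> (\<sigma> b \<star> y)"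
proof -
  have "\<sigma> b \<star> (x \<bullet> y) = E (\<lambda>p m. E (\<lambda>q n. \<sigma> b \<star> (p \<star> (q \<star> \<tau> (\<Gamma> n m)))) y) x"
    unfolding rprod_def by (simp only: E_additive[of "\<lambda>x. \<sigma> b \<star> x"] L.mult_add_right)
  then show "(\<sigma> b \<star> x) \<bullet> y = \<sigma> b \<star> (x \<bullet> y)"
    by (simp add: rprod_def E_src[OF rprod_otgt_bal(2)] L.mult_assoc)
  show "(x \<star> \<sigma> b) \<bullet> y = x \<bullet> (\<sigma> b \<star> y)"
    by (simp add: rprod_def E_srcR[OF rprod_otgt_bal(2)] E_src[OF rprod_otgt_bal(1)] L.mult_assoc)
qed

text \<open>
  \<open>(X \<otimes> Y)\<^sub>+ \<otimes> (X \<otimes> Y)\<^sub>- = X\<^sub>+ \<odot> Y\<^sub>+ \<otimes> Y\<^sub>- \<odot> X\<^sub>-\<close>.  The right factor \<open>\<tau>(\<Gamma>(Y\<^sub>-, X\<^sub>-))\<close> of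
  \<open>X \<otimes> Y\<close> becomes a left factor \<open>\<sigma>(\<Gamma>(Y\<^sub>-, X\<^sub>-))\<close> in the minus leg.  By \<open>E_coassoc_minus\<close>
  for \<open>X\<close> and for \<open>Y\<close>, what follows it are the second legs of \<open>Y\<^sub>-\<close> and \<open>X\<^sub>-\<close>, which makes up
  \<open>Y\<^sub>- \<odot> X\<^sub>-\<close>.
\<close>

lemma E_tprod:
  assumes \<phi>: "otgt_bal \<phi>"
  shows "E \<phi> (X \<otimes> Y) = E (\<lambda>p m. E (\<lambda>q n. \<phi> (p \<odot> q) (n \<odot> m)) Y) X"
proof -
  note s = otgt_bal_simps[OF \<phi>]
  have bs: "otgt_bal (\<lambda>p m. \<phi> p (\<sigma> c \<star> m))" for c by (rule otgt_balI) (simp_all add: s alg)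
  define G where "G n a m w = E (\<lambda>a' w'. \<phi> (a \<odot> a') (\<sigma> (\<Gamma> n m) \<star> (w' \<star> w)))" for n a m w
  have "E \<phi> (X \<otimes> Y) = E (\<lambda>p m. E (\<lambda>q n. E (\<lambda>a w. G n a m w q) p) Y) X"
    unfolding tprod_def
    by (simp add: E_additive[of "E \<phi>", OF E_add[OF \<phi>]] E_tgtR[OF \<phi>] E_lprod[OF bs] G_def)
  also have "\<dots> = E (\<lambda>p m. E (\<lambda>a w. E (\<lambda>q n. G n a m w q) Y) p) X"
    by (subst (2) E_swap) simp
  also have "\<dots> = E (\<lambda>p m. D (\<lambda>m1 m2. E (\<lambda>q n. G n p m1 m2 q) Y) m) X"
  proof (rule E_coassoc_minus[symmetric])
    have b1: "otgt_bal (\<lambda>a' w'. \<phi> (a \<odot> a') (\<sigma> (\<Gamma> n m) \<star> (w' \<star> w)))" for a n m w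
      by (rule otgt_balI) (simp_all add: s alg lprod_rules)
    have b2: "otgt_bal (\<lambda>q n. G n p m w q)" for p m w
      unfolding G_def by (rule otgt_balI) (simp_all add: E_add[OF b1] E_tgtR[OF b1] s alg\<Gamma> E_fun_add)
    show "diamond_bal (\<lambda>m1 m2. E (\<lambda>q n. G n p m1 m2 q) Y)" for p
    proof (rule diamond_balI)
      fix x r y
      have "(\<lambda>q n. G n p (\<tau> r \<star> x) y q) = (\<lambda>q n. G (n \<star> \<tau> r) p x y q)"
        by (intro ext) (simp add: G_def \<Gamma>_rules)
      moreover have "(\<lambda>q n. G n p x (\<sigma> r \<star> y) q) = (\<lambda>q n. G n p x y (\<tau> r \<star> q))"
        unfolding G_def by (intro ext) (simp add: E_tgt[OF b1] L.mult_assoc)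
      ultimately show "E (\<lambda>q n. G n p (\<tau> r \<star> x) y q) Y = E (\<lambda>q n. G n p x (\<sigma> r \<star> y) q) Y"
        by (simp only: E_tak[OF b2])
    qed (simp_all add: G_def s alg\<Gamma> E_fun_add)
    show "otgt_bal (\<lambda>p w. E (\<lambda>q n. G n p m w q) Y)" for m
    proof (rule otgt_balI)
      fix x r y
      have "G n (x \<star> \<tau> r) m y q = G n x m (\<tau> r \<star> y) q" for n q
        using E_tak[OF b1[of x n m y], of r q] by (simp add: G_def lprod_rules L.mult_assoc)
      then show "E (\<lambda>q n. G n (x \<star> \<tau> r) m y q) Y = E (\<lambda>q n. G n x m (\<tau> r \<star> y) q) Y" by simp
    qed (simp_all add: G_def s alg\<Gamma> lprod_rules E_fun_add)
  qed
  also have "\<dots> = E (\<lambda>p m. D (\<lambda>m1 m2. E (\<lambda>q n. D (\<lambda>n1 n2. \<phi> (p \<odot> q) (\<sigma> (\<Gamma> n1 m1) \<star> (n2 \<star> m2))) n) Y) m) X"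
  proof -
    have "E (\<lambda>q n. G n p m1 m2 q) Y = E (\<lambda>q n. D (\<lambda>n1 n2. \<phi> (p \<odot> q) (\<sigma> (\<Gamma> n1 m1) \<star> (n2 \<star> m2))) n) Y" for p m1 m2
      unfolding G_def
    proof (rule E_coassoc_minus[symmetric])
      show "diamond_bal (\<lambda>n1 n2. \<phi> (p \<odot> q) (\<sigma> (\<Gamma> n1 m1) \<star> (n2 \<star> m2)))" for q
        by (rule diamond_balI) (simp_all add: s alg\<Gamma>)
      show "otgt_bal (\<lambda>q n2. \<phi> (p \<odot> q) (\<sigma> (\<Gamma> n1 m1) \<star> (n2 \<star> m2)))" for n1
        by (rule otgt_balI) (simp_all add: s alg lprod_rules)
    qed
    then show ?thesis by simp
  qed
  also have "\<dots> = E (\<lambda>p m. E (\<lambda>q n. \<phi> (p \<odot> q) (n \<odot> m)) Y) X"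
    by (simp add: DE_swap lprod_def[of n m for n m] D2_def D_additive[of "\<phi> x" for x, OF s(2)])
  finally show ?thesis .
qed

text \<open>
  \<open>\<Delta>(X \<otimes> Y) = X\<^sub>1 \<odot> Y\<^sub>1 \<diamondop> X\<^sub>2 \<bullet> Y\<^sub>2\<close>.  The right factor \<open>\<tau>(\<Gamma>(Y\<^sub>-, X\<^sub>-))\<close> of \<open>X \<otimes> Y\<close> enters the
  second leg only, and \<open>E_coassoc_plus\<close> moves the translation maps there.
\<close>

lemma D_tprod:
  assumes \<chi>: "diamond_bal \<chi>"
  shows "D \<chi> (X \<otimes> Y) = D (\<lambda>y1 y2. D (\<lambda>x1 x2. \<chi> (x1 \<odot> y1) (x2 \<bullet> y2)) X) Y"
proof -
  note s = diamond_bal_simps[OF \<chi>]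
  have bs: "diamond_bal (\<lambda>x y. \<chi> x (y \<star> \<tau> c))" for c by (rule diamond_balI) (simp_all add: s alg)
  have bo': "otgt_bal (\<lambda>q n. \<chi> w (p \<star> (q \<star> \<tau> (\<Gamma> n m))))" for w p m
    by (rule otgt_balI) (simp_all add: s alg\<Gamma>)
  have both_bal: "both_bal (\<lambda>x1 x2 y1 y2. \<chi> (x1 \<odot> y1) (x2 \<star> (y2 \<star> \<tau> c)))" for c
    by (auto simp: both_bal_def diamond_bal_iff biadditive_def alg\<Gamma> s lprod_rules)
  have diamond_bal_both_bal: "diamond_bal (\<lambda>x1 x2. \<chi> (x1 \<odot> y1) (x2 \<star> (y2 \<star> \<tau> c)))" for y1 y2 c
    using both_bal by (simp add: both_bal_def)
  have "D \<chi> (X \<otimes> Y) = E (\<lambda>p m. E (\<lambda>q n. D (\<lambda>q1 q2. D (\<lambda>p1 p2. \<chi> (p1 \<odot> q1) (p2 \<star> (q2 \<star> \<tau> (\<Gamma> n m)))) p) q) Y) X"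
    unfolding tprod_def by (simp add: E_additive[of "D \<chi>", OF D_add[OF \<chi>]] D_tgtR[OF \<chi>] D_lprod[OF bs] L.mult_assoc)
  also have "\<dots> = E (\<lambda>p m. D (\<lambda>y1 y2. E (\<lambda>q n. D (\<lambda>p1 p2. \<chi> (p1 \<odot> y1) (p2 \<star> (q \<star> \<tau> (\<Gamma> n m)))) p) y2) Y) X"
  proof -
    have "D (\<lambda>y1 y2. E (\<lambda>q n. D (\<lambda>p1 p2. \<chi> (p1 \<odot> y1) (p2 \<star> (q \<star> \<tau> (\<Gamma> n m)))) p) y2) Y =
        E (\<lambda>q n. D (\<lambda>q1 q2. D (\<lambda>p1 p2. \<chi> (p1 \<odot> q1) (p2 \<star> (q2 \<star> \<tau> (\<Gamma> n m)))) p) q) Y" for p m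
    proof (rule E_coassoc_plus)
      show "diamond_bal (\<lambda>y1 q. D (\<lambda>p1 p2. \<chi> (p1 \<odot> y1) (p2 \<star> (q \<star> \<tau> (\<Gamma> n m)))) p)" for n
        by (rule both_bal_diamond_bal[OF both_bal])
      show "otgt_bal (\<lambda>q n. D (\<lambda>p1 p2. \<chi> (p1 \<odot> y1) (p2 \<star> (q \<star> \<tau> (\<Gamma> n m)))) p)" for y1
        by (rule otgt_balI) (simp_all add: s alg\<Gamma> D_fun_add)
    qed
    then show ?thesis by simp
  qed
  also have "\<dots> = D (\<lambda>y1 y2. E (\<lambda>p m. D (\<lambda>p1 p2. E (\<lambda>q n. \<chi> (p1 \<odot> y1) (p2 \<star> (q \<star> \<tau> (\<Gamma> n m)))) y2) p) X) Y"
    by (simp add: DE_swap)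
  also have "\<dots> = D (\<lambda>y1 y2. D (\<lambda>x1 x2. E (\<lambda>p m. E (\<lambda>q n. \<chi> (x1 \<odot> y1) (p \<star> (q \<star> \<tau> (\<Gamma> n m)))) y2) x2) X) Y"
  proof -
    have "D (\<lambda>x1 x2. E (\<lambda>p m. E (\<lambda>q n. \<chi> (x1 \<odot> y1) (p \<star> (q \<star> \<tau> (\<Gamma> n m)))) y2) x2) X =
       E (\<lambda>p m. D (\<lambda>p1 p2. E (\<lambda>q n. \<chi> (p1 \<odot> y1) (p2 \<star> (q \<star> \<tau> (\<Gamma> n m)))) y2) p) X" for y1 y2
    proof (rule E_coassoc_plus)
      show "diamond_bal (\<lambda>x1 p. E (\<lambda>q n. \<chi> (x1 \<odot> y1) (p \<star> (q \<star> \<tau> (\<Gamma> n m)))) y2)" for m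
        by (rule diamond_balI) (simp_all add: s alg lprod_rules E_fun_add)
      show "otgt_bal (\<lambda>p m. E (\<lambda>q n. \<chi> (x1 \<odot> y1) (p \<star> (q \<star> \<tau> (\<Gamma> n m)))) y2)" for x1
      proof (rule otgt_balI)
        fix x r y
        show "E (\<lambda>q n. \<chi> (x1 \<odot> y1) (x \<star> \<tau> r \<star> (q \<star> \<tau> (\<Gamma> n y)))) y2 = E (\<lambda>q n. \<chi> (x1 \<odot> y1) (x \<star> (q \<star> \<tau> (\<Gamma> n (\<tau> r \<star> y))))) y2"
          using E_tak[OF bo'[of "x1 \<odot> y1" x y], of r y2] by (simp add: alg\<Gamma>)
      qed (simp_all add: s alg\<Gamma> E_fun_add)
    qed
    then show ?thesis by simp
  qed
  also have "\<dots> = D (\<lambda>y1 y2. D (\<lambda>x1 x2. \<chi> (x1 \<odot> y1) (x2 \<bullet> y2)) X) Y"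
    unfolding rprod_def by (simp add: E_additive[of "\<chi> x" for x, OF s(2)] L.mult_assoc)
  finally show ?thesis .
qed

text \<open>
  By \<open>E_tprod\<close> the two sides are \<open>(X\<^sub>+ \<odot> Y\<^sub>+ \<odot> Z\<^sub>+)\<tau>(\<Gamma>(Z\<^sub>-, Y\<^sub>- \<odot> X\<^sub>-))\<close> and
  \<open>(X\<^sub>+ \<odot> Y\<^sub>+ \<odot> Z\<^sub>+)\<tau>(\<Gamma>(Z\<^sub>- \<odot> Y\<^sub>-, X\<^sub>-))\<close>.
\<close>

lemma tprod_assoc: "(X \<otimes> Y) \<otimes> Z = X \<otimes> (Y \<otimes> Z)"
proof -
  have "(X \<otimes> Y) \<otimes> Z = E (\<lambda>p m. E (\<lambda>q n. E (\<lambda>r k. (p \<odot> q \<odot> r) \<star> \<tau> (\<Gamma> k (n \<odot> m))) Z) Y) X"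
    unfolding tprod_def[of "X \<otimes> Y"] by (rule E_tprod[OF mixed_bal_otgt_bal(4)[OF mixed_bal_tprod]])
  also have "\<dots> = E (\<lambda>p m. E (\<lambda>q n. E (\<lambda>r k. (p \<odot> (q \<odot> r)) \<star> \<tau> (\<Gamma> (k \<odot> n) m)) Z) Y) X"
    by (simp add: cocycle_lprod lprod_assoc)
  also have "\<dots> = X \<otimes> (Y \<otimes> Z)"
    unfolding tprod_def[of X] by (simp add: E_tprod[OF mixed_bal_otgt_bal(2)[OF mixed_bal_tprod]])
  finally show ?thesis .
qed

lemma tprod_src: "\<sigma> b \<otimes> X = \<sigma> b \<odot> X" "X \<otimes> \<sigma> b = X \<odot> \<sigma> b"
proof -
  have "\<sigma> b \<otimes> X = E (\<lambda>q n. \<sigma> b \<odot> (q \<star> \<tau> (\<epsilon> n))) X"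
    unfolding tprod_def E_s[OF mixed_bal_otgt_bal(4)[OF mixed_bal_tprod]] by (simp add: lprod_rules \<Gamma>_rules)
  also have "\<dots> = \<sigma> b \<odot> X"
    by (subst E_additive[of "\<lambda>x. \<sigma> b \<odot> x", symmetric]) (simp_all add: lprod_add E_counit)
  finally show "\<sigma> b \<otimes> X = \<sigma> b \<odot> X" .
  have "X \<otimes> \<sigma> b = E (\<lambda>p m. (p \<star> \<tau> (\<epsilon> m)) \<odot> \<sigma> b) X"
    unfolding tprod_def E_s[OF mixed_bal_otgt_bal(2)[OF mixed_bal_tprod]]
    by (simp add: lprod_rules \<Gamma>_rules) (simp add: lprod_tgt_mult(3)[symmetric] comm(1)[symmetric])
  also have "\<dots> = X \<odot> \<sigma> b"
    by (subst E_additive[of "\<lambda>x. x \<odot> \<sigma> b", symmetric]) (simp_all add: lprod_add E_counit)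
  finally show "X \<otimes> \<sigma> b = X \<odot> \<sigma> b" .
qed

lemma tprod_tgt: "\<tau> b \<otimes> X = E (\<lambda>p m. p \<star> \<tau> (\<Gamma> m (\<sigma> b))) X" "X \<otimes> \<tau> b = E (\<lambda>p m. p \<star> \<tau> (\<Gamma> (\<sigma> b) m)) X"
  unfolding tprod_def E_t[OF mixed_bal_otgt_bal(4)[OF mixed_bal_tprod]] E_t[OF mixed_bal_otgt_bal(2)[OF mixed_bal_tprod]] by (simp_all add: lprod_one)

lemma tprod_one: "\<one> \<otimes> X = X" "X \<otimes> \<one> = X"
  using tprod_src(1)[of "aone (base H)" X] tprod_src(2)[of X "aone (base H)"] by (simp_all add: alg lprod_one)

section \<open>The twisted coproduct\<close>

lemma both_bal_lprod2: "diamond_bal \<chi> \<Longrightarrow> both_bal (\<lambda>x1 x2 y1 y2. \<chi> (x1 \<odot> y1) (x2 \<star> y2))"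
  by (auto simp: both_bal_def diamond_bal_iff biadditive_def alg\<Gamma> lprod_rules)

lemma diamond_bal_lprod2: "diamond_bal \<chi> \<Longrightarrow> diamond_bal (\<lambda>x1 x2. \<chi> (x1 \<odot> y1) (x2 \<star> y2))"
  using both_bal_lprod2[of \<chi>] by (simp add: both_bal_def)

lemma D_src_lprod: "diamond_bal \<chi> \<Longrightarrow> D \<chi> (\<sigma> b \<odot> X) = D (\<lambda>x y. \<chi> (\<sigma> b \<odot> x) y) X"
  and D_lprod_src: "diamond_bal \<chi> \<Longrightarrow> D \<chi> (X \<odot> \<sigma> b) = D (\<lambda>x y. \<chi> (x \<odot> \<sigma> b) y) X"
  by (simp_all add: D_lprod D_s[OF diamond_bal_lprod2] D_s[OF both_bal_diamond_bal[OF both_bal_lprod2]] alg)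

lemma D_tprod_tgt:
  assumes "diamond_bal \<chi>" shows "D \<chi> (\<tau> b \<otimes> X) = D (\<lambda>x y. \<chi> x (\<tau> b \<otimes> y)) X"
proof -
  note s = diamond_bal_simps[OF assms]
  have "D \<chi> (\<tau> b \<otimes> X) = E (\<lambda>p m. D (\<lambda>x y. \<chi> x (y \<star> \<tau> (\<Gamma> m (\<sigma> b)))) p) X"
    unfolding tprod_tgt by (simp add: E_additive[of "D \<chi>", OF D_add[OF assms]] D_tgtR[OF assms])
  also have "\<dots> = D (\<lambda>x y. E (\<lambda>p m. \<chi> x (p \<star> \<tau> (\<Gamma> m (\<sigma> b)))) y) X"
    by (rule E_coassoc_plus[symmetric]; (rule diamond_balI | rule otgt_balI); simp add: s alg\<Gamma>)
  also have "\<dots> = D (\<lambda>x y. \<chi> x (\<tau> b \<otimes> y)) X"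
    unfolding tprod_tgt by (simp add: E_additive[of "\<chi> x" for x, OF s(2)])
  finally show ?thesis .
qed

lemma otgt_bal_tprod:
  assumes "otgt_bal \<chi>"
  shows "otgt_bal (\<lambda>q n. \<chi> (p \<odot> q) (n \<odot> m))" "otgt_bal (\<lambda>p m. E (\<lambda>q n. \<chi> (p \<odot> q) (n \<odot> m)) Y)"
proof -
  note s = otgt_bal_simps[OF assms]
  show b: "otgt_bal (\<lambda>q n. \<chi> (p \<odot> q) (n \<odot> m))" for p m
    by (rule otgt_balI) (simp_all add: s lprod_rules)
  show "otgt_bal (\<lambda>p m. E (\<lambda>q n. \<chi> (p \<odot> q) (n \<odot> m)) Y)"
  proof (rule otgt_balI)
    fix x r y
    show "E (\<lambda>q n. \<chi> ((x \<star> \<tau> r) \<odot> q) (n \<odot> y)) Y = E (\<lambda>q n. \<chi> (x \<odot> q) (n \<odot> (\<tau> r \<star> y))) Y"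
      using E_tak[OF b[of x y], of r Y] by (simp add: lprod_rules)
  qed (simp_all add: s lprod_rules E_fun_add)
qed

lemma E_tprod_rules:
  assumes "otgt_bal \<chi>"
  shows "E \<chi> (\<sigma> b \<otimes> X) = E (\<lambda>p m. \<chi> (\<sigma> b \<odot> p) m) X" "E \<chi> (\<tau> b \<otimes> X) = E (\<lambda>p m. \<chi> p (m \<odot> \<sigma> b)) X"
    "E \<chi> (X \<otimes> \<sigma> b) = E (\<lambda>p m. \<chi> (p \<odot> \<sigma> b) m) X" "E \<chi> (X \<otimes> \<tau> b) = E (\<lambda>p m. \<chi> p (\<sigma> b \<odot> m)) X"
  by (simp_all add: E_tprod[OF assms] E_s[OF otgt_bal_tprod(1)[OF assms]] E_s[OF otgt_bal_tprod(2)[OF assms]] E_t[OF otgt_bal_tprod(1)[OF assms]]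
    E_t[OF otgt_bal_tprod(2)[OF assms]] lprod_one)

text \<open>
  The pullback of \<open>\<psi>\<close> along \<open>\<Gamma>\<^sup>#\<close>, which maps \<open>X \<diamondop> Y\<close> to \<open>X\<^sub>+\<tau>(\<Gamma>(X\<^sub>-, Y\<^sub>1)) \<diamondop> Y\<^sub>2\<close>.
\<close>

definition sharp_pull :: "('l \<Rightarrow> 'l \<Rightarrow> 'v::ab_group_add) \<Rightarrow> 'l \<Rightarrow> 'l \<Rightarrow> 'v" where
  "sharp_pull \<psi> X Y = D (\<lambda>y1 y2. E (\<lambda>p m. \<psi> (p \<star> \<tau> (\<Gamma> m y1)) y2) X) Y"

text \<open>
  Maps that can be evaluated on \<open>X\<^sub>+ \<otimes> X\<^sub>- \<odot> Y\<^sub>1 \<otimes> Y\<^sub>2\<close>, as in \<open>sharp_pull3\<close>.  The latter expression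
  refines the pullback: pulling back along \<open>\<Gamma>\<^sup>#\<close> after a twisted multiplication puts a term such as
  \<open>\<Gamma>(a, X\<^sub>- \<odot> Y\<^sub>1)\<close> in the place of \<open>\<Gamma>(X\<^sub>-, Y\<^sub>1)\<close>.
\<close>

definition sharp_bal :: "('l \<Rightarrow> 'l \<Rightarrow> 'l \<Rightarrow> 'v::ab_group_add) \<Rightarrow> bool" where
  "sharp_bal \<phi> \<longleftrightarrow> (\<forall>y. otgt_bal (\<lambda>p m. \<phi> p m y)) \<and> (\<forall>m. diamond_bal (\<lambda>p y. \<phi> p m y))"

definition sharp_pull3 :: "('l \<Rightarrow> 'l \<Rightarrow> 'l \<Rightarrow> 'v::ab_group_add) \<Rightarrow> 'l \<Rightarrow> 'l \<Rightarrow> 'v" where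
  "sharp_pull3 \<phi> X Y = D (\<lambda>y1 y2. E (\<lambda>p m. \<phi> p (m \<odot> y1) y2) X) Y"

lemma sharp_bal_simps:
  assumes "sharp_bal \<phi>"
  shows "\<phi> (x + x') m y = \<phi> x m y + \<phi> x' m y" "\<phi> x (m + m') y = \<phi> x m y + \<phi> x m' y"
    "\<phi> x m (y + y') = \<phi> x m y + \<phi> x m y'" "\<phi> (x \<star> \<tau> b) m y = \<phi> x (\<tau> b \<star> m) y"
    "\<phi> (\<tau> b \<star> x) m y = \<phi> x m (\<sigma> b \<star> y)"
  using assms by (auto simp: sharp_bal_def otgt_bal_iff diamond_bal_iff)

lemma sharp_balI:
  assumes "\<And>x x' m y. \<phi> (x + x') m y = \<phi> x m y + \<phi> x' m y" "\<And>x m m' y. \<phi> x (m + m') y = \<phi> x m y + \<phi> x m' y"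
    "\<And>x m y y'. \<phi> x m (y + y') = \<phi> x m y + \<phi> x m y'" "\<And>x b m y. \<phi> (x \<star> \<tau> b) m y = \<phi> x (\<tau> b \<star> m) y"
    "\<And>x b m y. \<phi> (\<tau> b \<star> x) m y = \<phi> x m (\<sigma> b \<star> y)"
  shows "sharp_bal \<phi>"
  using assms by (auto simp: sharp_bal_def otgt_bal_iff diamond_bal_iff)

lemma sharp_pull3_bal:
  assumes "sharp_bal \<phi>"
  shows "otgt_bal (\<lambda>p m. \<phi> p (m \<odot> y1) y2)" "diamond_bal (\<lambda>y1 y2. E (\<lambda>p m. \<phi> p (m \<odot> y1) y2) x)"
    "otgt_bal (\<lambda>p m. \<phi> p (m \<star> y1) y2)" "diamond_bal (\<lambda>y1 y2. E (\<lambda>p m. \<phi> p (m \<star> y1) y2) x)"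
proof -
  note s = sharp_bal_simps[OF assms]
  show b: "otgt_bal (\<lambda>p m. \<phi> p (m \<odot> y1) y2)" "otgt_bal (\<lambda>p m. \<phi> p (m \<star> y1) y2)" for y1 y2
    by (rule otgt_balI; simp add: s lprod_rules alg)+
  show "diamond_bal (\<lambda>y1 y2. E (\<lambda>p m. \<phi> p (m \<odot> y1) y2) x)"
  proof (rule diamond_balI)
    fix u r y
    show "E (\<lambda>p m. \<phi> p (m \<odot> (\<tau> r \<star> u)) y) x = E (\<lambda>p m. \<phi> p (m \<odot> u) (\<sigma> r \<star> y)) x"
      using E_tak[OF b(1)[of u y], of r x] by (simp add: s lprod_rules)
  qed (simp_all add: s lprod_rules E_fun_add)
  show "diamond_bal (\<lambda>y1 y2. E (\<lambda>p m. \<phi> p (m \<star> y1) y2) x)"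
  proof (rule diamond_balI)
    fix u r y
    show "E (\<lambda>p m. \<phi> p (m \<star> (\<tau> r \<star> u)) y) x = E (\<lambda>p m. \<phi> p (m \<star> u) (\<sigma> r \<star> y)) x"
      using E_tak[OF b(2)[of u y], of r x] by (simp add: s L.mult_assoc)
  qed (simp_all add: s alg E_fun_add)
qed

lemma sharp_pull_bal:
  assumes "diamond_bal \<psi>"
  shows "otgt_bal (\<lambda>p m. \<psi> (p \<star> \<tau> (\<Gamma> m y1)) y2)" "diamond_bal (\<lambda>y1 y2. E (\<lambda>p m. \<psi> (p \<star> \<tau> (\<Gamma> m y1)) y2) x)"
proof -
  note s = diamond_bal_simps[OF assms]
  show b: "otgt_bal (\<lambda>p m. \<psi> (p \<star> \<tau> (\<Gamma> m y1)) y2)" for y1 y2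
    by (rule otgt_balI; simp add: s alg\<Gamma>)
  show "diamond_bal (\<lambda>y1 y2. E (\<lambda>p m. \<psi> (p \<star> \<tau> (\<Gamma> m y1)) y2) x)"
  proof (rule diamond_balI)
    fix u r y
    show "E (\<lambda>p m. \<psi> (p \<star> \<tau> (\<Gamma> m (\<tau> r \<star> u))) y) x = E (\<lambda>p m. \<psi> (p \<star> \<tau> (\<Gamma> m u)) (\<sigma> r \<star> y)) x"
      using E_tak[OF b[of u y], of r x] by (simp add: s alg\<Gamma>)
  qed (simp_all add: s alg\<Gamma> E_fun_add)
qed

lemma D_hom: "(\<And>x y. sV c (x + y) = sV c x + sV c y) \<Longrightarrow> D (\<lambda>x y. sV c (f x y)) X = sV c (D f X)"
  by (rule D_additive[symmetric])
lemma E_hom: "(\<And>x y. sV c (x + y) = sV c x + sV c y) \<Longrightarrow> E (\<lambda>x y. sV c (f x y)) X = sV c (E f X)"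
  by (rule E_additive[symmetric])

lemma vs_add: "vector_space sV \<Longrightarrow> sV c (x + y) = sV c x + sV c y"
  by (simp add: vector_space_def)

text \<open>
  \<open>\<Gamma>\<^sup>#\<close> on formal tensors.
\<close>

definition sharp0 :: "(('l \<times> 'l) \<Rightarrow>\<^sub>0 'k) \<Rightarrow> (('l \<times> 'l) \<Rightarrow>\<^sub>0 'k)" where
  "sharp0 = lsum fscale (\<lambda>(X, Y). lsum fscale (\<lambda>(p, m). lsum fscale (\<lambda>(y1, y2). pure (p \<star> \<tau> (\<Gamma> m y1), y2))
            (rep (cop H Y))) (rep (translation H X)))"

lemma lsum_sharp0:
  assumes V: "vector_space sV" and \<psi>: "homogeneous sc sV \<psi>"
  shows "lsum sV (\<lambda>(x, y). \<psi> x y) (sharp0 t) = lsum sV (\<lambda>(x, y). sharp_pull \<psi> x y) t"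
proof -
  have "\<psi> (sc c x) = (\<lambda>y. sV c (\<psi> x y))" for c x
    using \<psi> by (auto simp: homogeneous_def)
  then have h: "homogeneous sc sV (\<lambda>y1 y2. \<psi> (p \<star> \<tau> (\<Gamma> m y1)) y2)"
     "homogeneous sc sV (\<lambda>p m. D (\<lambda>y1 y2. \<psi> (p \<star> \<tau> (\<Gamma> m y1)) y2) Y)" for p m Y
    by (simp_all add: homogeneous_def alg\<Gamma> D_hom[where sV = sV, OF vs_add[OF V]])
  have "lsum sV (\<lambda>(x, y). \<psi> x y) (sharp0 t) = lsum sV (\<lambda>(X, Y). E (\<lambda>p m. D (\<lambda>y1 y2. \<psi> (p \<star> \<tau> (\<Gamma> m y1)) y2) Y) X) t"
    unfolding sharp0_def lsum_lsum[OF V]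
    by (rule lsum_cong) (auto simp: lsum_lsum[OF V] lsum_pure[OF V] case_prod_unfold
        E_homogeneous[OF h(2), unfolded case_prod_unfold] D_homogeneous[OF h(1), unfolded case_prod_unfold])
  then show ?thesis by (simp add: sharp_pull_def DE_swap)
qed

lemma sharp0_linear: "Vector_Spaces.linear fscale fscale sharp0"
  unfolding sharp0_def by (rule lsum_linear[OF vector_space_fscale])

end

text \<open>
  The assumption is that \<open>\<Gamma>\<^sup>#\<close> is bijective; it is derived from the invertibility of the cocycle in
  \<open>sharp0_iso\<close>.
\<close>

locale twist_iso = twist H \<Gamma>
  for H :: "('k::field, 'b::ab_group_add, 'l::ab_group_add) bialgebroid" and \<Gamma> :: "'l \<Rightarrow> 'l \<Rightarrow> 'b" +
  assumes sharp0_iso: "induces_iso (twisted_diamond_null H \<Gamma>) UNIV (diamond_null H) UNIV sharp0"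
begin

lemma sharp0_null: "sharp0 t \<in> diamond_null H \<longleftrightarrow> t \<in> twisted_diamond_null H \<Gamma>"
  using sharp0_iso by (simp add: induces_iso_def)

lemma subspace_twisted: "module.subspace fscale (twisted_diamond_null H \<Gamma>)"
  unfolding twisted_diamond_null_def by (rule subspace_tensor_null)

lemma twisted_nullI:
  assumes "\<And>\<psi> :: 'l \<Rightarrow> 'l \<Rightarrow> 'k. diamond_bal \<psi> \<Longrightarrow> homogeneous sc (*) \<psi> \<Longrightarrow> lsum (*) (\<lambda>(x, y). sharp_pull \<psi> x y) t = 0"
  shows "t \<in> twisted_diamond_null H \<Gamma>"
  unfolding sharp0_null[symmetric] by (rule diamond_nullI) (simp add: lsum_sharp0[OF vector_space_mult] assms)

lemma twisted_coset_eqI: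
  assumes "\<And>\<psi> :: 'l \<Rightarrow> 'l \<Rightarrow> 'k. diamond_bal \<psi> \<Longrightarrow> homogeneous sc (*) \<psi> \<Longrightarrow>
    lsum (*) (\<lambda>(x, y). sharp_pull \<psi> x y) s = lsum (*) (\<lambda>(x, y). sharp_pull \<psi> x y) t"
  shows "coset (twisted_diamond_null H \<Gamma>) s = coset (twisted_diamond_null H \<Gamma>) t"
  unfolding coset_eq_iff[OF subspace_twisted]
  by (rule twisted_nullI) (simp add: lsum_diff[OF vector_space_mult] assms)

lemma diamond_sharp_bij:
  "bij_betw (diamond_sharp H \<Gamma>) (tensor (twisted_diamond_null H \<Gamma>) UNIV) (tensor (diamond_null H) UNIV)"
proof -
  have "diamond_sharp H \<Gamma> = (\<lambda>c. coset (diamond_null H) (sharp0 (rep c)))"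
    by (simp add: fun_eq_iff diamond_sharp_def sharp0_def)
  then show ?thesis
    using sharp0_iso by (simp add: bij_betw_tensor_iff[OF subspace_null(1) subspace_twisted sharp0_linear] sharp0_null)
qed

lemma twisted_cop_tensor: "twisted_cop H \<Gamma> X \<in> tensor (twisted_diamond_null H \<Gamma>) UNIV"
  unfolding twisted_cop_def using bij_betwE[OF bij_betw_the_inv_into[OF diamond_sharp_bij]] cop_diamond by blast

lemma twisted_cop_iff: "T \<in> twisted_cop H \<Gamma> X \<longleftrightarrow> sharp0 T \<in> cop H X"
proof -
  interpret g: Vector_Spaces.linear fscale fscale sharp0 by (rule sharp0_linear)
  let ?r = "rep (twisted_cop H \<Gamma> X)"
  have "diamond_sharp H \<Gamma> (twisted_cop H \<Gamma> X) = cop H X"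
    unfolding twisted_cop_def by (rule f_the_inv_into_f_bij_betw[OF diamond_sharp_bij]) (simp add: cop_diamond)
  then have *: "coset (diamond_null H) (sharp0 ?r) = cop H X"
    by (simp add: diamond_sharp_def sharp0_def)
  have "T \<in> twisted_cop H \<Gamma> X \<longleftrightarrow> T - ?r \<in> twisted_diamond_null H \<Gamma>"
    by (subst coset_rep(1)[OF subspace_twisted twisted_cop_tensor, symmetric]) (simp add: coset_def)
  also have "\<dots> \<longleftrightarrow> sharp0 T \<in> cop H X"
    unfolding sharp0_null[symmetric] *[symmetric] by (simp add: coset_def g.diff)
  finally show ?thesis .
qed

lemma twisted_copI:
  assumes "\<And>\<psi> :: 'l \<Rightarrow> 'l \<Rightarrow> 'k. diamond_bal \<psi> \<Longrightarrow> homogeneous sc (*) \<psi> \<Longrightarrow> lsum (*) (\<lambda>(x, y). sharp_pull \<psi> x y) T = D \<psi> X"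
  shows "T \<in> twisted_cop H \<Gamma> X"
  unfolding twisted_cop_iff by (rule copI) (simp add: lsum_sharp0[OF vector_space_mult] assms)

lemma lsum_twisted_cop:
  assumes "vector_space sV" "T \<in> twisted_cop H \<Gamma> X" "diamond_bal \<psi>" "homogeneous sc sV \<psi>"
  shows "lsum sV (\<lambda>(x, y). sharp_pull \<psi> x y) T = D \<psi> X"
  using lsum_cop[OF _ assms(3,4)] assms(2) unfolding twisted_cop_iff lsum_sharp0[OF assms(1,4), symmetric] by blast

text \<open>
  \<open>X\<^sub>[\<^sub>1\<^sub>]\<^sub>+ \<otimes> X\<^sub>[\<^sub>1\<^sub>]\<^sub>- \<odot> X\<^sub>[\<^sub>2\<^sub>]\<^sub>1 \<otimes> X\<^sub>[\<^sub>2\<^sub>]\<^sub>2 = X\<^sub>1 \<otimes> 1 \<otimes> X\<^sub>2\<close>, where \<open>X\<^sub>[\<^sub>1\<^sub>] \<diamondop> X\<^sub>[\<^sub>2\<^sub>]\<close> is the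
  twisted coproduct.  Put \<open>\<psi>(u, v) = \<phi>(u\<^sub>+, u\<^sub>-v\<^sub>1, v\<^sub>2)\<close>.  The pullback of \<open>\<psi>\<close> along \<open>\<Gamma>\<^sup>#\<close> is
  \<open>\<phi>(X\<^sub>+, X\<^sub>- \<odot> Y\<^sub>1, Y\<^sub>2)\<close>, so by definition of the twisted coproduct the left hand side has the
  value \<open>\<psi>(X\<^sub>1, X\<^sub>2) = \<phi>(X\<^sub>1\<^sub>+, X\<^sub>1\<^sub>-X\<^sub>2, X\<^sub>3)\<close>, which is \<open>\<phi>(X\<^sub>1, 1, X\<^sub>2)\<close> by \<open>D_galois\<close>.
\<close>

lemma lsum_twisted_cop_sharp_pull3:
  assumes V: "vector_space sV" and T: "T \<in> twisted_cop H \<Gamma> X" and \<phi>: "sharp_bal \<phi>"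
    and hom: "\<And>m. homogeneous sc sV (\<lambda>x y. \<phi> x m y)"
  shows "lsum sV (\<lambda>(x, y). sharp_pull3 \<phi> x y) T = D (\<lambda>x y. \<phi> x \<one> y) X"
proof -
  note s = sharp_bal_simps[OF \<phi>]
  note b = sharp_pull3_bal[OF \<phi>]
  define \<psi> where "\<psi> u v = D (\<lambda>v1 v2. E (\<lambda>p m. \<phi> p (m \<star> v1) v2) u) v" for u v
  have \<psi>: "diamond_bal \<psi>"
    by (rule diamond_balI) (simp_all add: \<psi>_def D_rules[OF b(4)] E_rules[OF b(3)] D_fun_add alg)
  have "homogeneous sc sV \<psi>"
    using hom by (simp add: homogeneous_def \<psi>_def E_scale[OF b(3)] E_hom[where sV = sV, OF vs_add[OF V]] D_hom[where sV = sV, OF vs_add[OF V]])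
  from lsum_twisted_cop[OF V T \<psi> this]
  have "lsum sV (\<lambda>(x, y). sharp_pull \<psi> x y) T = D \<psi> X" .
  moreover have "sharp_pull \<psi> x y = sharp_pull3 \<phi> x y" for x y
  proof -
    have "sharp_pull \<psi> x y = D (\<lambda>y1 y2. E (\<lambda>p m. D (\<lambda>v1 v2. E (\<lambda>q n. \<phi> q (\<sigma> (\<Gamma> m y1) \<star> (n \<star> v1)) v2) p) y2) x) y"
      unfolding sharp_pull_def \<psi>_def by (simp add: E_tgtR[OF b(3)] L.mult_assoc)
    also have "\<dots> = D (\<lambda>y1 y2. D (\<lambda>v1 v2. E (\<lambda>p m. E (\<lambda>q n. \<phi> q (\<sigma> (\<Gamma> m y1) \<star> (n \<star> v1)) v2) p) x) y2) y"
      by (simp add: DE_swap)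
    also have "\<dots> = D (\<lambda>y1 y2. D (\<lambda>v1 v2. E (\<lambda>p m. D (\<lambda>m1 m2. \<phi> p (\<sigma> (\<Gamma> m1 y1) \<star> (m2 \<star> v1)) v2) m) x) y2) y"
    proof -
      have "E (\<lambda>p m. D (\<lambda>m1 m2. \<phi> p (\<sigma> (\<Gamma> m1 y1) \<star> (m2 \<star> v1)) v2) m) x =
         E (\<lambda>p m. E (\<lambda>q n. \<phi> q (\<sigma> (\<Gamma> m y1) \<star> (n \<star> v1)) v2) p) x" for y1 v1 v2
        by (rule E_coassoc_minus; (rule diamond_balI | rule otgt_balI); simp add: s alg\<Gamma>)
      then show ?thesis by simp
    qed
    also have "\<dots> = D (\<lambda>u v2. D (\<lambda>y1 v1. E (\<lambda>p m. D (\<lambda>m1 m2. \<phi> p (\<sigma> (\<Gamma> m1 y1) \<star> (m2 \<star> v1)) v2) m) x) u) y"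
    proof (rule D_coassoc[symmetric], unfold diamond_bal3_def, intro conjI allI)
      have both_bal: "both_bal (\<lambda>m1 m2 y1 v1. \<phi> p (\<sigma> (\<Gamma> m1 y1) \<star> (m2 \<star> v1)) v2)" for p v2
        by (auto simp: both_bal_def diamond_bal_iff biadditive_def s alg\<Gamma>)
      have b2: "diamond_bal (\<lambda>m1 m2. \<phi> p (\<sigma> (\<Gamma> m1 y1) \<star> (m2 \<star> v1)) v2)" for p y1 v1 v2 using both_bal by (simp add: both_bal_def)
      have bb: "otgt_bal (\<lambda>p m. D (\<lambda>m1 m2. \<phi> p (\<sigma> (\<Gamma> m1 y1) \<star> (m2 \<star> v1)) v2) m)" for y1 v1 v2
        by (rule otgt_balI) (simp_all add: s D_rules[OF b2] D_fun_add alg)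
      show "diamond_bal (\<lambda>y1 v1. E (\<lambda>p m. D (\<lambda>m1 m2. \<phi> p (\<sigma> (\<Gamma> m1 y1) \<star> (m2 \<star> v1)) v2) m) x)" for v2
        using diamond_bal_simps[OF both_bal_diamond_bal[OF both_bal]] by (intro diamond_balI) (simp_all add: E_fun_add)
      show "diamond_bal (\<lambda>v1 v2. E (\<lambda>p m. D (\<lambda>m1 m2. \<phi> p (\<sigma> (\<Gamma> m1 y1) \<star> (m2 \<star> v1)) v2) m) x)" for y1
      proof (rule diamond_balI)
        fix u r y
        show "E (\<lambda>p m. D (\<lambda>m1 m2. \<phi> p (\<sigma> (\<Gamma> m1 y1) \<star> (m2 \<star> (\<tau> r \<star> u))) y) m) x =
           E (\<lambda>p m. D (\<lambda>m1 m2. \<phi> p (\<sigma> (\<Gamma> m1 y1) \<star> (m2 \<star> u)) (\<sigma> r \<star> y)) m) x"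
          using E_tak[OF bb[of y1 u y], of r x] by (simp add: s D_tgtR[OF b2] L.mult_assoc)
      qed (simp_all add: s alg D_fun_add E_fun_add)
    qed
    also have "\<dots> = sharp_pull3 \<phi> x y"
      unfolding sharp_pull3_def lprod_def D2_def by (simp only: DE_swap D_additive[of "\<lambda>m. \<phi> x m y" for x y, OF s(2)])
    finally show ?thesis .
  qed
  moreover have "D \<psi> X = D (\<lambda>x y. \<phi> x \<one> y) X"
  proof -
    have "D \<psi> X = D (\<lambda>x v2. D (\<lambda>x1 v1. E (\<lambda>p m. \<phi> p (m \<star> v1) v2) x1) x) X"
      unfolding \<psi>_def[abs_def]
    proof (rule D_coassoc[symmetric], unfold diamond_bal3_def, intro conjI allI)
      show "diamond_bal (\<lambda>x1 v1. E (\<lambda>p m. \<phi> p (m \<star> v1) v2) x1)" for v2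
        by (rule diamond_balI) (simp_all add: E_rules[OF b(3)] s alg E_fun_add)
    qed (rule b(4))
    also have "\<dots> = D (\<lambda>x y. \<phi> x \<one> y) X"
    proof -
      have "otgt_bal (\<lambda>p m. \<phi> p m y)" for y using \<phi> by (simp add: sharp_bal_def)
      from D_galois[OF this] show ?thesis by simp
    qed
    finally show ?thesis .
  qed
  ultimately show ?thesis by simp
qed

end

section \<open>The twisted bialgebroid\<close>

lemma lsum_swap2:
  assumes "vector_space sV"
  shows "lsum sV (\<lambda>(x, y). lsum sV (\<lambda>(u, v). f x y u v) T) S = lsum sV (\<lambda>(u, v). lsum sV (\<lambda>(x, y). f x y u v) S) T"
  unfolding case_prod_unfold by (rule lsum_swap[OF assms])

context twist begin

lemma \<Gamma>_src_tgt: "\<Gamma> (\<sigma> b) (\<tau> c \<star> x) = \<Gamma> (\<sigma> b) x \<circ>\<^sub>B c"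
  using balanced[of "\<sigma> b" c x] by (simp add: comm tgt_linear)

lemma hom_fun: "homogeneous sc sV \<psi> \<Longrightarrow> \<psi> (sc c x) = (\<lambda>y. sV c (\<psi> x y))"
  by (auto simp: homogeneous_def)

lemma D_cmult: "D (\<lambda>x y. c * f x y) X = c * D f X" for c :: 'k
  by (rule D_additive[symmetric]) (simp add: algebra_simps)
lemma E_cmult: "E (\<lambda>x y. c * f x y) X = c * E f X" for c :: 'k
  by (rule E_additive[symmetric]) (simp add: algebra_simps)

lemma both_bal_tprod: "diamond_bal \<chi> \<Longrightarrow> both_bal (\<lambda>x1 x2 y1 y2. \<chi> (x1 \<odot> y1) (x2 \<bullet> y2))"
  by (auto simp: both_bal_def diamond_bal_iff biadditive_def lprod_rules rprod_add rprod_src)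

abbreviation cou_tw where "cou_tw X \<equiv> E \<Gamma> X"

lemma otgt_bal_\<Gamma>: "otgt_bal \<Gamma>" by (rule otgt_balI) (simp_all add: \<Gamma>_rules)

lemma twisted_cou_eq: "twisted_cou H \<Gamma> X = cou_tw X"
  unfolding twisted_cou_def by (rule E_homogeneous) (simp add: homogeneous_def \<Gamma>_rules)

lemma cou_tw_add: "cou_tw (X + Y) = cou_tw X + cou_tw Y" by (rule E_add[OF otgt_bal_\<Gamma>])
lemma cou_tw_scale: "cou_tw (sc c X) = ascale (base H) c (cou_tw X)"
  unfolding E_scale[OF otgt_bal_\<Gamma>] \<Gamma>_rules
  by (rule E_additive[symmetric]) (simp add: B.vs.scale_right_distrib)

lemma lprod_cou_tw: "\<sigma> (cou_tw X) = E (\<lambda>p m. p \<odot> m) X" using lprod_antipode[of X] by simp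

text \<open>
  By the cocycle identity, \<open>\<Gamma>(X\<^sub>+ \<odot> Y\<^sub>+, Y\<^sub>- \<odot> X\<^sub>-) = \<Gamma>(X\<^sub>+, Y\<^sub>+ \<odot> Y\<^sub>- \<odot> X\<^sub>-)\<close>.  The result depends
  on \<open>Y\<close> through its counit alone, which is what the counit axioms of the twisted product require.
\<close>

lemma cou_tw_tprod: "cou_tw (X \<otimes> Y) = E (\<lambda>p m. \<Gamma> p (\<sigma> (cou_tw Y) \<odot> m)) X"
proof -
  have "cou_tw (X \<otimes> Y) = E (\<lambda>p m. E (\<lambda>q n. \<Gamma> p (q \<odot> n \<odot> m)) Y) X"
    by (simp add: E_tprod[OF otgt_bal_\<Gamma>] lprod_assoc flip: cocycle_lprod)
  also have "\<dots> = E (\<lambda>p m. \<Gamma> p (E (\<lambda>q n. q \<odot> n) Y \<odot> m)) X"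
    by (simp only: E_additive[of "\<lambda>x. \<Gamma> p (x \<odot> m)" for p m] lprod_add \<Gamma>_rules)
  finally show ?thesis by (simp add: lprod_cou_tw)
qed

lemma cou_tw_bimod: "cou_tw (\<sigma> a \<otimes> (\<tau> b \<otimes> X)) = \<Gamma> (\<sigma> a) (\<sigma> (\<Gamma> (\<sigma> (cou_tw X)) (\<sigma> b)))"
proof -
  have b: "otgt_bal (\<lambda>p m. \<Gamma> (\<sigma> a) (p \<odot> m))" by (rule otgt_balI) (simp_all add: \<Gamma>_rules lprod_rules)
  have "cou_tw (\<sigma> a \<otimes> (\<tau> b \<otimes> X)) = E (\<lambda>p m. \<Gamma> (\<sigma> a) (p \<odot> m \<odot> \<sigma> b)) X"
    by (simp add: E_tprod_rules[OF otgt_bal_\<Gamma>] E_tprod_rules[OF b] lprod_assoc flip: cocycle_lprod)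
  also have "\<dots> = \<Gamma> (\<sigma> a) (E (\<lambda>p m. p \<odot> m) X \<odot> \<sigma> b)"
    by (simp only: E_additive[of "\<lambda>x. \<Gamma> (\<sigma> a) (x \<odot> \<sigma> b)"] lprod_add \<Gamma>_rules)
  finally show ?thesis by (simp add: lprod_src flip: lprod_cou_tw)
qed

lemma cou_tw_s: "cou_tw (\<sigma> b) = b" and cou_tw_t: "cou_tw (\<tau> b) = b" and cou_tw_one: "cou_tw \<one> = aone (base H)"
  by (simp_all add: E_s[OF otgt_bal_\<Gamma>] E_t[OF otgt_bal_\<Gamma>] E_one[OF otgt_bal_\<Gamma>] \<Gamma>_rules cou_s cou_one)

text \<open>
  \<open>\<Gamma>\<^sup>#\<close> commutes with the coproduct of its first factor, by \<open>E_coassoc_plus\<close>.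
\<close>

lemma sharp_pull_D_left:
  assumes "diamond_bal3 \<psi>"
  shows "D (\<lambda>u v. sharp_pull (\<psi> u) v z) x = sharp_pull (\<lambda>v w. D (\<lambda>u v. \<psi> u v w) v) x z"
proof -
  have diamond_bal: "diamond_bal (\<lambda>u v. \<psi> u v w)" "diamond_bal (\<psi> u)" for u w using assms by (simp_all add: diamond_bal3_def)
  note s = diamond_bal_simps[OF diamond_bal(1)] diamond_bal_simps[OF diamond_bal(2)]
  have "D (\<lambda>u v. E (\<lambda>p m. \<psi> u (p \<star> \<tau> (\<Gamma> m z1)) z2) v) x = E (\<lambda>p m. D (\<lambda>u v. \<psi> u (v \<star> \<tau> (\<Gamma> m z1)) z2) p) x" for z1 z2
    by (rule E_coassoc_plus; (rule diamond_balI | rule otgt_balI); simp add: s alg\<Gamma>)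
  then have "D (\<lambda>z1 z2. D (\<lambda>u v. E (\<lambda>p m. \<psi> u (p \<star> \<tau> (\<Gamma> m z1)) z2) v) x) z =
      D (\<lambda>z1 z2. E (\<lambda>p m. D (\<lambda>u v. \<psi> u v z2) (p \<star> \<tau> (\<Gamma> m z1))) x) z"
    by (simp add: D_tgtR[OF diamond_bal(1)])
  then show ?thesis
    unfolding sharp_pull_def by (subst D_swap)
qed

text \<open>
  For the second factor, \<open>(id \<otimes> \<Gamma>\<^sup>#)(\<Gamma>\<^sup>#(x \<diamondop> Y\<^sub>[\<^sub>1\<^sub>]) \<diamondop> Y\<^sub>[\<^sub>2\<^sub>]) = (id \<otimes> \<Delta>)(\<Gamma>\<^sup>#(x \<diamondop> Y))\<close> with the twisted
  coproduct of \<open>Y\<close> on the left.  Both sides are expressed by the form \<open>\<chi> x\<close>, on the left through its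
  pullback and on the right through its value at \<open>Y\<^sub>1 \<diamondop> Y\<^sub>2\<close>.
\<close>

lemma sharp_pull_D_right:
  assumes "diamond_bal3 \<psi>"
  defines "\<chi> \<equiv> \<lambda>x v w. D (\<lambda>v1 v2. E (\<lambda>p m. \<psi> (p \<star> \<tau> (\<Gamma> m v1)) v2 w) x) v"
  shows "diamond_bal (\<chi> x)" "sharp_pull (\<lambda>u v. sharp_pull (\<psi> u) v z) x y = sharp_pull (\<chi> x) y z" "D (\<chi> x) y = sharp_pull (\<lambda>u y. D (\<psi> u) y) x y"
proof -
  have diamond_bal: "diamond_bal (\<lambda>u v. \<psi> u v w)" "diamond_bal (\<psi> u)" for u w using assms by (simp_all add: diamond_bal3_def)
  note s = diamond_bal_simps[OF diamond_bal(1)] diamond_bal_simps[OF diamond_bal(2)]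
  note b = sharp_pull_bal[OF diamond_bal(1)]
  show \<chi>: "diamond_bal (\<chi> x)" for x
    unfolding \<chi>_def by (rule diamond_balI) (simp_all add: D_rules[OF b(2)] s D_fun_add E_fun_add)
  have b': "diamond_bal (\<lambda>u v. \<psi> u (v \<star> c) w)" for c w
    by (rule diamond_balI) (simp_all add: s alg)
  have "sharp_pull (\<lambda>u v. sharp_pull (\<psi> u) v z) x y =
      D (\<lambda>z1 z2. D (\<lambda>y1 y2. E (\<lambda>q n. E (\<lambda>p m. \<psi> (p \<star> \<tau> (\<Gamma> m y1)) (q \<star> \<tau> (\<Gamma> n z1)) z2) x) y2) y) z"
  proof -
    have "sharp_pull (\<lambda>u v. sharp_pull (\<psi> u) v z) x y =
      D (\<lambda>y1 y2. D (\<lambda>z1 z2. E (\<lambda>p m. E (\<lambda>q n. \<psi> (p \<star> \<tau> (\<Gamma> m y1)) (q \<star> \<tau> (\<Gamma> n z1)) z2) y2) x) z) y"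
      unfolding sharp_pull_def by (simp add: DE_swap)
    also have "\<dots> = D (\<lambda>z1 z2. D (\<lambda>y1 y2. E (\<lambda>p m. E (\<lambda>q n. \<psi> (p \<star> \<tau> (\<Gamma> m y1)) (q \<star> \<tau> (\<Gamma> n z1)) z2) y2) x) y) z"
      by (rule D_swap)
    finally show ?thesis by (simp only: E_swap[where X = x])
  qed
  also have "\<dots> = D (\<lambda>z1 z2. E (\<lambda>q n. D (\<lambda>v1 v2. E (\<lambda>p m. \<psi> (p \<star> \<tau> (\<Gamma> m v1)) (v2 \<star> \<tau> (\<Gamma> n z1)) z2) x) q) y) z"
  proof -
    have "D (\<lambda>y1 y2. E (\<lambda>q n. E (\<lambda>p m. \<psi> (p \<star> \<tau> (\<Gamma> m y1)) (q \<star> \<tau> (\<Gamma> n z1)) z2) x) y2) y =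
       E (\<lambda>q n. D (\<lambda>v1 v2. E (\<lambda>p m. \<psi> (p \<star> \<tau> (\<Gamma> m v1)) (v2 \<star> \<tau> (\<Gamma> n z1)) z2) x) q) y" for z1 z2
    proof (rule E_coassoc_plus)
      show "diamond_bal (\<lambda>y1 q. E (\<lambda>p m. \<psi> (p \<star> \<tau> (\<Gamma> m y1)) (q \<star> \<tau> (\<Gamma> n z1)) z2) x)" for n
        by (rule sharp_pull_bal(2)[OF b'])
      show "otgt_bal (\<lambda>q n. E (\<lambda>p m. \<psi> (p \<star> \<tau> (\<Gamma> m y1)) (q \<star> \<tau> (\<Gamma> n z1)) z2) x)" for y1
        by (rule otgt_balI) (simp_all add: s alg\<Gamma> E_fun_add)
    qed
    then show ?thesis by simp
  qed
  also have "\<dots> = sharp_pull (\<chi> x) y z"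
    unfolding sharp_pull_def \<chi>_def by (simp add: D_tgtR[OF b(2)])
  finally show "sharp_pull (\<lambda>u v. sharp_pull (\<psi> u) v z) x y = sharp_pull (\<chi> x) y z" .
  have "D (\<chi> x) y = D (\<lambda>v1 u. D (\<lambda>v2 w. E (\<lambda>p m. \<psi> (p \<star> \<tau> (\<Gamma> m v1)) v2 w) x) u) y"
    unfolding \<chi>_def
  proof (rule D_coassoc, unfold diamond_bal3_def, intro conjI allI)
    show "diamond_bal (\<lambda>v2 w. E (\<lambda>p m. \<psi> (p \<star> \<tau> (\<Gamma> m v1)) v2 w) x)" for v1
      by (rule diamond_balI) (simp_all add: s E_fun_add)
  qed (rule b(2))
  then show "D (\<chi> x) y = sharp_pull (\<lambda>u y. D (\<psi> u) y) x y"
    unfolding sharp_pull_def by (simp add: DE_swap)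
qed

end

context twist_iso begin

abbreviation tw_null where "tw_null \<equiv> twisted_diamond_null H \<Gamma>"
abbreviation tw_cop where "tw_cop \<equiv> twisted_cop H \<Gamma>"

lemma rep_tw_cop: "rep (tw_cop X) \<in> tw_cop X"
  by (rule coset_rep(2)[OF subspace_twisted twisted_cop_tensor])

lemmas field_vs = vector_space_mult

subsection \<open>Coassociativity\<close>

text \<open>
  Preimages under \<open>\<Gamma>\<^sup>#\<close>.  Choosing them for pure tensors only is enough to define
  \<open>sharp_unpull \<phi>\<close>, the form on \<open>L \<diamondop> L\<close> whose pullback along \<open>\<Gamma>\<^sup>#\<close> is \<open>\<phi>\<close>.
\<close>

definition sharp_section :: "(('l \<times> 'l) \<Rightarrow>\<^sub>0 'k) \<Rightarrow> (('l \<times> 'l) \<Rightarrow>\<^sub>0 'k)" where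
  "sharp_section u = (SOME t. sharp0 t - u \<in> diamond_null H)"

lemma sharp_section: "sharp0 (sharp_section u) - u \<in> diamond_null H"
proof -
  have "\<exists>t. sharp0 t - u \<in> diamond_null H" using sharp0_iso by (simp add: induces_iso_def)
  then show ?thesis unfolding sharp_section_def by (rule someI_ex)
qed

text \<open>
  The forms that factor through the twisted tensor product \<open>L\<^sup>\<Gamma> \<diamondop> L\<^sup>\<Gamma>\<close>.
\<close>

definition kills :: "('l \<Rightarrow> 'l \<Rightarrow> 'k) \<Rightarrow> bool" where
  "kills \<phi> \<longleftrightarrow> (\<forall>n\<in>tw_null. lsum (*) (\<lambda>(x, y). \<phi> x y) n = 0)"

definition sharp_unpull :: "('l \<Rightarrow> 'l \<Rightarrow> 'k) \<Rightarrow> 'l \<Rightarrow> 'l \<Rightarrow> 'k" where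
  "sharp_unpull \<phi> u v = lsum (*) (\<lambda>(x, y). \<phi> x y) (sharp_section (pure (u, v)))"

lemma lsum_sharp_unpull:
  assumes \<phi>: "kills \<phi>" and t: "sharp0 t - w \<in> diamond_null H"
  shows "lsum (*) (\<lambda>(x, y). \<phi> x y) t = lsum (*) (\<lambda>(u, v). sharp_unpull \<phi> u v) w"
proof -
  interpret g: Vector_Spaces.linear fscale fscale sharp0 by (rule sharp0_linear)
  \<comment> \<open>\<open>R\<close> is a preimage of \<open>w\<close> made up from the chosen preimages of pure tensors.\<close>
  define R where "R = lsum fscale (\<lambda>a. sharp_section (pure a)) w"
  have "sharp0 R - w = lsum fscale (\<lambda>a. sharp0 (sharp_section (pure a)) - pure a) w"
    by (simp add: R_def linear_lsum[OF sharp0_linear] lsum_fun_diff[OF vector_space_fscale] lsum_pure_id)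
  also have "\<dots> \<in> diamond_null H"
    by (rule lsum_in_subspace[OF subspace_null(1) sharp_section])
  finally have "sharp0 (t - R) \<in> diamond_null H"
    using free.subspace_diff[OF subspace_null(1) t, of "sharp0 R - w"] by (simp add: g.diff)
  then have "t - R \<in> tw_null" by (simp add: sharp0_null)
  with \<phi> have "lsum (*) (\<lambda>(x, y). \<phi> x y) (t - R) = 0" unfolding kills_def by blast
  then have "lsum (*) (\<lambda>(x, y). \<phi> x y) t = lsum (*) (\<lambda>(x, y). \<phi> x y) R"
    by (simp add: lsum_diff[OF field_vs])
  also have "\<dots> = lsum (*) (\<lambda>(u, v). sharp_unpull \<phi> u v) w"
    by (simp add: R_def lsum_lsum[OF field_vs] sharp_unpull_def case_prod_unfold)
  finally show ?thesis .
qed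

lemma sharp_unpull_bal:
  assumes "kills \<phi>" shows "diamond_bal (sharp_unpull \<phi>)" "homogeneous sc (*) (sharp_unpull \<phi>)"
proof -
  interpret g: Vector_Spaces.linear fscale fscale sharp0 by (rule sharp0_linear)
  have "lsum (*) (\<lambda>(u, v). sharp_unpull \<phi> u v) n = 0" if "n \<in> diamond_null H" for n
    using lsum_sharp_unpull[OF assms, of 0 n] that by (simp add: g.zero free.subspace_neg[OF subspace_null(1)])
  from functional_tensor_null[OF this[unfolded diamond_null_def]]
  show "diamond_bal (sharp_unpull \<phi>)" "homogeneous sc (*) (sharp_unpull \<phi>)" by (simp_all add: diamond_bal_def)
qed

lemma sharp_pull_sharp_unpull: assumes "kills \<phi>" shows "sharp_pull (sharp_unpull \<phi>) x y = \<phi> x y"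
  using lsum_sharp_unpull[OF assms, of "pure (x, y)" "sharp0 (pure (x, y))"] lsum_sharp0[OF field_vs sharp_unpull_bal(2)[OF assms], of "pure (x, y)"]
  by (simp add: lsum_pure[OF field_vs] free.subspace_0[OF subspace_null(1)])

lemma sharp_unpull_sharp_pull:
  assumes \<chi>: "diamond_bal \<chi>" "homogeneous sc (*) \<chi>" shows "sharp_unpull (sharp_pull \<chi>) u v = \<chi> u v"
proof -
  have "lsum (*) (\<lambda>(x, y). \<chi> x y) (sharp0 (sharp_section (pure (u, v))) - pure (u, v)) = 0"
    using ev_diamond_null[OF sharp_section \<chi>(1)] by (simp add: ev_homogeneous[OF \<chi>(2)])
  then show ?thesis
    by (simp add: sharp_unpull_def lsum_sharp0[OF field_vs \<chi>(2), symmetric] lsum_diff[OF field_vs] lsum_pure[OF field_vs])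
qed

lemma killsI:
  assumes add: "biadditive \<phi>" and hom: "homogeneous sc (*) \<phi>" and bal: "\<And>x b y. \<phi> (\<tau> b \<otimes> x) y = \<phi> x (\<sigma> b \<otimes> y)"
  shows "kills \<phi>"
  unfolding kills_def
proof
  fix n assume n: "n \<in> tw_null"
  have sc: "sc c y = \<sigma> (ascale (base H) c (aone (base H))) \<otimes> y" "sc c y = \<tau> (ascale (base H) c (aone (base H))) \<otimes> y" for c y
    by (simp_all add: src_hom tgt_hom tprod_scale tprod_one)
  have "ev sc \<phi> n = 0"
  proof (rule L.vs.ev_tensor_null[where sQ = sc])
    show "n \<in> tensor_null sc UNIV (\<lambda>X b. \<tau> b \<otimes> X) sc UNIV (\<lambda>b X. \<sigma> b \<otimes> X)"
      using n by (simp add: twisted_diamond_null_def twisted_mult_eq)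
    show "balanced (\<lambda>X b. \<tau> b \<otimes> X) (\<lambda>b X. \<sigma> b \<otimes> X) \<phi>"
      using add bal by (simp add: balanced_def)
    show "\<phi> (sc c x) y = \<phi> x (sc c y)" for c x y
      unfolding sc(1)[of c y] sc(2)[of c x] by (rule bal)
  qed (simp add: tprod_scale)
  then show "lsum (*) (\<lambda>(x, y). \<phi> x y) n = 0" by (simp add: ev_homogeneous[OF hom])
qed

lemma sharp_pull_tgt:
  assumes "diamond_bal \<psi>" shows "sharp_pull \<psi> x (\<tau> b \<otimes> y) = sharp_pull (\<lambda>u v. \<psi> u (\<tau> b \<otimes> v)) x y"
  unfolding sharp_pull_def by (rule D_tprod_tgt[OF sharp_pull_bal(2)[OF assms]])

lemma tprod_tgt_src: "\<tau> b \<otimes> (\<sigma> c \<star> v) = \<sigma> c \<star> (\<tau> b \<otimes> v)"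
proof -
  have b: "otgt_bal (\<lambda>p m. p \<star> \<tau> (\<Gamma> m (\<sigma> b)))" by (rule otgt_balI) (simp_all add: alg\<Gamma>)
  show ?thesis
    unfolding tprod_tgt
    by (simp only: E_src[OF b] E_additive[of "\<lambda>x. \<sigma> c \<star> x"] L.mult_add_right L.mult_assoc)
qed

text \<open>
  The form \<open>h\<close> arises from \<open>\<psi>\<close> by pulling back along \<open>\<Gamma>\<^sup>#\<close> in the last two variables and then in the
  first two, and \<open>sharp_unpull\<close> reverses these steps.  That the intermediate form again factors
  through the twisted tensor product, and that \<open>\<psi>\<close> is balanced, holds because \<open>sharp_unpull\<close> is
  inverse to \<open>sharp_pull\<close> and the actions of the base on the outer sides of \<open>L \<diamondop> L\<close> commute with
  \<open>\<Gamma>\<^sup>#\<close>.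
\<close>

lemma twisted_trilinear:
  fixes h :: "'l \<Rightarrow> 'l \<Rightarrow> 'l \<Rightarrow> 'k"
  assumes k12: "\<And>z. kills (\<lambda>x y. h x y z)" and k23: "\<And>x. kills (h x)"
    and bal: "\<And>x y b z. h x (\<tau> b \<otimes> y) z = h x y (\<sigma> b \<otimes> z)"
    and add: "\<And>x y z z'. h x y (z + z') = h x y z + h x y z'"
  obtains \<psi> where "diamond_bal3 \<psi>" "\<And>w. homogeneous sc (*) (\<lambda>u v. \<psi> u v w)" "\<And>u. homogeneous sc (*) (\<psi> u)"
    "\<And>x y z. sharp_pull (\<lambda>u v. sharp_pull (\<psi> u) v z) x y = h x y z"
proof -
  \<comment> \<open>Undo \<open>\<Gamma>\<^sup>#\<close> in the first two variables, then in the last two.\<close>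
  define \<psi>1 where "\<psi>1 u v z = sharp_unpull (\<lambda>x y. h x y z) u v" for u v z
  have b1: "diamond_bal (\<lambda>u v. \<psi>1 u v z)" and h1: "homogeneous sc (*) (\<lambda>u v. \<psi>1 u v z)" for z
    using sharp_unpull_bal[OF k12, of z] by (simp_all add: \<psi>1_def[abs_def])
  note s1 = diamond_bal_simps[OF b1]
  have sh1: "sharp_pull (\<lambda>u v. \<psi>1 u v z) x y = h x y z" for x y z
    using sharp_pull_sharp_unpull[OF k12, of z x y] by (simp add: \<psi>1_def[abs_def])
  have scale1: "\<psi>1 u (sc c v) z = c * \<psi>1 u v z" "\<psi>1 (sc c u) v z = c * \<psi>1 u v z" for u c v z
    using diamond_bal_scale[OF b1, of c u v z] h1[of z] by (simp_all add: homogeneous_def)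
  have k1: "kills (\<psi>1 u)" for u
  proof (rule killsI)
    have "\<psi>1 u v (z + z') = \<psi>1 u v z + \<psi>1 u v z'" for v z z'
      by (simp add: \<psi>1_def sharp_unpull_def add lsum_fun_add[OF field_vs] case_prod_unfold)
    then show "biadditive (\<psi>1 u)"
      using s1 by (simp add: biadditive_def)
    show "homogeneous sc (*) (\<psi>1 u)" by (simp add: homogeneous_def scale1)
    fix v b z
    define \<chi> where "\<chi> u v = \<psi>1 u (\<tau> b \<otimes> v) z" for u v
    have "diamond_bal \<chi>" unfolding \<chi>_def by (rule diamond_balI) (simp_all add: s1 tprod_add tprod_tgt_src)
    moreover have "homogeneous sc (*) \<chi>" using h1[of z] by (simp add: homogeneous_def \<chi>_def)
    ultimately have "\<chi> u v = sharp_unpull (sharp_pull \<chi>) u v" by (rule sharp_unpull_sharp_pull[symmetric])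
    also have "sharp_pull \<chi> = (\<lambda>x y. h x y (\<sigma> b \<otimes> z))"
    proof (intro ext)
      fix x y
      show "sharp_pull \<chi> x y = h x y (\<sigma> b \<otimes> z)"
        using sharp_pull_tgt[OF b1, of z x b y] sh1[of z x "\<tau> b \<otimes> y"] by (simp add: \<chi>_def[abs_def] bal)
    qed
    finally show "\<psi>1 u (\<tau> b \<otimes> v) z = \<psi>1 u v (\<sigma> b \<otimes> z)" by (simp add: \<chi>_def \<psi>1_def)
  qed
  define \<psi> where "\<psi> u = sharp_unpull (\<psi>1 u)" for u
  have b2: "diamond_bal (\<psi> u)" and h2: "homogeneous sc (*) (\<psi> u)" and sh2: "sharp_pull (\<psi> u) x y = \<psi>1 u x y" for u x y
    unfolding \<psi>_def by (rule sharp_unpull_bal[OF k1] sharp_pull_sharp_unpull[OF k1])+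
  have h3: "homogeneous sc (*) (\<lambda>u v. \<psi> u v w)" for w
    unfolding homogeneous_def \<psi>_def sharp_unpull_def scale1(2)
    by (simp add: lsum_def sum_distrib_left case_prod_unfold algebra_simps)
  have b23: "diamond_bal (\<lambda>u v. \<psi> u v w)" for w
  proof (rule diamond_balI)
    fix u r v
    define \<chi> where "\<chi> v w = \<psi> u (\<sigma> r \<star> v) w" for v w
    have "diamond_bal \<chi>" unfolding \<chi>_def by (rule diamond_balI) (simp_all add: diamond_bal_simps[OF b2] alg)
    moreover have "homogeneous sc (*) \<chi>" using h2[of u] by (simp add: homogeneous_def \<chi>_def alg)
    ultimately have "\<chi> v w = sharp_unpull (sharp_pull \<chi>) v w" by (rule sharp_unpull_sharp_pull[symmetric])
    also have "sharp_pull \<chi> = \<psi>1 (\<tau> r \<star> u)"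
    proof (intro ext)
      fix y z
      have "sharp_pull \<chi> y z = sharp_pull (\<psi> u) (\<sigma> r \<star> y) z"
        unfolding sharp_pull_def by (simp add: E_src[OF sharp_pull_bal(1)[OF b2]] \<chi>_def L.mult_assoc)
      then show "sharp_pull \<chi> y z = \<psi>1 (\<tau> r \<star> u) y z" by (simp add: sh2 s1)
    qed
    finally show "\<psi> (\<tau> r \<star> u) v w = \<psi> u (\<sigma> r \<star> v) w" by (simp add: \<chi>_def \<psi>_def)
  next
    fix u u' v
    show "\<psi> (u + u') v w = \<psi> u v w + \<psi> u' v w"
      by (simp add: \<psi>_def sharp_unpull_def s1 lsum_fun_add[OF field_vs] case_prod_unfold)
  qed (simp add: diamond_bal_simps[OF b2])
  show thesis
  proof (rule that[of \<psi>])
    show "diamond_bal3 \<psi>" using b2 b23 by (simp add: diamond_bal3_def)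
    show "sharp_pull (\<lambda>u v. sharp_pull (\<psi> u) v z) x y = h x y z" for x y z
      by (simp add: sh2 sh1)
  qed (rule h3 h2)+
qed

text \<open>
  A functional on the twisted threefold tensor product comes from some \<open>\<psi>\<close> as in
  \<open>twisted_trilinear\<close>, and it takes the value \<open>\<psi>(X\<^sub>1, X\<^sub>2, X\<^sub>3)\<close> on both sides.
\<close>

lemma twisted_coassoc:
  assumes T: "T \<in> tw_cop X"
  shows "lsum fscale (\<lambda>(x, y). lsum fscale (\<lambda>(x1, x2). pure (x1, x2, y)) (rep (tw_cop x))) T -
     lsum fscale (\<lambda>(x, y). lsum fscale (\<lambda>(y1, y2). pure (x, y1, y2)) (rep (tw_cop y))) T \<in> tensor_null3 UNIV UNIV tw_null tw_null"
    (is "?l - ?r \<in> _")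
  unfolding tensor_null3_def
proof (rule functional_separation, fold tensor_null3_def)
  fix g :: "'l \<times> 'l \<times> 'l \<Rightarrow> 'k"
  assume g: "\<And>n. n \<in> tensor_null3 UNIV UNIV tw_null tw_null \<Longrightarrow> lsum (*) g n = 0"
  note base = g[unfolded tensor_null3_def, OF free.span_base]
  define h where "h x y z = g (x, y, z)" for x y z
  have k12: "kills (\<lambda>x y. h x y z)" for z
    unfolding kills_def
  proof
    fix n assume "n \<in> tw_null"
    then have "lsum (*) g (lsum fscale (\<lambda>(p, q). pure (p, q, z)) n) = 0" by (intro base) blast
    then show "lsum (*) (\<lambda>(x, y). h x y z) n = 0"
      by (simp add: lsum_lsum[OF field_vs] lsum_pure[OF field_vs] case_prod_unfold h_def)
  qed
  have k23: "kills (h x)" for x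
    unfolding kills_def
  proof
    fix n assume "n \<in> tw_null"
    then have "lsum (*) g (lsum fscale (\<lambda>(q, r). pure (x, q, r)) n) = 0" by (intro base) blast
    then show "lsum (*) (\<lambda>(y, z). h x y z) n = 0"
      by (simp add: lsum_lsum[OF field_vs] lsum_pure[OF field_vs] case_prod_unfold h_def)
  qed
  have "balanced (\<lambda>X b. \<tau> b \<otimes> X) (\<lambda>b X. \<sigma> b \<otimes> X) (h x)" for x
    using functional_tensor_null(1)[of sc "\<lambda>X b. \<tau> b \<otimes> X" sc "\<lambda>b X. \<sigma> b \<otimes> X" "\<lambda>(y, z). h x y z"] k23[of x]
    by (simp add: kills_def twisted_diamond_null_def twisted_mult_eq)
  then have bal: "h x (\<tau> b \<otimes> y) z = h x y (\<sigma> b \<otimes> z)" and add: "h x y (z + z') = h x y z + h x y z'" for x b y z z'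
    by (simp_all add: balanced_def biadditive_def)
  obtain \<psi> where \<psi>: "diamond_bal3 \<psi>" "\<And>w. homogeneous sc (*) (\<lambda>u v. \<psi> u v w)" "\<And>u. homogeneous sc (*) (\<psi> u)"
    and h: "\<And>x y z. sharp_pull (\<lambda>u v. sharp_pull (\<psi> u) v z) x y = h x y z"
    using twisted_trilinear[OF k12 k23 bal add] by blast
  have diamond_bal: "diamond_bal (\<lambda>u v. \<psi> u v w)" "diamond_bal (\<psi> u)" for u w using \<psi>(1) by (simp_all add: diamond_bal3_def)
  note s = diamond_bal_simps[OF diamond_bal(1)] diamond_bal_simps[OF diamond_bal(2)]
  have \<psi>_sc: "\<psi> (sc c u) = (\<lambda>v w. c * \<psi> u v w)" "\<psi> u (sc c v) = (\<lambda>w. c * \<psi> u v w)" for c u v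
    using \<psi>(2,3) by (simp_all add: homogeneous_def fun_eq_iff)
  have shb: "diamond_bal (\<lambda>u v. sharp_pull (\<psi> u) v z)" for z
    unfolding sharp_pull_def
    by (rule diamond_balI) (simp_all add: s E_rules[OF sharp_pull_bal(1)[OF diamond_bal(2)]] D_fun_add E_fun_add L.mult_assoc)
  have shh: "homogeneous sc (*) (\<lambda>u v. sharp_pull (\<psi> u) v z)" for z
    by (simp add: homogeneous_def sharp_pull_def \<psi>_sc D_cmult E_cmult)
  have "lsum (*) g ?l = lsum (*) (\<lambda>(x, z). lsum (*) (\<lambda>(x, y). h x y z) (rep (tw_cop x))) T"
    by (simp add: lsum_lsum[OF field_vs] lsum_pure[OF field_vs] case_prod_unfold h_def)
  also have "\<dots> = lsum (*) (\<lambda>(x, z). D (\<lambda>u v. sharp_pull (\<psi> u) v z) x) T"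
    by (simp add: lsum_twisted_cop[OF field_vs rep_tw_cop shb shh] flip: h)
  also have "\<dots> = lsum (*) (\<lambda>(x, z). sharp_pull (\<lambda>v w. D (\<lambda>u v. \<psi> u v w) v) x z) T"
    by (simp add: sharp_pull_D_left[OF \<psi>(1)])
  also have "\<dots> = D (\<lambda>v w. D (\<lambda>u v. \<psi> u v w) v) X"
  proof (rule lsum_twisted_cop[OF field_vs T])
    show "diamond_bal (\<lambda>v w. D (\<lambda>u v. \<psi> u v w) v)"
      by (rule diamond_balI) (simp_all add: s D_rules[OF diamond_bal(1)] D_fun_add)
    show "homogeneous sc (*) (\<lambda>v w. D (\<lambda>u v. \<psi> u v w) v)"
      by (simp add: homogeneous_def D_scale[OF diamond_bal(1)] \<psi>_sc D_cmult)
  qed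
  also have "\<dots> = D (\<lambda>u y. D (\<psi> u) y) X"
    by (rule D_coassoc[OF \<psi>(1)])
  also have "\<dots> = lsum (*) (\<lambda>(x, y). sharp_pull (\<lambda>u y. D (\<psi> u) y) x y) T"
  proof (rule lsum_twisted_cop[OF field_vs T, symmetric])
    show "diamond_bal (\<lambda>u y. D (\<psi> u) y)"
    proof -
      have "\<psi> (u + u') = (\<lambda>v w. \<psi> u v w + \<psi> u' v w)" "\<psi> (\<tau> r \<star> u) = (\<lambda>v w. \<psi> u (\<sigma> r \<star> v) w)" for u u' r
        by (intro ext; simp add: s)+
      then show ?thesis by (intro diamond_balI) (simp_all only: D_fun_add D_rules[OF diamond_bal(2)])
    qed
    show "homogeneous sc (*) (\<lambda>u y. D (\<psi> u) y)" by (simp add: homogeneous_def \<psi>_sc D_cmult)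
  qed
  also have "\<dots> = lsum (*) (\<lambda>(x, y). lsum (*) (\<lambda>(y, z). h x y z) (rep (tw_cop y))) T"
  proof -
    define \<chi> where "\<chi> x v w = D (\<lambda>v1 v2. E (\<lambda>p m. \<psi> (p \<star> \<tau> (\<Gamma> m v1)) v2 w) x) v" for x v w
    note \<chi> = sharp_pull_D_right[OF \<psi>(1), folded \<chi>_def]
    have "homogeneous sc (*) (\<chi> x)" for x
      by (simp add: homogeneous_def \<chi>_def D_scale[OF sharp_pull_bal(2)[OF diamond_bal(1)]] \<psi>_sc alg\<Gamma> D_cmult E_cmult)
    from lsum_twisted_cop[OF field_vs rep_tw_cop \<chi>(1) this]
    show ?thesis by (simp add: \<chi>(3)[symmetric] \<chi>(2) flip: h)
  qed
  also have "\<dots> = lsum (*) g ?r"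
    by (simp add: lsum_lsum[OF field_vs] lsum_pure[OF field_vs] case_prod_unfold h_def)
  finally show "lsum (*) g (?l - ?r) = 0" by (simp add: lsum_diff[OF field_vs])
qed

lemma twisted_simps:
  "base (twisted H \<Gamma>) = twisted_base H \<Gamma>" "lscale (twisted H \<Gamma>) = sc" "aone (total (twisted H \<Gamma>)) = \<one>"
  "amult (total (twisted H \<Gamma>)) = (\<lambda>X Y. X \<otimes> Y)" "src (twisted H \<Gamma>) = \<sigma>" "tgt (twisted H \<Gamma>) = \<tau>"
  "cop (twisted H \<Gamma>) = tw_cop" "cou (twisted H \<Gamma>) = (\<lambda>X. cou_tw X)"
  "ascale (twisted_base H \<Gamma>) = ascale (base H)" "aone (twisted_base H \<Gamma>) = aone (base H)"
  "amult (twisted_base H \<Gamma>) = (\<lambda>a b. \<Gamma> (\<sigma> a) (\<sigma> b))"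
  by (simp_all add: twisted_def twisted_base_def twisted_mult_eq twisted_cou_eq fun_eq_iff)

lemma diamond_null_twisted: "diamond_null (twisted H \<Gamma>) = tw_null"
  by (simp add: diamond_null_def twisted_diamond_null_def twisted_simps twisted_mult_eq)

lemma lprod_src_tgt: "\<sigma> a \<odot> (\<tau> c \<star> u) = \<tau> c \<star> (\<sigma> a \<odot> u)"
  unfolding lprod_tgt_mult(2)[symmetric] comm lprod_tgt_mult(1) ..

lemma twisted_cop_bimodule:
  assumes T: "T \<in> tw_cop X"
  shows "legs (\<lambda>Y. \<sigma> a \<otimes> Y) (\<lambda>Y. \<tau> b \<otimes> Y) T \<in> tw_cop (\<sigma> a \<otimes> (\<tau> b \<otimes> X))"
proof (rule twisted_copI)
  fix \<psi> :: "'l \<Rightarrow> 'l \<Rightarrow> 'k" assume \<psi>: "diamond_bal \<psi>" "homogeneous sc (*) \<psi>"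
  note s = diamond_bal_simps[OF \<psi>(1)]
  define \<psi>' where "\<psi>' u v = \<psi> u (\<tau> b \<otimes> v)" for u v
  define \<chi> where "\<chi> u v = \<psi>' (\<sigma> a \<odot> u) v" for u v
  have \<psi>': "diamond_bal \<psi>'" unfolding \<psi>'_def by (rule diamond_balI) (simp_all add: s tprod_add tprod_tgt_src)
  have \<chi>: "diamond_bal \<chi>" unfolding \<chi>_def by (rule diamond_balI) (simp_all add: diamond_bal_simps[OF \<psi>'] lprod_add lprod_src_tgt)
  have \<chi>h: "homogeneous sc (*) \<chi>"
    using \<psi>(2) by (simp add: homogeneous_def \<chi>_def \<psi>'_def lprod_scale)
  have "sharp_pull \<psi> (\<sigma> a \<otimes> x) (\<tau> b \<otimes> y) = sharp_pull \<chi> x y" for x y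
    unfolding sharp_pull_tgt[OF \<psi>(1)] \<psi>'_def[abs_def, symmetric] by (simp add: sharp_pull_def \<chi>_def E_tprod_rules[OF sharp_pull_bal(1)[OF \<psi>']] lprod_rules)
  then have "lsum (*) (\<lambda>(x, y). sharp_pull \<psi> x y) (legs (\<lambda>Y. \<sigma> a \<otimes> Y) (\<lambda>Y. \<tau> b \<otimes> Y) T) = lsum (*) (\<lambda>(x, y). sharp_pull \<chi> x y) T"
    by (simp add: lsum_legs[OF field_vs])
  also have "\<dots> = D \<chi> X" by (rule lsum_twisted_cop[OF field_vs T \<chi> \<chi>h])
  also have "\<dots> = D \<psi> (\<sigma> a \<otimes> (\<tau> b \<otimes> X))"
    unfolding tprod_src D_src_lprod[OF \<psi>(1)] using \<psi>
    by (subst D_tprod_tgt) (simp_all add: diamond_balI diamond_bal_simps lprod_add lprod_src_tgt \<chi>_def[abs_def] \<psi>'_def)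
  finally show "lsum (*) (\<lambda>(x, y). sharp_pull \<psi> x y) (legs (\<lambda>Y. \<sigma> a \<otimes> Y) (\<lambda>Y. \<tau> b \<otimes> Y) T) = D \<psi> (\<sigma> a \<otimes> (\<tau> b \<otimes> X))" .
qed

text \<open>
  As \<open>\<sigma>(\<epsilon>\<^sup>\<Gamma>(x)) \<otimes> y = \<sigma>(\<Gamma>(x\<^sub>+ \<odot> x\<^sub>-, y\<^sub>1))y\<^sub>2 = \<sigma>(\<Gamma>(x\<^sub>+, x\<^sub>- \<odot> y\<^sub>1))y\<^sub>2\<close>, the sum over the twisted
  coproduct is \<open>\<sigma>(\<Gamma>(X\<^sub>1, 1))X\<^sub>2 = X\<close>.
\<close>

lemma twisted_counit_left:
  assumes T: "T \<in> tw_cop X"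
  shows "lsum sc (\<lambda>(x, y). \<sigma> (cou_tw x) \<otimes> y) T = X"
proof -
  have "\<sigma> (cou_tw x) \<otimes> y = sharp_pull3 (\<lambda>p m y. \<sigma> (\<Gamma> p m) \<star> y) x y" for x y
  proof -
    have "\<sigma> (cou_tw x) \<otimes> y = D (\<lambda>y1 y2. \<sigma> (\<Gamma> (\<sigma> (cou_tw x)) y1) \<star> y2) y"
      unfolding tprod_src lprod_def D2_def by (simp add: D_s[OF diamond_bal_lprod(1)] L.mult_one_left)
    also have "\<dots> = D (\<lambda>y1 y2. E (\<lambda>p m. \<sigma> (\<Gamma> (p \<odot> m) y1) \<star> y2) x) y"
      unfolding lprod_cou_tw by (simp only: E_additive[of "\<lambda>x. \<sigma> (\<Gamma> x y1) \<star> y2" for y1 y2] alg\<Gamma>)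
    finally show ?thesis unfolding sharp_pull3_def cocycle_lprod .
  qed
  then have "lsum sc (\<lambda>(x, y). \<sigma> (cou_tw x) \<otimes> y) T = lsum sc (\<lambda>(x, y). sharp_pull3 (\<lambda>p m y. \<sigma> (\<Gamma> p m) \<star> y) x y) T" by simp
  also have "\<dots> = D (\<lambda>x y. \<sigma> (\<Gamma> x \<one>) \<star> y) X"
  proof (rule lsum_twisted_cop_sharp_pull3[OF L.vector_space T])
    show "sharp_bal (\<lambda>p m y. \<sigma> (\<Gamma> p m) \<star> y)" by (rule sharp_balI) (simp_all add: alg\<Gamma>)
  qed (simp add: homogeneous_def alg\<Gamma>)
  finally show ?thesis by (simp add: \<Gamma>_rules counitL)
qed

lemma \<Gamma>_balanced2:
  "\<Gamma> (x \<star> (y \<star> \<tau> b)) z = \<Gamma> (x \<star> y) (\<tau> b \<star> z)"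
  "\<Gamma> (x \<star> (y \<star> (w \<star> \<tau> b))) z = \<Gamma> (x \<star> (y \<star> w)) (\<tau> b \<star> z)"
  using balanced[of "x \<star> y" b z] balanced[of "x \<star> (y \<star> w)" b z] by (simp_all add: L.mult_assoc)

lemma E_swap3:
  "E (\<lambda>p m. E (\<lambda>p' m'. E (\<lambda>q n. f p m p' m' q n) Z) p) X = E (\<lambda>q n. E (\<lambda>p m. E (\<lambda>p' m'. f p m p' m' q n) p) X) Z"
  by (simp only: E_swap[where Y = Z])

text \<open>
  The expression \<open>\<tau>(\<epsilon>\<^sup>\<Gamma>(y)) \<otimes> x = x\<^sub>+\<tau>(\<Gamma>(x\<^sub>- \<odot> y\<^sub>+, y\<^sub>-))\<close> is the pullback along \<open>\<Gamma>\<^sup>#\<close> of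
  \<open>\<psi>(u, v) = u\<^sub>+\<tau>(\<Gamma>(u\<^sub>-v\<^sub>+, v\<^sub>-))\<close>.  The sum over the twisted coproduct is therefore \<open>\<psi>(X\<^sub>1, X\<^sub>2)\<close>, and
  this is \<open>X\<^sub>+\<^sub>1\<^sub>+\<tau>(\<Gamma>(X\<^sub>+\<^sub>1\<^sub>-X\<^sub>+\<^sub>2, X\<^sub>-)) = X\<^sub>+\<tau>(\<Gamma>(1, X\<^sub>-)) = X\<close>.
\<close>

lemma twisted_counit_right:
  assumes T: "T \<in> tw_cop X"
  shows "lsum sc (\<lambda>(x, y). \<tau> (cou_tw y) \<otimes> x) T = X"
proof -
  note a = alg\<Gamma> \<Gamma>_balanced2
  define \<psi> where "\<psi> u v = E (\<lambda>p m. E (\<lambda>q n. p \<star> \<tau> (\<Gamma> (m \<star> q) n)) v) u" for u v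
  have b1: "otgt_bal (\<lambda>q n. p \<star> \<tau> (\<Gamma> (m \<star> q) n))" for p m
    by (rule otgt_balI) (simp_all add: a)
  have b2: "otgt_bal (\<lambda>p m. E (\<lambda>q n. p \<star> \<tau> (\<Gamma> (m \<star> q) n)) v)" for v
    by (rule otgt_balI) (simp_all add: a E_fun_add)
  have b5: "otgt_bal (\<lambda>p m. p \<star> \<tau> (\<Gamma> m n))" for n
    by (rule otgt_balI) (simp_all add: a)
  have \<psi>: "diamond_bal \<psi>"
    unfolding \<psi>_def by (rule diamond_balI) (simp_all add: E_rules[OF b1] E_rules[OF b2] E_fun_add L.mult_assoc)
  have \<psi>h: "homogeneous sc sc \<psi>"
    by (simp add: homogeneous_def \<psi>_def E_scale[OF b2] L.mult_scale_left E_sc)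
  have sharp_pull: "\<tau> (cou_tw y) \<otimes> x = sharp_pull \<psi> x y" for x y
  proof -
    have both_bal: "both_bal (\<lambda>m1 m2 y1 q. p \<star> \<tau> (\<Gamma> (\<sigma> (\<Gamma> m1 y1) \<star> (m2 \<star> q)) n))" for p n
      by (auto simp: both_bal_def diamond_bal_iff biadditive_def a)
    have "sharp_pull \<psi> x y = D (\<lambda>y1 y2. E (\<lambda>q n. E (\<lambda>p m. E (\<lambda>p' m'. p' \<star> \<tau> (\<Gamma> (\<sigma> (\<Gamma> m y1) \<star> (m' \<star> q)) n)) p) x) y2) y"
      unfolding sharp_pull_def \<psi>_def E_tgtR[OF b2] by (simp only: E_swap3 L.mult_assoc)
    also have "\<dots> = D (\<lambda>y1 y2. E (\<lambda>q n. E (\<lambda>p m. D (\<lambda>m1 m2. p \<star> \<tau> (\<Gamma> (\<sigma> (\<Gamma> m1 y1) \<star> (m2 \<star> q)) n)) m) x) y2) y"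
    proof -
      have "E (\<lambda>p m. D (\<lambda>m1 m2. p \<star> \<tau> (\<Gamma> (\<sigma> (\<Gamma> m1 y1) \<star> (m2 \<star> q)) n)) m) x =
          E (\<lambda>p m. E (\<lambda>p' m'. p' \<star> \<tau> (\<Gamma> (\<sigma> (\<Gamma> m y1) \<star> (m' \<star> q)) n)) p) x" for y1 q n
        by (rule E_coassoc_minus; (rule diamond_balI | rule otgt_balI); simp add: a)
      then show ?thesis by simp
    qed
    also have "\<dots> = E (\<lambda>q n. D (\<lambda>y1 y2. E (\<lambda>p m. D (\<lambda>m1 m2. p \<star> \<tau> (\<Gamma> (\<sigma> (\<Gamma> m1 y1) \<star> (m2 \<star> y2)) n)) m) x) q) y"
    proof (rule E_coassoc_plus)
      show "diamond_bal (\<lambda>y1 q. E (\<lambda>p m. D (\<lambda>m1 m2. p \<star> \<tau> (\<Gamma> (\<sigma> (\<Gamma> m1 y1) \<star> (m2 \<star> q)) n)) m) x)" for n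
        by (rule diamond_balI; simp add: diamond_bal_simps[OF both_bal_diamond_bal[OF both_bal]] E_fun_add)
      show "otgt_bal (\<lambda>q n. E (\<lambda>p m. D (\<lambda>m1 m2. p \<star> \<tau> (\<Gamma> (\<sigma> (\<Gamma> m1 y1) \<star> (m2 \<star> q)) n)) m) x)" for y1
        by (rule otgt_balI; simp add: a D_fun_add E_fun_add)
    qed
    also have "\<dots> = E (\<lambda>q n. E (\<lambda>p m. p \<star> \<tau> (\<Gamma> (m \<odot> q) n)) x) y"
      unfolding lprod_def D2_def
      by (simp only: D_additive[of "\<lambda>w. p \<star> \<tau> (\<Gamma> w n)" for p n] a DE_swap)
    also have "\<dots> = E (\<lambda>p m. p \<star> \<tau> (\<Gamma> m (\<sigma> (cou_tw y)))) x"
      unfolding lprod_cou_tw cocycle_lprod[symmetric]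
      by (subst E_swap) (simp only: E_additive[of "\<lambda>w. p \<star> \<tau> (\<Gamma> m w)" for p m] a)
    finally show ?thesis by (simp add: tprod_tgt(1))
  qed
  have "lsum sc (\<lambda>(x, y). \<tau> (cou_tw y) \<otimes> x) T = D \<psi> X"
    unfolding sharp_pull by (rule lsum_twisted_cop[OF L.vector_space T \<psi> \<psi>h])
  also have "\<dots> = D (\<lambda>x y. E (\<lambda>q n. E (\<lambda>p m. p \<star> \<tau> (\<Gamma> (m \<star> q) n)) x) y) X"
    unfolding \<psi>_def[abs_def] by (rule arg_cong[where f = "\<lambda>f. D f X"], intro ext, rule E_swap)
  also have "\<dots> = E (\<lambda>z n. D (\<lambda>x y. E (\<lambda>p m. p \<star> \<tau> (\<Gamma> (m \<star> y) n)) x) z) X"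
  proof (rule E_coassoc_plus)
    have b4: "otgt_bal (\<lambda>p m. p \<star> \<tau> (\<Gamma> (m \<star> q) n))" for q n
      by (rule otgt_balI) (simp_all add: a)
    show "diamond_bal (\<lambda>x q. E (\<lambda>p m. p \<star> \<tau> (\<Gamma> (m \<star> q) n)) x)" for n
      by (rule diamond_balI) (simp_all add: E_rules[OF b4] E_fun_add a)
    show "otgt_bal (\<lambda>q n. E (\<lambda>p m. p \<star> \<tau> (\<Gamma> (m \<star> q) n)) x)" for x
      by (rule otgt_balI; simp add: a E_fun_add)
  qed
  also have "\<dots> = X"
    unfolding D_galois[OF b5] \<Gamma>_rules by (rule E_counit)
  finally show ?thesis .
qed

text \<open>
  Under \<open>\<Gamma>\<^sup>#\<close> the two sides differ from the coproduct by factors \<open>\<tau>(\<Gamma>(\<sigma>(b), w))\<close> and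
  \<open>\<tau>(\<Gamma>(w, \<sigma>(b)))\<close>, where \<open>w = X\<^sub>[\<^sub>1\<^sub>]\<^sub>- \<odot> X\<^sub>[\<^sub>2\<^sub>]\<^sub>1\<close> can be replaced by \<open>1\<close>; both are then \<open>\<tau>(b)\<close>.
\<close>

lemma twisted_takeuchi:
  assumes T: "T \<in> tw_cop X"
  shows "coset tw_null (legs (\<lambda>Y. Y \<otimes> \<tau> b) id T) = coset tw_null (legs id (\<lambda>Y. Y \<otimes> \<sigma> b) T)"
proof (rule twisted_coset_eqI)
  fix \<psi> :: "'l \<Rightarrow> 'l \<Rightarrow> 'k" assume \<psi>: "diamond_bal \<psi>" "homogeneous sc (*) \<psi>"
  note s = diamond_bal_simps[OF \<psi>(1)]
  have 1: "sharp_pull \<psi> (x \<otimes> \<tau> b) y = sharp_pull3 (\<lambda>p w y. \<psi> (p \<star> \<tau> (\<Gamma> (\<sigma> b) w)) y) x y" for x y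
    by (simp add: sharp_pull_def sharp_pull3_def E_tprod_rules[OF sharp_pull_bal(1)[OF \<psi>(1)]] cocycle_lprod)
  have 2: "sharp_pull \<psi> x (y \<otimes> \<sigma> b) = sharp_pull3 (\<lambda>p w y. \<psi> (p \<star> \<tau> (\<Gamma> w (\<sigma> b))) y) x y" for x y
    by (simp add: sharp_pull_def sharp_pull3_def tprod_src D_lprod_src[OF sharp_pull_bal(2)[OF \<psi>(1)]] cocycle_lprod)
  have "lsum (*) (\<lambda>(x, y). sharp_pull \<psi> (x \<otimes> \<tau> b) y) T = D (\<lambda>x y. \<psi> (x \<star> \<tau> (\<Gamma> (\<sigma> b) \<one>)) y) X"
    unfolding 1
    by (rule lsum_twisted_cop_sharp_pull3[OF field_vs T]) (use \<psi>(2) in \<open>auto intro!: sharp_balI simp: s alg\<Gamma> \<Gamma>_src_tgt homogeneous_def\<close>)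
  moreover have "lsum (*) (\<lambda>(x, y). sharp_pull \<psi> x (y \<otimes> \<sigma> b)) T = D (\<lambda>x y. \<psi> (x \<star> \<tau> (\<Gamma> \<one> (\<sigma> b))) y) X"
    unfolding 2
    by (rule lsum_twisted_cop_sharp_pull3[OF field_vs T]) (use \<psi>(2) in \<open>auto intro!: sharp_balI simp: s alg\<Gamma> homogeneous_def\<close>)
  ultimately show "lsum (*) (\<lambda>(x, y). sharp_pull \<psi> x y) (legs (\<lambda>Y. Y \<otimes> \<tau> b) id T) =
      lsum (*) (\<lambda>(x, y). sharp_pull \<psi> x y) (legs id (\<lambda>Y. Y \<otimes> \<sigma> b) T)"
    by (simp add: lsum_legs[OF field_vs] \<Gamma>_rules)
qed

text \<open>
  By \<open>E_tprod\<close>, \<open>D_tprod\<close> and the cocycle identity, \<open>\<Gamma>\<^sup>#\<close> maps \<open>x \<otimes> y \<diamondop> x' \<otimes> y'\<close> to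
  \<open>(x\<^sub>+ \<odot> y\<^sub>+)\<tau>(\<Gamma>(y\<^sub>-, (x\<^sub>- \<odot> x'\<^sub>1) \<odot> y'\<^sub>1)) \<diamondop> x'\<^sub>2 \<bullet> y'\<^sub>2\<close>.  For the twisted coproduct of \<open>X\<close> the inner
  term \<open>x\<^sub>- \<odot> x'\<^sub>1\<close> becomes \<open>1\<close>, and what is left is \<open>\<Gamma>\<^sup>#\<close> in \<open>y\<close> and \<open>y'\<close>.
\<close>

lemma twisted_cop_mult:
  assumes T: "T \<in> tw_cop X" and T': "T' \<in> tw_cop Y"
  shows "lsum fscale (\<lambda>(x1, x2). legs (\<lambda>y1. x1 \<otimes> y1) (\<lambda>y2. x2 \<otimes> y2) T') T \<in> tw_cop (X \<otimes> Y)"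
proof (rule twisted_copI)
  fix \<psi> :: "'l \<Rightarrow> 'l \<Rightarrow> 'k" assume \<psi>: "diamond_bal \<psi>" "homogeneous sc (*) \<psi>"
  note s = diamond_bal_simps[OF \<psi>(1)]
  note h = hom_fun[OF \<psi>(2)]
  define \<Phi> where "\<Phi> y y' p w z =
    D (\<lambda>y1 y2. E (\<lambda>q n. \<psi> ((p \<odot> q) \<star> \<tau> (\<Gamma> n (w \<odot> y1))) (z \<bullet> y2)) y) y'" for y y' p w z
  define \<chi> where "\<chi> u v = D (\<lambda>x1 x2. \<psi> (x1 \<odot> u) (x2 \<bullet> v)) X" for u v
  have \<chi>: "diamond_bal \<chi>" unfolding \<chi>_def by (rule both_bal_diamond_bal[OF both_bal_tprod[OF \<psi>(1)]])
  have \<chi>h: "homogeneous sc (*) \<chi>" by (simp add: homogeneous_def \<chi>_def lprod_scale h D_cmult)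
  have sharp_pull3: "sharp_pull \<psi> (x \<otimes> y) (x' \<otimes> y') = sharp_pull3 (\<Phi> y y') x x'" for x y x' y'
  proof -
    have "sharp_pull \<psi> (x \<otimes> y) (x' \<otimes> y') = D (\<lambda>y1 y2. D (\<lambda>a b. E (\<lambda>p m. E (\<lambda>q n.
        \<psi> ((p \<odot> q) \<star> \<tau> (\<Gamma> n ((m \<odot> a) \<odot> y1))) (b \<bullet> y2)) y) x) x') y'"
      unfolding sharp_pull_def D_tprod[OF sharp_pull_bal(2)[OF \<psi>(1)]]
      unfolding E_tprod[OF sharp_pull_bal(1)[OF \<psi>(1)]]
      unfolding cocycle_lprod lprod_assoc ..
    also have "\<dots> = sharp_pull3 (\<Phi> y y') x x'"
      unfolding sharp_pull3_def \<Phi>_def by (subst D_swap) (simp add: DE_swap)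
    finally show ?thesis .
  qed
  have otgt_bal: "otgt_bal (\<lambda>q n. \<psi> ((p \<odot> q) \<star> \<tau> (\<Gamma> n w)) z)" for p w z
    by (rule otgt_balI) (simp_all add: s lprod_rules alg\<Gamma>)
  have sharp_bal: "sharp_bal (\<Phi> y y')" for y y'
  proof (rule sharp_balI)
    fix p b w z
    have "E (\<lambda>q n. \<psi> (((p \<star> \<tau> b) \<odot> q) \<star> \<tau> (\<Gamma> n (w \<odot> y1))) (z \<bullet> y2)) y =
      E (\<lambda>q n. \<psi> ((p \<odot> q) \<star> \<tau> (\<Gamma> n ((\<tau> b \<star> w) \<odot> y1))) (z \<bullet> y2)) y" for y1 y2
      using E_tak[OF otgt_bal[of p "w \<odot> y1" "z \<bullet> y2"], of b y] by (simp add: lprod_rules \<Gamma>_rules)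
    then show "\<Phi> y y' (p \<star> \<tau> b) w z = \<Phi> y y' p (\<tau> b \<star> w) z" by (simp add: \<Phi>_def)
  qed (simp_all add: \<Phi>_def s lprod_rules rprod_add rprod_src alg\<Gamma> D_fun_add E_fun_add)
  have "lsum (*) (\<lambda>(x, y). sharp_pull \<psi> x y) (lsum fscale (\<lambda>(x1, x2). legs (\<lambda>y1. x1 \<otimes> y1) (\<lambda>y2. x2 \<otimes> y2) T') T) =
     lsum (*) (\<lambda>(x, x'). lsum (*) (\<lambda>(y, y'). sharp_pull3 (\<Phi> y y') x x') T') T"
    by (simp add: lsum_lsum[OF field_vs] case_prod_unfold lsum_legs[OF field_vs] sharp_pull3)
  also have "\<dots> = lsum (*) (\<lambda>(y, y'). lsum (*) (\<lambda>(x, x'). sharp_pull3 (\<Phi> y y') x x') T) T'"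
    by (rule lsum_swap2[OF field_vs])
  also have "\<dots> = lsum (*) (\<lambda>(y, y'). D (\<lambda>x x'. \<Phi> y y' x \<one> x') X) T'"
  proof -
    have "homogeneous sc (*) (\<lambda>x z. \<Phi> y y' x m z)" for y y' m
      by (simp add: homogeneous_def \<Phi>_def lprod_scale L.mult_scale_left h D_cmult E_cmult)
    then show ?thesis by (simp add: lsum_twisted_cop_sharp_pull3[OF field_vs T sharp_bal])
  qed
  also have "\<dots> = lsum (*) (\<lambda>(y, y'). sharp_pull \<chi> y y') T'"
  proof -
    have "D (\<lambda>x x'. \<Phi> y y' x \<one> x') X = sharp_pull \<chi> y y'" for y y'
      unfolding \<Phi>_def sharp_pull_def \<chi>_def by (subst D_swap) (simp add: DE_swap lprod_rules)
    then show ?thesis by simp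
  qed
  also have "\<dots> = D \<chi> Y" by (rule lsum_twisted_cop[OF field_vs T' \<chi> \<chi>h])
  also have "\<dots> = D \<psi> (X \<otimes> Y)" unfolding D_tprod[OF \<psi>(1)] \<chi>_def[abs_def] ..
  finally show "lsum (*) (\<lambda>(x, y). sharp_pull \<psi> x y) (lsum fscale (\<lambda>(x1, x2). legs (\<lambda>y1. x1 \<otimes> y1) (\<lambda>y2. x2 \<otimes> y2) T') T) = D \<psi> (X \<otimes> Y)" .
qed

lemma unital_algebra_twisted_base: "unital_algebra (twisted_base H \<Gamma>)"
proof (rule unital_algebra.intro)
  show "vector_space (ascale (twisted_base H \<Gamma>))" by (simp add: twisted_simps B.vector_space)
  show "amult (twisted_base H \<Gamma>) (amult (twisted_base H \<Gamma>) a b) c =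
    amult (twisted_base H \<Gamma>) a (amult (twisted_base H \<Gamma>) b c)" for a b c
    unfolding twisted_simps lprod_src[symmetric] cocycle_lprod ..
qed (simp_all add: twisted_simps alg\<Gamma> cou_s)

lemma unital_algebra_twisted: "unital_algebra (total (twisted H \<Gamma>))"
  by (rule unital_algebra.intro) (simp_all add: twisted_simps L.vector_space tprod_add tprod_scale tprod_assoc tprod_one)

lemma left_bialgebroid_twisted: "left_bialgebroid (twisted H \<Gamma>)"
proof (rule left_bialgebroid.intro, goal_cases)
  case 1 show ?case by (simp add: twisted_simps unital_algebra_twisted_base)
next
  case 2 show ?case by (rule unital_algebra_twisted)
next
  case 3
  have "\<sigma> (\<Gamma> (\<sigma> a) (\<sigma> b)) = \<sigma> a \<otimes> \<sigma> b" for a b by (simp add: tprod_src lprod_src)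
  then show ?case by (simp add: algebra_map_def twisted_simps Vector_Spaces.linear_iff src_hom B.vector_space L.vector_space)
next
  case 4
  have "\<tau> b \<otimes> \<tau> a = \<tau> (\<Gamma> (\<sigma> a) (\<sigma> b))" for a b
  proof -
    have "otgt_bal (\<lambda>p m. p \<star> \<tau> (\<Gamma> m (\<sigma> b)))" by (rule otgt_balI) (simp_all add: alg\<Gamma>)
    from E_t[OF this] show ?thesis by (simp add: tprod_tgt(1) L.mult_one_left)
  qed
  then show ?case by (simp add: algebra_map_def opposite_def twisted_simps Vector_Spaces.linear_iff tgt_hom B.vector_space L.vector_space)
next
  case (5 a b)
  have "\<sigma> a \<otimes> \<tau> b = \<sigma> a \<star> \<tau> b" "\<tau> b \<otimes> \<sigma> a = \<tau> b \<star> \<sigma> a"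
    by (simp_all add: tprod_src lprod_tgt)
  then show ?case by (simp add: twisted_simps comm)
next
  case (6 X) show ?case by (simp add: twisted_simps diamond_null_twisted twisted_cop_tensor)
next
  case (7 T X T' Y)
  interpret g: Vector_Spaces.linear fscale fscale sharp0 by (rule sharp0_linear)
  from 7 show ?case by (simp add: twisted_simps twisted_cop_iff g.add cop_add)
next
  case (8 T X c)
  interpret g: Vector_Spaces.linear fscale fscale sharp0 by (rule sharp0_linear)
  from 8 show ?case by (simp add: twisted_simps twisted_cop_iff g.scale cop_scale)
next
  case (9 T X a b)
  then show ?case by (simp add: twisted_simps twisted_cop_bimodule tprod_assoc)
next
  case 10 show ?case by (simp add: twisted_simps Vector_Spaces.linear_iff B.vector_space L.vector_space cou_tw_add cou_tw_scale)
next
  case (11 a b X)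
  show ?case unfolding twisted_simps tprod_assoc cou_tw_bimod unfolding lprod_src[symmetric] cocycle_lprod ..
next
  case (12 T X)
  then show ?case
    by (simp add: twisted_simps diamond_null_twisted coset_eq_iff[OF subspace_tensor_null3] twisted_coassoc)
next
  case (13 T X) then show ?case by (simp add: twisted_simps twisted_counit_left)
next
  case (14 T X) then show ?case by (simp add: twisted_simps twisted_counit_right)
next
  case (15 T X b) then show ?case by (simp add: twisted_simps diamond_null_twisted twisted_takeuchi)
next
  case (16 T X T' Y) then show ?case by (simp add: twisted_simps twisted_cop_mult)
next
  case 17
  have "pure (\<one>, \<one>) \<in> tw_cop \<one>"
  proof (rule twisted_copI)
    fix \<psi> :: "'l \<Rightarrow> 'l \<Rightarrow> 'k" assume \<psi>: "diamond_bal \<psi>"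
    show "lsum (*) (\<lambda>(x, y). sharp_pull \<psi> x y) (pure (\<one>, \<one>)) = D \<psi> \<one>"
      unfolding lsum_pure[OF field_vs] prod.case sharp_pull_def D_one[OF sharp_pull_bal(2)[OF \<psi>]] D_one[OF \<psi>]
      unfolding E_one[OF sharp_pull_bal(1)[OF \<psi>]] by (simp add: \<Gamma>_rules cou_one alg)
  qed
  then show ?case by (simp add: twisted_simps)
next
  case 18 show ?case by (simp add: twisted_simps cou_tw_one)
next
  case (19 X Y) show ?case by (simp add: twisted_simps cou_tw_tprod cou_tw_s)
next
  case (20 X Y) show ?case by (simp add: twisted_simps cou_tw_tprod cou_tw_t)
qed

section \<open>The Galois maps of the twisted bialgebroid\<close>

lemma otgt_null_twisted: "otgt_null (twisted H \<Gamma>) = tensor_null sc UNIV (\<lambda>X b. X \<otimes> \<tau> b) sc UNIV (\<lambda>b X. \<tau> b \<otimes> X)"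
  by (simp add: otgt_null_def twisted_simps)
lemma osrc_null_twisted: "osrc_null (twisted H \<Gamma>) = tensor_null sc UNIV (\<lambda>X b. X \<otimes> \<sigma> b) sc UNIV (\<lambda>b X. \<sigma> b \<otimes> X)"
  by (simp add: osrc_null_def twisted_simps)

text \<open>
  The map \<open>G\<close> will be a Galois map of the twisted bialgebroid.  If \<open>\<Gamma>\<^sup># \<circ> G = g \<circ> \<theta>\<close> and \<open>\<Gamma>\<^sup>#\<close>, \<open>g\<close>, \<open>\<theta>\<close>
  are bijective, then so is \<open>G\<close>.
\<close>

lemma galois_factorization:
  fixes G \<theta> g :: "(('l \<times> 'l) \<Rightarrow>\<^sub>0 'k) \<Rightarrow> (('l \<times> 'l) \<Rightarrow>\<^sub>0 'k)"
  assumes \<theta>: "induces_iso N1 UNIV N2 UNIV \<theta>" and g: "induces_iso N2 UNIV (diamond_null H) UNIV g"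
    and g_lin: "Vector_Spaces.linear fscale fscale g" and G_lin: "Vector_Spaces.linear fscale fscale G"
    and N1: "module.subspace fscale N1"
    and eq: "\<And>t. sharp0 (G t) - g (\<theta> t) \<in> diamond_null H"
  shows "bij_betw (\<lambda>c. coset tw_null (G (rep c))) (tensor N1 UNIV) (tensor tw_null UNIV)"
proof -
  interpret s: Vector_Spaces.linear fscale fscale sharp0 by (rule sharp0_linear)
  interpret g: Vector_Spaces.linear fscale fscale g by (rule g_lin)
  note sub = free.subspace_add[OF subspace_null(1)] free.subspace_diff[OF subspace_null(1)]
  have iff: "G t \<in> tw_null \<longleftrightarrow> t \<in> N1" for t
  proof -
    have "sharp0 (G t) \<in> diamond_null H \<longleftrightarrow> g (\<theta> t) \<in> diamond_null H"
      using sub(2)[OF _ eq[of t], of "sharp0 (G t)"] sub(1)[OF _ eq[of t], of "g (\<theta> t)"] by auto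
    then show ?thesis using \<theta> g by (simp add: sharp0_null induces_iso_def)
  qed
  have surj: "\<exists>t. G t - u \<in> tw_null" for u
  proof -
    obtain w where w: "g w - sharp0 u \<in> diamond_null H" using g by (auto simp: induces_iso_def)
    obtain t where "\<theta> t - w \<in> N2" using \<theta> by (auto simp: induces_iso_def)
    then have "g (\<theta> t) - g w \<in> diamond_null H" using g by (simp add: induces_iso_def flip: g.diff)
    from sub(1)[OF sub(1)[OF this w] eq[of t]] have "sharp0 (G t - u) \<in> diamond_null H" by (simp add: s.diff algebra_simps)
    then show ?thesis using sharp0_null by blast
  qed
  show ?thesis
    by (subst bij_betw_tensor_iff[OF subspace_twisted N1 G_lin]) (simp_all add: iff surj induces_iso_def)
qed

lemma lsum_lambda0: "diamond_bal \<psi> \<Longrightarrow> homogeneous sc (*) \<psi> \<Longrightarrow> lsum (*) (\<lambda>(x, y). \<psi> x y) (lambda0 t) = lsum (*) (\<lambda>(x, y). lambda_pull \<psi> x y) t"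
proof -
  assume \<psi>: "diamond_bal \<psi>" "homogeneous sc (*) \<psi>"
  have "homogeneous sc (*) (\<lambda>x y. lambda_pull \<psi> x y)"
    by (simp add: homogeneous_def lambda_pull_def D_scale[OF diamond_bal_mulr[OF \<psi>(1)]] hom_fun[OF \<psi>(2)] D_cmult)
  from ev_homogeneous[OF this] ev_homogeneous[OF \<psi>(2)] show ?thesis
    using ev_lambda0[OF \<psi>(1)] by simp
qed

text \<open>
  The map \<open>\<Theta>\<close> with \<open>\<Gamma>\<^sup># \<circ> \<lambda>\<^sup>\<Gamma> = \<lambda> \<circ> \<Theta>\<close>.
\<close>

definition theta0 :: "(('l \<times> 'l) \<Rightarrow>\<^sub>0 'k) \<Rightarrow> (('l \<times> 'l) \<Rightarrow>\<^sub>0 'k)" where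
  "theta0 = lsum fscale (\<lambda>(X, Y). lsum fscale (\<lambda>(p, m). lsum fscale (\<lambda>(q, n). pure (p, q \<star> \<tau> (\<Gamma> n m)))
     (rep (translation H Y))) (rep (translation H X)))"

definition lambda_tw0 :: "(('l \<times> 'l) \<Rightarrow>\<^sub>0 'k) \<Rightarrow> (('l \<times> 'l) \<Rightarrow>\<^sub>0 'k)" where
  "lambda_tw0 = lsum fscale (\<lambda>(X, Y). legs id (\<lambda>X2. X2 \<otimes> Y) (rep (tw_cop X)))"

text \<open>
  \<open>\<Gamma>\<^sup>#(X\<^sub>[\<^sub>1\<^sub>] \<diamondop> X\<^sub>[\<^sub>2\<^sub>] \<otimes> Y) = X\<^sub>1 \<diamondop> X\<^sub>2 \<bullet> Y\<close>.  The cocycle identity produces the argument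
  \<open>X\<^sub>[\<^sub>1\<^sub>]\<^sub>- \<odot> X\<^sub>[\<^sub>2\<^sub>]\<^sub>1\<close> of \<open>\<Gamma>\<close>; replacing it by \<open>1\<close> leaves a factor \<open>\<tau>(\<epsilon>(Y\<^sub>1))\<close> in the first leg.  By the
  Takeuchi property this factor combines with \<open>Y\<^sub>2\<close> to \<open>Y\<close>.
\<close>

lemma lambda_twisted_form:
  assumes T: "T \<in> tw_cop X" and \<psi>: "diamond_bal \<psi>" "homogeneous sc (*) \<psi>"
  shows "lsum (*) (\<lambda>(x, y). sharp_pull \<psi> x (y \<otimes> Y)) T = D (\<lambda>x1 x2. \<psi> x1 (x2 \<bullet> Y)) X"
proof -
  note s = diamond_bal_simps[OF \<psi>(1)]
  define \<Phi> where "\<Phi> p w z = D (\<lambda>y1 y2. \<psi> (p \<star> \<tau> (\<Gamma> w y1)) (z \<bullet> y2)) Y" for p w z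
  have "sharp_pull \<psi> x (y \<otimes> Y) = sharp_pull3 \<Phi> x y" for x y
  proof -
    have "sharp_pull \<psi> x (y \<otimes> Y) = D (\<lambda>Y1 Y2. D (\<lambda>y1 y2. E (\<lambda>p m. \<psi> (p \<star> \<tau> (\<Gamma> (m \<odot> y1) Y1)) (y2 \<bullet> Y2)) x) y) Y"
      unfolding sharp_pull_def D_tprod[OF sharp_pull_bal(2)[OF \<psi>(1)]] cocycle_lprod ..
    also have "\<dots> = sharp_pull3 \<Phi> x y"
      unfolding sharp_pull3_def \<Phi>_def by (subst D_swap) (simp add: DE_swap)
    finally show ?thesis .
  qed
  then have "lsum (*) (\<lambda>(x, y). sharp_pull \<psi> x (y \<otimes> Y)) T = lsum (*) (\<lambda>(x, y). sharp_pull3 \<Phi> x y) T" by simp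
  also have "\<dots> = D (\<lambda>x y. \<Phi> x \<one> y) X"
  proof (rule lsum_twisted_cop_sharp_pull3[OF field_vs T])
    show "sharp_bal \<Phi>" by (rule sharp_balI) (simp_all add: \<Phi>_def s alg\<Gamma> rprod_add rprod_src D_fun_add)
  qed (simp add: homogeneous_def \<Phi>_def L.mult_scale_left hom_fun[OF \<psi>(2)] D_cmult)
  also have "\<dots> = D (\<lambda>y1 y2. D (\<lambda>x1 x2. \<psi> (x1 \<star> \<tau> (\<epsilon> y1)) (x2 \<bullet> y2)) X) Y"
    unfolding \<Phi>_def \<Gamma>_rules by (rule D_swap)
  also have "\<dots> = D (\<lambda>y1 y2. D (\<lambda>x1 x2. \<psi> x1 (x2 \<bullet> (\<sigma> (\<epsilon> y1) \<star> y2))) X) Y"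
  proof -
    have "diamond_bal (\<lambda>x y. \<psi> x (y \<bullet> z))" for z by (rule diamond_balI) (simp_all add: s rprod_add rprod_src)
    from D_tak[OF this] show ?thesis by (simp add: rprod_src)
  qed
  also have "\<dots> = D (\<lambda>x1 x2. \<psi> x1 (x2 \<bullet> D (\<lambda>y1 y2. \<sigma> (\<epsilon> y1) \<star> y2) Y)) X"
    by (subst D_swap) (simp only: D_additive[of "\<lambda>z. \<psi> x1 (x2 \<bullet> z)" for x1 x2] rprod_add s)
  finally show ?thesis by (simp add: counitL)
qed

lemma lambda_tw0_eq: "sharp0 (lambda_tw0 t) - lambda0 (theta0 t) \<in> diamond_null H"
proof (rule diamond_nullI)
  fix \<psi> :: "'l \<Rightarrow> 'l \<Rightarrow> 'k" assume \<psi>: "diamond_bal \<psi>" "homogeneous sc (*) \<psi>"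
  note s = diamond_bal_simps[OF \<psi>(1)]
  note otgt_bal = otgt_bal_lambda_pull[OF \<psi>(1)]
  have lamh: "lambda_pull \<psi> (sc c x) y = c * lambda_pull \<psi> x y" "lambda_pull \<psi> x (sc c y) = c * lambda_pull \<psi> x y" for c x y
    using otgt_bal_scale[OF otgt_bal, of c x y]
    by (simp_all add: lambda_pull_def D_scale[OF diamond_bal_mulr[OF \<psi>(1)]] hom_fun[OF \<psi>(2)] D_cmult)
  have "lsum (*) (\<lambda>(x, y). \<psi> x y) (lambda0 (theta0 t)) =
    lsum (*) (\<lambda>(X, Y). E (\<lambda>p m. E (\<lambda>q n. lambda_pull \<psi> p (q \<star> \<tau> (\<Gamma> n m))) Y) X) t"
  proof -
    have h: "homogeneous sc (*) (\<lambda>q n. lambda_pull \<psi> p (q \<star> \<tau> (\<Gamma> n m)))"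
        "homogeneous sc (*) (\<lambda>p m. E (\<lambda>q n. lambda_pull \<psi> p (q \<star> \<tau> (\<Gamma> n m))) Y)" for p m Y
      by (simp_all add: homogeneous_def L.mult_scale_left lamh E_cmult)
    show ?thesis
      unfolding lsum_lambda0[OF \<psi>] theta0_def lsum_lsum[OF field_vs]
      by (rule lsum_cong) (auto simp: lsum_lsum[OF field_vs] lsum_pure[OF field_vs] case_prod_unfold
        E_homogeneous[OF h(2), unfolded case_prod_unfold] E_homogeneous[OF h(1), unfolded case_prod_unfold])
  qed
  also have "\<dots> = lsum (*) (\<lambda>(X, Y). D (\<lambda>x1 x2. \<psi> x1 (x2 \<bullet> Y)) X) t"
  proof -
    have "E (\<lambda>p m. E (\<lambda>q n. lambda_pull \<psi> p (q \<star> \<tau> (\<Gamma> n m))) Y) X = D (\<lambda>x1 x2. \<psi> x1 (x2 \<bullet> Y)) X" for X Y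
    proof -
      have "D (\<lambda>x1 x2. \<psi> x1 (x2 \<bullet> Y)) X = D (\<lambda>x1 x2. E (\<lambda>p m. E (\<lambda>q n. \<psi> x1 (p \<star> (q \<star> \<tau> (\<Gamma> n m)))) Y) x2) X"
        unfolding rprod_def by (simp only: E_additive[of "\<psi> x1" for x1] s)
      also have "\<dots> = E (\<lambda>p m. D (\<lambda>x1 x2. E (\<lambda>q n. \<psi> x1 (x2 \<star> (q \<star> \<tau> (\<Gamma> n m)))) Y) p) X"
      proof (rule E_coassoc_plus)
        show "diamond_bal (\<lambda>x p. E (\<lambda>q n. \<psi> x (p \<star> (q \<star> \<tau> (\<Gamma> n m)))) Y)" for m
          by (rule diamond_balI) (simp_all add: s alg E_fun_add)
        have b: "otgt_bal (\<lambda>q n. \<psi> x (p \<star> (q \<star> \<tau> (\<Gamma> n m))))" for x p m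
          by (rule otgt_balI) (simp_all add: s alg\<Gamma>)
        show "otgt_bal (\<lambda>p m. E (\<lambda>q n. \<psi> x (p \<star> (q \<star> \<tau> (\<Gamma> n m)))) Y)" for x
        proof (rule otgt_balI)
          fix p r m
          show "E (\<lambda>q n. \<psi> x (p \<star> \<tau> r \<star> (q \<star> \<tau> (\<Gamma> n m)))) Y = E (\<lambda>q n. \<psi> x (p \<star> (q \<star> \<tau> (\<Gamma> n (\<tau> r \<star> m))))) Y"
            using E_tak[OF b[of x p m], of r Y] by (simp add: alg\<Gamma>)
        qed (simp_all add: s alg\<Gamma> E_fun_add)
      qed
      finally show ?thesis by (simp add: lambda_pull_def DE_swap)
    qed
    then show ?thesis by simp
  qed
  also have "\<dots> = lsum (*) (\<lambda>(x, y). \<psi> x y) (sharp0 (lambda_tw0 t))"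
    unfolding lsum_sharp0[OF field_vs \<psi>(2)] lambda_tw0_def lsum_lsum[OF field_vs]
    by (rule lsum_cong) (auto simp: lsum_legs[OF field_vs] lambda_twisted_form[OF rep_tw_cop \<psi>])
  finally show "lsum (*) (\<lambda>(x, y). \<psi> x y) (sharp0 (lambda_tw0 t) - lambda0 (theta0 t)) = 0"
    by (simp add: lsum_diff[OF field_vs])
qed

lemma left_hopf_twisted:
  assumes "induces_iso (otgt_null (twisted H \<Gamma>)) UNIV (otgt_null H) UNIV theta0"
  shows "left_hopf_algebroid (twisted H \<Gamma>)"
proof -
  have "bij_betw (\<lambda>c. coset tw_null (lambda_tw0 (rep c))) (tensor (otgt_null (twisted H \<Gamma>)) UNIV) (tensor tw_null UNIV)"
    by (rule galois_factorization[OF assms lambda0_iso])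
      (simp_all add: lambda0_def lambda_tw0_def lsum_linear[OF vector_space_fscale] otgt_null_twisted subspace_tensor_null
        lambda_tw0_eq[unfolded lambda0_def lambda_tw0_def])
  moreover have "hopf_lambda (twisted H \<Gamma>) = (\<lambda>c. coset tw_null (lambda_tw0 (rep c)))"
    by (simp add: fun_eq_iff hopf_lambda_def lambda_tw0_def twisted_simps diamond_null_twisted)
  ultimately show ?thesis
    by (simp add: left_hopf_algebroid_def left_bialgebroid_twisted diamond_null_twisted)
qed

definition mu0 :: "(('l \<times> 'l) \<Rightarrow>\<^sub>0 'k) \<Rightarrow> (('l \<times> 'l) \<Rightarrow>\<^sub>0 'k)" where
  "mu0 = lsum fscale (\<lambda>(X, Y). legs (\<lambda>X1. X1 \<star> Y) id (rep (cop H X)))"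

text \<open>
  The map \<open>\<Xi>\<close> with \<open>\<Gamma>\<^sup># \<circ> \<mu>\<^sup>\<Gamma> = \<mu> \<circ> \<Xi>\<close>.
\<close>

definition xi0 :: "(('l \<times> 'l) \<Rightarrow>\<^sub>0 'k) \<Rightarrow> (('l \<times> 'l) \<Rightarrow>\<^sub>0 'k)" where
  "xi0 = lsum fscale (\<lambda>(X, Y). lsum fscale (\<lambda>(x1, x2). lsum fscale (\<lambda>(y1, y2). pure (\<sigma> (\<Gamma> x1 y1) \<star> x2, y2))
     (rep (cop H Y))) (rep (cop H X)))"

definition mu_tw0 :: "(('l \<times> 'l) \<Rightarrow>\<^sub>0 'k) \<Rightarrow> (('l \<times> 'l) \<Rightarrow>\<^sub>0 'k)" where
  "mu_tw0 = lsum fscale (\<lambda>(X, Y). legs (\<lambda>X1. X1 \<otimes> Y) id (rep (tw_cop X)))"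

lemma lsum_mu0:
  assumes \<psi>: "diamond_bal \<psi>" "homogeneous sc (*) \<psi>"
  shows "lsum (*) (\<lambda>(x, y). \<psi> x y) (mu0 t) = lsum (*) (\<lambda>(X, Y). D (\<lambda>x y. \<psi> (x \<star> Y) y) X) t"
proof -
  have h: "homogeneous sc (*) (\<lambda>x y. \<psi> (x \<star> Y) y)" for Y
    using \<psi>(2) by (simp add: homogeneous_def L.mult_scale_left)
  show ?thesis
    unfolding mu0_def lsum_lsum[OF field_vs]
    by (rule lsum_cong) (auto simp: lsum_legs[OF field_vs] D_homogeneous[OF h])
qed

lemma mu0_null: "t \<in> osrc_null H \<Longrightarrow> mu0 t \<in> diamond_null H"
proof (rule diamond_nullI)
  fix \<psi> :: "'l \<Rightarrow> 'l \<Rightarrow> 'k" assume t: "t \<in> osrc_null H" and \<psi>: "diamond_bal \<psi>" "homogeneous sc (*) \<psi>"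
  note b = diamond_bal_l[OF \<psi>(1)]
  have h: "homogeneous sc (*) (\<lambda>X Y. D (\<lambda>x y. \<psi> (x \<star> Y) y) X)"
    by (simp add: homogeneous_def D_scale[OF b] L.mult_scale_left hom_fun[OF \<psi>(2)] D_cmult)
  have add: "\<psi> (x + x') = (\<lambda>y. \<psi> x y + \<psi> x' y)" for x x'
    by (simp add: fun_eq_iff diamond_bal_simps[OF \<psi>(1)])
  have "ev sc (\<lambda>X Y. D (\<lambda>x y. \<psi> (x \<star> Y) y) X) t = 0"
  proof (rule L.vs.ev_tensor_null[OF t[unfolded osrc_null_def]])
    show "balanced (\<lambda>X b. X \<star> \<sigma> b) (\<lambda>b X. \<sigma> b \<star> X) (\<lambda>X Y. D (\<lambda>x y. \<psi> (x \<star> Y) y) X)"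
      by (simp add: balanced_def biadditive_def D_rules[OF b] D_fun_add alg add)
  qed (simp_all add: L.mult_scale_right D_scale[OF b] L.mult_scale_left)
  then show "lsum (*) (\<lambda>(x, y). \<psi> x y) (mu0 t) = 0"
    unfolding lsum_mu0[OF \<psi>] by (simp add: ev_homogeneous[OF h])
qed

text \<open>
  \<open>\<Gamma>\<^sup>#(X\<^sub>[\<^sub>1\<^sub>] \<otimes> Y \<diamondop> X\<^sub>[\<^sub>2\<^sub>]) = X\<^sub>1 \<odot> Y \<diamondop> X\<^sub>2\<close>, where \<open>Y\<close> is recovered from
  \<open>Y\<^sub>+\<tau>(\<Gamma>(Y\<^sub>-, 1)) = Y\<close>.
\<close>

lemma mu_twisted_form:
  assumes T: "T \<in> tw_cop X" and \<psi>: "diamond_bal \<psi>" "homogeneous sc (*) \<psi>"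
  shows "lsum (*) (\<lambda>(x, y). sharp_pull \<psi> (x \<otimes> Y) y) T = D (\<lambda>x1 x2. \<psi> (x1 \<odot> Y) x2) X"
proof -
  note s = diamond_bal_simps[OF \<psi>(1)]
  define \<Phi> where "\<Phi> p w z = E (\<lambda>q n. \<psi> ((p \<odot> q) \<star> \<tau> (\<Gamma> n w)) z) Y" for p w z
  have otgt_bal: "otgt_bal (\<lambda>q n. \<psi> ((p \<odot> q) \<star> \<tau> (\<Gamma> n w)) z)" for p w z
    by (rule otgt_balI) (simp_all add: s lprod_rules alg\<Gamma>)
  have "sharp_pull \<psi> (x \<otimes> Y) y = sharp_pull3 \<Phi> x y" for x y
    unfolding sharp_pull_def E_tprod[OF sharp_pull_bal(1)[OF \<psi>(1)]] sharp_pull3_def \<Phi>_def cocycle_lprod ..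
  then have "lsum (*) (\<lambda>(x, y). sharp_pull \<psi> (x \<otimes> Y) y) T = lsum (*) (\<lambda>(x, y). sharp_pull3 \<Phi> x y) T" by simp
  also have "\<dots> = D (\<lambda>x y. \<Phi> x \<one> y) X"
  proof (rule lsum_twisted_cop_sharp_pull3[OF field_vs T])
    show "sharp_bal \<Phi>"
    proof (rule sharp_balI)
      fix p b w z
      show "\<Phi> (p \<star> \<tau> b) w z = \<Phi> p (\<tau> b \<star> w) z"
        using E_tak[OF otgt_bal[of p w z], of b Y] by (simp add: \<Phi>_def lprod_rules \<Gamma>_rules)
    qed (simp_all add: \<Phi>_def s lprod_rules alg\<Gamma> E_fun_add)
  qed (simp add: homogeneous_def \<Phi>_def lprod_scale L.mult_scale_left hom_fun[OF \<psi>(2)] E_cmult)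
  also have "\<dots> = D (\<lambda>x y. \<psi> (x \<odot> E (\<lambda>q n. q \<star> \<tau> (\<epsilon> n)) Y) y) X"
    unfolding \<Phi>_def by (simp only: E_additive[of "\<lambda>w. \<psi> (x \<odot> w) y" for x y] lprod_rules s \<Gamma>_rules)
  finally show ?thesis by (simp add: E_counit)
qed

lemma mu_tw0_eq: "sharp0 (mu_tw0 t) - mu0 (xi0 t) \<in> diamond_null H"
proof (rule diamond_nullI)
  fix \<psi> :: "'l \<Rightarrow> 'l \<Rightarrow> 'k" assume \<psi>: "diamond_bal \<psi>" "homogeneous sc (*) \<psi>"
  note s = diamond_bal_simps[OF \<psi>(1)]
  note b = diamond_bal_l[OF \<psi>(1)]
  have "lsum (*) (\<lambda>(x, y). \<psi> x y) (mu0 (xi0 t)) =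
    lsum (*) (\<lambda>(X, Y). D (\<lambda>x1 x2. D (\<lambda>y1 y2. D (\<lambda>x y. \<psi> (x \<star> y2) y) (\<sigma> (\<Gamma> x1 y1) \<star> x2)) Y) X) t"
  proof -
    have h: "homogeneous sc (*) (\<lambda>y1 y2. D (\<lambda>x y. \<psi> (x \<star> y2) y) (\<sigma> (\<Gamma> x1 y1) \<star> x2))"
        "homogeneous sc (*) (\<lambda>x1 x2. D (\<lambda>y1 y2. D (\<lambda>x y. \<psi> (x \<star> y2) y) (\<sigma> (\<Gamma> x1 y1) \<star> x2)) Y)" for x1 x2 Y
      by (simp_all add: homogeneous_def alg\<Gamma> D_scale[OF b] hom_fun[OF \<psi>(2)] D_cmult)
    show ?thesis
      unfolding lsum_mu0[OF \<psi>] xi0_def lsum_lsum[OF field_vs]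
      by (rule lsum_cong) (auto simp: lsum_lsum[OF field_vs] lsum_pure[OF field_vs] case_prod_unfold
        D_homogeneous[OF h(2), unfolded case_prod_unfold] D_homogeneous[OF h(1), unfolded case_prod_unfold])
  qed
  also have "\<dots> = lsum (*) (\<lambda>(X, Y). D (\<lambda>x1 x2. \<psi> (x1 \<odot> Y) x2) X) t"
  proof -
    have "D (\<lambda>x1 x2. D (\<lambda>y1 y2. D (\<lambda>x y. \<psi> (x \<star> y2) y) (\<sigma> (\<Gamma> x1 y1) \<star> x2)) Y) X = D (\<lambda>x1 x2. \<psi> (x1 \<odot> Y) x2) X" for X Y
    proof -
      have "D (\<lambda>x1 x2. D (\<lambda>y1 y2. D (\<lambda>x y. \<psi> (x \<star> y2) y) (\<sigma> (\<Gamma> x1 y1) \<star> x2)) Y) X =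
        D (\<lambda>x1 x2. D (\<lambda>x y. D (\<lambda>y1 y2. \<psi> (\<sigma> (\<Gamma> x1 y1) \<star> (x \<star> y2)) y) Y) x2) X"
        by (simp add: D_src[OF b] L.mult_assoc) (subst (2) D_swap, rule refl)
      also have "\<dots> = D (\<lambda>z y. D (\<lambda>x1 x. D (\<lambda>y1 y2. \<psi> (\<sigma> (\<Gamma> x1 y1) \<star> (x \<star> y2)) y) Y) z) X"
        by (rule D_coassoc[symmetric], unfold diamond_bal3_def, intro conjI allI; rule diamond_balI) (simp_all add: s alg\<Gamma> D_fun_add)
      also have "\<dots> = D (\<lambda>z y. \<psi> (z \<odot> Y) y) X"
      proof -
        have "D (\<lambda>x1 x. D (\<lambda>y1 y2. \<psi> (\<sigma> (\<Gamma> x1 y1) \<star> (x \<star> y2)) y) Y) z = \<psi> (z \<odot> Y) y" for z y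
          unfolding lprod_def D2_def by (subst D_swap) (simp only: D_additive[of "\<lambda>x. \<psi> x y"] s)
        then show ?thesis by simp
      qed
      finally show ?thesis .
    qed
    then show ?thesis by simp
  qed
  also have "\<dots> = lsum (*) (\<lambda>(x, y). \<psi> x y) (sharp0 (mu_tw0 t))"
    unfolding lsum_sharp0[OF field_vs \<psi>(2)] mu_tw0_def lsum_lsum[OF field_vs]
    by (rule lsum_cong) (auto simp: lsum_legs[OF field_vs] mu_twisted_form[OF rep_tw_cop \<psi>])
  finally show "lsum (*) (\<lambda>(x, y). \<psi> x y) (sharp0 (mu_tw0 t) - mu0 (xi0 t)) = 0"
    by (simp add: lsum_diff[OF field_vs])
qed

lemma anti_left_hopf_twisted:
  assumes xi: "induces_iso (osrc_null (twisted H \<Gamma>)) UNIV (osrc_null H) UNIV xi0" and "anti_left_hopf_algebroid H"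
  shows "anti_left_hopf_algebroid (twisted H \<Gamma>)"
proof -
  have lin: "Vector_Spaces.linear fscale fscale mu0" "Vector_Spaces.linear fscale fscale mu_tw0"
    unfolding mu0_def mu_tw0_def by (rule lsum_linear[OF vector_space_fscale])+
  have "hopf_mu H = (\<lambda>c. coset (diamond_null H) (mu0 (rep c)))"
    by (simp add: fun_eq_iff hopf_mu_def mu0_def)
  then have "induces_iso (osrc_null H) UNIV (diamond_null H) UNIV mu0"
    using assms(2) lin(1)
    by (subst bij_betw_tensor_iff[symmetric]) (simp_all add: anti_left_hopf_algebroid_def subspace_null mu0_null)
  then have "bij_betw (\<lambda>c. coset tw_null (mu_tw0 (rep c))) (tensor (osrc_null (twisted H \<Gamma>)) UNIV) (tensor tw_null UNIV)"
    by (rule galois_factorization[OF xi _ lin _ mu_tw0_eq]) (simp add: osrc_null_twisted subspace_tensor_null)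
  moreover have "hopf_mu (twisted H \<Gamma>) = (\<lambda>c. coset tw_null (mu_tw0 (rep c)))"
    by (simp add: fun_eq_iff hopf_mu_def mu_tw0_def twisted_simps diamond_null_twisted)
  ultimately show ?thesis
    by (simp add: anti_left_hopf_algebroid_def left_bialgebroid_twisted diamond_null_twisted)
qed

end

section \<open>Transport along an injective linear map\<close>

text \<open>
  Invertibility of the cocycle speaks of comodules carried by subspaces of an ambient space.  In
  order to apply it to \<open>L\<close> itself, comodule structures on \<open>L\<close> are transported to the range of an
  injective linear map \<open>f\<close>.
\<close>

lemma legs_tensor_null:
  assumes n: "n \<in> tensor_null sP P ra sQ Q la"
    and f: "\<And>p. p \<in> P \<Longrightarrow> f p \<in> P'" "\<And>p p'. p \<in> P \<Longrightarrow> p' \<in> P \<Longrightarrow> f (p + p') = f p + f p'"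
      "\<And>c p. p \<in> P \<Longrightarrow> f (sP c p) = sP' c (f p)" "\<And>p r. p \<in> P \<Longrightarrow> f (ra p r) = ra' (f p) r"
    and g: "\<And>p. p \<in> Q \<Longrightarrow> g p \<in> Q'" "\<And>p p'. p \<in> Q \<Longrightarrow> p' \<in> Q \<Longrightarrow> g (p + p') = g p + g p'"
      "\<And>c p. p \<in> Q \<Longrightarrow> g (sQ c p) = sQ' c (g p)" "\<And>p r. p \<in> Q \<Longrightarrow> g (la r p) = la' r (g p)"
  shows "legs f g n \<in> tensor_null sP' P' ra' sQ' Q' la'"
  using n unfolding tensor_null_def[of sP]
proof (induction rule: free.span_induct_alt)
  case base
  show ?case by (simp add: legs_def free.subspace_0[OF subspace_tensor_null])
next
  case (step c x y)
  have "legs f g x \<in> tensor_null sP' P' ra' sQ' Q' la'"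
    unfolding tensor_null_def
  proof (rule free.span_base, use step(1) in \<open>elim UnE\<close>, goal_cases)
    case 1
    then obtain p p' q where "x = pure (p + p', q) - pure (p, q) - pure (p', q)" "p \<in> P" "p' \<in> P" "q \<in> Q" by blast
    then have "legs f g x = pure (f p + f p', g q) - pure (f p, g q) - pure (f p', g q)" "f p \<in> P'" "f p' \<in> P'" "g q \<in> Q'"
      using f g by (auto simp: legs_diff)
    then show ?case by blast
  next
    case 2
    then obtain p q q' where "x = pure (p, q + q') - pure (p, q) - pure (p, q')" "p \<in> P" "q \<in> Q" "q' \<in> Q" by blast
    then have "legs f g x = pure (f p, g q + g q') - pure (f p, g q) - pure (f p, g q')" "f p \<in> P'" "g q \<in> Q'" "g q' \<in> Q'"
      using f g by (auto simp: legs_diff)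
    then show ?case by blast
  next
    case 3
    then obtain c p q where "x = pure (sP c p, q) - fscale c (pure (p, q))" "p \<in> P" "q \<in> Q" by blast
    then have "legs f g x = pure (sP' c (f p), g q) - fscale c (pure (f p, g q))" "f p \<in> P'" "g q \<in> Q'"
      using f g by (auto simp: legs_diff legs_fscale)
    then show ?case by blast
  next
    case 4
    then obtain c p q where "x = pure (p, sQ c q) - fscale c (pure (p, q))" "p \<in> P" "q \<in> Q" by blast
    then have "legs f g x = pure (f p, sQ' c (g q)) - fscale c (pure (f p, g q))" "f p \<in> P'" "g q \<in> Q'"
      using f g by (auto simp: legs_diff legs_fscale)
    then show ?case by blast
  next
    case 5
    then obtain p r q where "x = pure (ra p r, q) - pure (p, la r q)" "p \<in> P" "q \<in> Q" by blast
    then have "legs f g x = pure (ra' (f p) r, g q) - pure (f p, la' r (g q))" "f p \<in> P'" "g q \<in> Q'"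
      using f g by (auto simp: legs_diff)
    then show ?case by blast
  qed
  then show ?case
    using step(2) by (simp add: legs_add legs_fscale free.subspace_add[OF subspace_tensor_null] free.subspace_scale[OF subspace_tensor_null])
qed

lemma keys_legs: "Poly_Mapping.keys (legs f g t) \<subseteq> map_prod f g ` Poly_Mapping.keys t"
proof -
  have "Poly_Mapping.keys (fscale c (pure a)) \<subseteq> {a}" for c :: "'k::field" and a :: 'z
    by (auto simp: in_keys_iff lookup_single when_def split: if_splits)
  then show ?thesis
    unfolding legs_def lsum_def by (intro order_trans[OF keys_sum]) fastforce
qed

lemma legs_cong: "(\<And>x y. (x, y) \<in> Poly_Mapping.keys t \<Longrightarrow> f x = f' x \<and> g y = g' y) \<Longrightarrow> legs f g t = legs f' g' t"
  unfolding legs_def by (rule lsum_cong) auto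

lemma legs_inv:
  assumes "inj f" "inj g"
  shows "legs (inv f) (inv g) (legs f g t) = t"
  using legs_id[of t] by (simp add: legs_legs inv_f_f[OF assms(1)] inv_f_f[OF assms(2)] id_def)

lemma legs_onto:
  assumes "inj f" "inj g" "Poly_Mapping.keys t \<subseteq> f ` P \<times> g ` Q"
  shows "Poly_Mapping.keys (legs (inv f) (inv g) t) \<subseteq> P \<times> Q" "legs f g (legs (inv f) (inv g) t) = t"
proof -
  show "Poly_Mapping.keys (legs (inv f) (inv g) t) \<subseteq> P \<times> Q"
    using keys_legs[of "inv f" "inv g" t] assms by (fastforce simp: inv_f_f)
  have "legs f g (legs (inv f) (inv g) t) = legs id id t"
    unfolding legs_legs by (rule legs_cong) (use assms in \<open>auto simp: f_inv_into_f\<close>)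
  then show "legs f g (legs (inv f) (inv g) t) = t" by simp
qed

lemma legs_tensor_null_iff:
  assumes f: "Vector_Spaces.linear sP sP' f" "inj f" and g: "Vector_Spaces.linear sQ sQ' g" "inj g"
    and ra: "\<And>p r. p \<in> P \<Longrightarrow> ra' (f p) r = f (ra p r)" and la: "\<And>q r. q \<in> Q \<Longrightarrow> la' r (g q) = g (la r q)"
  shows "legs f g n \<in> tensor_null sP' (f ` P) ra' sQ' (g ` Q) la' \<longleftrightarrow> n \<in> tensor_null sP P ra sQ Q la"
proof
  interpret f: Vector_Spaces.linear sP sP' f by fact
  interpret g: Vector_Spaces.linear sQ sQ' g by fact
  {
    assume "n \<in> tensor_null sP P ra sQ Q la"
    then show "legs f g n \<in> tensor_null sP' (f ` P) ra' sQ' (g ` Q) la'"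
      by (rule legs_tensor_null) (auto simp: f.add f.scale g.add g.scale ra la)
  }
  assume "legs f g n \<in> tensor_null sP' (f ` P) ra' sQ' (g ` Q) la'"
  then have "legs (inv f) (inv g) (legs f g n) \<in> tensor_null sP P ra sQ Q la"
    by (rule legs_tensor_null)
      (auto simp: inv_f_f[OF f(2)] inv_f_f[OF g(2)] ra la simp flip: f.add f.scale g.add g.scale)
  then show "n \<in> tensor_null sP P ra sQ Q la" by (simp add: legs_inv f g)
qed

lemma left_module_image:
  assumes M: "left_module A sP UNIV act" and f: "Vector_Spaces.linear sP sU f"
    and act: "\<And>a m. act' a (f m) = f (act a m)"
  shows "left_module A sU (range f) act'"
proof -
  interpret f: Vector_Spaces.linear sP sU f by fact
  interpret M: left_module A sP UNIV act by fact
  show ?thesis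
    by (rule left_module.intro)
      (auto simp: act M.act_add_left M.act_add_right M.act_scale_left M.act_scale_right M.act_mult M.act_one
        intro: f.subspace_image M.subspace simp flip: f.add f.scale)
qed

text \<open>
  Exactness of a sequence of tensor products, as in the definition of faithful flatness, in terms of
  representatives.
\<close>

lemma exactness_iff:
  assumes Z: "module.subspace fscale Z1" "module.subspace fscale Z2" "module.subspace fscale Z3"
    and h: "Vector_Spaces.linear fscale fscale h" "\<And>n. n \<in> Z1 \<Longrightarrow> h n \<in> Z2"
    and g: "Vector_Spaces.linear fscale fscale g" "\<And>n. n \<in> Z2 \<Longrightarrow> g n \<in> Z3"
  shows "(\<lambda>c. coset Z2 (h (rep c))) ` tensor Z1 D1 = {c \<in> tensor Z2 D2. coset Z3 (g (rep c)) = coset Z3 0} \<longleftrightarrow>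
    (\<forall>t. Poly_Mapping.keys t \<subseteq> D1 \<longrightarrow> (\<exists>s. Poly_Mapping.keys s \<subseteq> D2 \<and> g s \<in> Z3 \<and> h t - s \<in> Z2)) \<and>
    (\<forall>s. Poly_Mapping.keys s \<subseteq> D2 \<longrightarrow> g s \<in> Z3 \<longrightarrow> (\<exists>t. Poly_Mapping.keys t \<subseteq> D1 \<and> h t - s \<in> Z2))"
proof -
  interpret h: Vector_Spaces.linear fscale fscale h by fact
  interpret g: Vector_Spaces.linear fscale fscale g by fact
  have rh: "coset Z2 (h (rep (coset Z1 t))) = coset Z2 (h t)" for t
    unfolding coset_eq_iff[OF Z(2)] h.diff[symmetric] by (intro h(2) rep_coset Z)
  have rg: "coset Z3 (g (rep (coset Z2 t))) = coset Z3 (g t)" for t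
    unfolding coset_eq_iff[OF Z(3)] g.diff[symmetric] by (intro g(2) rep_coset Z)
  have A: "(\<lambda>c. coset Z2 (h (rep c))) ` tensor Z1 D1 = {coset Z2 (h t) | t. Poly_Mapping.keys t \<subseteq> D1}"
    unfolding tensor_def image_image rh by blast
  have B: "{c \<in> tensor Z2 D2. coset Z3 (g (rep c)) = coset Z3 0} = {coset Z2 s | s. Poly_Mapping.keys s \<subseteq> D2 \<and> g s \<in> Z3}"
  proof -
    have "coset Z3 (g t) = coset Z3 0 \<longleftrightarrow> g t \<in> Z3" for t by (simp add: coset_eq_iff[OF Z(3)])
    then have "g (rep (coset Z2 t)) \<in> Z3 \<longleftrightarrow> g t \<in> Z3" for t using rg by metis
    then show ?thesis unfolding tensor_def by (auto simp: coset_eq_iff[OF Z(3)])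
  qed
  have C: "{coset Z2 (h t) | t. Poly_Mapping.keys t \<subseteq> D1} \<subseteq> {coset Z2 s | s. Poly_Mapping.keys s \<subseteq> D2 \<and> g s \<in> Z3} \<longleftrightarrow>
    (\<forall>t. Poly_Mapping.keys t \<subseteq> D1 \<longrightarrow> (\<exists>s. Poly_Mapping.keys s \<subseteq> D2 \<and> g s \<in> Z3 \<and> h t - s \<in> Z2))"
    unfolding coset_eq_iff[OF Z(2), symmetric] by blast
  have D: "{coset Z2 s | s. Poly_Mapping.keys s \<subseteq> D2 \<and> g s \<in> Z3} \<subseteq> {coset Z2 (h t) | t. Poly_Mapping.keys t \<subseteq> D1} \<longleftrightarrow>
    (\<forall>s. Poly_Mapping.keys s \<subseteq> D2 \<longrightarrow> g s \<in> Z3 \<longrightarrow> (\<exists>t. Poly_Mapping.keys t \<subseteq> D1 \<and> h t - s \<in> Z2))"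
  proof -
    have "(\<exists>t. Poly_Mapping.keys t \<subseteq> D1 \<and> h t - s \<in> Z2) \<longleftrightarrow> coset Z2 s \<in> {coset Z2 (h t) | t. Poly_Mapping.keys t \<subseteq> D1}" for s
      unfolding coset_eq_iff[OF Z(2), symmetric] by auto
    then show ?thesis by blast
  qed
  show ?thesis unfolding A B by (rule trans[OF set_eq_subset arg_cong2[where f = "(\<and>)", OF C D]])
qed

text \<open>
  The map \<open>legs f id\<close> is a bijection of formal tensors under which the relations correspond to each
  other (\<open>legs_tensor_null_iff\<close>), so it carries the condition of \<open>exactness_iff\<close> over.
\<close>

lemma faithfully_flat_right_image:
  fixes f :: "'p::ab_group_add \<Rightarrow> 'u::ab_group_add" and sU :: "'k::field \<Rightarrow> 'u \<Rightarrow> 'u"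
    and A :: "('k, 'a::ab_group_add) alg"
  assumes ff: "faithfully_flat_right sU A sP UNIV ra" and f: "Vector_Spaces.linear sP sU f" "inj f"
    and ra: "\<And>m a. ra' (f m) a = f (ra m a)"
  shows "faithfully_flat_right sU A sU (range f) ra'"
  unfolding faithfully_flat_right_def Let_def
proof (intro conjI[of "right_module _ _ _ _"] allI impI)
  show "right_module A sU (range f) ra'"
    using ff left_module_image[OF _ f(1), of _ "\<lambda>a m. ra m a" "\<lambda>a m. ra' m a"] ra
    by (auto simp: faithfully_flat_right_def right_module_def)
  interpret f: Vector_Spaces.linear sP sU f by fact
  fix N1 N2 N3 a1 a2 a3 h g
  assume asm: "left_module A sU N1 a1 \<and> left_module A sU N2 a2 \<and> left_module A sU N3 a3 \<and>
      module_map sU N1 a1 sU N2 a2 h \<and> module_map sU N2 a2 sU N3 a3 g"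
  then have N: "left_module A sU N1 a1" "left_module A sU N2 a2" "left_module A sU N3 a3"
    and h: "module_map sU N1 a1 sU N2 a2 h" and g: "module_map sU N2 a2 sU N3 a3 g" by auto
  have id: "Vector_Spaces.linear sU sU id" using f.vs2.linear_id by (simp add: id_def)
  have iff: "legs f id n \<in> tensor_null sU (range f) ra' sU N a \<longleftrightarrow> n \<in> tensor_null sP UNIV ra sU N a" for n N a
    using legs_tensor_null_iff[OF f id inj_on_id, of UNIV ra' ra N a a n] by (simp add: ra)
  have onto: "\<exists>s. Poly_Mapping.keys s \<subseteq> UNIV \<times> N \<and> t = legs f id s" if "Poly_Mapping.keys t \<subseteq> range f \<times> N" for t :: "('u \<times> 'u) \<Rightarrow>\<^sub>0 'k" and N
    using legs_onto[OF f(2) inj_on_id, of t UNIV N] that by (intro exI[of _ "legs (inv f) (inv id) t"]) simp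
  have keys: "Poly_Mapping.keys (legs f id s) \<subseteq> range f \<times> N" if "Poly_Mapping.keys s \<subseteq> UNIV \<times> N" for s :: "('p \<times> 'u) \<Rightarrow>\<^sub>0 'k" and N
    using keys_legs[of f id s] that by fastforce
  have comm: "legs id k (legs f id s) = legs f id (legs id k s)" for k and s :: "('p \<times> 'u) \<Rightarrow>\<^sub>0 'k"
    by (simp add: legs_legs)
  have wd: "n \<in> tensor_null sQ P r sU M b \<Longrightarrow> legs id k n \<in> tensor_null sQ P r sU M' b'"
    if "module_map sU M b sU M' b' k" for n and sQ :: "'k \<Rightarrow> 'z::ab_group_add \<Rightarrow> 'z" and P r k M M' b b'
    by (erule legs_tensor_null) (use that in \<open>auto simp: module_map_def\<close>)
  have ex: "((\<lambda>c. coset (tensor_null sQ P r sU N2 a2) (legs id h (rep c))) ` tensor (tensor_null sQ P r sU N1 a1) D1 =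
      {c \<in> tensor (tensor_null sQ P r sU N2 a2) D2. coset (tensor_null sQ P r sU N3 a3) (legs id g (rep c)) = coset (tensor_null sQ P r sU N3 a3) 0}) \<longleftrightarrow>
    (\<forall>t. Poly_Mapping.keys t \<subseteq> D1 \<longrightarrow> (\<exists>s. Poly_Mapping.keys s \<subseteq> D2 \<and>
        legs id g s \<in> tensor_null sQ P r sU N3 a3 \<and> legs id h t - s \<in> tensor_null sQ P r sU N2 a2)) \<and>
    (\<forall>s. Poly_Mapping.keys s \<subseteq> D2 \<longrightarrow> legs id g s \<in> tensor_null sQ P r sU N3 a3 \<longrightarrow>
        (\<exists>t. Poly_Mapping.keys t \<subseteq> D1 \<and> legs id h t - s \<in> tensor_null sQ P r sU N2 a2))"
    for sQ :: "'k \<Rightarrow> 'z::ab_group_add \<Rightarrow> 'z" and P and r :: "'z \<Rightarrow> 'a \<Rightarrow> 'z" and D1 D2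
    by (rule exactness_iff[OF subspace_tensor_null subspace_tensor_null subspace_tensor_null legs_linear _ legs_linear])
      (erule wd[OF h], erule wd[OF g])
  have "h ` N1 = {n \<in> N2. g n = 0} \<longleftrightarrow>
      (\<lambda>c. coset (tensor_null sP UNIV ra sU N2 a2) (legs id h (rep c))) ` tensor (tensor_null sP UNIV ra sU N1 a1) (UNIV \<times> N1) =
      {c \<in> tensor (tensor_null sP UNIV ra sU N2 a2) (UNIV \<times> N2).
        coset (tensor_null sP UNIV ra sU N3 a3) (legs id g (rep c)) = coset (tensor_null sP UNIV ra sU N3 a3) 0}"
    using ff N h g unfolding faithfully_flat_right_def Let_def by blast
  also have "\<dots> \<longleftrightarrow>
      (\<lambda>c. coset (tensor_null sU (range f) ra' sU N2 a2) (legs id h (rep c))) ` tensor (tensor_null sU (range f) ra' sU N1 a1) (range f \<times> N1) =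
      {c \<in> tensor (tensor_null sU (range f) ra' sU N2 a2) (range f \<times> N2).
        coset (tensor_null sU (range f) ra' sU N3 a3) (legs id g (rep c)) = coset (tensor_null sU (range f) ra' sU N3 a3) 0}"
    unfolding ex
  proof (rule arg_cong2[where f = "(\<and>)"]; intro iffI allI impI)
    fix t :: "('u \<times> 'u) \<Rightarrow>\<^sub>0 'k"
    assume *: "\<forall>t. Poly_Mapping.keys t \<subseteq> UNIV \<times> N1 \<longrightarrow> (\<exists>s. Poly_Mapping.keys s \<subseteq> UNIV \<times> N2 \<and>
        legs id g s \<in> tensor_null sP UNIV ra sU N3 a3 \<and> legs id h t - s \<in> tensor_null sP UNIV ra sU N2 a2)"
      and t: "Poly_Mapping.keys t \<subseteq> range f \<times> N1"
    obtain s where s: "Poly_Mapping.keys s \<subseteq> UNIV \<times> N1" "t = legs f id s" using onto[OF t] by blast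
    obtain u where "Poly_Mapping.keys u \<subseteq> UNIV \<times> N2" "legs id g u \<in> tensor_null sP UNIV ra sU N3 a3"
      "legs id h s - u \<in> tensor_null sP UNIV ra sU N2 a2" using * s(1) by blast
    then show "\<exists>s. Poly_Mapping.keys s \<subseteq> range f \<times> N2 \<and>
        legs id g s \<in> tensor_null sU (range f) ra' sU N3 a3 \<and> legs id h t - s \<in> tensor_null sU (range f) ra' sU N2 a2"
      by (intro exI[of _ "legs f id u"]) (simp add: keys s comm iff flip: legs_diff)
  next
    fix t :: "('p \<times> 'u) \<Rightarrow>\<^sub>0 'k"
    assume *: "\<forall>t. Poly_Mapping.keys t \<subseteq> range f \<times> N1 \<longrightarrow> (\<exists>s. Poly_Mapping.keys s \<subseteq> range f \<times> N2 \<and>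
        legs id g s \<in> tensor_null sU (range f) ra' sU N3 a3 \<and> legs id h t - s \<in> tensor_null sU (range f) ra' sU N2 a2)"
      and t: "Poly_Mapping.keys t \<subseteq> UNIV \<times> N1"
    obtain s where s: "Poly_Mapping.keys s \<subseteq> range f \<times> N2" "legs id g s \<in> tensor_null sU (range f) ra' sU N3 a3"
      "legs id h (legs f id t) - s \<in> tensor_null sU (range f) ra' sU N2 a2" using * keys[OF t] by blast
    obtain u where "Poly_Mapping.keys u \<subseteq> UNIV \<times> N2" "s = legs f id u" using onto[OF s(1)] by blast
    with s show "\<exists>s. Poly_Mapping.keys s \<subseteq> UNIV \<times> N2 \<and>
        legs id g s \<in> tensor_null sP UNIV ra sU N3 a3 \<and> legs id h t - s \<in> tensor_null sP UNIV ra sU N2 a2"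
      by (intro exI[of _ u]) (simp add: comm iff flip: legs_diff)
  next
    fix s :: "('u \<times> 'u) \<Rightarrow>\<^sub>0 'k"
    assume *: "\<forall>s. Poly_Mapping.keys s \<subseteq> UNIV \<times> N2 \<longrightarrow> legs id g s \<in> tensor_null sP UNIV ra sU N3 a3 \<longrightarrow>
        (\<exists>t. Poly_Mapping.keys t \<subseteq> UNIV \<times> N1 \<and> legs id h t - s \<in> tensor_null sP UNIV ra sU N2 a2)"
      and s: "Poly_Mapping.keys s \<subseteq> range f \<times> N2" "legs id g s \<in> tensor_null sU (range f) ra' sU N3 a3"
    obtain u where u: "Poly_Mapping.keys u \<subseteq> UNIV \<times> N2" "s = legs f id u" using onto[OF s(1)] by blast
    then have "legs id g u \<in> tensor_null sP UNIV ra sU N3 a3" using s(2) by (simp add: comm iff)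
    with * u(1) obtain t where "Poly_Mapping.keys t \<subseteq> UNIV \<times> N1" "legs id h t - u \<in> tensor_null sP UNIV ra sU N2 a2"
      by blast
    then show "\<exists>t. Poly_Mapping.keys t \<subseteq> range f \<times> N1 \<and> legs id h t - s \<in> tensor_null sU (range f) ra' sU N2 a2"
      by (intro exI[of _ "legs f id t"]) (simp add: keys u comm iff flip: legs_diff)
  next
    fix s :: "('p \<times> 'u) \<Rightarrow>\<^sub>0 'k"
    assume *: "\<forall>s. Poly_Mapping.keys s \<subseteq> range f \<times> N2 \<longrightarrow> legs id g s \<in> tensor_null sU (range f) ra' sU N3 a3 \<longrightarrow>
        (\<exists>t. Poly_Mapping.keys t \<subseteq> range f \<times> N1 \<and> legs id h t - s \<in> tensor_null sU (range f) ra' sU N2 a2)"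
      and s: "Poly_Mapping.keys s \<subseteq> UNIV \<times> N2" "legs id g s \<in> tensor_null sP UNIV ra sU N3 a3"
    have "legs id g (legs f id s) \<in> tensor_null sU (range f) ra' sU N3 a3" using s(2) by (simp add: comm iff)
    then obtain t where t: "Poly_Mapping.keys t \<subseteq> range f \<times> N1" "legs id h t - legs f id s \<in> tensor_null sU (range f) ra' sU N2 a2"
      using * keys[OF s(1)] by blast
    obtain u where "Poly_Mapping.keys u \<subseteq> UNIV \<times> N1" "t = legs f id u" using onto[OF t(1)] by blast
    with t show "\<exists>t. Poly_Mapping.keys t \<subseteq> UNIV \<times> N1 \<and> legs id h t - s \<in> tensor_null sP UNIV ra sU N2 a2"
      by (intro exI[of _ u]) (simp add: comm iff flip: legs_diff)
  qed
  finally show "h ` N1 = {n \<in> N2. g n = 0} \<longleftrightarrow>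
      (\<lambda>c. coset (tensor_null sU (range f) ra' sU N2 a2) (legs id h (rep c))) ` tensor (tensor_null sU (range f) ra' sU N1 a1) (range f \<times> N1) =
      {c \<in> tensor (tensor_null sU (range f) ra' sU N2 a2) (range f \<times> N2).
        coset (tensor_null sU (range f) ra' sU N3 a3) (legs id g (rep c)) = coset (tensor_null sU (range f) ra' sU N3 a3) 0}" .
qed

definition push :: "('l \<Rightarrow> 'u) \<Rightarrow> ('k::field, 'b, 'l, 'l) comodule \<Rightarrow> ('k, 'b, 'l, 'u) comodule" where
  "push f M = \<lparr>carr = range f, lact = \<lambda>b u. f (lact M b (inv f u)), ract = \<lambda>u b. f (ract M (inv f u) b),
     coact = \<lambda>u. legs id f ` coact M (inv f u)\<rparr>"

context left_bialgebroid begin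

lemma push_simps:
  assumes "inj f"
  shows "carr (push f M) = range f" "lact (push f M) b (f m) = f (lact M b m)" "ract (push f M) (f m) b = f (ract M m b)"
    "coact (push f M) (f m) = legs id f ` coact M m"
  by (simp_all add: push_def inv_f_f[OF assms])

lemma left_comodule_push:
  fixes f :: "'l \<Rightarrow> 'u::ab_group_add" and sU :: "'k \<Rightarrow> 'u \<Rightarrow> 'u"
  assumes M: "left_comodule sc H M" and carr: "carr M = UNIV" and f: "Vector_Spaces.linear sc sU f" "inj f"
  shows "left_comodule sU H (push f M)"
proof -
  interpret M: left_comodule sc H M by fact
  interpret f: Vector_Spaces.linear sc sU f by fact
  have V: "vector_space sU" by unfold_locales
  note p = push_simps[OF f(2), of M]
  have id: "Vector_Spaces.linear sc sc id" using L.vs.linear_id by (simp add: id_def)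
  have cn: "legs id f n \<in> codiamond_null sU H (push f M) \<longleftrightarrow> n \<in> codiamond_null sc H M" for n
    using legs_tensor_null_iff[OF id inj_on_id f, of UNIV "\<lambda>X b. \<tau> b \<star> X" "\<lambda>X b. \<tau> b \<star> X" UNIV "lact (push f M)" "lact M" n]
    by (simp add: codiamond_null_def p carr)
  have sub: "module.subspace fscale (codiamond_null sU H (push f M))" "module.subspace fscale (codiamond_null sc H M)"
    by (simp_all add: codiamond_null_def subspace_tensor_null)
  have ten: "coact (push f M) (f m) \<in> tensor (codiamond_null sU H (push f M)) (UNIV \<times> range f)" for m
  proof -
    obtain t where t: "coact M m = coset (codiamond_null sc H M) t"
      using M.coact_diamond[of m] by (auto simp: tensor_def carr)
    have "legs id f ` coset (codiamond_null sc H M) t = coset (codiamond_null sU H (push f M)) (legs id f t)"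
    proof (intro equalityI subsetI)
      fix u assume "u \<in> coset (codiamond_null sU H (push f M)) (legs id f t)"
      then have u: "u - legs id f t \<in> codiamond_null sU H (push f M)" by (simp add: coset_def)
      moreover have "legs id (inv f) n \<in> codiamond_null sc H M" if "n \<in> codiamond_null sU H (push f M)" for n
        using that unfolding codiamond_null_def p carr
        by (rule legs_tensor_null) (auto simp: inv_f_f[OF f(2)] p simp flip: f.add f.scale)
      moreover have keys_null: "legs id f (legs id (inv f) n) = n" if "n \<in> codiamond_null sU H (push f M)" for n
        using that unfolding codiamond_null_def tensor_null_def
      proof (induction rule: free.span_induct_alt)
        case (step c x y)
        have "legs id f (legs id (inv f) x) = x"
          using step(1)
          by (auto simp: p legs_diff legs_fscale inv_f_f[OF f(2)] simp flip: f.add f.scale)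
        with step(2) show ?case by (simp only: legs_add legs_fscale)
      qed (simp add: legs_def)
      ultimately have "u - legs id f t = legs id f (legs id (inv f) (u - legs id f t))"
         "legs id (inv f) (u - legs id f t) \<in> codiamond_null sc H M" by auto
      then show "u \<in> legs id f ` coset (codiamond_null sc H M) t"
        by (intro image_eqI[of _ _ "t + legs id (inv f) (u - legs id f t)"]) (auto simp: legs_add coset_def)
    qed (auto simp: coset_def cn simp flip: legs_diff)
    moreover have "Poly_Mapping.keys (legs id f t) \<subseteq> UNIV \<times> range f"
      using keys_legs[of id f t] by fastforce
    ultimately show ?thesis by (auto simp: p t tensor_def)
  qed
  show ?thesis
  proof (rule left_comodule.intro, goal_cases)
    case 1 show ?case using left_module_image[OF _ f(1), of "base H" "lact M" "lact (push f M)"] M.left by (simp add: p carr)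
  next
    case 2 show ?case
      using left_module_image[OF _ f(1), of "opposite (base H)" "\<lambda>b m. ract M m b" "\<lambda>b m. ract (push f M) m b"] M.right
      by (simp add: p carr right_module_def)
  next
    case (3 m a b) then show ?case using M.bimodule by (auto simp: p carr)
  next
    case (4 m) then show ?case using ten by (auto simp: p)
  next
    case (5 m n T T') then show ?case by (auto simp: p carr M.coact_add simp flip: f.add legs_add)
  next
    case (6 m T c) then show ?case by (auto simp: p carr M.coact_scale simp flip: f.scale legs_fscale)
  next
    case (7 m T b)
    then obtain x r where r: "m = f x" "r \<in> coact M x" "T = legs id f r" by (auto simp: p)
    have eq1: "legs id (\<lambda>n. ract (push f M) n b) (legs id f r) = legs id f (legs id (\<lambda>n. ract M n b) r)" for r
      by (simp add: legs_legs p)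
    have eq2: "legs (\<lambda>X. X \<star> \<tau> b) id (legs id f r) = legs id f (legs (\<lambda>X. X \<star> \<tau> b) id r)" for r
      by (simp add: legs_legs)
    have "legs (\<lambda>X. X \<star> \<tau> b) id r - legs id (\<lambda>n. ract M n b) r \<in> codiamond_null sc H M"
      using M.coact_takeuchi[of x r b] r(2) by (simp add: coset_eq_iff[OF sub(2)] carr)
    then show ?case
      unfolding coset_eq_iff[OF sub(1)] r(3) eq1 eq2 legs_diff[symmetric] cn .
  next
    case (8 m T)
    then obtain x r where r: "m = f x" "r \<in> coact M x" "T = legs id f r" by (auto simp: p)
    let ?N = "tensor_null3 UNIV (carr M) (diamond_null H) (codiamond_null sc H M)"
    let ?N' = "tensor_null3 UNIV (carr (push f M)) (diamond_null H) (codiamond_null sU H (push f M))"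
    \<comment> \<open>\<open>F3\<close> applies \<open>f\<close> to the third leg.\<close>
    define F3 where "F3 = lsum fscale (\<lambda>(x, y, n). pure (x, y, f n) :: ('l \<times> 'l \<times> 'u) \<Rightarrow>\<^sub>0 'k)"
    interpret F3: Vector_Spaces.linear fscale fscale F3
      unfolding F3_def by (rule lsum_linear[OF vector_space_fscale])
    note fl = lsum_lsum[OF vector_space_fscale] lsum_pure[OF vector_space_fscale] lsum_legs[OF vector_space_fscale]
    have F3: "F3 n \<in> ?N'" if "n \<in> ?N" for n
      using that unfolding tensor_null3_def[of _ "carr M"]
    proof (induction rule: free.span_induct_alt)
      case base show ?case by (simp add: free.subspace_0[OF subspace_tensor_null3])
    next
      case (step c u v)
      have "F3 u \<in> ?N'"
        unfolding tensor_null3_def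
      proof (rule free.span_base, use step(1) in \<open>elim UnE\<close>, goal_cases)
        case 1
        then obtain n z where nz: "u = lsum fscale (\<lambda>(p, q). pure (p, q, z)) n" "n \<in> diamond_null H" by blast
        have "F3 u = lsum fscale (\<lambda>(p, q). pure (p, q, f z)) n"
          unfolding nz F3_def by (simp add: fl case_prod_unfold)
        with nz(2) show ?case by (intro UnI1) (auto simp: p)
      next
        case 2
        then obtain n z where nz: "u = lsum fscale (\<lambda>(q, r). pure (z, q, r)) n" "n \<in> codiamond_null sc H M" by blast
        have "F3 u = lsum fscale (\<lambda>(q, r). pure (z, q, r)) (legs id f n)"
          unfolding nz F3_def by (simp add: fl case_prod_unfold)
        moreover have "legs id f n \<in> codiamond_null sU H (push f M)" using nz(2) by (simp add: cn)
        ultimately show ?case by (intro UnI2) auto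
      qed
      then show ?case
        using step(2) by (simp add: F3.add F3.scale free.subspace_add[OF subspace_tensor_null3] free.subspace_scale[OF subspace_tensor_null3])
    qed
    \<comment> \<open>The representatives chosen for the pushed coaction need not be the images of those chosen for \<open>M\<close>; \<open>\<rho>\<close> lifts them, and the lifts differ from \<open>rep\<close> by relations.\<close>
    define \<rho> where "\<rho> n = (SOME s. s \<in> coact M n \<and> rep (coact (push f M) (f n)) = legs id f s)" for n
    have \<rho>: "\<rho> n \<in> coact M n" "rep (coact (push f M) (f n)) = legs id f (\<rho> n)" for n
    proof -
      have "\<exists>s. s \<in> coact M n \<and> rep (coact (push f M) (f n)) = legs id f s"
        using coset_rep(2)[OF sub(1) ten[of n]] by (auto simp: p)
      from someI_ex[OF this] show "\<rho> n \<in> coact M n" "rep (coact (push f M) (f n)) = legs id f (\<rho> n)"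
        by (simp_all add: \<rho>_def)
    qed
    let ?A = "lsum fscale (\<lambda>(x, n). lsum fscale (\<lambda>(x1, x2). pure (x1, x2, n)) (rep (cop H x))) r"
    let ?B = "lsum fscale (\<lambda>(x, n). lsum fscale (\<lambda>(y, n'). pure (x, y, n')) (rep (coact M n))) r"
    let ?C = "lsum fscale (\<lambda>(x, n). lsum fscale (\<lambda>(y, n'). pure (x, y, n')) (\<rho> n)) r"
    have "?A - ?B \<in> ?N"
      using M.coact_coassociative[of x r] r(2) by (simp add: Let_def coset_eq_iff[OF subspace_tensor_null3] carr)
    moreover have "?B - ?C \<in> ?N"
    proof -
      have "?B - ?C = lsum fscale (\<lambda>(x, n). lsum fscale (\<lambda>(y, n'). pure (x, y, n')) (rep (coact M n) - \<rho> n)) r"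
        by (simp add: lsum_diff[OF vector_space_fscale] case_prod_unfold lsum_fun_diff[OF vector_space_fscale])
      also have "\<dots> \<in> ?N"
      proof (rule lsum_in_subspace[OF subspace_tensor_null3], clarify)
        fix x n
        have "coact M n = coset (codiamond_null sc H M) (\<rho> n)"
          by (rule coset_mem_eq[OF sub(2) M.coact_diamond \<rho>(1)]) (simp add: carr)
        then have "rep (coact M n) - \<rho> n \<in> codiamond_null sc H M" using rep_coset[OF sub(2)] by simp
        then show "lsum fscale (\<lambda>(y, n'). pure (x, y, n')) (rep (coact M n) - \<rho> n) \<in> ?N"
          unfolding tensor_null3_def by (intro free.span_base UnI2) blast
      qed
      finally show ?thesis .
    qed
    ultimately have "?A - ?C \<in> ?N"
      using free.subspace_add[OF subspace_tensor_null3] by fastforce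
    from F3[OF this] have "F3 ?A - F3 ?C \<in> ?N'" by (simp add: F3.diff)
    moreover have "F3 ?A = lsum fscale (\<lambda>(x, n). lsum fscale (\<lambda>(x1, x2). pure (x1, x2, n)) (rep (cop H x))) T"
      unfolding F3_def r(3) by (simp add: fl case_prod_unfold)
    moreover have "F3 ?C = lsum fscale (\<lambda>(x, n). lsum fscale (\<lambda>(y, n'). pure (x, y, n')) (rep (coact (push f M) n))) T"
      unfolding F3_def r(3) by (simp add: fl case_prod_unfold \<rho>(2))
    ultimately show ?case by (simp add: Let_def coset_eq_iff[OF subspace_tensor_null3])
  next
    case (9 m T)
    then obtain x r where "m = f x" "r \<in> coact M x" "T = legs id f r" by (auto simp: p)
    then show ?case
      using M.coact_counit[of x r] linear_lsum[OF f(1), of "\<lambda>(x, n). lact M (\<epsilon> x) n" r]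
      by (simp add: lsum_legs[OF V] p carr case_prod_unfold)
  next
    case (10 m T a b)
    then obtain x r where "m = f x" "r \<in> coact M x" "T = legs id f r" by (auto simp: p)
    then show ?case
      using M.coact_bimodule[of x r a b] by (auto simp: legs_legs p carr intro!: image_eqI[rotated])
  qed
qed

lemma faithfully_flat_comodule_push:
  assumes M: "left_comodule sc H M" and carr: "carr M = UNIV" and f: "Vector_Spaces.linear sc sU f" "inj f"
    and l: "faithfully_flat_left sU (base H) sc UNIV (lact M)" and r: "faithfully_flat_right sU (base H) sc UNIV (ract M)"
  shows "faithfully_flat_comodule sU H (push f M)"
  unfolding faithfully_flat_comodule_def
  using left_comodule_push[OF M carr f]
    faithfully_flat_right_image[OF r f, of "ract (push f M)"]
    faithfully_flat_right_image[OF l[unfolded faithfully_flat_left_def] f, of "\<lambda>m b. lact (push f M) b m"]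
  by (simp add: push_simps[OF f(2)] faithfully_flat_left_def)

text \<open>
  The actions \<open>rM\<close> and \<open>lN\<close> stand for the twisted actions, and \<open>g\<close> for \<open>\<Gamma>\<^sup>#\<close>, in a form that suits the
  application.  The choice of representatives for the pushed coactions is unknown, which is why
  \<open>rM\<close>, \<open>lN\<close> and \<open>g\<close> are required to be correct for every choice.
\<close>

lemma gamma_sharp_push:
  fixes f :: "'l \<Rightarrow> 'u::ab_group_add" and sU :: "'k \<Rightarrow> 'u \<Rightarrow> 'u"
  assumes M: "left_comodule sc H M" "carr M = UNIV" and N: "left_comodule sc H N" "carr N = UNIV"
    and f: "Vector_Spaces.linear sc sU f" "inj f"
    and bij: "bij_betw (gamma_sharp sU H \<Gamma> (push f M) (push f N))
          (tensor (twisted_comod_null sU H \<Gamma> (push f M) (push f N)) (range f \<times> range f))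
          (tensor (comod_null sU (push f M) (push f N)) (range f \<times> range f))"
    and rM: "\<And>m \<rho> a. \<rho> \<in> coact M m \<Longrightarrow> lsum sc (\<lambda>(x, n). lact M (\<Gamma> x (\<sigma> a)) n) \<rho> = rM m a"
    and lN: "\<And>m \<rho> a. \<rho> \<in> coact N m \<Longrightarrow> lsum sc (\<lambda>(x, n). lact N (\<Gamma> (\<sigma> a) x) n) \<rho> = lN a m"
    and g: "Vector_Spaces.linear fscale fscale g" "\<And>t. t \<in> tensor_null sc UNIV rM sc UNIV lN \<Longrightarrow> g t \<in> comod_null sc M N"
    and eq: "\<And>\<rho>M \<rho>N t. (\<And>m. \<rho>M m \<in> coact M m) \<Longrightarrow> (\<And>n. \<rho>N n \<in> coact N n) \<Longrightarrow>
       lsum fscale (\<lambda>(m, n). lsum fscale (\<lambda>(x, m0). lsum fscale (\<lambda>(y, n0). pure (lact M (\<Gamma> x y) m0, n0)) (\<rho>N n)) (\<rho>M m)) t - g t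
       \<in> comod_null sc M N"
  shows "induces_iso (tensor_null sc UNIV rM sc UNIV lN) UNIV (comod_null sc M N) UNIV g"
proof -
  interpret f: Vector_Spaces.linear sc sU f by fact
  have V: "vector_space sU" by unfold_locales
  note fl = lsum_lsum[OF vector_space_fscale] lsum_pure[OF vector_space_fscale] lsum_legs[OF vector_space_fscale]
  have ex: "\<exists>\<rho>. \<forall>n. \<rho> n \<in> coact M n \<and> rep (coact (push f M) (f n)) = legs id f (\<rho> n)"
    if M: "left_comodule sc H M" "carr M = UNIV" for M
  proof -
    interpret P: left_comodule sU H "push f M" by (rule left_comodule_push[OF that f])
    have "\<exists>s. s \<in> coact M n \<and> rep (coact (push f M) (f n)) = legs id f s" for n
      using coset_rep(2)[OF subspace_tensor_null P.coact_diamond[unfolded codiamond_null_def], of "f n"]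
      by (auto simp: push_simps[OF f(2)])
    then show ?thesis by metis
  qed
  obtain \<rho>M where \<rho>M: "\<And>n. \<rho>M n \<in> coact M n" "\<And>n. rep (coact (push f M) (f n)) = legs id f (\<rho>M n)"
    using ex[OF M] by blast
  obtain \<rho>N where \<rho>N: "\<And>n. \<rho>N n \<in> coact N n" "\<And>n. rep (coact (push f N) (f n)) = legs id f (\<rho>N n)"
    using ex[OF N] by blast
  note p = push_simps[OF f(2)]
  let ?N1 = "tensor_null sc UNIV rM sc UNIV lN" and ?N1' = "twisted_comod_null sU H \<Gamma> (push f M) (push f N)"
  let ?N2 = "comod_null sc M N" and ?N2' = "comod_null sU (push f M) (push f N)"
  have sub: "module.subspace fscale ?N1'" "module.subspace fscale ?N2'" "module.subspace fscale ?N2"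
    by (simp_all add: twisted_comod_null_def comod_null_def subspace_tensor_null)
  have tr: "twisted_ract sU H \<Gamma> (push f M) (f m) a = f (rM m a)" for m a
    using linear_lsum[OF f(1), of "\<lambda>(x, n). lact M (\<Gamma> x (\<sigma> a)) n" "\<rho>M m"] rM[OF \<rho>M(1)]
    unfolding twisted_ract_def \<rho>M(2) by (simp add: lsum_legs[OF V] p case_prod_unfold)
  have tl: "twisted_lact sU H \<Gamma> (push f N) a (f m) = f (lN a m)" for m a
    using linear_lsum[OF f(1), of "\<lambda>(x, n). lact N (\<Gamma> (\<sigma> a) x) n" "\<rho>N m"] lN[OF \<rho>N(1)]
    unfolding twisted_lact_def \<rho>N(2) by (simp add: lsum_legs[OF V] p case_prod_unfold)
  have n1: "legs f f n \<in> ?N1' \<longleftrightarrow> n \<in> ?N1" for n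
    using legs_tensor_null_iff[OF f f, of UNIV "twisted_ract sU H \<Gamma> (push f M)" rM UNIV "twisted_lact sU H \<Gamma> (push f N)" lN n]
    by (simp add: twisted_comod_null_def p tr tl)
  have n2: "legs f f n \<in> ?N2' \<longleftrightarrow> n \<in> ?N2" for n
    using legs_tensor_null_iff[OF f f, of UNIV "ract (push f M)" "ract M" UNIV "lact (push f N)" "lact N" n]
    by (simp add: comod_null_def p M(2) N(2))
  define g' where "g' = lsum fscale (\<lambda>(m, n).
        lsum fscale (\<lambda>(x, m0). lsum fscale (\<lambda>(y, n0). pure (lact (push f M) (\<Gamma> x y) m0, n0))
            (rep (coact (push f N) n))) (rep (coact (push f M) m)))"
  define g1 where "g1 = lsum fscale (\<lambda>(m, n). lsum fscale (\<lambda>(x, m0). lsum fscale (\<lambda>(y, n0). pure (lact M (\<Gamma> x y) m0, n0)) (\<rho>N n)) (\<rho>M m))"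
  interpret g: Vector_Spaces.linear fscale fscale g by fact
  have g'g1: "g' (legs f f t) = legs f f (g1 t)" for t
    unfolding g'_def g1_def
    by (simp add: linear_lsum[OF legs_linear] fl case_prod_unfold \<rho>M(2) \<rho>N(2) p(1-3))
  have g1g: "g1 t - g t \<in> ?N2" for t unfolding g1_def by (rule eq[OF \<rho>M(1) \<rho>N(1)])
  have g1iff: "g1 t \<in> ?N2 \<longleftrightarrow> g t \<in> ?N2" for t
    using free.subspace_add[OF sub(3) g1g[of t], of "g t"] free.subspace_diff[OF sub(3) _ g1g[of t], of "g1 t"] by auto
  have keys: "Poly_Mapping.keys (legs f f t) \<subseteq> range f \<times> range f" for t :: "('l \<times> 'l) \<Rightarrow>\<^sub>0 'k"
    using keys_legs[of f f t] by fastforce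
  have onto: "\<exists>s. t = legs f f s" if "Poly_Mapping.keys t \<subseteq> range f \<times> range f" for t :: "('u \<times> 'u) \<Rightarrow>\<^sub>0 'k"
    using legs_onto(2)[OF f(2) f(2) that] by metis
  have null_onto: "\<exists>s. t = legs f f s" if "t \<in> ?N1'" for t
    using that unfolding twisted_comod_null_def tensor_null_def p
  proof (induction rule: free.span_induct_alt)
    case base show ?case by (rule exI[of _ 0]) (simp add: legs_def)
  next
    case (step c x y)
    have "\<exists>s. x = legs f f s"
    proof -
      have "legs f f (legs (inv f) (inv f) x) = x"
        using step(1) by (auto simp: tr tl legs_diff legs_fscale inv_f_f[OF f(2)] simp flip: f.add f.scale)
      then show ?thesis by metis
    qed
    then show ?case using step(2) by (auto simp flip: legs_add legs_fscale)
  qed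
  have "gamma_sharp sU H \<Gamma> (push f M) (push f N) = (\<lambda>c. coset ?N2' (g' (rep c)))"
    by (simp add: fun_eq_iff gamma_sharp_def g'_def)
  then have "induces_iso ?N1' (range f \<times> range f) ?N2' (range f \<times> range f) g'"
  proof (subst bij_betw_tensor_iff[OF sub(2,1), symmetric])
    show "Vector_Spaces.linear fscale fscale g'" unfolding g'_def by (rule lsum_linear[OF vector_space_fscale])
    show "g' t \<in> ?N2'" if t: "t \<in> ?N1'" for t
    proof -
      obtain s where s: "t = legs f f s" using null_onto[OF t] by blast
      with t have "g s \<in> ?N2" by (intro g(2)) (simp add: n1)
      then show ?thesis by (simp add: s g'g1 n2 g1iff)
    qed
    show "coset ?N2' (g' t) \<in> tensor ?N2' (range f \<times> range f)" if "Poly_Mapping.keys t \<subseteq> range f \<times> range f" for t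
      using onto[OF that] keys by (auto simp: g'g1 tensor_def)
  qed (use bij in simp)
  then have iso: "\<And>t. g' (legs f f t) \<in> ?N2' \<longleftrightarrow> legs f f t \<in> ?N1'"
     "\<And>u. \<exists>t. Poly_Mapping.keys t \<subseteq> range f \<times> range f \<and> g' t - legs f f u \<in> ?N2'"
    using keys by (auto simp: induces_iso_def)
  have "\<exists>t. g t - u \<in> ?N2" for u
  proof -
    obtain t where t: "Poly_Mapping.keys t \<subseteq> range f \<times> range f" "g' t - legs f f u \<in> ?N2'" using iso(2) by blast
    obtain s where "t = legs f f s" using onto[OF t(1)] by blast
    then have "g1 s - u \<in> ?N2" using t(2) by (simp add: g'g1 n2 flip: legs_diff)
    from free.subspace_diff[OF sub(3) this g1g[of s]] show ?thesis by auto
  qed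
  moreover have "g t \<in> ?N2 \<longleftrightarrow> t \<in> ?N1" for t
    using iso(1)[of t] by (simp add: g'g1 n1 n2 g1iff)
  ultimately show ?thesis by (simp add: induces_iso_def)
qed

end

section \<open>The two comodule structures on a left Hopf algebroid\<close>

definition flip :: "(('p \<times> 'q) \<Rightarrow>\<^sub>0 'k::field) \<Rightarrow> (('q \<times> 'p) \<Rightarrow>\<^sub>0 'k)" where
  "flip = lsum fscale (\<lambda>(x, y). pure (y, x))"

lemma flip_linear: "Vector_Spaces.linear fscale fscale flip"
  unfolding flip_def by (rule lsum_linear[OF vector_space_fscale])

lemma flip_simps: "flip (s + t) = flip s + flip t" "flip (s - t) = flip s - flip t" "flip (fscale c t) = fscale c (flip t)"
    "flip (pure (x, y)) = pure (y, x)" "flip 0 = 0"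
  by (simp_all add: flip_def lsum_add lsum_diff lsum_fscale lsum_pure vector_space_fscale)

lemma lsum_flip: "vector_space sV \<Longrightarrow> lsum sV h (flip t) = lsum sV (\<lambda>(x, y). h (y, x)) t"
  unfolding flip_def by (simp add: lsum_lsum lsum_pure case_prod_unfold)

lemma flip_flip [simp]: "flip (flip t) = t"
  unfolding flip_def lsum_flip[OF vector_space_fscale, folded flip_def]
  by (simp add: flip_def lsum_lsum[OF vector_space_fscale] lsum_pure[OF vector_space_fscale] case_prod_unfold lsum_pure_id)

lemma flip_tensor_null: "n \<in> tensor_null sP P ra sQ Q la \<Longrightarrow> flip n \<in> tensor_null sQ Q (\<lambda>X b. la b X) sP P (\<lambda>b X. ra X b)"
  unfolding tensor_null_def[of sP]
proof (induction rule: free.span_induct_alt)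
  case base show ?case by (simp add: flip_simps free.subspace_0[OF subspace_tensor_null])
next
  case (step c x y)
  have base: "u \<in> tensor_null sQ Q (\<lambda>X b. la b X) sP P (\<lambda>b X. ra X b)"
    if "u \<in> {pure (p + p', q) - pure (p, q) - pure (p', q) | p p' q. p \<in> Q \<and> p' \<in> Q \<and> q \<in> P} \<union>
      {pure (p, q + q') - pure (p, q) - pure (p, q') | p q q'. p \<in> Q \<and> q \<in> P \<and> q' \<in> P} \<union>
      {pure (sQ c p, q) - fscale c (pure (p, q)) | c p q. p \<in> Q \<and> q \<in> P} \<union>
      {pure (p, sP c q) - fscale c (pure (p, q)) | c p q. p \<in> Q \<and> q \<in> P} \<union>
      {pure (la r p, q) - pure (p, ra q r) | p r q. p \<in> Q \<and> q \<in> P}" for u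
    unfolding tensor_null_def by (rule free.span_base) (rule that)
  have "flip x \<in> tensor_null sQ Q (\<lambda>X b. la b X) sP P (\<lambda>b X. ra X b)"
    using step(1)
  proof (elim UnE, goal_cases)
    case 1
    then obtain p p' q where "x = pure (p + p', q) - pure (p, q) - pure (p', q)" "p \<in> P" "p' \<in> P" "q \<in> Q" by blast
    then have "flip x = pure (q, p + p') - pure (q, p) - pure (q, p')" "p \<in> P" "p' \<in> P" "q \<in> Q" by (simp_all add: flip_simps)
    then show ?thesis by (intro base) blast
  next
    case 2
    then obtain p q q' where "x = pure (p, q + q') - pure (p, q) - pure (p, q')" "p \<in> P" "q \<in> Q" "q' \<in> Q" by blast
    then have "flip x = pure (q + q', p) - pure (q, p) - pure (q', p)" "p \<in> P" "q \<in> Q" "q' \<in> Q" by (simp_all add: flip_simps)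
    then show ?thesis by (intro base) blast
  next
    case 3
    then obtain c p q where "x = pure (sP c p, q) - fscale c (pure (p, q))" "p \<in> P" "q \<in> Q" by blast
    then have "flip x = pure (q, sP c p) - fscale c (pure (q, p))" "p \<in> P" "q \<in> Q" by (simp_all add: flip_simps)
    then show ?thesis by (intro base) blast
  next
    case 4
    then obtain c p q where "x = pure (p, sQ c q) - fscale c (pure (p, q))" "p \<in> P" "q \<in> Q" by blast
    then have "flip x = pure (sQ c q, p) - fscale c (pure (q, p))" "p \<in> P" "q \<in> Q" by (simp_all add: flip_simps)
    then show ?thesis by (intro base) blast
  next
    case 5
    then obtain p r q where x: "x = pure (ra p r, q) - pure (p, la r q)" "p \<in> P" "q \<in> Q" by blast
    then have "- flip x = pure (la r q, p) - pure (q, ra p r)" by (simp add: flip_simps)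
    then have "- flip x \<in> tensor_null sQ Q (\<lambda>X b. la b X) sP P (\<lambda>b X. ra X b)"
      using x by (intro base) blast
    then show ?thesis using free.subspace_neg[OF subspace_tensor_null] by fastforce
  qed
  then show ?case
    using step(2) by (simp add: flip_simps free.subspace_add[OF subspace_tensor_null] free.subspace_scale[OF subspace_tensor_null])
qed

lemma flip_tensor_null_iff:
  "flip n \<in> tensor_null sQ Q (\<lambda>X b. la b X) sP P (\<lambda>b X. ra X b) \<longleftrightarrow> n \<in> tensor_null sP P ra sQ Q la"
  using flip_tensor_null[of "flip n" sQ Q "\<lambda>X b. la b X" sP P "\<lambda>b X. ra X b"] flip_tensor_null[of n sP P ra sQ Q la] by auto

context left_hopf begin

lemma translationI:
  assumes "\<And>\<phi> :: 'l \<Rightarrow> 'l \<Rightarrow> 'k. otgt_bal \<phi> \<Longrightarrow> homogeneous sc (*) \<phi> \<Longrightarrow> lsum (*) (\<lambda>(x, y). \<phi> x y) T = E \<phi> X"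
  shows "T \<in> translation H X"
proof -
  have "T - rep (translation H X) \<in> otgt_null H"
    unfolding otgt_null_def
  proof (rule tensor_nullI)
    fix \<phi> :: "'l \<Rightarrow> 'l \<Rightarrow> 'k" assume "balanced (\<lambda>X b. X \<star> \<tau> b) (\<lambda>b X. \<tau> b \<star> X) \<phi>" "homogeneous sc (*) \<phi>"
    then show "lsum (*) (\<lambda>(x, y). \<phi> x y) (T - rep (translation H X)) = 0"
      using assms[of \<phi>] ev_homogeneous[of sc "(*)" \<phi> "rep (translation H X)"]
      by (simp add: otgt_bal_def lsum_diff[OF vector_space_mult] E_def)
  qed
  then show ?thesis
    by (subst coset_mem_eq[OF subspace_null(2) translation_tensor coset_rep(2)[OF subspace_null(2) translation_tensor]])
      (simp add: coset_def)
qed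

lemma lsum_translation:
  "T \<in> translation H X \<Longrightarrow> otgt_bal \<phi> \<Longrightarrow> homogeneous sc sV \<phi> \<Longrightarrow> lsum sV (\<lambda>(x, y). \<phi> x y) T = E \<phi> X"
  by (simp add: ev_homogeneous ev_translation)

text \<open>
  \<open>L\<close> as a comodule over itself by means of \<open>\<Delta>\<close>.
\<close>

definition coprod_comodule :: "('k, 'b, 'l, 'l) comodule" where
  "coprod_comodule = \<lparr>carr = UNIV, lact = \<lambda>b X. \<sigma> b \<star> X, ract = \<lambda>X b. X \<star> \<sigma> b, coact = cop H\<rparr>"

text \<open>
  \<open>L\<close> with coaction \<open>X\<^sub>- \<otimes> X\<^sub>+\<close>.  With \<open>N\<close> the previous comodule, \<open>\<Gamma>\<^sup>#\<close> of this comodule and \<open>N\<close> is the map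
  by which the twisted coproduct is defined.
\<close>

definition trans_comodule :: "('k, 'b, 'l, 'l) comodule" where
  "trans_comodule = \<lparr>carr = UNIV, lact = \<lambda>b X. X \<star> \<tau> b, ract = \<lambda>X b. \<tau> b \<star> X, coact = \<lambda>X. flip ` translation H X\<rparr>"

lemma coprod_simps:
  "carr coprod_comodule = UNIV" "lact coprod_comodule = (\<lambda>b X. \<sigma> b \<star> X)" "ract coprod_comodule = (\<lambda>X b. X \<star> \<sigma> b)"
  "coact coprod_comodule = cop H"
  by (simp_all add: coprod_comodule_def)

lemma trans_simps:
  "carr trans_comodule = UNIV" "lact trans_comodule = (\<lambda>b X. X \<star> \<tau> b)" "ract trans_comodule = (\<lambda>X b. \<tau> b \<star> X)"
  "coact trans_comodule = (\<lambda>X. flip ` translation H X)"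
  by (simp_all add: trans_comodule_def)

lemma subspace_UNIV: "module.subspace sc UNIV"
  by (rule L.vs.subspace_UNIV)

lemma left_comodule_coprod: "left_comodule sc H coprod_comodule"
proof -
  have null: "codiamond_null sc H coprod_comodule = diamond_null H"
    by (simp add: codiamond_null_def diamond_null_def coprod_simps)
  show ?thesis
  proof (rule left_comodule.intro, goal_cases)
    case 1 show ?case by (rule left_module.intro) (simp_all add: coprod_simps alg subspace_UNIV)
  next
    case 2 show ?case
      unfolding right_module_def by (rule left_module.intro) (simp_all add: coprod_simps alg subspace_UNIV opposite_def)
  next
    case (10 m T a b)
    then have T: "T \<in> cop H m" by (simp add: coprod_simps)
    have "legs (\<lambda>X. \<sigma> a \<star> X \<star> \<sigma> b) id T \<in> cop H (\<sigma> a \<star> (m \<star> \<sigma> b))"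
    proof (rule copI)
      fix \<phi> :: "'l \<Rightarrow> 'l \<Rightarrow> 'k" assume \<phi>: "diamond_bal \<phi>" "homogeneous sc (*) \<phi>"
      have "diamond_bal (\<lambda>x y. \<phi> (\<sigma> a \<star> (x \<star> \<sigma> b)) y)" "homogeneous sc (*) (\<lambda>x y. \<phi> (\<sigma> a \<star> (x \<star> \<sigma> b)) y)"
        using \<phi> by (auto intro!: diamond_balI simp: diamond_bal_simps alg homogeneous_def)
      from lsum_cop[OF T this]
      show "lsum (*) (\<lambda>(x, y). \<phi> x y) (legs (\<lambda>X. \<sigma> a \<star> X \<star> \<sigma> b) id T) = D \<phi> (\<sigma> a \<star> (m \<star> \<sigma> b))"
        using D_srcR[OF diamond_bal_lsrc[OF \<phi>(1)], of a m b]
        by (simp add: lsum_legs[OF vector_space_mult] D_src[OF \<phi>(1)] L.mult_assoc)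
    qed
    then show ?case by (simp add: coprod_simps)
  qed (use cop_diamond cop_add cop_scale takeuchi coassociative counit_left in \<open>simp_all add: coprod_simps alg null\<close>)
qed

lemma trans_null: "flip n \<in> codiamond_null sc H trans_comodule \<longleftrightarrow> n \<in> otgt_null H"
  using flip_tensor_null_iff[of n sc UNIV "\<lambda>b X. \<tau> b \<star> X" sc UNIV "\<lambda>X b. X \<star> \<tau> b"]
  by (simp add: codiamond_null_def otgt_null_def trans_simps)

lemma trans_balanced:
  assumes "balanced (\<lambda>X b. \<tau> b \<star> X) (\<lambda>b X. X \<star> \<tau> b) \<phi>" "homogeneous sc (*) \<phi>"
  shows "otgt_bal (\<lambda>p m. \<phi> m p)" "homogeneous sc (*) (\<lambda>p m. \<phi> m p)"
proof -
  show otgt_bal: "otgt_bal (\<lambda>p m. \<phi> m p)"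
    using assms by (auto simp: balanced_def biadditive_def otgt_bal_iff)
  show "homogeneous sc (*) (\<lambda>p m. \<phi> m p)"
    using otgt_bal_scale[OF otgt_bal] assms(2) by (simp add: homogeneous_def)
qed

text \<open>
  Coassociativity is \<open>E_coassoc_minus\<close>, the Takeuchi property is \<open>E_tak\<close>, and the counit property is
  \<open>E_counit\<close>.
\<close>

lemma left_comodule_trans: "left_comodule sc H trans_comodule"
proof -
  let ?N = "codiamond_null sc H trans_comodule"
  have sub: "module.subspace fscale ?N" by (simp add: codiamond_null_def subspace_tensor_null)
  have coset: "flip ` translation H X = coset ?N (flip (rep (translation H X)))" for X
  proof -
    have "translation H X = coset (otgt_null H) (rep (translation H X))"
      by (rule coset_mem_eq[OF subspace_null(2) translation_tensor coset_rep(2)[OF subspace_null(2) translation_tensor]])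
    then have iff: "T \<in> translation H X \<longleftrightarrow> T - rep (translation H X) \<in> otgt_null H" for T by (auto simp: coset_def)
    have "T \<in> flip ` translation H X \<longleftrightarrow> flip T \<in> translation H X" for T
      by (auto intro: image_eqI[of _ _ "flip T"])
    moreover have "flip T \<in> translation H X \<longleftrightarrow> T \<in> coset ?N (flip (rep (translation H X)))" for T
      using trans_null[of "flip T - rep (translation H X)"] by (simp add: iff coset_def flip_simps)
    ultimately show ?thesis by blast
  qed
  have rep: "\<exists>r. rep (flip ` translation H X) = flip r \<and> r \<in> translation H X" for X
  proof -
    have "rep (flip ` translation H X) \<in> flip ` translation H X"
      by (rule coset_rep(2)[OF sub, of _ UNIV]) (simp add: coset)
    then show ?thesis by blast
  qed
  note field_vs = vector_space_mult
  show ?thesis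
  proof (rule left_comodule.intro, goal_cases)
    case 1 show ?case by (rule left_module.intro) (simp_all add: trans_simps alg subspace_UNIV)
  next
    case 2 show ?case
      unfolding right_module_def by (rule left_module.intro) (simp_all add: trans_simps alg subspace_UNIV opposite_def)
  next
    case (3 m a b) show ?case by (simp add: trans_simps alg)
  next
    case (4 m) show ?case by (simp add: trans_simps coset)
  next
    case (5 m n T T')
    then obtain r r' where r: "T = flip r" "T' = flip r'" "r \<in> translation H m" "r' \<in> translation H n" by (auto simp: trans_simps)
    then have "r + r' \<in> translation H (m + n)"
      by (intro translationI) (simp add: lsum_add[OF field_vs] lsum_translation E_add)
    then show ?case by (auto simp: trans_simps r simp flip: flip_simps)
  next
    case (6 m T c)
    then obtain r where r: "T = flip r" "r \<in> translation H m" by (auto simp: trans_simps)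
    then have "fscale c r \<in> translation H (sc c m)"
      by (intro translationI) (simp add: lsum_fscale[OF field_vs] lsum_translation E_scale homogeneous_def
        E_additive[of "\<lambda>x. c * x" for c :: 'k, symmetric] algebra_simps)
    then show ?case by (auto simp: trans_simps r simp flip: flip_simps)
  next
    case (7 m T b)
    then obtain r where r: "T = flip r" "r \<in> translation H m" by (auto simp: trans_simps)
    have "legs (\<lambda>X. X \<star> \<tau> b) id T - legs id (\<lambda>n. \<tau> b \<star> n) T \<in> ?N"
      unfolding codiamond_null_def trans_simps
    proof (rule tensor_nullI)
      fix \<phi> :: "'l \<Rightarrow> 'l \<Rightarrow> 'k" assume \<phi>: "balanced (\<lambda>X b. \<tau> b \<star> X) (\<lambda>b X. X \<star> \<tau> b) \<phi>" "homogeneous sc (*) \<phi>"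
      note b = trans_balanced[OF \<phi>]
      have "otgt_bal (\<lambda>p m. \<phi> (m \<star> \<tau> b) p)" "homogeneous sc (*) (\<lambda>p m. \<phi> (m \<star> \<tau> b) p)"
        using b by (auto intro!: otgt_balI simp: otgt_bal_simps[OF b(1)] alg homogeneous_def)
      from lsum_translation[OF r(2) this]
      have 1: "lsum (*) (\<lambda>(x, y). \<phi> x y) (legs (\<lambda>X. X \<star> \<tau> b) id T) = E (\<lambda>p m. \<phi> (m \<star> \<tau> b) p) m"
        by (simp add: r(1) lsum_legs[OF field_vs] lsum_flip[OF field_vs])
      have "otgt_bal (\<lambda>p m. \<phi> m (\<tau> b \<star> p))" "homogeneous sc (*) (\<lambda>p m. \<phi> m (\<tau> b \<star> p))"
        using b by (auto intro!: otgt_balI simp: otgt_bal_simps[OF b(1)] alg homogeneous_def)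
      from lsum_translation[OF r(2) this]
      have 2: "lsum (*) (\<lambda>(x, y). \<phi> x y) (legs id (\<lambda>n. \<tau> b \<star> n) T) = E (\<lambda>p m. \<phi> m (\<tau> b \<star> p)) m"
        by (simp add: r(1) lsum_legs[OF field_vs] lsum_flip[OF field_vs])
      show "lsum (*) (\<lambda>(x, y). \<phi> x y) (legs (\<lambda>X. X \<star> \<tau> b) id T - legs id (\<lambda>n. \<tau> b \<star> n) T) = 0"
        using E_tak[OF b(1), of b m] by (simp add: lsum_diff[OF field_vs] 1 2)
    qed
    then show ?case by (simp add: coset_eq_iff[OF sub] trans_simps)
  next
    case (8 m T)
    then obtain r where r: "T = flip r" "r \<in> translation H m" by (auto simp: trans_simps)
    let ?l = "lsum fscale (\<lambda>(x, n). lsum fscale (\<lambda>(x1, x2). pure (x1, x2, n)) (rep (cop H x))) T"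
    let ?r = "lsum fscale (\<lambda>(x, n). lsum fscale (\<lambda>(y, n'). pure (x, y, n')) (rep (flip ` translation H n))) T"
    let ?Z = "tensor_null3 UNIV UNIV (diamond_null H) ?N :: (('l \<times> 'l \<times> 'l) \<Rightarrow>\<^sub>0 'k) set"
    have "?l - ?r \<in> ?Z"
      unfolding tensor_null3_def
    proof (rule functional_separation, fold tensor_null3_def)
      fix g :: "'l \<times> 'l \<times> 'l \<Rightarrow> 'k"
      assume g: "\<And>n. n \<in> ?Z \<Longrightarrow> lsum (*) g n = 0"
      note base = g[unfolded tensor_null3_def, OF free.span_base]
      define h where "h x y z = g (x, y, z)" for x y z
      have "lsum (*) (\<lambda>(x, y). h x y z) n = 0" if "n \<in> diamond_null H" for n z
      proof -
        have "lsum (*) g (lsum fscale (\<lambda>(p, q). pure (p, q, z)) n) = 0" using that by (intro base) blast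
        then show ?thesis by (simp add: lsum_lsum[OF field_vs] lsum_pure[OF field_vs] case_prod_unfold h_def)
      qed
      from functional_tensor_null[OF this[unfolded diamond_null_def]]
      have h1: "diamond_bal (\<lambda>x y. h x y z)" "homogeneous sc (*) (\<lambda>x y. h x y z)" for z by (simp_all add: diamond_bal_def)
      have "lsum (*) (\<lambda>(y, z). h x y z) n = 0" if "n \<in> ?N" for n x
      proof -
        have "lsum (*) g (lsum fscale (\<lambda>(q, r). pure (x, q, r)) n) = 0" using that by (intro base) blast
        then show ?thesis by (simp add: lsum_lsum[OF field_vs] lsum_pure[OF field_vs] case_prod_unfold h_def)
      qed
      from trans_balanced[OF functional_tensor_null[OF this[unfolded codiamond_null_def trans_simps]]]
      have h2: "otgt_bal (\<lambda>z y. h x y z)" "homogeneous sc (*) (\<lambda>z y. h x y z)" for x by simp_all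
      note s = diamond_bal_simps[OF h1(1)] otgt_bal_simps[OF h2(1)]
      have h3: "h (sc c x) y z = c * h x y z" "h x (sc c y) z = c * h x y z" "h x y (sc c z) = c * h x y z" for c x y z
        using h1(2)[of z] h2(2)[of x] diamond_bal_scale[OF h1(1), of c x y z] by (simp_all add: homogeneous_def)
      have cm: "D (\<lambda>x y. c * f x y) X = c * D f X" "E (\<lambda>x y. c * f x y) X = c * E f X" for c :: 'k and f X
        by (rule D_additive[symmetric] E_additive[symmetric], simp add: algebra_simps)+
      have "lsum (*) g ?l = lsum (*) (\<lambda>(p, m). D (\<lambda>x1 x2. h x1 x2 p) m) r"
        unfolding r(1) lsum_lsum[OF field_vs] lsum_flip[OF field_vs]
        by (rule lsum_cong) (auto simp: lsum_lsum[OF field_vs] lsum_pure[OF field_vs] case_prod_unfold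
          lsum_cop[OF rep_cop h1, unfolded case_prod_unfold] h_def[symmetric])
      also have "\<dots> = E (\<lambda>p m. D (\<lambda>x1 x2. h x1 x2 p) m) m"
      proof (rule lsum_translation[OF r(2)])
        show "otgt_bal (\<lambda>p m. D (\<lambda>x1 x2. h x1 x2 p) m)"
          by (rule otgt_balI) (simp_all add: D_rules[OF h1(1)] s D_fun_add)
        show "homogeneous sc (*) (\<lambda>p m. D (\<lambda>x1 x2. h x1 x2 p) m)"
          by (simp add: homogeneous_def h3 cm)
      qed
      also have "\<dots> = E (\<lambda>p m. E (\<lambda>q n. h m n q) p) m"
        by (rule E_coassoc_minus[OF h1(1) h2(1)])
      also have "\<dots> = lsum (*) (\<lambda>(p, m). E (\<lambda>q n. h m n q) p) r"
      proof (rule lsum_translation[OF r(2), symmetric])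
        show "otgt_bal (\<lambda>p m. E (\<lambda>q n. h m n q) p)"
          by (rule otgt_balI) (simp_all add: E_rules[OF h2(1)] s E_fun_add)
        show "homogeneous sc (*) (\<lambda>p m. E (\<lambda>q n. h m n q) p)"
          by (simp add: homogeneous_def E_scale[OF h2(1)] h3 cm)
      qed
      also have "\<dots> = lsum (*) g ?r"
      proof -
        have "lsum (*) (\<lambda>(y, n'). h x y n') (rep (flip ` translation H n)) = E (\<lambda>q n. h x n q) n" for x n
        proof -
          obtain r' where "rep (flip ` translation H n) = flip r'" "r' \<in> translation H n" using rep by blast
          then show ?thesis using lsum_translation[OF _ h2] by (simp add: lsum_flip[OF field_vs])
        qed
        then show ?thesis
          unfolding r(1) lsum_lsum[OF field_vs] lsum_flip[OF field_vs]
          by (intro lsum_cong) (auto simp: lsum_lsum[OF field_vs] lsum_pure[OF field_vs] case_prod_unfold h_def)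
      qed
      finally show "lsum (*) g (?l - ?r) = 0" by (simp add: lsum_diff[OF field_vs])
    qed
    then show ?case by (simp add: Let_def coset_eq_iff[OF subspace_tensor_null3] trans_simps)
  next
    case (9 m T)
    then obtain r where r: "T = flip r" "r \<in> translation H m" by (auto simp: trans_simps)
    have "otgt_bal (\<lambda>p m. p \<star> \<tau> (\<epsilon> m))"
      by (rule otgt_balI) (simp_all add: alg cou_right)
    from lsum_translation[OF r(2) this, of sc] show ?case
      by (simp add: trans_simps r(1) lsum_flip[OF L.vector_space] homogeneous_def alg E_counit)
  next
    case (10 m T a b)
    then obtain r where r: "T = flip r" "r \<in> translation H m" by (auto simp: trans_simps)
    have "legs id (\<lambda>X. \<sigma> a \<star> X \<star> \<sigma> b) r \<in> translation H ((\<tau> b \<star> m) \<star> \<tau> a)"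
    proof (rule translationI)
      fix \<phi> :: "'l \<Rightarrow> 'l \<Rightarrow> 'k" assume \<phi>: "otgt_bal \<phi>" "homogeneous sc (*) \<phi>"
      have b': "otgt_bal (\<lambda>p m. \<phi> p (m \<star> \<sigma> b))"
        using \<phi>(1) by (auto intro!: otgt_balI simp: otgt_bal_simps alg)
      have b: "otgt_bal (\<lambda>p m. \<phi> p (\<sigma> a \<star> (m \<star> \<sigma> b)))" "homogeneous sc (*) (\<lambda>p m. \<phi> p (\<sigma> a \<star> (m \<star> \<sigma> b)))"
        using \<phi> by (auto intro!: otgt_balI simp: otgt_bal_simps alg homogeneous_def)
      from lsum_translation[OF r(2) this]
      show "lsum (*) (\<lambda>(x, y). \<phi> x y) (legs id (\<lambda>X. \<sigma> a \<star> X \<star> \<sigma> b) r) = E \<phi> ((\<tau> b \<star> m) \<star> \<tau> a)"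
        by (simp add: lsum_legs[OF field_vs] E_tgt[OF \<phi>(1)] E_tgtR[OF b'] L.mult_assoc)
    qed
    moreover have "legs (\<lambda>X. \<sigma> a \<star> X \<star> \<sigma> b) id T = flip (legs id (\<lambda>X. \<sigma> a \<star> X \<star> \<sigma> b) r)"
      unfolding r(1) legs_def flip_def
      by (simp add: lsum_lsum[OF vector_space_fscale] lsum_pure[OF vector_space_fscale] case_prod_unfold)
    ultimately show ?case by (auto simp: trans_simps)
  qed
qed

lemma push_faithfully_flat:
  fixes f :: "'l \<Rightarrow> 'u::ab_group_add" and sU :: "'k \<Rightarrow> 'u \<Rightarrow> 'u"
  assumes f: "Vector_Spaces.linear sc sU f" "inj f" and ff: "all_faithfully_flat sU H"
  shows "faithfully_flat_comodule sU H (push f coprod_comodule)" "faithfully_flat_comodule sU H (push f trans_comodule)"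
proof -
  have oo: "opposite (opposite A) = A" for A :: "('k, 'b) alg" by (simp add: opposite_def)
  show "faithfully_flat_comodule sU H (push f coprod_comodule)"
    by (rule faithfully_flat_comodule_push[OF left_comodule_coprod _ f])
      (use ff in \<open>simp_all add: all_faithfully_flat_def coprod_simps\<close>)
  show "faithfully_flat_comodule sU H (push f trans_comodule)"
    by (rule faithfully_flat_comodule_push[OF left_comodule_trans _ f])
      (use ff in \<open>simp_all add: all_faithfully_flat_def trans_simps faithfully_flat_left_def oo\<close>)
qed

end

section \<open>Invertibility of the cocycle\<close>

context twist begin

lemma lsum_null:
  assumes n: "n \<in> tensor_null sc UNIV ra sc UNIV la" and \<phi>: "balanced ra la \<phi>" "homogeneous sc (*) \<phi>"
    and "\<And>c x y. \<phi> (sc c x) y = \<phi> x (sc c y)" and la: "\<And>c r q. la r (sc c q) = sc c (la r q)"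
  shows "lsum (*) (\<lambda>(x, y). \<phi> x y) n = 0"
  using L.vs.ev_tensor_null[OF n \<phi>(1)] assms(4,5) by (simp add: ev_homogeneous[OF \<phi>(2)])

text \<open>
  The twisted actions of the base on the two comodules are twisted multiplications by \<open>\<tau>(a)\<close> and, in
  \<open>coprod_twisted\<close>, by \<open>\<sigma>(a)\<close>.  Hence the tensor products of these comodules over the twisted base are
  those that occur in the twisted bialgebroid.
\<close>

lemma trans_twisted:
  assumes "\<rho> \<in> flip ` translation H m"
  shows "lsum sc (\<lambda>(x, n). n \<star> \<tau> (\<Gamma> x (\<sigma> a))) \<rho> = \<tau> a \<otimes> m" "lsum sc (\<lambda>(x, n). n \<star> \<tau> (\<Gamma> (\<sigma> a) x)) \<rho> = m \<otimes> \<tau> a"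
proof -
  obtain r where r: "\<rho> = flip r" "r \<in> translation H m" using assms by blast
  have b: "otgt_bal (\<lambda>p m. p \<star> \<tau> (\<Gamma> m (\<sigma> a)))" "otgt_bal (\<lambda>p m. p \<star> \<tau> (\<Gamma> (\<sigma> a) m))"
    by (rule otgt_balI; simp add: alg\<Gamma> \<Gamma>_src_tgt)+
  have h: "homogeneous sc sc (\<lambda>p m. p \<star> \<tau> (\<Gamma> m (\<sigma> a)))" "homogeneous sc sc (\<lambda>p m. p \<star> \<tau> (\<Gamma> (\<sigma> a) m))"
    by (simp_all add: homogeneous_def alg)
  show "lsum sc (\<lambda>(x, n). n \<star> \<tau> (\<Gamma> x (\<sigma> a))) \<rho> = \<tau> a \<otimes> m" "lsum sc (\<lambda>(x, n). n \<star> \<tau> (\<Gamma> (\<sigma> a) x)) \<rho> = m \<otimes> \<tau> a"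
    using lsum_translation[OF r(2) b(1) h(1)] lsum_translation[OF r(2) b(2) h(2)]
    by (simp_all add: r(1) lsum_flip[OF L.vector_space] tprod_tgt)
qed

lemma coprod_twisted:
  assumes "\<rho> \<in> cop H m"
  shows "lsum sc (\<lambda>(x, n). \<sigma> (\<Gamma> x (\<sigma> a)) \<star> n) \<rho> = m \<otimes> \<sigma> a" "lsum sc (\<lambda>(x, n). \<sigma> (\<Gamma> (\<sigma> a) x) \<star> n) \<rho> = \<sigma> a \<otimes> m"
proof -
  have b: "diamond_bal (\<lambda>x n. \<sigma> (\<Gamma> x (\<sigma> a)) \<star> n)" "diamond_bal (\<lambda>x n. \<sigma> (\<Gamma> (\<sigma> a) x) \<star> n)"
    by (rule diamond_balI; simp add: alg\<Gamma> \<Gamma>_src_tgt)+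
  have h: "homogeneous sc sc (\<lambda>x n. \<sigma> (\<Gamma> x (\<sigma> a)) \<star> n)" "homogeneous sc sc (\<lambda>x n. \<sigma> (\<Gamma> (\<sigma> a) x) \<star> n)"
    by (simp_all add: homogeneous_def alg\<Gamma>)
  have "m \<odot> \<sigma> a = D (\<lambda>x n. \<sigma> (\<Gamma> x (\<sigma> a)) \<star> n) m"
    unfolding lprod_def D2_def D_s[OF diamond_bal_lprod(2)] by (simp add: L.mult_one_right)
  moreover have "\<sigma> a \<odot> m = D (\<lambda>x n. \<sigma> (\<Gamma> (\<sigma> a) x) \<star> n) m"
    unfolding lprod_def D2_def D_s[OF diamond_bal_lprod(1)] by (simp add: L.mult_one_left)
  ultimately show "lsum sc (\<lambda>(x, n). \<sigma> (\<Gamma> x (\<sigma> a)) \<star> n) \<rho> = m \<otimes> \<sigma> a" "lsum sc (\<lambda>(x, n). \<sigma> (\<Gamma> (\<sigma> a) x) \<star> n) \<rho> = \<sigma> a \<otimes> m"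
    using lsum_cop[OF assms b(1) h(1)] lsum_cop[OF assms b(2) h(2)] by (simp_all add: tprod_src)
qed

context
  fixes f :: "'l \<Rightarrow> 'u::ab_group_add" and sU :: "'k \<Rightarrow> 'u \<Rightarrow> 'u"
  assumes f: "Vector_Spaces.linear sc sU f" "inj f" and ff: "all_faithfully_flat sU H" and inv: "invertible_cocycle sU H \<Gamma>"
begin

lemma gamma_sharp_bij:
  assumes "M \<in> {coprod_comodule, trans_comodule}" "N \<in> {coprod_comodule, trans_comodule}"
  shows "bij_betw (gamma_sharp sU H \<Gamma> (push f M) (push f N))
          (tensor (twisted_comod_null sU H \<Gamma> (push f M) (push f N)) (range f \<times> range f))
          (tensor (comod_null sU (push f M) (push f N)) (range f \<times> range f))"
proof -
  have c: "carr (push f M) = range f" for M :: "('k, 'b, 'l, 'l) comodule" by (rule push_simps[OF f(2)])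
  have "faithfully_flat_comodule sU H (push f M)" "faithfully_flat_comodule sU H (push f N)"
    using assms push_faithfully_flat[OF f ff] by auto
  then show ?thesis using inv unfolding invertible_cocycle_def by (metis c)
qed

text \<open>
  \<open>\<Gamma>\<^sup>#\<close> for the comodules with coactions \<open>X\<^sub>- \<otimes> X\<^sub>+\<close> and \<open>\<Delta>\<close>.
\<close>

lemma sharp0_iso: "induces_iso (twisted_diamond_null H \<Gamma>) UNIV (diamond_null H) UNIV sharp0"
proof -
  note field_vs = vector_space_mult
  have cn: "comod_null sc trans_comodule coprod_comodule = diamond_null H"
    by (simp add: comod_null_def diamond_null_def coprod_simps trans_simps)
  have tn: "twisted_diamond_null H \<Gamma> = tensor_null sc UNIV (\<lambda>X b. \<tau> b \<otimes> X) sc UNIV (\<lambda>b X. \<sigma> b \<otimes> X)"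
    by (simp add: twisted_diamond_null_def twisted_mult_eq)
  have "induces_iso (tensor_null sc UNIV (\<lambda>X b. \<tau> b \<otimes> X) sc UNIV (\<lambda>b X. \<sigma> b \<otimes> X)) UNIV (comod_null sc trans_comodule coprod_comodule) UNIV sharp0"
  proof (rule gamma_sharp_push[OF left_comodule_trans trans_simps(1) left_comodule_coprod coprod_simps(1) f gamma_sharp_bij])
    show "sharp0 t \<in> comod_null sc trans_comodule coprod_comodule"
      if t: "t \<in> tensor_null sc UNIV (\<lambda>X b. \<tau> b \<otimes> X) sc UNIV (\<lambda>b X. \<sigma> b \<otimes> X)" for t
      unfolding cn
    proof (rule diamond_nullI)
      fix \<psi> :: "'l \<Rightarrow> 'l \<Rightarrow> 'k" assume \<psi>: "diamond_bal \<psi>" "homogeneous sc (*) \<psi>"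
      note b = sharp_pull_bal[OF \<psi>(1)]
      have h: "sharp_pull \<psi> (sc c x) y = c * sharp_pull \<psi> x y" "sharp_pull \<psi> x (sc c y) = c * sharp_pull \<psi> x y" for c x y
        by (simp_all add: sharp_pull_def E_scale[OF b(1)] D_scale[OF b(2)] alg\<Gamma> hom_fun[OF \<psi>(2)] D_cmult E_cmult)
      have "lsum (*) (\<lambda>(x, y). sharp_pull \<psi> x y) t = 0"
      proof (rule lsum_null[OF t])
        show "balanced (\<lambda>X b. \<tau> b \<otimes> X) (\<lambda>b X. \<sigma> b \<otimes> X) (sharp_pull \<psi>)"
          unfolding balanced_def biadditive_def sharp_pull_def
        proof (intro conjI allI)
          fix x r y
          show "D (\<lambda>y1 y2. E (\<lambda>p m. \<psi> (p \<star> \<tau> (\<Gamma> m y1)) y2) (\<tau> r \<otimes> x)) y =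
            D (\<lambda>y1 y2. E (\<lambda>p m. \<psi> (p \<star> \<tau> (\<Gamma> m y1)) y2) x) (\<sigma> r \<otimes> y)"
            unfolding E_tprod_rules(2)[OF b(1)] tprod_src D_src_lprod[OF b(2)] cocycle_lprod ..
        qed (simp_all add: D_add[OF b(2)] E_add[OF b(1)] D_fun_add)
      qed (simp_all add: homogeneous_def h tprod_scale)
      then show "lsum (*) (\<lambda>(x, y). \<psi> x y) (sharp0 t) = 0" by (simp add: lsum_sharp0[OF field_vs \<psi>(2)])
    qed
  next
    fix \<rho>M \<rho>N t
    assume \<rho>M: "\<And>m. \<rho>M m \<in> coact trans_comodule m" and \<rho>N: "\<And>n. \<rho>N n \<in> coact coprod_comodule n"
    let ?g = "lsum fscale (\<lambda>(m, n). lsum fscale (\<lambda>(x, m0). lsum fscale (\<lambda>(y, n0). pure (lact trans_comodule (\<Gamma> x y) m0, n0)) (\<rho>N n)) (\<rho>M m)) t"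
    show "?g - sharp0 t \<in> comod_null sc trans_comodule coprod_comodule"
      unfolding cn
    proof (rule diamond_nullI)
      fix \<psi> :: "'l \<Rightarrow> 'l \<Rightarrow> 'k" assume \<psi>: "diamond_bal \<psi>" "homogeneous sc (*) \<psi>"
      note b = sharp_pull_bal[OF \<psi>(1)]
      have h: "homogeneous sc (*) (\<lambda>p m. \<psi> (p \<star> \<tau> (\<Gamma> m y1)) y2)"
        "homogeneous sc (*) (\<lambda>y1 y2. E (\<lambda>p m. \<psi> (p \<star> \<tau> (\<Gamma> m y1)) y2) x)" for x y1 y2
        by (simp_all add: homogeneous_def alg\<Gamma> hom_fun[OF \<psi>(2)] E_cmult)
      have "lsum (*) (\<lambda>(x, m0). lsum (*) (\<lambda>(y, n0). \<psi> (m0 \<star> \<tau> (\<Gamma> x y)) n0) (\<rho>N n)) (\<rho>M m) = sharp_pull \<psi> m n" for m n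
      proof -
        obtain r where r: "\<rho>M m = flip r" "r \<in> translation H m" using \<rho>M[of m] by (auto simp: trans_simps)
        have "lsum (*) (\<lambda>(x, m0). lsum (*) (\<lambda>(y, n0). \<psi> (m0 \<star> \<tau> (\<Gamma> x y)) n0) (\<rho>N n)) (\<rho>M m) =
          lsum (*) (\<lambda>(y, n0). lsum (*) (\<lambda>(p, x). \<psi> (p \<star> \<tau> (\<Gamma> x y)) n0) r) (\<rho>N n)"
          by (subst lsum_swap2[OF field_vs]) (simp add: r(1) lsum_flip[OF field_vs])
        also have "\<dots> = sharp_pull \<psi> m n"
          using \<rho>N[of n] by (simp add: lsum_translation[OF r(2) b(1) h(1)] lsum_cop[OF _ b(2) h(2)] coprod_simps sharp_pull_def)
        finally show ?thesis .
      qed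
      then have "lsum (*) (\<lambda>(x, y). \<psi> x y) ?g = lsum (*) (\<lambda>(x, y). sharp_pull \<psi> x y) t"
        by (simp add: lsum_lsum[OF field_vs] lsum_pure[OF field_vs] case_prod_unfold trans_simps)
      then show "lsum (*) (\<lambda>(x, y). \<psi> x y) (?g - sharp0 t) = 0"
        by (simp add: lsum_diff[OF field_vs] lsum_sharp0[OF field_vs \<psi>(2)])
    qed
  qed (use trans_twisted(1) coprod_twisted(2) sharp0_linear in \<open>simp_all add: trans_simps coprod_simps\<close>)
  then show ?thesis by (simp add: cn tn)
qed

end

end

context twist_iso begin

context
  fixes f :: "'l \<Rightarrow> 'u::ab_group_add" and sU :: "'k \<Rightarrow> 'u \<Rightarrow> 'u"
  assumes f: "Vector_Spaces.linear sc sU f" "inj f" and ff: "all_faithfully_flat sU H" and inv: "invertible_cocycle sU H \<Gamma>"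
begin

text \<open>
  \<open>\<Gamma>\<^sup>#\<close> for the comodule with coaction \<open>\<Delta>\<close> and itself.
\<close>

lemma xi0_iso: "induces_iso (osrc_null (twisted H \<Gamma>)) UNIV (osrc_null H) UNIV xi0"
proof -
  have cn: "comod_null sc coprod_comodule coprod_comodule = osrc_null H"
    by (simp add: comod_null_def osrc_null_def coprod_simps)
  define xi where "xi \<psi> X Y = D (\<lambda>y1 y2. D (\<lambda>x1 x2. \<psi> (\<sigma> (\<Gamma> x1 y1) \<star> x2) y2) X) Y" for \<psi> :: "'l \<Rightarrow> 'l \<Rightarrow> 'k" and X Y
  have key: "both_bal (\<lambda>x1 x2 y1 y2. \<psi> (\<sigma> (\<Gamma> x1 y1) \<star> x2) y2)"
      "homogeneous sc (*) (\<lambda>x1 x2. \<psi> (\<sigma> (\<Gamma> x1 y1) \<star> x2) y2)"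
      "homogeneous sc (*) (\<lambda>y1 y2. D (\<lambda>x1 x2. \<psi> (\<sigma> (\<Gamma> x1 y1) \<star> x2) y2) X)"
    if \<psi>: "balanced (\<lambda>X b. X \<star> \<sigma> b) (\<lambda>b X. \<sigma> b \<star> X) \<psi>" "homogeneous sc (*) \<psi>" for \<psi> :: "'l \<Rightarrow> 'l \<Rightarrow> 'k" and X y1 y2
  proof -
    have s: "\<psi> (x + x') y = \<psi> x y + \<psi> x' y" "\<psi> x (y + y') = \<psi> x y + \<psi> x y'" "\<psi> (x \<star> \<sigma> b) y = \<psi> x (\<sigma> b \<star> y)"
       "\<psi> (x \<star> (x' \<star> \<sigma> b)) y = \<psi> (x \<star> x') (\<sigma> b \<star> y)" for x x' y y' b
      using \<psi>(1) by (auto simp: balanced_def biadditive_def simp flip: L.mult_assoc)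
    show "both_bal (\<lambda>x1 x2 y1 y2. \<psi> (\<sigma> (\<Gamma> x1 y1) \<star> x2) y2)"
      by (auto simp: both_bal_def diamond_bal_iff biadditive_def alg\<Gamma> s)
    show "homogeneous sc (*) (\<lambda>x1 x2. \<psi> (\<sigma> (\<Gamma> x1 y1) \<star> x2) y2)"
      "homogeneous sc (*) (\<lambda>y1 y2. D (\<lambda>x1 x2. \<psi> (\<sigma> (\<Gamma> x1 y1) \<star> x2) y2) X)"
      by (simp_all add: homogeneous_def alg\<Gamma> hom_fun[OF \<psi>(2)] D_cmult)
  qed
  have lsum_xi0: "lsum (*) (\<lambda>(x, y). \<psi> x y) (lsum fscale (\<lambda>(m, n). lsum fscale (\<lambda>(x, m0). lsum fscale (\<lambda>(y, n0). pure (\<sigma> (\<Gamma> x y) \<star> m0, n0)) (\<rho>N n)) (\<rho>M m)) t) =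
     lsum (*) (\<lambda>(x, y). xi \<psi> x y) t"
    if \<psi>: "balanced (\<lambda>X b. X \<star> \<sigma> b) (\<lambda>b X. \<sigma> b \<star> X) \<psi>" "homogeneous sc (*) \<psi>"
      and \<rho>: "\<And>m. \<rho>M m \<in> cop H m" "\<And>m. \<rho>N m \<in> cop H m" for \<psi> :: "'l \<Rightarrow> 'l \<Rightarrow> 'k" and \<rho>M \<rho>N t
  proof -
    have b: "diamond_bal (\<lambda>x1 x2. \<psi> (\<sigma> (\<Gamma> x1 y1) \<star> x2) y2)" for y1 y2 using key(1)[OF \<psi>] by (simp add: both_bal_def)
    have "lsum (*) (\<lambda>(x, m0). lsum (*) (\<lambda>(y, n0). \<psi> (\<sigma> (\<Gamma> x y) \<star> m0) n0) (\<rho>N n)) (\<rho>M m) = xi \<psi> m n" for m n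
      by (subst lsum_swap2[OF field_vs])
        (simp add: lsum_cop[OF \<rho>(1) b key(2)[OF \<psi>]] lsum_cop[OF \<rho>(2) both_bal_diamond_bal[OF key(1)[OF \<psi>]] key(3)[OF \<psi>]] xi_def)
    then show ?thesis by (simp add: lsum_lsum[OF field_vs] lsum_pure[OF field_vs] case_prod_unfold)
  qed
  have "induces_iso (tensor_null sc UNIV (\<lambda>X b. X \<otimes> \<sigma> b) sc UNIV (\<lambda>b X. \<sigma> b \<otimes> X)) UNIV (comod_null sc coprod_comodule coprod_comodule) UNIV xi0"
  proof (rule gamma_sharp_push[OF left_comodule_coprod coprod_simps(1) left_comodule_coprod coprod_simps(1) f gamma_sharp_bij[OF f ff inv]])
    show "xi0 t \<in> comod_null sc coprod_comodule coprod_comodule"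
      if t: "t \<in> tensor_null sc UNIV (\<lambda>X b. X \<otimes> \<sigma> b) sc UNIV (\<lambda>b X. \<sigma> b \<otimes> X)" for t
      unfolding cn osrc_null_def
    proof (rule tensor_nullI)
      fix \<psi> :: "'l \<Rightarrow> 'l \<Rightarrow> 'k" assume \<psi>: "balanced (\<lambda>X b. X \<star> \<sigma> b) (\<lambda>b X. \<sigma> b \<star> X) \<psi>" "homogeneous sc (*) \<psi>"
      have b1: "diamond_bal (\<lambda>x1 x2. \<psi> (\<sigma> (\<Gamma> x1 y1) \<star> x2) y2)" for y1 y2 using key(1)[OF \<psi>] by (simp add: both_bal_def)
      note b2 = both_bal_diamond_bal[OF key(1)[OF \<psi>]]
      have h: "xi \<psi> (sc c x) y = c * xi \<psi> x y" "xi \<psi> x (sc c y) = c * xi \<psi> x y" for c x y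
        by (simp_all add: xi_def D_scale[OF b1] D_scale[OF b2] alg\<Gamma> hom_fun[OF \<psi>(2)] D_cmult)
      have "lsum (*) (\<lambda>(x, y). xi \<psi> x y) t = 0"
      proof (rule lsum_null[OF t])
        show "balanced (\<lambda>X b. X \<otimes> \<sigma> b) (\<lambda>b X. \<sigma> b \<otimes> X) (xi \<psi>)"
          unfolding balanced_def biadditive_def xi_def
        proof (intro conjI allI)
          fix x r y
          show "D (\<lambda>y1 y2. D (\<lambda>x1 x2. \<psi> (\<sigma> (\<Gamma> x1 y1) \<star> x2) y2) (x \<otimes> \<sigma> r)) y =
            D (\<lambda>y1 y2. D (\<lambda>x1 x2. \<psi> (\<sigma> (\<Gamma> x1 y1) \<star> x2) y2) x) (\<sigma> r \<otimes> y)"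
            unfolding tprod_src D_src_lprod[OF b2] D_lprod_src[OF b1] cocycle_lprod ..
        qed (simp_all add: D_add[OF b2] D_add[OF b1] D_fun_add)
      qed (simp_all add: homogeneous_def h tprod_scale)
      then show "lsum (*) (\<lambda>(x, y). \<psi> x y) (xi0 t) = 0"
        unfolding xi0_def lsum_xi0[OF \<psi> rep_cop rep_cop] .
    qed
  next
    fix \<rho>M \<rho>N t
    assume \<rho>M: "\<And>m. \<rho>M m \<in> coact coprod_comodule m" and \<rho>N: "\<And>n. \<rho>N n \<in> coact coprod_comodule n"
    let ?g = "lsum fscale (\<lambda>(m, n). lsum fscale (\<lambda>(x, m0). lsum fscale (\<lambda>(y, n0). pure (lact coprod_comodule (\<Gamma> x y) m0, n0)) (\<rho>N n)) (\<rho>M m)) t"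
    show "?g - xi0 t \<in> comod_null sc coprod_comodule coprod_comodule"
      unfolding cn osrc_null_def coprod_simps
    proof (rule tensor_nullI)
      fix \<psi> :: "'l \<Rightarrow> 'l \<Rightarrow> 'k" assume \<psi>: "balanced (\<lambda>X b. X \<star> \<sigma> b) (\<lambda>b X. \<sigma> b \<star> X) \<psi>" "homogeneous sc (*) \<psi>"
      show "lsum (*) (\<lambda>(x, y). \<psi> x y) (lsum fscale (\<lambda>(m, n). lsum fscale (\<lambda>(x, m0). lsum fscale (\<lambda>(y, n0). pure (\<sigma> (\<Gamma> x y) \<star> m0, n0)) (\<rho>N n)) (\<rho>M m)) t - xi0 t) = 0"
        using \<rho>M \<rho>N unfolding coprod_simps xi0_def
        by (simp only: lsum_diff[OF field_vs] lsum_xi0[OF \<psi>] lsum_xi0[OF \<psi> rep_cop rep_cop]) simp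
    qed
  qed (use coprod_twisted in \<open>simp_all add: coprod_simps xi0_def lsum_linear[OF vector_space_fscale]\<close>)
  then show ?thesis by (simp add: cn osrc_null_twisted)
qed

text \<open>
  \<open>\<Gamma>\<^sup>#\<close> for the comodule with coaction \<open>X\<^sub>- \<otimes> X\<^sub>+\<close> and itself, which acts on the factors in the opposite
  order.
\<close>

lemma theta0_iso: "induces_iso (otgt_null (twisted H \<Gamma>)) UNIV (otgt_null H) UNIV theta0"
proof -
  define th where "th \<psi> X Y = E (\<lambda>p m. E (\<lambda>q n. \<psi> p (q \<star> \<tau> (\<Gamma> n m))) Y) X" for \<psi> :: "'l \<Rightarrow> 'l \<Rightarrow> 'k" and X Y
  have b1: "otgt_bal (\<lambda>q n. \<psi> p (q \<star> \<tau> (\<Gamma> n m)))" and b2: "otgt_bal (\<lambda>p m. E (\<lambda>q n. \<psi> p (q \<star> \<tau> (\<Gamma> n m))) Y)"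
    if \<psi>: "otgt_bal \<psi>" for \<psi> :: "'l \<Rightarrow> 'l \<Rightarrow> 'k" and p m Y
  proof -
    note s = otgt_bal_simps[OF \<psi>]
    show b: "otgt_bal (\<lambda>q n. \<psi> p (q \<star> \<tau> (\<Gamma> n m)))" for p m
      by (rule otgt_balI) (simp_all add: s alg\<Gamma>)
    show "otgt_bal (\<lambda>p m. E (\<lambda>q n. \<psi> p (q \<star> \<tau> (\<Gamma> n m))) Y)"
    proof (rule otgt_balI)
      fix x r y
      show "E (\<lambda>q n. \<psi> (x \<star> \<tau> r) (q \<star> \<tau> (\<Gamma> n y))) Y = E (\<lambda>q n. \<psi> x (q \<star> \<tau> (\<Gamma> n (\<tau> r \<star> y)))) Y"
        using E_tak[OF b[of x y], of r Y] by (simp add: s \<Gamma>_rules L.mult_assoc)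
    qed (simp_all add: s alg\<Gamma> E_fun_add)
  qed
  have h: "\<psi> x (sc c y) = c * \<psi> x y" "\<psi> (sc c x) y = c * \<psi> x y"
    if "otgt_bal \<psi>" "homogeneous sc (*) \<psi>" for \<psi> :: "'l \<Rightarrow> 'l \<Rightarrow> 'k" and c x y
    using that otgt_bal_scale[OF that(1), of c x y] by (simp_all add: homogeneous_def)
  have lsum_th: "lsum (*) (\<lambda>(m, q). lsum (*) (\<lambda>(n, p). \<psi> p (q \<star> \<tau> (\<Gamma> m n))) \<rho>') \<rho> = th \<psi> X Y"
    if \<psi>: "otgt_bal \<psi>" "homogeneous sc (*) \<psi>" and \<rho>: "\<rho> \<in> flip ` translation H Y" "\<rho>' \<in> flip ` translation H X"
    for \<psi> :: "'l \<Rightarrow> 'l \<Rightarrow> 'k" and \<rho> \<rho>' X Y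
  proof -
    obtain r r' where r: "\<rho> = flip r" "r \<in> translation H Y" "\<rho>' = flip r'" "r' \<in> translation H X" using \<rho> by blast
    have hh: "homogeneous sc (*) (\<lambda>q n. \<psi> p (q \<star> \<tau> (\<Gamma> n m)))"
      "homogeneous sc (*) (\<lambda>p m. E (\<lambda>q n. \<psi> p (q \<star> \<tau> (\<Gamma> n m))) Y)" for p m
      by (simp_all add: homogeneous_def alg h[OF \<psi>] E_cmult)
    show ?thesis
      by (subst lsum_swap2[OF field_vs])
        (simp add: r(1,3) lsum_flip[OF field_vs] lsum_translation[OF r(2) b1[OF \<psi>(1)] hh(1)] lsum_translation[OF r(4) b2[OF \<psi>(1)] hh(2)] th_def)
  qed
  have lsum_theta0: "lsum (*) (\<lambda>(x, y). \<psi> x y) (theta0 t) = lsum (*) (\<lambda>(x, y). th \<psi> x y) t"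
    if \<psi>: "otgt_bal \<psi>" "homogeneous sc (*) \<psi>" for \<psi> :: "'l \<Rightarrow> 'l \<Rightarrow> 'k" and t
  proof -
    have hh: "homogeneous sc (*) (\<lambda>q n. \<psi> p (q \<star> \<tau> (\<Gamma> n m)))"
      "homogeneous sc (*) (\<lambda>p m. E (\<lambda>q n. \<psi> p (q \<star> \<tau> (\<Gamma> n m))) Y)" for p m Y
      by (simp_all add: homogeneous_def alg h[OF \<psi>] E_cmult)
    show ?thesis
      unfolding theta0_def lsum_lsum[OF field_vs]
      by (rule lsum_cong) (auto simp: lsum_lsum[OF field_vs] lsum_pure[OF field_vs] case_prod_unfold th_def
        E_homogeneous[OF hh(2), unfolded case_prod_unfold] E_homogeneous[OF hh(1), unfolded case_prod_unfold])
  qed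
  let ?N1 = "tensor_null sc UNIV (\<lambda>X b. \<tau> b \<otimes> X) sc UNIV (\<lambda>b X. X \<otimes> \<tau> b)"
  let ?N2 = "comod_null sc trans_comodule trans_comodule"
  have f1: "flip t \<in> ?N1 \<longleftrightarrow> t \<in> otgt_null (twisted H \<Gamma>)" for t
    unfolding otgt_null_twisted by (rule flip_tensor_null_iff)
  have f2: "flip t \<in> ?N2 \<longleftrightarrow> t \<in> otgt_null H" for t
    unfolding comod_null_def trans_simps otgt_null_def by (rule flip_tensor_null_iff)
  have wd: "theta0 t \<in> otgt_null H" if t: "t \<in> otgt_null (twisted H \<Gamma>)" for t
    unfolding otgt_null_def
  proof (rule tensor_nullI, fold otgt_bal_def)
    fix \<psi> :: "'l \<Rightarrow> 'l \<Rightarrow> 'k" assume \<psi>: "otgt_bal \<psi>" "homogeneous sc (*) \<psi>"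
    have hth: "th \<psi> (sc c x) y = c * th \<psi> x y" "th \<psi> x (sc c y) = c * th \<psi> x y" for c x y
      by (simp_all add: th_def E_scale[OF b1[OF \<psi>(1)]] E_scale[OF b2[OF \<psi>(1)]] h[OF \<psi>] alg E_cmult)
    have "lsum (*) (\<lambda>(x, y). th \<psi> x y) t = 0"
    proof (rule lsum_null[OF t[unfolded otgt_null_twisted]])
      show "balanced (\<lambda>X b. X \<otimes> \<tau> b) (\<lambda>b X. \<tau> b \<otimes> X) (th \<psi>)"
        unfolding balanced_def biadditive_def th_def
      proof (intro conjI allI)
        fix x r y
        show "E (\<lambda>p m. E (\<lambda>q n. \<psi> p (q \<star> \<tau> (\<Gamma> n m))) y) (x \<otimes> \<tau> r) = E (\<lambda>p m. E (\<lambda>q n. \<psi> p (q \<star> \<tau> (\<Gamma> n m))) (\<tau> r \<otimes> y)) x"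
          unfolding E_tprod_rules(4)[OF b2[OF \<psi>(1)]] E_tprod_rules(2)[OF b1[OF \<psi>(1)]] cocycle_lprod ..
      qed (simp_all add: E_add[OF b1[OF \<psi>(1)]] E_add[OF b2[OF \<psi>(1)]] E_fun_add)
    qed (simp_all add: homogeneous_def hth tprod_scale)
    then show "lsum (*) (\<lambda>(x, y). \<psi> x y) (theta0 t) = 0" by (simp add: lsum_theta0[OF \<psi>])
  qed
  have iso: "induces_iso ?N1 UNIV ?N2 UNIV (\<lambda>t. flip (theta0 (flip t)))"
  proof (rule gamma_sharp_push[OF left_comodule_trans trans_simps(1) left_comodule_trans trans_simps(1) f gamma_sharp_bij[OF f ff inv]])
    have lin: "Vector_Spaces.linear fscale fscale theta0"
      unfolding theta0_def by (rule lsum_linear[OF vector_space_fscale])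
    interpret F: Vector_Spaces.linear fscale fscale "flip :: (('l \<times> 'l) \<Rightarrow>\<^sub>0 'k) \<Rightarrow> _" by (rule flip_linear)
    interpret T: Vector_Spaces.linear fscale fscale theta0 by (rule lin)
    show "Vector_Spaces.linear fscale fscale (\<lambda>t. flip (theta0 (flip t)))"
      by (simp add: Vector_Spaces.linear_iff vector_space_fscale F.add T.add F.scale T.scale)
    show "flip (theta0 (flip t)) \<in> ?N2" if "t \<in> ?N1" for t
      using that wd[of "flip t"] f1[of "flip t"] by (simp add: f2)
    fix \<rho>M \<rho>N :: "'l \<Rightarrow> (('l \<times> 'l) \<Rightarrow>\<^sub>0 'k)" and t
    assume \<rho>M: "\<And>m. \<rho>M m \<in> coact trans_comodule m" and \<rho>N: "\<And>n. \<rho>N n \<in> coact trans_comodule n"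
    let ?g = "lsum fscale (\<lambda>(m, n). lsum fscale (\<lambda>(x, m0). lsum fscale (\<lambda>(y, n0). pure (lact trans_comodule (\<Gamma> x y) m0, n0)) (\<rho>N n)) (\<rho>M m)) t"
    have "flip ?g - theta0 (flip t) \<in> otgt_null H"
      unfolding otgt_null_def
    proof (rule tensor_nullI, fold otgt_bal_def)
      fix \<psi> :: "'l \<Rightarrow> 'l \<Rightarrow> 'k" assume \<psi>: "otgt_bal \<psi>" "homogeneous sc (*) \<psi>"
      have "lsum (*) (\<lambda>(x, y). \<psi> x y) (flip ?g) = lsum (*) (\<lambda>(m, n). th \<psi> n m) t"
        using lsum_th[OF \<psi> \<rho>M[unfolded trans_simps] \<rho>N[unfolded trans_simps]]
        by (simp add: lsum_flip[OF field_vs] lsum_lsum[OF field_vs] lsum_pure[OF field_vs] case_prod_unfold trans_simps)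
      then show "lsum (*) (\<lambda>(x, y). \<psi> x y) (flip ?g - theta0 (flip t)) = 0"
        by (simp add: lsum_diff[OF field_vs] lsum_theta0[OF \<psi>] lsum_flip[OF field_vs])
    qed
    then show "?g - flip (theta0 (flip t)) \<in> ?N2"
      using f2[of "flip ?g - theta0 (flip t)"] by (simp add: flip_simps)
  qed (use trans_twisted in \<open>simp_all add: trans_simps\<close>)
  show ?thesis
    unfolding induces_iso_def
  proof (intro conjI allI impI)
    fix t
    show "theta0 t \<in> otgt_null H \<longleftrightarrow> t \<in> otgt_null (twisted H \<Gamma>)"
      using iso f1[of t] f2[of "theta0 t"] by (auto simp: induces_iso_def dest: spec[of _ "flip t"])
  next
    fix u
    obtain t where "flip (theta0 (flip t)) - flip u \<in> ?N2" using iso by (auto simp: induces_iso_def)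
    then have "theta0 (flip t) - u \<in> otgt_null H" using f2[of "theta0 (flip t) - u"] by (simp add: flip_simps)
    then show "\<exists>t. Poly_Mapping.keys t \<subseteq> UNIV \<and> theta0 t - u \<in> otgt_null H" by blast
  qed
qed

end

end

section \<open>The twisted Hopf algebroid\<close>

theorem theorem3p10:
  fixes sU :: "'k::field \<Rightarrow> 'u::ab_group_add \<Rightarrow> 'u"
    and H :: "('k, 'b::ab_group_add, 'l::ab_group_add) bialgebroid"
    and \<Gamma> :: "'l \<Rightarrow> 'l \<Rightarrow> 'b"
  assumes "left_hopf_algebroid H"
    and "large_space sU H"
    and "all_faithfully_flat sU H"
    and "left_2_cocycle H \<Gamma>"
    and "invertible_cocycle sU H \<Gamma>"
  shows "left_hopf_algebroid (twisted H \<Gamma>) \<and>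
    (anti_left_hopf_algebroid H \<longrightarrow> anti_left_hopf_algebroid (twisted H \<Gamma>))"
proof -
  obtain f where f: "Vector_Spaces.linear (lscale H) sU f" "inj f"
    using assms(2) by (auto simp: large_space_def)
  have hopf: "left_hopf H"
    using assms(1) by (simp add: left_hopf_algebroid_def left_hopf_def left_hopf_axioms_def)
  interpret twist H \<Gamma>
    using hopf assms(4) by (simp add: twist_def)
  interpret twist_iso H \<Gamma>
    by (unfold_locales) (rule sharp0_iso[OF f assms(3,5)])
  show ?thesis
    using left_hopf_twisted[OF theta0_iso[OF f assms(3,5)]] anti_left_hopf_twisted[OF xi0_iso[OF f assms(3,5)]] by blast
qed

end
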